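(* Let $n\ge1$, let $\varphi=(\varphi_1,\dots,\varphi_n)\in C(\mathbb{R},\mathbb{R}^n)$ be continuous, and let $M_0$ be an additive subgroup of $\mathbb{R}^n$. Then the non-degeneracy condition "for every $\xi\in M_0$, $\xi\ne0$, the function $u\mapsto\xi\cdot\varphi(u)$ is not affine on any non-empty open interval of $\mathbb{R}$" is necessary and sufficient for the following decay property: for every $v_0\in L^\infty(\mathbb{B}_n,m)$ with $Sp(v_0)\subset M_0$, the entropy solution $v=v(t,y)$ of $$v_t+\sum_{j=1}^n(\varphi_j(v))_{x_j}=0,\quad t>0,\ y\in\mathbb{B}_n,\qquad v(0,y)=v_0(y),$$ satisfies $$\mathop{\mathrm{ess\,lim}}_{t\to+\infty}\int_{\mathbb{B}_n}|v(t,y)-C|\,dm(y)=0,\qquad C=\int_{\mathbb{B}_n}v_0(y)\,dm(y).$$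
   Context: Notation: $\mathbb{R}_+=(0,+\infty)$. **Bohr compactification.** $AP(\mathbb{R}^n)$ is the algebra of Bohr almost periodic functions, i.e. uniform limits of trigonometric polynomials (finite sums $\sum a_\lambda e^{2\pi i\lambda\cdot x}$, $\lambda\in\mathbb{R}^n$). $\mathbb{B}_n$ is the Bohr compactification of $\mathbb{R}^n$, a compact abelian group identified with the spectrum of the algebra $AP(\mathbb{R}^n)$; $m$ is its normalized Haar measure. For $f\in AP(\mathbb{R}^n)$, $\hat f\in C(\mathbb{B}_n)$ is its Gelfand transform. There is a canonical injective continuous homomorphism $in:\mathbb{R}^n\to\mathbb{B}_n$ with dense image such that $\hat f(in(x))=f(x)$ for all $f\in AP(\mathbb{R}^n)$; $\mathbb{R}^n$ is identified with its image. **Spectrum.** For $\lambda\in\mathbb{R}^n$ let $\hat e_\lambda$ be the Gelfand transform of $e^{2\pi i\lambda\cdot x}$ (a continuous character of $\mathbb{B}_n$). For $v_0\in L^1(\mathbb{B}_n,m)$, $Sp(v_0)=\{\lambda\in\mathbb{R}^n: \int_{\mathbb{B}_n}v_0\,\overline{\hat e_\lambda}\,dm\ne0\}$. (Equivalently, it is the set of $\lambda$ with nonzero Bohr–Fourier coefficient of the Besicovitch almost periodic function on $\mathbb{R}^n$ whose Gelfand transform is $v_0$.) **Entropy solution on $\mathbb{B}_n$.** $C^1_0(\mathbb{R}_+\times\mathbb{B}_n)$ is the space of continuous compactly supported functions $f(t,y)$ on $\mathbb{R}_+\times\mathbb{B}_n$ having continuous partial derivatives $f_t(t,y)=\lim_{\delta\to0}\frac{f(t+\delta,y)-f(t,y)}{\delta}$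 and $f_{x_j}(t,y)=\lim_{\delta\to0}\frac{f(t,y+\delta e_j)-f(t,y)}{\delta}$, $j=1,\dots,n$, where $e_j$ is the canonical basis of $\mathbb{R}^n\subset\mathbb{B}_n$; $\nabla_x^yf=(f_{x_1},\dots,f_{x_n})(t,y)$. A function $v\in L^\infty(\mathbb{R}_+\times\mathbb{B}_n)=L^\infty(\mathbb{R}_+\times\mathbb{B}_n,dt\times m)$ is an entropy solution of $v_t+\sum_j(\varphi_j(v))_{x_j}=0$, $v(0,y)=v_0(y)$, if for all $k\in\mathbb{R}$ and all nonnegative $f\in C^1_0(\mathbb{R}_+\times\mathbb{B}_n)$ $$\int_{\mathbb{R}_+\times\mathbb{B}_n}\big[|v-k|f_t+\mathrm{sign}(v-k)(\varphi(v)-\varphi(k))\cdot\nabla_x^yf\big]dt\,dm(y)\ge0,$$ and $\mathrm{ess\,lim}_{t\to0}v(t,\cdot)=v_0$ in $L^1(\mathbb{B}_n,m)$. For every $v_0\in L^\infty(\mathbb{B}_n,m)$ an entropy solution exists and is unique. *)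

theory Defs
  imports "HOL-Analysis.Analysis"
begin

definition bohr_exp :: "real^'n \<Rightarrow> real^'n \<Rightarrow> complex" where
  "bohr_exp l x = exp (2 * of_real pi * \<i> * of_real (l \<bullet> x))"

definition trig_polys :: "(real^'n \<Rightarrow> complex) set" where
  "trig_polys = {p. \<exists>S a. finite S \<and> p = (\<lambda>x. \<Sum>l\<in>S. a l * bohr_exp l x)}"

definition AP :: "(real^'n \<Rightarrow> complex) set" where
  "AP = {f. \<exists>p. (\<forall>k. p k \<in> trig_polys) \<and> uniform_limit UNIV p f sequentially}"

type_synonym 'n bohr_point = "(real^'n \<Rightarrow> complex) \<Rightarrow> complex"

text \<open>
  The Bohr compactification is the spectrum of the Banach algebra \<^term>\<open>AP\<close>: its nonzero
  multiplicative linear functionals, with the Gelfand topology (pointwise convergence on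
  \<^term>\<open>AP\<close>).  Functionals are represented extensionally, i.e. with the value
  \<^term>\<open>undefined\<close> outside \<^term>\<open>AP\<close>.
\<close>

definition bohr :: "'n::finite bohr_point set" where
  "bohr = {h \<in> extensional AP.
     (\<forall>f\<in>AP. \<forall>g\<in>AP. h (\<lambda>x. f x + g x) = h f + h g) \<and>
     (\<forall>c. \<forall>f\<in>AP. h (\<lambda>x. c * f x) = c * h f) \<and>
     (\<forall>f\<in>AP. \<forall>g\<in>AP. h (\<lambda>x. f x * g x) = h f * h g) \<and>
     (\<exists>f\<in>AP. h f \<noteq> 0)}"

definition bohr_topology :: "'n::finite bohr_point topology" where
  "bohr_topology = subtopology (product_topology (\<lambda>_. euclidean) AP) bohr"

definition gelfand :: "(real^'n \<Rightarrow> complex) \<Rightarrow> 'n::finite bohr_point \<Rightarrow> complex" where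
  "gelfand f = (\<lambda>y. y f)"

definition bohr_in :: "real^'n \<Rightarrow> 'n::finite bohr_point" where
  "bohr_in x = restrict (\<lambda>f. f x) AP"

text \<open>
  The group law is convolution of functionals: the continuous extension of addition on
  \<^term>\<open>range bohr_in\<close>, for which the transforms of the exponentials are characters.
\<close>

definition bohr_add :: "'n::finite bohr_point \<Rightarrow> 'n bohr_point \<Rightarrow> 'n bohr_point" where
  "bohr_add g h = restrict (\<lambda>f. g (\<lambda>x. h (\<lambda>z. f (x + z)))) AP"

text \<open>
  A normalized Haar measure is a regular Borel probability measure that is invariant under
  translations.  It exists and, as the \<open>\<sigma>\<close>-algebra is prescribed, is unique.
\<close>

definition normalized_haar :: "'n::finite bohr_point measure \<Rightarrow> bool" where
  "normalized_haar m \<longleftrightarrow>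
     space m = bohr \<and>
     sets m = sigma_sets bohr {U. openin bohr_topology U} \<and>
     emeasure m bohr = 1 \<and>
     (\<forall>g\<in>bohr. \<forall>A\<in>sets m. emeasure m (bohr_add g ` A) = emeasure m A) \<and>
     (\<forall>A\<in>sets m. emeasure m A = (INF U\<in>{U. openin bohr_topology U \<and> A \<subseteq> U}. emeasure m U)) \<and>
     (\<forall>A\<in>sets m. emeasure m A = (SUP K\<in>{K. compactin bohr_topology K \<and> K \<subseteq> A \<and> K \<in> sets m}. emeasure m K))"

definition Sp :: "'n::finite bohr_point measure \<Rightarrow> ('n bohr_point \<Rightarrow> real) \<Rightarrow> (real^'n) set" where
  "Sp m v0 = {l. (\<integral>y. of_real (v0 y) * cnj (gelfand (bohr_exp l) y) \<partial>m) \<noteq> 0}"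

definition Linf :: "'a measure \<Rightarrow> ('a \<Rightarrow> real) set" where
  "Linf M = {f \<in> borel_measurable M. \<exists>K. AE x in M. \<bar>f x\<bar> \<le> K}"

definition ess_tendsto :: "(real \<Rightarrow> real) \<Rightarrow> real \<Rightarrow> real filter \<Rightarrow> bool" where
  "ess_tendsto g l F \<longleftrightarrow> (\<exists>N\<in>null_sets lborel. (g \<longlongrightarrow> l) (inf F (principal (- N))))"

text \<open>
  Since the half-line is second countable, the product \<open>\<sigma>\<close>-algebra below is the Borel
  \<open>\<sigma>\<close>-algebra of the product space.
\<close>

definition cyl_measure :: "'n::finite bohr_point measure \<Rightarrow> (real \<times> 'n bohr_point) measure" where
  "cyl_measure m = restrict_space lborel {0<..} \<Otimes>\<^sub>M m"

definition cyl_topology :: "(real \<times> 'n::finite bohr_point) topology" where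
  "cyl_topology = prod_topology (top_of_set {0<..}) bohr_topology"

definition quot_t :: "(real \<times> 'n::finite bohr_point \<Rightarrow> real) \<Rightarrow> real \<times> 'n bohr_point \<Rightarrow> real \<Rightarrow> real" where
  "quot_t f = (\<lambda>(t, y) \<delta>. (f (t + \<delta>, y) - f (t, y)) / \<delta>)"

definition quot_x :: "'n \<Rightarrow> (real \<times> 'n::finite bohr_point \<Rightarrow> real) \<Rightarrow> real \<times> 'n bohr_point \<Rightarrow> real \<Rightarrow> real" where
  "quot_x j f = (\<lambda>(t, y) \<delta>. (f (t, bohr_add y (bohr_in (\<delta> *\<^sub>R axis j 1))) - f (t, y)) / \<delta>)"

definition partial_t :: "(real \<times> 'n::finite bohr_point \<Rightarrow> real) \<Rightarrow> real \<times> 'n bohr_point \<Rightarrow> real" where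
  "partial_t f p = Lim (at 0) (quot_t f p)"

definition partial_x :: "'n \<Rightarrow> (real \<times> 'n::finite bohr_point \<Rightarrow> real) \<Rightarrow> real \<times> 'n bohr_point \<Rightarrow> real" where
  "partial_x j f p = Lim (at 0) (quot_x j f p)"

definition grad_x :: "(real \<times> 'n::finite bohr_point \<Rightarrow> real) \<Rightarrow> real \<times> 'n bohr_point \<Rightarrow> real^'n" where
  "grad_x f p = (\<chi> j. partial_x j f p)"

definition C10 :: "(real \<times> 'n::finite bohr_point \<Rightarrow> real) set" where
  "C10 = {f.
     continuous_map cyl_topology euclidean f \<and>
     compactin cyl_topology (cyl_topology closure_of {p \<in> topspace cyl_topology. f p \<noteq> 0}) \<and>
     (\<forall>p \<in> topspace cyl_topology. (quot_t f p \<longlongrightarrow> partial_t f p) (at 0)) \<and>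
     continuous_map cyl_topology euclidean (partial_t f) \<and>
     (\<forall>j. (\<forall>p \<in> topspace cyl_topology. (quot_x j f p \<longlongrightarrow> partial_x j f p) (at 0)) \<and>
          continuous_map cyl_topology euclidean (partial_x j f))}"

definition entropy_solution ::
  "'n::finite bohr_point measure \<Rightarrow> (real \<Rightarrow> real^'n) \<Rightarrow> ('n bohr_point \<Rightarrow> real) \<Rightarrow>
   (real \<times> 'n bohr_point \<Rightarrow> real) \<Rightarrow> bool" where
  "entropy_solution m \<phi> v0 v \<longleftrightarrow>
     v \<in> Linf (cyl_measure m) \<and>
     (\<forall>k. \<forall>f\<in>C10. (\<forall>p \<in> topspace cyl_topology. 0 \<le> f p) \<longrightarrow>
        (\<integral>p. \<bar>v p - k\<bar> * partial_t f p + (sgn (v p - k) *\<^sub>R (\<phi> (v p) - \<phi> k)) \<bullet> grad_x f p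
           \<partial>cyl_measure m) \<ge> 0) \<and>
     ess_tendsto (\<lambda>t. \<integral>y. \<bar>v (t, y) - v0 y\<bar> \<partial>m) 0 (at_right 0)"

definition affine_fun_on :: "real set \<Rightarrow> (real \<Rightarrow> real) \<Rightarrow> bool" where
  "affine_fun_on I g \<longleftrightarrow> (\<exists>a b. \<forall>u\<in>I. g u = a * u + b)"

definition nondegenerate :: "(real \<Rightarrow> real^'n) \<Rightarrow> (real^'n) set \<Rightarrow> bool" where
  "nondegenerate \<phi> M0 \<longleftrightarrow>
     (\<forall>\<xi>\<in>M0. \<xi> \<noteq> 0 \<longrightarrow>
        (\<forall>I. open I \<and> is_interval I \<and> I \<noteq> {} \<longrightarrow> \<not> affine_fun_on I (\<lambda>u. \<xi> \<bullet> \<phi> u)))"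

end

theory Submission
  imports Defs
begin

text \<open>
  Sufficiency. By non-degeneracy an entropy solution has Fourier coefficients at nonzero frequencies of
  \<open>M0\<close> which tend to zero. For this, fix \<open>\<xi>\<close> and cut the range of the solution into short
  intervals \<open>[a, b]\<close>. The entropies \<open>\<integral>|v - k|\<close> decrease, hence converge, and the entropy inequality
  tested with \<open>\<alpha>(t) (1 + Re (c \<cdot> e))\<close> says that the coefficient of the truncation of \<open>v\<close> to \<open>[a, b]\<close> solves,
  up to the vanishing entropy dissipation, an equation driven by the coefficient of \<open>\<xi> \<cdot> \<phi>\<close> minus its
  chord. Both this source and the truncation are supported on the set \<open>a < v < b\<close>; comparing the
  equations for \<open>[a, b]\<close> and for \<open>[a, x]\<close>, where \<open>x\<close> is the point of largest distance from the chord,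
  bounds the coefficient by the square root of the measure of that set times \<open>b - a\<close>, and the Cauchy-Schwarz inequality sums
  these bounds to something arbitrarily small. Finally, doubling of variables with a nonnegative trigonometric kernel
  \<open>\<kappa>(y - z)\<close> with frequencies in \<open>M0\<close> shows that \<open>\<integral>\<integral>\<kappa>(y - z) |v(t, y) - v(t, z)|\<close>
  essentially does not increase. It is small initially, so \<open>v\<close> stays close to the trigonometric polynomial
  \<open>\<kappa> * v\<close>, which converges to its mean since its finitely many coefficients do.

  Necessity. If \<open>\<xi> \<cdot> \<phi>(w) = a w + b\<close> on an interval, then \<open>x + r cos (2\<pi>(\<xi> \<cdot> y - a t))\<close>, with
  values in this interval, is an entropy solution which does not decay.
\<close>

section \<open>Monotonicity from integrated inequalities\<close>

text \<open>As \<phi> is merely continuous, no derivative of the flux is available; only the entropy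
  inequality can be used. It yields an equation for each Fourier coefficient up to entropy
  dissipation, and such an equation has no damping. The gain comes from comparing two truncations:
  the source for [a, x] contains a fixed multiple of the coefficient for [a, b], whose time average
  is therefore bounded by a constant over the length of the time window, whereas over a long window
  the coefficient may drift. Balancing the two effects produces the square root of the measure of
  the slice. The measures of n slices add up to a bounded number while their lengths are 2R/n, so
  the total is of order 1/sqrt n. The decay obtained is not uniform in the frequency. This is why
  the kernel \<kappa> is chosen once, from the initial data, and never refined: only finitely many
  coefficients are waited for. The mollifier in time is fixed as well, so monotonicity holds for an
  average in t - s, and the decrease of the L1 distance to the mean turns the averaged bound into
  one at a single time.\<close>

definition C1c :: "(real \<Rightarrow> 'b::real_normed_vector) \<Rightarrow> (real \<Rightarrow> 'b) \<Rightarrow> bool" where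
  "C1c \<alpha> \<alpha>' \<longleftrightarrow> (\<forall>t. (\<alpha> has_vector_derivative \<alpha>' t) (at t)) \<and> continuous_on UNIV \<alpha>' \<and>
     (\<exists>a>0. \<exists>b. \<forall>t. t \<notin> {a..b} \<longrightarrow> \<alpha> t = 0)"

text \<open>\<open>C1c\<close> serves to test a time derivative and carries it as a second argument;
  \<open>Cc_on\<close> serves to test a density. An empty \<open>{a..b}\<close> is allowed here and
  gives the zero function, which a unit integral rules out later.\<close>

definition Cc_on :: "real set \<Rightarrow> (real \<Rightarrow> real) \<Rightarrow> bool" where
  "Cc_on I \<theta> \<longleftrightarrow> continuous_on UNIV \<theta> \<and> (\<forall>t. 0 \<le> \<theta> t) \<and> (\<exists>a b. {a..b} \<subseteq> I \<and> (\<forall>t. t \<notin> {a..b} \<longrightarrow> \<theta> t = 0))"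

lemma vector_derivative_zero_outside:
  fixes f :: "real \<Rightarrow> 'b::real_normed_vector"
  assumes "(f has_vector_derivative d) (at t)" "\<And>t. t \<notin> {a..b} \<Longrightarrow> f t = 0" "t \<notin> {a..b}"
  shows "d = 0"
proof -
  have "(f has_vector_derivative 0) (at t)"
    by (rule has_vector_derivative_transform_within_open[where f="\<lambda>_. 0" and S="- {a..b}"])
       (use assms in auto)
  then show ?thesis using assms(1) vector_derivative_unique_at by blast
qed

lemma C1c_support:
  assumes "C1c \<alpha> \<alpha>'"
  obtains a b where "0 < a" "\<And>t. t \<notin> {a..b} \<Longrightarrow> \<alpha> t = 0" "\<And>t. t \<notin> {a..b} \<Longrightarrow> \<alpha>' t = 0"
proof -
  obtain a b where ab: "0 < a" "\<And>t. t \<notin> {a..b} \<Longrightarrow> \<alpha> t = 0" using assms unfolding C1c_def by blast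
  moreover have "\<alpha>' t = 0" if "t \<notin> {a..b}" for t
    by (rule vector_derivative_zero_outside[OF _ ab(2) that]) (use assms in \<open>auto simp: C1c_def\<close>)
  ultimately show ?thesis using that by blast
qed

lemma C1c_continuous: assumes "C1c \<alpha> \<alpha>'" shows "continuous_on UNIV \<alpha>" "continuous_on UNIV \<alpha>'"
  using assms unfolding C1c_def by (auto intro!: continuous_at_imp_continuous_on has_vector_derivative_continuous)

lemma borel_measurable_lborel_continuous [measurable (raw)]:
  fixes f :: "real \<Rightarrow> 'b::topological_space"
  shows "continuous_on UNIV f \<Longrightarrow> f \<in> borel_measurable borel"
  by (rule borel_measurable_continuous_onI)

lemma integrable_bounded_support:
  fixes f :: "real \<Rightarrow> 'b::{banach, second_countable_topology}"
  assumes "f \<in> borel_measurable borel" "\<And>t. norm (f t) \<le> B" "\<And>t. t \<notin> {a..b} \<Longrightarrow> f t = 0"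
  shows "integrable lborel f"
proof -
  have "integrable lborel (\<lambda>t. B * indicator {a..b} t)"
    by (intro integrable_mult_right integrable_real_indicator) (auto simp: emeasure_lborel_Icc_eq)
  then show ?thesis
    by (rule Bochner_Integration.integrable_bound)
       (use assms in \<open>auto split: split_indicator intro!: AE_I2 order.trans[OF assms(2) abs_ge_self]\<close>)
qed

lemma bounded_of_support:
  fixes f :: "real \<Rightarrow> 'b::real_normed_vector"
  assumes "continuous_on UNIV f" "\<And>t. t \<notin> {a..b} \<Longrightarrow> f t = 0"
  obtains B where "0 < B" "\<And>t. norm (f t) \<le> B"
proof -
  have "compact (f ` {a..b})"
    by (meson assms(1) compact_Icc compact_continuous_image continuous_on_subset subset_UNIV)
  then obtain B where B: "\<And>x. x \<in> f ` {a..b} \<Longrightarrow> norm x \<le> B"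
    using compact_imp_bounded[of "f ` {a..b}"] unfolding bounded_iff by blast
  have "norm (f t) \<le> max B 1" for t
    using B[of "f t"] assms(2)[of t] by (cases "t \<in> {a..b}") (auto simp: le_max_iff_disj)
  then show ?thesis by (intro that[of "max B 1"]) auto
qed

lemma Cc_on_integrable:
  assumes "Cc_on I \<theta>" "g \<in> borel_measurable borel" "\<And>t. t \<in> I \<Longrightarrow> \<bar>g t\<bar> \<le> B"
  shows "integrable lborel (\<lambda>t. \<theta> t * g t)"
proof -
  obtain a b where ab: "\<And>t. t \<notin> {a..b} \<Longrightarrow> \<theta> t = 0" and c: "continuous_on UNIV \<theta>" and I: "{a..b} \<subseteq> I"
    using assms(1) unfolding Cc_on_def by blast
  obtain D where D: "0 < D" "\<And>t. norm (\<theta> t) \<le> D"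
    using bounded_of_support[OF c ab] by blast
  show ?thesis
  proof (rule integrable_bounded_support[of _ "D * \<bar>B\<bar>" a b])
    show "norm (\<theta> t * g t) \<le> D * \<bar>B\<bar>" for t
    proof (cases "t \<in> {a..b}")
      case True
      then have "\<bar>g t\<bar> \<le> \<bar>B\<bar>" using assms(3)[of t] I by auto
      then show ?thesis using mult_mono[OF D(2)[of t]] D(1) by (auto simp: abs_mult)
    qed (use ab D(1) in auto)
    show "(\<lambda>t. \<theta> t * g t) \<in> borel_measurable borel"
      using c assms(2) by measurable
  qed (use ab in auto)
qed

lemma Cc_on_bump:
  assumes "a < (b::real)" "{a..b} \<subseteq> I"
  shows "\<exists>\<theta>. Cc_on I \<theta> \<and> (\<integral>t. \<theta> t \<partial>lborel) = 1"
proof -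
  define f where "f t = max 0 ((t - a) * (b - t))" for t
  have supp: "f t = 0" if "t \<notin> {a..b}" for t
    using that assms(1) by (simp add: f_def max_def mult_le_0_iff zero_le_mult_iff not_le) linarith
  have c: "continuous_on UNIV f" unfolding f_def by (intro continuous_intros)
  have cc: "Cc_on I f"
    unfolding Cc_on_def using c supp assms by (auto simp: f_def)
  have fnn: "0 \<le> f t" for t by (simp add: f_def)
  have int: "integrable lborel f"
    using Cc_on_integrable[OF cc, of "\<lambda>_. 1" 1] by simp
  have "0 < (\<integral>t. f t \<partial>lborel)"
  proof (rule ccontr)
    assume "\<not> ?thesis"
    then have "(\<integral>t. f t \<partial>lborel) = 0"
      using Bochner_Integration.integral_nonneg[of lborel f] fnn by fastforce
    then have "AE t in lborel. f t = 0"
      using integral_nonneg_eq_0_iff_AE[OF int] fnn by simp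
    moreover have "f t \<noteq> 0" if "t \<in> {a<..<b}" for t using that by (auto simp: f_def max_def)
    ultimately have "AE t in lborel. t \<notin> {a<..<b}" by (auto elim: eventually_mono)
    then have "emeasure lborel {a<..<b} = 0"
      by (subst (asm) AE_iff_measurable[of "{a<..<b}"]) auto
    then show False using assms by simp
  qed
  then have "Cc_on I (\<lambda>t. f t / (\<integral>t. f t \<partial>lborel)) \<and> (\<integral>t. f t / (\<integral>t. f t \<partial>lborel) \<partial>lborel) = 1"
    using cc unfolding Cc_on_def by (auto intro!: continuous_intros)
  then show ?thesis by blast
qed

lemma integral_Icc_support:
  fixes f :: "real \<Rightarrow> real"
  assumes c: "continuous_on UNIV f" and a: "0 < a" and supp: "\<And>t. t \<notin> {a..b} \<Longrightarrow> f t = 0" and t: "b \<le> t"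
  shows "integral {0..t} f = (\<integral>t. f t \<partial>lborel)"
proof -
  obtain B where B: "0 < B" "\<And>t. norm (f t) \<le> B"
    using bounded_of_support[OF c supp] by blast
  have "integrable lborel f"
    by (rule integrable_bounded_support[OF _ B(2) supp]) (use c in measurable)
  then have "(f has_integral (\<integral>t. f t \<partial>lborel)) UNIV"
    using has_integral_integral_lborel by metis
  then have "((\<lambda>x. if x \<in> {0..t} then f x else 0) has_integral (\<integral>t. f t \<partial>lborel)) UNIV"
    by (rule has_integral_eq[rotated]) (use supp a t in auto)
  then have "(f has_integral (\<integral>t. f t \<partial>lborel)) {0..t}"
    by (simp only: has_integral_restrict_UNIV)
  then show ?thesis by (rule integral_unique)
qed

text \<open>Mean zero is what makes the primitive vanish again to the right of the support, so that
  the difference of two unit bumps is the derivative of an admissible test function.\<close>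

lemma C1c_primitive:
  fixes f :: "real \<Rightarrow> real"
  assumes c: "continuous_on UNIV f" and a: "0 < a" and supp: "\<And>t. t \<notin> {a..b} \<Longrightarrow> f t = 0"
    and int0: "(\<integral>t. f t \<partial>lborel) = 0"
  shows "C1c (\<lambda>t. integral {0..t} f) f"
proof -
  have cS: "continuous_on S f" for S using c continuous_on_subset by blast
  have z: "integral {0..t} f = 0" if "t < a" for t
  proof -
    have "integral {0..t} f = integral {0..t} (\<lambda>_. 0)"
      by (rule integral_cong) (use supp that in auto)
    then show ?thesis by simp
  qed
  have d: "((\<lambda>t. integral {0..t} f) has_vector_derivative f t) (at t)" for t
  proof (cases "t < a")
    case True
    have "((\<lambda>t. integral {0..t} f) has_vector_derivative 0) (at t)"
      by (rule has_vector_derivative_transform_within_open[where f="\<lambda>_. 0" and S="{..<a}"])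
         (use True z in auto)
    then show ?thesis using supp True by auto
  next
    case False
    \<comment> \<open>The upper end \<open>t + 1\<close> puts t in the interior of the interval,
      where the derivative within it is the full derivative.\<close>
    have "((\<lambda>t. integral {0..t} f) has_vector_derivative f t) (at t within {0..t+1})"
      by (rule integral_has_vector_derivative[OF cS]) (use False a in auto)
    then show ?thesis
      using False a by (subst (asm) at_within_interior) (auto simp: interior_atLeastAtMost_real)
  qed
  have e: "integral {0..t} f = 0" if "t \<notin> {a..b}" for t
  proof (cases "t < a")
    case False
    then show ?thesis using integral_Icc_support[OF c a, of b t] supp int0 that False by auto
  qed (use z in auto)
  show ?thesis unfolding C1c_def using d c a e by blast
qed

text \<open>A one-sided fundamental lemma of the calculus of variations. Continuous tests decreasing
  to the indicator of a compact K give a nonnegative integral of G over K; inner regularity carries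
  this to the set where G is negative, which must then be null.\<close>

lemma AE_nonneg_of_tests:
  fixes G :: "real \<Rightarrow> real"
  assumes m: "G \<in> borel_measurable borel" and B0: "\<And>t. t \<in> {a<..<b} \<Longrightarrow> \<bar>G t\<bar> \<le> B0"
    and t: "\<And>\<theta>. Cc_on {a<..<b} \<theta> \<Longrightarrow> 0 \<le> (\<integral>t. \<theta> t * G t \<partial>lborel)"
  shows "AE t in lborel. t \<in> {a<..<b} \<longrightarrow> 0 \<le> G t"
proof -
  define B where "B = \<bar>B0\<bar>"
  have B: "\<bar>G t\<bar> \<le> B" if "t \<in> {a<..<b}" for t using B0[OF that] by (simp add: B_def)
  have Bnn: "0 \<le> B" by (simp add: B_def)
  have intG: "integrable lborel (\<lambda>t. indicator A t * G t)" if "A \<in> sets borel" "A \<subseteq> {a<..<b}" for A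
    by (rule integrable_bounded_support[of _ B a b])
       (use m that B Bnn in \<open>force split: split_indicator\<close>)+
  have K: "0 \<le> (\<integral>t. indicator K t * G t \<partial>lborel)" if K: "compact K" "K \<subseteq> {a<..<b}" for K
  proof (cases "K = {}")
    case False
    have "\<exists>a' b'. a < a' \<and> b' < b \<and> K \<subseteq> {a'..b'}"
    proof -
      obtain l where "l \<in> K" "\<And>x. x \<in> K \<Longrightarrow> l \<le> x" using compact_attains_inf[OF K(1) False] by blast
      moreover obtain u where "u \<in> K" "\<And>x. x \<in> K \<Longrightarrow> x \<le> u" using compact_attains_sup[OF K(1) False] by blast
      ultimately show ?thesis using K(2) by (intro exI[of _ l] exI[of _ u]) auto
    qed
    then obtain a' b' where ab: "a < a'" "b' < b" "K \<subseteq> {a'..b'}" by blast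
    \<comment> \<open>Room for the supports: \<open>{a' - d..b' + d}\<close> still lies in
      \<open>{a<..<b}\<close>.\<close>
    define d where "d = min (a' - a) (b - b') / 2"
    have d: "0 < d" "a < a' - d" "b' + d < b" using ab by (auto simp: d_def min_def field_simps)
    \<comment> \<open>The slope tends to infinity with n, and the summand \<open>1 / d\<close> makes
      every member, even the first, vanish at distance d from K.\<close>
    define \<theta> where "\<theta> n x = max 0 (1 - (real n + 1 / d) * infdist x K)" for n x
    have th: "Cc_on {a<..<b} (\<theta> n)" for n
      unfolding Cc_on_def
    proof (intro conjI exI)
      show "continuous_on UNIV (\<theta> n)" unfolding \<theta>_def by (intro continuous_intros)
      show "{a'-d..b'+d} \<subseteq> {a<..<b}" using d by auto
      show "\<forall>t. t \<notin> {a'-d..b'+d} \<longrightarrow> \<theta> n t = 0"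
      proof (intro allI impI)
        fix t assume t: "t \<notin> {a'-d..b'+d}"
        have "d \<le> infdist t K"
          unfolding infdist_notempty[OF False]
        proof (rule cINF_greatest[OF False])
          fix x assume "x \<in> K"
          then have "a' \<le> x" "x \<le> b'" using ab(3) by auto
          then show "d \<le> dist t x" using t unfolding dist_real_def by (simp add: not_le) linarith
        qed
        then have "1 \<le> (real n + 1 / d) * infdist t K"
          using d mult_mono[of "1/d" "real n + 1/d" d "infdist t K"] by auto
        then show "\<theta> n t = 0" by (auto simp: \<theta>_def)
      qed
    qed (auto simp: \<theta>_def)
    have "(\<lambda>n. \<integral>t. \<theta> n t * G t \<partial>lborel) \<longlonglongrightarrow> (\<integral>t. indicator K t * G t \<partial>lborel)"
    proof (rule integral_dominated_convergence[where w="\<lambda>t. B * indicator {a..b} t"])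
      show "(\<lambda>t. indicator K t * G t) \<in> borel_measurable lborel"
        using m K(1) by (auto intro!: borel_measurable_times borel_measurable_indicator borel_compact)
      show "(\<lambda>t. \<theta> n t * G t) \<in> borel_measurable lborel" for n
        using m th[of n] unfolding Cc_on_def by (auto intro!: borel_measurable_times borel_measurable_continuous_onI)
      show "integrable lborel (\<lambda>t. B * indicator {a..b} t)"
        by (intro integrable_mult_right integrable_real_indicator) (auto simp: emeasure_lborel_Icc_eq)
      show "AE t in lborel. norm (\<theta> n t * G t) \<le> B * indicator {a..b} t" for n
      proof (intro AE_I2)
        fix t
        have "\<theta> n t = 0" if "t \<notin> {a<..<b}"
        proof -
          obtain c d where cd: "{c..d} \<subseteq> {a<..<b}" "\<forall>t. t \<notin> {c..d} \<longrightarrow> \<theta> n t = 0"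
            using th[of n] unfolding Cc_on_def by blast
          have "t \<notin> {c..d}" using cd(1) that by blast
          then show ?thesis using cd(2) by blast
        qed
        moreover have "0 \<le> \<theta> n t" "\<theta> n t \<le> 1" using d(1) by (auto simp: \<theta>_def infdist_nonneg)
        ultimately show "norm (\<theta> n t * G t) \<le> B * indicator {a..b} t"
          using mult_mono[of "\<theta> n t" 1 "\<bar>G t\<bar>" B] B[of t] Bnn
          by (cases "t \<in> {a<..<b}") (auto simp: abs_mult split: split_indicator)
      qed
      show "AE t in lborel. (\<lambda>n. \<theta> n t * G t) \<longlonglongrightarrow> indicator K t * G t"
      proof (intro AE_I2 tendsto_mult tendsto_const)
        fix t
        show "(\<lambda>n. \<theta> n t) \<longlonglongrightarrow> indicator K t"
        proof (cases "t \<in> K")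
          case True then show ?thesis by (simp add: \<theta>_def)
        next
          case F: False
          then have p: "0 < infdist t K"
            using K(1) False compact_imp_closed in_closed_iff_infdist_zero infdist_nonneg
            by (metis less_eq_real_def)
          obtain N where N: "1 / infdist t K < real N" using reals_Archimedean2 by blast
          have "\<theta> n t = 0" if "n \<ge> N" for n
          proof -
            have "1 < real N * infdist t K" using N p by (simp add: field_simps)
            also have "\<dots> \<le> real n * infdist t K" using p that by (intro mult_right_mono) auto
            finally have "1 \<le> real n * infdist t K" by simp
            then have "1 \<le> (real n + 1/d) * infdist t K" using d p by (simp add: distrib_right add_increasing2)
            then show ?thesis by (simp add: \<theta>_def)
          qed
          then show ?thesis using F
            by (intro tendsto_eventually) (auto simp: eventually_sequentially)
        qed
      qed
    qed
    then show ?thesis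
      by (rule LIMSEQ_le_const) (use t[OF th] in auto)
  qed auto
  define A where "A = {t \<in> {a<..<b}. G t < 0}"
  have A: "A \<in> sets borel" "A \<subseteq> {a<..<b}" unfolding A_def using m by (measurable, auto)
  \<comment> \<open>Replacing A by a closed subset F costs at most B times the measure of
    \<open>A - F\<close>; d is chosen to make this at most e.\<close>
  have "0 \<le> (\<integral>t. indicator A t * G t \<partial>lborel)"
  proof (rule field_le_epsilon)
    fix e :: real assume e: "0 < e"
    define d where "d = e / (B + 1)"
    have d: "0 < d" "B * d \<le> e" using e Bnn by (auto simp: d_def field_simps)
    have "A \<in> sets lebesgue" using A by simp
    then obtain F where F: "closed F" "F \<subseteq> A" "A - F \<in> lmeasurable" "emeasure lebesgue (A - F) < ennreal d"
      using sets_lebesgue_inner_closed[of A d] d by metis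
    have cF: "compact F"
      using F A by (meson bounded_Ioo bounded_subset compact_eq_bounded_closed)
    have sF: "F \<in> sets borel" using F(1) by simp
    have mAF: "A - F \<in> sets borel" using A sF by auto
    have AF: "measure lborel (A - F) \<le> d"
    proof -
      have "emeasure lborel (A - F) \<le> ennreal d" using F(4) mAF by (simp add: emeasure_completion)
      then show ?thesis using d by (simp add: measure_def enn2real_leI)
    qed
    have fin: "emeasure lborel (A - F) < \<infinity>"
      by (rule le_less_trans[OF emeasure_mono[of "A - F" "{a..b}" lborel]]) (use A in \<open>auto simp: emeasure_lborel_Icc_eq\<close>)
    have intAF: "integrable lborel (\<lambda>t. B * indicator (A - F) t)"
      using mAF fin by (intro integrable_mult_right integrable_real_indicator) auto
    have "(\<integral>t. indicator A t * G t \<partial>lborel)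
        = (\<integral>t. indicator F t * G t \<partial>lborel) + (\<integral>t. indicator (A - F) t * G t \<partial>lborel)"
      by (subst Bochner_Integration.integral_add[symmetric])
         (use F(2) A sF mAF in \<open>auto intro!: intG Bochner_Integration.integral_cong split: split_indicator\<close>)
    moreover have "0 \<le> (\<integral>t. indicator F t * G t \<partial>lborel)" using K[OF cF] F(2) A(2) by auto
    moreover have "\<bar>\<integral>t. indicator (A - F) t * G t \<partial>lborel\<bar> \<le> (\<integral>t. B * indicator (A - F) t \<partial>lborel)"
    proof -
      have iAF: "integrable lborel (\<lambda>t. indicator (A - F) t * G t)"
        using A(2) by (intro intG mAF) auto
      have "norm (\<integral>t. indicator (A - F) t * G t \<partial>lborel) \<le> (\<integral>t. B * indicator (A - F) t \<partial>lborel)"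
        by (rule Bochner_Integration.integral_norm_bound_integral[OF iAF intAF]) (use B A(2) in \<open>auto simp: indicator_def\<close>)
      then show ?thesis by simp
    qed
    moreover have "(\<integral>t. B * indicator (A - F) t \<partial>lborel) \<le> e"
    proof -
      have "(\<integral>t. B * indicator (A - F) t \<partial>lborel) = B * measure lborel (A - F)"
        unfolding integral_mult_right_zero Bochner_Integration.integral_indicator by simp
      also have "\<dots> \<le> B * d" by (rule mult_left_mono[OF AF Bnn])
      finally show ?thesis using d(2) by simp
    qed
    ultimately show "0 \<le> (\<integral>t. indicator A t * G t \<partial>lborel) + e" by linarith
  qed
  moreover have "(\<integral>t. indicator A t * G t \<partial>lborel) = - (\<integral>t. indicator A t * (- G t) \<partial>lborel)" by simp
  ultimately have "(\<integral>t. indicator A t * (- G t) \<partial>lborel) \<le> 0" by linarith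
  moreover have "0 \<le> (\<integral>t. indicator A t * (- G t) \<partial>lborel)"
    by (rule integral_nonneg_AE) (auto simp: A_def split: split_indicator)
  ultimately have "AE t in lborel. indicator A t * (- G t) = 0"
    using integral_nonneg_eq_0_iff_AE[of lborel "\<lambda>t. indicator A t * (- G t)"] intG[OF A]
    by (auto simp: A_def split: split_indicator)
  then show ?thesis by eventually_elim (auto simp: A_def split: split_indicator_asm)
qed

text \<open>Fix a cut q. A unit bump left of q minus one right of q is the derivative of a
  nonnegative test function, so every weighted average of g on the left dominates every one on the
  right. The infimum c of the left averages therefore separates: g \<ge> c almost everywhere before
  q and g \<le> c after it. With rational cuts only, the exceptional sets have a null union, and any
  two remaining times are separated by some cut.\<close>

lemma ess_decreasing:
  fixes g :: "real \<Rightarrow> real"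
  assumes m: "g \<in> borel_measurable borel" and bd: "\<And>T. \<exists>B. \<forall>t\<in>{0<..<T}. \<bar>g t\<bar> \<le> B"
    and t: "\<And>\<alpha> \<alpha>'. C1c \<alpha> \<alpha>' \<Longrightarrow> (\<And>t. 0 \<le> \<alpha> t) \<Longrightarrow> 0 \<le> (\<integral>t. \<alpha>' t * g t \<partial>lborel)"
  shows "\<exists>N\<in>null_sets lborel. \<forall>s t. 0 < s \<longrightarrow> s < t \<longrightarrow> s \<notin> N \<longrightarrow> t \<notin> N \<longrightarrow> g t \<le> g s"
proof -
  obtain B where B: "\<And>T t. t \<in> {0<..<T} \<Longrightarrow> \<bar>g t\<bar> \<le> B T" using bd by metis
  have key: "(\<integral>t. \<gamma> t * g t \<partial>lborel) \<le> (\<integral>t. \<theta> t * g t \<partial>lborel)"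
    if q: "0 < q" and th: "Cc_on {0<..<q} \<theta>" "(\<integral>t. \<theta> t \<partial>lborel) = 1" and ga: "Cc_on {q<..<r} \<gamma>" "(\<integral>t. \<gamma> t \<partial>lborel) = 1"
    for q r \<theta> \<gamma>
  proof -
    have Br: "\<bar>g t\<bar> \<le> B r" if "t \<in> {q<..<r}" for t using B[of t r] q that by auto
    obtain a b where ab: "{a..b} \<subseteq> {0<..<q}" "\<And>t. t \<notin> {a..b} \<Longrightarrow> \<theta> t = 0" and c1: "continuous_on UNIV \<theta>"
      and n1: "\<And>t. 0 \<le> \<theta> t"
      using th(1) unfolding Cc_on_def by blast
    obtain a' b' where ab': "{a'..b'} \<subseteq> {q<..<r}" "\<And>t. t \<notin> {a'..b'} \<Longrightarrow> \<gamma> t = 0" and c2: "continuous_on UNIV \<gamma>"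
      and n2: "\<And>t. 0 \<le> \<gamma> t"
      using ga(1) unfolding Cc_on_def by blast
    have ne: "a \<le> b" "a' \<le> b'"
    proof -
      show "a \<le> b"
      proof (rule ccontr)
        assume "\<not> a \<le> b" then have "\<theta> = (\<lambda>_. 0)" using ab(2) by (auto simp: fun_eq_iff)
        then show False using th(2) by simp
      qed
      show "a' \<le> b'"
      proof (rule ccontr)
        assume "\<not> a' \<le> b'" then have "\<gamma> = (\<lambda>_. 0)" using ab'(2) by (auto simp: fun_eq_iff)
        then show False using ga(2) by simp
      qed
    qed
    have i1: "integrable lborel \<theta>" using Cc_on_integrable[OF th(1), of "\<lambda>_. 1" 1] by simp
    have i2: "integrable lborel \<gamma>" using Cc_on_integrable[OF ga(1), of "\<lambda>_. 1" 1] by simp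
    have pos: "0 < a" "b < q" "q < a'" using ab(1) ab'(1) ne by auto
    define f where "f t = \<theta> t - \<gamma> t" for t
    have cf: "continuous_on UNIV f" unfolding f_def using c1 c2 by (intro continuous_intros)
    have sf: "f t = 0" if "t \<notin> {a..b'}" for t using that ab(2) ab'(2) pos ne by (force simp: f_def)
    have int0: "(\<integral>t. f t \<partial>lborel) = 0" by (simp add: f_def i1 i2 th(2) ga(2))
    have C: "C1c (\<lambda>t. integral {0..t} f) f"
      by (rule C1c_primitive[OF cf pos(1) sf int0])
    have io: "f integrable_on {c..d}" for c d
      by (rule integrable_continuous_real) (use cf continuous_on_subset in blast)
    \<comment> \<open>Before q only \<theta> has contributed. After q the total mass zero rewrites
      the primitive as minus the remaining integral, to which only - \<gamma> contributes.\<close>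
    have nn: "0 \<le> integral {0..t} f" for t
    proof (cases "t \<le> q")
      case True
      then show ?thesis
        by (intro integral_nonneg io) (use n1 ab'(2) pos in \<open>auto simp: f_def\<close>)
    next
      case False
      have "integral {0..t} f = 0 - integral {t..b'} f"
      proof (cases "t \<le> b'")
        case True
        have "integral {0..t} f + integral {t..b'} f = integral {0..b'} f"
          by (rule Henstock_Kurzweil_Integration.integral_combine) (use True False pos io ne in auto)
        moreover have "integral {0..b'} f = 0"
          using integral_Icc_support[OF cf pos(1) sf] int0 by simp
        ultimately show ?thesis by simp
      next
        case F: False
        show ?thesis using integral_Icc_support[OF cf pos(1), of b' t] sf int0 F by auto
      qed
      moreover have "integral {t..b'} f \<le> 0"
      proof -
        have "integral {t..b'} f \<le> integral {t..b'} (\<lambda>_. 0)"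
          by (intro integral_le io) (use n2 ab(2) pos False in \<open>auto simp: f_def\<close>)
        then show ?thesis by simp
      qed
      ultimately show ?thesis by simp
    qed
    have "0 \<le> (\<integral>t. f t * g t \<partial>lborel)" by (rule t[OF C nn])
    also have "\<dots> = (\<integral>t. \<theta> t * g t \<partial>lborel) - (\<integral>t. \<gamma> t * g t \<partial>lborel)"
      unfolding f_def left_diff_distrib
      by (rule Bochner_Integration.integral_diff[OF Cc_on_integrable[OF th(1) m, of "B q"] Cc_on_integrable[OF ga(1) m Br]])
         (use B in auto)
    finally show ?thesis by simp
  qed
  have "\<exists>c. AE t in lborel. (0 < t \<and> t < q \<longrightarrow> c \<le> g t) \<and> (q < t \<longrightarrow> g t \<le> c)" if q: "0 < q" for q
  proof -
    define T where "T = {\<integral>t. \<theta> t * g t \<partial>lborel |\<theta>. Cc_on {0<..<q} \<theta> \<and> (\<integral>t. \<theta> t \<partial>lborel) = 1}"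
    obtain \<theta>0 where th0: "Cc_on {0<..<q} \<theta>0" "(\<integral>t. \<theta>0 t \<partial>lborel) = 1"
    proof -
      have "{q/3..q/2} \<subseteq> {0<..<q}" using q by (auto simp: field_simps)
      then show ?thesis using Cc_on_bump[of "q/3" "q/2" "{0<..<q}"] q that by auto
    qed
    have Tne: "T \<noteq> {}" using th0 unfolding T_def by blast
    obtain \<gamma>0 where ga0: "Cc_on {q<..<q+3} \<gamma>0" "(\<integral>t. \<gamma>0 t \<partial>lborel) = 1"
    proof -
      have "{q+1..q+2} \<subseteq> {q<..<q+3}" by auto
      then show ?thesis using Cc_on_bump[of "q+1" "q+2" "{q<..<q+3}"] that by auto
    qed
    have bdd: "bdd_below T"
      unfolding T_def by (rule bdd_belowI[of _ "\<integral>t. \<gamma>0 t * g t \<partial>lborel"]) (use key[OF q _ _ ga0] in blast)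
    define c where "c = Inf T"
    have lo: "c \<le> (\<integral>t. \<theta> t * g t \<partial>lborel)" if "Cc_on {0<..<q} \<theta>" "(\<integral>t. \<theta> t \<partial>lborel) = 1" for \<theta>
      unfolding c_def by (rule cInf_lower[OF _ bdd]) (use that in \<open>auto simp: T_def\<close>)
    have hi: "(\<integral>t. \<gamma> t * g t \<partial>lborel) \<le> c" if "Cc_on {q<..<r} \<gamma>" "(\<integral>t. \<gamma> t \<partial>lborel) = 1" for \<gamma> r
      unfolding c_def by (rule cInf_greatest[OF Tne]) (use that key[OF q] in \<open>auto simp: T_def\<close>)
    have Bc: "\<bar>g t - c\<bar> \<le> B T + \<bar>c\<bar>" if "t \<in> {0<..<T}" for t T using B[OF that] by linarith
    have split: "(\<integral>t. \<theta> t * g t \<partial>lborel) = (\<integral>t. \<theta> t * (g t - c) \<partial>lborel) + c * (\<integral>t. \<theta> t \<partial>lborel)"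
      if "Cc_on I \<theta>" "I \<subseteq> {0<..<T}" for I \<theta> T
    proof -
      have BI: "\<bar>g t\<bar> \<le> B T" if "t \<in> I" for t using B[of t T] that \<open>I \<subseteq> _\<close> by auto
      have "integrable lborel \<theta>" using Cc_on_integrable[OF that(1), of "\<lambda>_. 1" 1] by simp
      then show ?thesis using Cc_on_integrable[OF that(1) m BI]
        by (simp add: right_diff_distrib)
    qed
    \<comment> \<open>A weight of mass zero cannot be normalized, but it vanishes almost
      everywhere.\<close>
    have zero: "(\<integral>t. \<theta> t * h t \<partial>lborel) = 0" if "Cc_on I \<theta>" "(\<integral>t. \<theta> t \<partial>lborel) = 0" for I \<theta> and h :: "real \<Rightarrow> real"
    proof -
      have "integrable lborel \<theta>" using Cc_on_integrable[OF that(1), of "\<lambda>_. 1" 1] by simp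
      then have "AE t in lborel. \<theta> t = 0"
        using that integral_nonneg_eq_0_iff_AE[of lborel \<theta>] by (auto simp: Cc_on_def)
      then have "(\<integral>t. \<theta> t * h t \<partial>lborel) = (\<integral>t. 0 \<partial>lborel)"
        by (intro integral_eq_zero_AE[THEN trans]) (auto elim: eventually_mono)
      then show ?thesis by simp
    qed
    have scale: "Cc_on I (\<lambda>t. \<theta> t / J)" if "Cc_on I \<theta>" "0 < J" for I \<theta> J
      using that unfolding Cc_on_def by (auto intro!: continuous_intros)
    have a1: "AE t in lborel. t \<in> {0<..<q} \<longrightarrow> 0 \<le> g t - c"
    proof (rule AE_nonneg_of_tests[OF _ Bc])
      fix \<theta> assume th: "Cc_on {0<..<q} \<theta>"
      define J where "J = (\<integral>t. \<theta> t \<partial>lborel)"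
      have "0 \<le> J" using th unfolding J_def Cc_on_def by (intro integral_nonneg_AE) auto
      then consider "J = 0" | "0 < J" by linarith
      then show "0 \<le> (\<integral>t. \<theta> t * (g t - c) \<partial>lborel)"
      proof cases
        case 2
        have "c \<le> (\<integral>t. \<theta> t / J * g t \<partial>lborel)"
          by (rule lo[OF scale[OF th 2]]) (use 2 in \<open>simp add: J_def[symmetric]\<close>)
        also have "\<dots> = (\<integral>t. \<theta> t * g t \<partial>lborel) / J" by (simp add: field_simps flip: integral_divide_zero)
        finally have "c * J \<le> (\<integral>t. \<theta> t * g t \<partial>lborel)" using 2 by (simp add: field_simps)
        then show ?thesis using split[OF th order.refl] by (simp add: J_def)
      qed (use zero[OF th] in \<open>simp add: J_def\<close>)
    qed (use m in measurable)
    \<comment> \<open>Bounds for g are available on bounded intervals only, so the half-line after q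
      is exhausted by the intervals \<open>{q<..<q + real r}\<close>.\<close>
    have a2: "AE t in lborel. \<forall>r::nat. t \<in> {q<..<q+real r} \<longrightarrow> 0 \<le> c - g t"
    proof (subst AE_all_countable, rule allI)
      fix r :: nat
      show "AE t in lborel. t \<in> {q<..<q+real r} \<longrightarrow> 0 \<le> c - g t"
      proof (rule AE_nonneg_of_tests[of _ _ _ "B (q + real r) + \<bar>c\<bar>"])
        fix \<theta> assume th: "Cc_on {q<..<q+real r} \<theta>"
        define J where "J = (\<integral>t. \<theta> t \<partial>lborel)"
        have "0 \<le> J" using th unfolding J_def Cc_on_def by (intro integral_nonneg_AE) auto
        then consider "J = 0" | "0 < J" by linarith
        then have "0 \<ge> (\<integral>t. \<theta> t * (g t - c) \<partial>lborel)"
        proof cases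
          case 2
          have "c \<ge> (\<integral>t. \<theta> t / J * g t \<partial>lborel)"
            by (rule hi[OF scale[OF th 2]]) (use 2 in \<open>simp add: J_def[symmetric]\<close>)
          also have "(\<integral>t. \<theta> t / J * g t \<partial>lborel) = (\<integral>t. \<theta> t * g t \<partial>lborel) / J"
            by (simp add: field_simps flip: integral_divide_zero)
          finally have "c * J \<ge> (\<integral>t. \<theta> t * g t \<partial>lborel)" using 2 by (simp add: field_simps)
          moreover have "{q<..<q+real r} \<subseteq> {0<..<q+real r}" using q by auto
          ultimately show ?thesis using split[OF th] by (simp add: J_def)
        qed (use zero[OF th] in \<open>simp add: J_def\<close>)
        moreover have "(\<integral>t. \<theta> t * (c - g t) \<partial>lborel) = (\<integral>t. - (\<theta> t * (g t - c)) \<partial>lborel)"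
          by (rule Bochner_Integration.integral_cong) (auto simp: algebra_simps)
        ultimately show "0 \<le> (\<integral>t. \<theta> t * (c - g t) \<partial>lborel)" by simp
      next
        show "\<bar>c - g t\<bar> \<le> B (q + real r) + \<bar>c\<bar>" if "t \<in> {q<..<q + real r}" for t
          using Bc[of t "q + real r"] that q by (auto simp: abs_minus_commute)
      qed (use m in measurable)
    qed
    show ?thesis
    proof (intro exI[of _ c])
      show "AE t in lborel. (0 < t \<and> t < q \<longrightarrow> c \<le> g t) \<and> (q < t \<longrightarrow> g t \<le> c)"
        using a1 a2
      proof eventually_elim
        case (elim t)
        show ?case
        proof (intro conjI impI)
          assume "q < t"
          obtain r where "t - q < real r" using reals_Archimedean2 by blast
          then show "g t \<le> c" using elim(2)[rule_format, of r] \<open>q < t\<close> by auto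
        qed (use elim(1) in auto)
      qed
    qed
  qed
  then have "\<forall>q. \<exists>c. 0 < q \<longrightarrow> (AE t in lborel. (0 < t \<and> t < q \<longrightarrow> c \<le> g t) \<and> (q < t \<longrightarrow> g t \<le> c))" by blast
  from choice[OF this] obtain c where c: "\<And>q. 0 < q \<Longrightarrow> AE t in lborel. (0 < t \<and> t < q \<longrightarrow> c q \<le> g t) \<and> (q < t \<longrightarrow> g t \<le> c q)"
    by blast
  have "AE t in lborel. \<forall>q\<in>\<rat>. 0 < q \<longrightarrow> (0 < t \<and> t < q \<longrightarrow> c q \<le> g t) \<and> (q < t \<longrightarrow> g t \<le> c q)"
    by (subst AE_ball_countable[OF countable_rat]) (use c in auto)
  then obtain N where N: "N \<in> null_sets lborel"
    "{t \<in> space lborel. \<not> (\<forall>q\<in>\<rat>. 0 < q \<longrightarrow> (0 < t \<and> t < q \<longrightarrow> c q \<le> g t) \<and> (q < t \<longrightarrow> g t \<le> c q))} \<subseteq> N"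
    unfolding eventually_ae_filter by blast
  show ?thesis
  proof (intro bexI[OF _ N(1)] allI impI)
    fix s t :: real assume st: "0 < s" "s < t" "s \<notin> N" "t \<notin> N"
    obtain q where q: "q \<in> \<rat>" "s < q" "q < t" using Rats_dense_in_real[OF st(2)] by blast
    have "0 < q" using st(1) q(2) by linarith
    have good: "\<forall>q\<in>\<rat>. 0 < q \<longrightarrow> (0 < x \<and> x < q \<longrightarrow> c q \<le> g x) \<and> (q < x \<longrightarrow> g x \<le> c q)" if "x \<notin> N" for x
    proof (rule ccontr)
      assume "\<not> ?thesis"
      then have "x \<in> {t \<in> space lborel. \<not> (\<forall>q\<in>\<rat>. 0 < q \<longrightarrow> (0 < t \<and> t < q \<longrightarrow> c q \<le> g t) \<and> (q < t \<longrightarrow> g t \<le> c q))}"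
        by (simp only: mem_Collect_eq space_lborel space_borel UNIV_I simp_thms)
      then show False using N(2) that by blast
    qed
    have "c q \<le> g s" "g t \<le> c q" using good[OF st(3)] good[OF st(4)] st q \<open>0 < q\<close> by auto
    then show "g t \<le> g s" by linarith
  qed
qed

text \<open>The primitive Y of the drift is subtracted from g. As y is merely bounded and
  measurable, the integration by parts of \<alpha>' against Y is done by Fubini's theorem on the
  triangle 0 < r \<le> t.\<close>

lemma ess_decreasing_drift:
  fixes g y :: "real \<Rightarrow> real"
  assumes m[measurable]: "g \<in> borel_measurable borel" "y \<in> borel_measurable borel"
    and B: "\<And>t. \<bar>g t\<bar> \<le> B" "\<And>t. \<bar>y t\<bar> \<le> D"
    and t: "\<And>\<alpha> \<alpha>'. C1c \<alpha> \<alpha>' \<Longrightarrow> (\<And>t. 0 \<le> \<alpha> t) \<Longrightarrow> 0 \<le> (\<integral>t. \<alpha>' t * g t + \<alpha> t * y t \<partial>lborel)"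
  shows "\<exists>N\<in>null_sets lborel. \<forall>s t. 0 < s \<longrightarrow> s < t \<longrightarrow> s \<notin> N \<longrightarrow> t \<notin> N \<longrightarrow>
    g t \<le> g s + (\<integral>r. indicator {s<..t} r * y r \<partial>lborel)"
proof -
  have D0: "0 \<le> D" using B(2)[of 0] by linarith
  have iy: "integrable lborel (\<lambda>r. indicator {a<..b} r * y r)" for a b :: real
    by (rule integrable_bounded_support[of _ D a b]) (use B(2) D0 in \<open>auto split: split_indicator\<close>)
  define Y where "Y t = (\<integral>r. indicator {0<..t} r * y r \<partial>lborel)" for t
  have Ym[measurable]: "Y \<in> borel_measurable borel"
  proof -
    have "(\<lambda>t. \<integral>r. (if 0 < r \<and> r \<le> t then y r else 0) \<partial>lborel) \<in> borel_measurable borel"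
      by measurable
    also have "(\<lambda>t. \<integral>r. (if 0 < r \<and> r \<le> t then y r else 0) \<partial>lborel) = Y"
      unfolding Y_def by (intro ext Bochner_Integration.integral_cong) auto
    finally show ?thesis .
  qed
  have Yb: "\<bar>Y t\<bar> \<le> D * T" if "t \<in> {0<..<T}" for t T
  proof -
    have "norm (Y t) \<le> (\<integral>r. D * indicator {0<..t} r \<partial>lborel)"
      unfolding Y_def
    proof (rule Bochner_Integration.integral_norm_bound_integral[OF iy])
      show "integrable lborel (\<lambda>r. D * indicator {0<..t} r)"
        by (intro integrable_mult_right integrable_real_indicator) (use that in auto)
    qed (use B(2) D0 in \<open>auto split: split_indicator\<close>)
    also have "\<dots> = D * t" using that unfolding integral_mult_right_zero by simp
    also have "\<dots> \<le> D * T" using that D0 by (intro mult_left_mono) auto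
    finally show ?thesis by simp
  qed
  have "\<exists>N\<in>null_sets lborel. \<forall>s t. 0 < s \<longrightarrow> s < t \<longrightarrow> s \<notin> N \<longrightarrow> t \<notin> N \<longrightarrow> g t - Y t \<le> g s - Y s"
  proof (rule ess_decreasing)
    show "\<exists>C. \<forall>t\<in>{0<..<T}. \<bar>g t - Y t\<bar> \<le> C" for T
    proof (intro exI ballI)
      fix t assume "t \<in> {0<..<T}"
      then show "\<bar>g t - Y t\<bar> \<le> B + D * T" using Yb[of t T] B(1)[of t] by linarith
    qed
    fix \<alpha> \<alpha>' :: "real \<Rightarrow> real" assume C: "C1c \<alpha> \<alpha>'" and nn: "\<And>t. 0 \<le> \<alpha> t"
    obtain a b where ab: "0 < a" "\<And>t. t \<notin> {a..b} \<Longrightarrow> \<alpha> t = 0" and ab': "\<And>t. t \<notin> {a..b} \<Longrightarrow> \<alpha>' t = 0"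
      using C1c_support[OF C] by blast
    have der: "(\<alpha> has_vector_derivative \<alpha>' t) (at t)" for t using C unfolding C1c_def by blast
    note c = C1c_continuous(1)[OF C] and c' = C1c_continuous(2)[OF C]
    obtain A where A: "0 < A" "\<And>t. norm (\<alpha> t) \<le> A" using bounded_of_support[OF c ab(2)] by blast
    obtain A' where A': "0 < A'" "\<And>t. norm (\<alpha>' t) \<le> A'" using bounded_of_support[OF c' ab'] by blast
    have am[measurable]: "\<alpha> \<in> borel_measurable borel" "\<alpha>' \<in> borel_measurable borel"
      using c c' by (auto intro: borel_measurable_continuous_onI)
    have i1: "integrable lborel (\<lambda>t. \<alpha>' t * g t)"
      by (rule integrable_bounded_support[of _ "A' * B" a b])
         (use ab' A' B(1) mult_mono[OF A'(2) B(1)] in \<open>auto simp: abs_mult\<close>)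
    have i2: "integrable lborel (\<lambda>t. \<alpha> t * y t)"
      by (rule integrable_bounded_support[of _ "A * D" a b])
         (use ab A B(2) mult_mono[OF A(2) B(2)] in \<open>auto simp: abs_mult\<close>)
    have i3: "integrable lborel (\<lambda>t. \<alpha>' t * Y t)"
    proof (rule integrable_bounded_support[of _ "A' * (D * (\<bar>b\<bar> + 1))" a b])
      show "norm (\<alpha>' t * Y t) \<le> A' * (D * (\<bar>b\<bar> + 1))" for t
      proof (cases "t \<in> {a..b}")
        case True
        then have "\<bar>Y t\<bar> \<le> D * (\<bar>b\<bar> + 1)" using ab(1) by (intro Yb) auto
        then show ?thesis using A' by (auto simp: abs_mult intro!: mult_mono)
      qed (use ab' A' D0 in auto)
    qed (use ab' in auto)
    \<comment> \<open>Integrated in r this is \<open>\<alpha>' t * Y t\<close>; integrated in t it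
      is \<open>- (\<alpha> r * y r)\<close>, by the fundamental theorem and because \<alpha>
      vanishes eventually.\<close>
    define F where "F = (\<lambda>(t, r). \<alpha>' t * (if 0 < r \<and> r \<le> t then y r else 0) :: real)"
    have "integrable (lborel \<Otimes>\<^sub>M lborel) F"
    proof (rule Bochner_Integration.integrable_bound)
      show "integrable (lborel \<Otimes>\<^sub>M lborel) (\<lambda>x. (A' * D) * indicator ({a..b} \<times> {0..b}) x)"
        by (intro integrable_mult_right integrable_real_indicator)
           (auto simp: lborel.emeasure_pair_measure_Times emeasure_lborel_Icc_eq ennreal_mult_less_top)
      show "F \<in> borel_measurable (lborel \<Otimes>\<^sub>M lborel)" unfolding F_def by measurable
      show "AE x in lborel \<Otimes>\<^sub>M lborel. norm (F x) \<le> norm (A' * D * indicat_real ({a..b} \<times> {0..b}) x)"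
      proof (intro AE_I2)
        fix x :: "real \<times> real"
        show "norm (F x) \<le> norm (A' * D * indicat_real ({a..b} \<times> {0..b}) x)"
          using A' D0 ab'[of "fst x"] mult_mono[OF A'(2)[of "fst x"] B(2)[of "snd x"]]
          by (cases x) (auto simp: F_def abs_mult indicator_def)
      qed
    qed
    then have "(\<integral>r. (\<integral>t. F (t, r) \<partial>lborel) \<partial>lborel) = (\<integral>t. (\<integral>r. F (t, r) \<partial>lborel) \<partial>lborel)"
      using lborel_pair.Fubini_integral[of "\<lambda>t r. F (t, r)"] by simp
    moreover have "(\<integral>r. F (t, r) \<partial>lborel) = \<alpha>' t * Y t" for t
      unfolding F_def Y_def by (simp, intro disjI2 Bochner_Integration.integral_cong) auto
    moreover have "(\<integral>t. F (t, r) \<partial>lborel) = - (\<alpha> r * y r)" for r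
    proof (cases "0 < r")
      case True
      \<comment> \<open>The upper end lies beyond r and beyond the support of \<alpha>, so the
        boundary term there is zero.\<close>
      have "(\<integral>t. F (t, r) \<partial>lborel) = (\<integral>t. (indicator {r..\<bar>r\<bar> + \<bar>b\<bar> + 1} t *\<^sub>R \<alpha>' t) * y r \<partial>lborel)"
        unfolding F_def
      proof (intro Bochner_Integration.integral_cong refl)
        fix t :: real
        have "\<alpha>' t = 0" if "\<not> t \<le> \<bar>r\<bar> + \<bar>b\<bar> + 1" using that by (intro ab') auto
        then show "(case (t, r) of (t, r) \<Rightarrow> \<alpha>' t * (if 0 < r \<and> r \<le> t then y r else 0)) =
          (indicator {r..\<bar>r\<bar> + \<bar>b\<bar> + 1} t *\<^sub>R \<alpha>' t) * y r"
          using True by (cases "t \<le> \<bar>r\<bar> + \<bar>b\<bar> + 1") (auto split: split_indicator)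
      qed
      also have "\<dots> = (\<integral>t. indicator {r..\<bar>r\<bar> + \<bar>b\<bar> + 1} t *\<^sub>R \<alpha>' t \<partial>lborel) * y r" by simp
      also have "(\<integral>t. indicator {r..\<bar>r\<bar> + \<bar>b\<bar> + 1} t *\<^sub>R \<alpha>' t \<partial>lborel) = \<alpha> (\<bar>r\<bar> + \<bar>b\<bar> + 1) - \<alpha> r"
        by (rule integral_FTC_Icc)
           (use der c' in \<open>auto intro: has_vector_derivative_at_within continuous_on_subset\<close>)
      also have "\<alpha> (\<bar>r\<bar> + \<bar>b\<bar> + 1) = 0" by (intro ab(2)) auto
      finally show ?thesis by simp
    next
      case False
      then show ?thesis using ab(1) ab(2)[of r] by (simp add: F_def)
    qed
    ultimately have "(\<integral>t. \<alpha>' t * Y t \<partial>lborel) = - (\<integral>t. \<alpha> t * y t \<partial>lborel)" by simp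
    moreover have "0 \<le> (\<integral>t. \<alpha>' t * g t + \<alpha> t * y t \<partial>lborel)" by (rule t[OF C nn])
    ultimately show "0 \<le> (\<integral>t. \<alpha>' t * (g t - Y t) \<partial>lborel)"
      using i1 i2 i3 by (simp add: right_diff_distrib)
  qed measurable
  then obtain N where N: "N \<in> null_sets lborel"
    "\<And>s t. 0 < s \<Longrightarrow> s < t \<Longrightarrow> s \<notin> N \<Longrightarrow> t \<notin> N \<Longrightarrow> g t - Y t \<le> g s - Y s" by blast
  show ?thesis
  proof (intro bexI[OF _ N(1)] allI impI)
    fix s t :: real assume st: "0 < s" "s < t" "s \<notin> N" "t \<notin> N"
    have "Y t = (\<integral>r. indicator {0<..s} r * y r + indicator {s<..t} r * y r \<partial>lborel)"
      unfolding Y_def using st by (intro Bochner_Integration.integral_cong) (auto split: split_indicator)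
    also have "\<dots> = Y s + (\<integral>r. indicator {s<..t} r * y r \<partial>lborel)"
      unfolding Y_def by (rule Bochner_Integration.integral_add[OF iy iy])
    finally show "g t \<le> g s + (\<integral>r. indicator {s<..t} r * y r \<partial>lborel)" using N(2)[OF st] by simp
  qed
qed

section \<open>The entropy inequality for trigonometric test functions\<close>

text \<open>For almost every large time. In filter form finite conjunctions are immediate; the next
  lemma unpacks it into one null set and one threshold.\<close>

definition eventually_ae :: "(real \<Rightarrow> bool) \<Rightarrow> bool" where
  "eventually_ae P \<longleftrightarrow> (\<forall>\<^sub>F t in inf at_top (ae_filter lborel). P t)"

lemma eventually_ae_iff:
  "eventually_ae P \<longleftrightarrow> (\<exists>N\<in>null_sets lborel. \<exists>T>0. \<forall>t>T. t \<notin> N \<longrightarrow> P t)" (is "?l \<longleftrightarrow> ?r")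
proof
  assume ?l
  then obtain Q R where Q: "eventually Q at_top" "AE t in lborel. R t" "\<And>t. Q t \<Longrightarrow> R t \<Longrightarrow> P t"
    unfolding eventually_ae_def eventually_inf by blast
  obtain T where T: "\<And>t. t \<ge> T \<Longrightarrow> Q t" using Q(1) unfolding eventually_at_top_linorder by blast
  obtain N where N: "N \<in> null_sets lborel" "{t \<in> space lborel. \<not> R t} \<subseteq> N"
    using Q(2) unfolding eventually_ae_filter by blast
  have "P t" if "t > max T 1" "t \<notin> N" for t using that N(2) T[of t] by (intro Q(3)) auto
  then show ?r using N(1) by (intro bexI[of _ N] exI[of _ "max T 1"]) auto
next
  assume ?r
  then obtain N T where N: "N \<in> null_sets lborel" "\<And>t. t > T \<Longrightarrow> t \<notin> N \<Longrightarrow> P t" by blast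
  have "AE t in lborel. t \<notin> N" by (rule AE_not_in[OF N(1)])
  then show ?l unfolding eventually_ae_def eventually_inf using N(2)
    by (intro exI[of _ "\<lambda>t. t > T"] exI[of _ "\<lambda>t. t \<notin> N"]) (auto simp: eventually_gt_at_top)
qed

lemma eventually_aeE:
  assumes "eventually_ae P"
  obtains N T where "N \<in> null_sets lborel" "0 < T" "\<And>t. T < t \<Longrightarrow> t \<notin> N \<Longrightarrow> P t"
  using assms unfolding eventually_ae_iff by blast

lemma eventually_aeI:
  assumes "N \<in> null_sets lborel" "\<And>t. T < t \<Longrightarrow> t \<notin> N \<Longrightarrow> P t"
  shows "eventually_ae P"
  unfolding eventually_ae_iff using assms by (intro bexI[of _ N] exI[of _ "max T 1"]) auto

lemma eventually_ae_mono: "eventually_ae P \<Longrightarrow> (\<And>t. P t \<Longrightarrow> Q t) \<Longrightarrow> eventually_ae Q"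
  unfolding eventually_ae_def by (rule eventually_mono)

lemma eventually_ae_conj: "eventually_ae P \<Longrightarrow> eventually_ae Q \<Longrightarrow> eventually_ae (\<lambda>t. P t \<and> Q t)"
  unfolding eventually_ae_def by (rule eventually_conj)

lemma eventually_ae_ball_finite:
  "finite I \<Longrightarrow> (\<And>i. i \<in> I \<Longrightarrow> eventually_ae (P i)) \<Longrightarrow> eventually_ae (\<lambda>t. \<forall>i\<in>I. P i t)"
  unfolding eventually_ae_def by (rule eventually_ball_finite) auto

lemma norm_integral_le_integral:
  fixes f :: "'a \<Rightarrow> 'b::{banach, second_countable_topology}"
  assumes "integrable M f" "integrable M g" "\<And>x. x \<in> space M \<Longrightarrow> norm (f x) \<le> g x"
  shows "norm (\<integral>x. f x \<partial>M) \<le> (\<integral>x. g x \<partial>M)"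
  using integral_norm_bound[of M f] integral_mono[OF integrable_norm[OF assms(1)] assms(2,3)] by (rule order.trans)

text \<open>The character of frequency \<sigma> of the time axis. Multiplying a coefficient by it
  removes a linear flux of slope \<sigma>.\<close>

definition tone :: "real \<Rightarrow> real \<Rightarrow> complex" where
  "tone \<sigma> t = exp (2 * of_real pi * \<i> * of_real \<sigma> * of_real t)"

lemma norm_tone [simp]: "norm (tone \<sigma> t) = 1"
  by (simp add: tone_def norm_exp_eq_Re)

lemma tone_derivative: "(tone \<sigma> has_vector_derivative (2 * of_real pi * \<i> * of_real \<sigma> * tone \<sigma> t)) (at t)"
  unfolding tone_def[abs_def]
  by (auto intro!: derivative_eq_intros has_vector_derivative_real_field simp: algebra_simps)

lemma continuous_on_tone [continuous_intros]: "continuous_on A f \<Longrightarrow> continuous_on A (\<lambda>x. tone \<sigma> (f x))"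
  unfolding tone_def by (intro continuous_intros)

lemma tone_measurable [measurable]: "tone \<sigma> \<in> borel_measurable borel"
  by (intro borel_measurable_continuous_onI continuous_intros)

text \<open>What sufficiency uses of the harmonic analysis on the compactification: a probability
  space with a multiplicative family of unimodular functions, of mean zero at nonzero frequencies.
  There is no group law here; a function of y - z appears as a combination of
  \<open>e l y * cnj (e l z)\<close>.\<close>

locale char_space = finite_measure m for m :: "'a measure" +
  fixes e :: "real^'n \<Rightarrow> 'a \<Rightarrow> complex"
  assumes total: "measure m (space m) = 1"
    and e_measurable[measurable]: "\<And>l. e l \<in> borel_measurable m"
    and e_norm: "\<And>l y. y \<in> space m \<Longrightarrow> norm (e l y) = 1"
    and e_add: "\<And>l k y. y \<in> space m \<Longrightarrow> e (l + k) y = e l y * e k y"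
    and e_int: "\<And>l. l \<noteq> 0 \<Longrightarrow> (\<integral>y. e l y \<partial>m) = 0"
begin

sublocale slab: pair_sigma_finite lborel m
  by unfold_locales

lemma e_zero: "y \<in> space m \<Longrightarrow> e 0 y = 1"
  using e_add[of y 0 0] e_norm[of y 0] by auto

lemma e_uminus: assumes "y \<in> space m" shows "e (- l) y = cnj (e l y)"
proof -
  have "e (- l) y * e l y = 1" using e_add[OF assms, of "- l" l] e_zero[OF assms] by simp
  moreover have "cnj (e l y) * e l y = 1"
    using e_norm[OF assms, of l] by (metis complex_norm_square mult.commute of_real_1 power_one)
  moreover have "e l y \<noteq> 0" using e_norm[OF assms, of l] by auto
  ultimately show ?thesis by (metis mult_right_cancel)
qed

lemma integrable_bdd:
  fixes f :: "'a \<Rightarrow> 'b::{banach, second_countable_topology}"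
  assumes "f \<in> borel_measurable m" "\<And>y. y \<in> space m \<Longrightarrow> norm (f y) \<le> B"
  shows "integrable m f"
  by (rule integrable_const_bound[where B=B]) (use assms in \<open>auto intro!: AE_I2\<close>)

lemma norm_integral_le:
  fixes f :: "'a \<Rightarrow> 'b::{banach, second_countable_topology}"
  assumes "f \<in> borel_measurable m" "\<And>y. y \<in> space m \<Longrightarrow> norm (f y) \<le> B"
  shows "norm (\<integral>y. f y \<partial>m) \<le> B"
proof -
  have "norm (\<integral>y. f y \<partial>m) \<le> (\<integral>y. B \<partial>m)"
    by (rule norm_integral_le_integral)
       (use assms in \<open>auto intro: integrable_bdd[OF assms]\<close>)
  then show ?thesis using total by simp
qed

lemma integrable_slab:
  fixes F :: "real \<times> 'a \<Rightarrow> 'b::{banach, second_countable_topology}"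
  assumes "F \<in> borel_measurable (lborel \<Otimes>\<^sub>M m)" "\<And>t y. y \<in> space m \<Longrightarrow> norm (F (t, y)) \<le> B"
    and "\<And>t y. y \<in> space m \<Longrightarrow> t \<notin> {a..b} \<Longrightarrow> F (t, y) = 0"
  shows "integrable (lborel \<Otimes>\<^sub>M m) F"
proof (rule Bochner_Integration.integrable_bound)
  show "integrable (lborel \<Otimes>\<^sub>M m) (\<lambda>x. B * indicator ({a..b} \<times> space m) x)"
    by (intro integrable_mult_right integrable_real_indicator)
       (auto simp: emeasure_pair_measure_Times emeasure_lborel_Icc_eq ennreal_mult_less_top
             emeasure_eq_measure)
  show "AE x in lborel \<Otimes>\<^sub>M m. norm (F x) \<le> norm (B * indicat_real ({a..b} \<times> space m) x)"
    using assms(2,3) by (intro AE_I2) (force simp: space_pair_measure indicator_def intro: order.trans[OF assms(2)])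
qed fact

lemma slab_integral:
  fixes F :: "real \<times> 'a \<Rightarrow> 'b::{banach, second_countable_topology}"
  assumes "integrable (lborel \<Otimes>\<^sub>M m) F"
  shows "(\<integral>p. F p \<partial>(lborel \<Otimes>\<^sub>M m)) = (\<integral>t. (\<integral>y. F (t, y) \<partial>m) \<partial>lborel)"
  using slab.integral_fst'[OF assms] by simp

end

text \<open>The entropy inequality for tests that are trigonometric polynomials in y with
  coefficients \<open>A l\<close> in t, the derivatives being carried out: the gradient of the real
  part of A times a character of frequency l is the real part of 2 \<pi> i A times the character,
  times l. The function u is bounded at every point and defined for all times, which spares
  almost-everywhere arguments; the tests do not see t \<le> 0.\<close>

locale trig_entropy = char_space m e for m :: "'a measure" and e :: "real^'n \<Rightarrow> 'a \<Rightarrow> complex" +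
  fixes \<phi> :: "real \<Rightarrow> real^'n" and u :: "real \<times> 'a \<Rightarrow> real" and R :: real
  assumes phi_cont: "continuous_on UNIV \<phi>" and R_pos: "0 < R"
    and u_measurable[measurable]: "u \<in> borel_measurable (lborel \<Otimes>\<^sub>M m)"
    and u_bound: "\<And>p. \<bar>u p\<bar> \<le> R"
    and entropy: "\<And>k S A A'. finite S \<Longrightarrow> (\<And>l. l \<in> S \<Longrightarrow> C1c (A l) (A' l)) \<Longrightarrow>
       (\<And>t y. y \<in> space m \<Longrightarrow> 0 \<le> Re (\<Sum>l\<in>S. A l t * e l y)) \<Longrightarrow>
       0 \<le> (\<integral>(t, y). \<bar>u (t, y) - k\<bar> * Re (\<Sum>l\<in>S. A' l t * e l y) +
          sgn (u (t, y) - k) * Re (\<Sum>l\<in>S. 2 * of_real pi * \<i> * A l t * e l y * of_real (l \<bullet> (\<phi> (u (t, y)) - \<phi> k)))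
          \<partial>(lborel \<Otimes>\<^sub>M m))"
begin

lemma phi_measurable[measurable]: "\<phi> \<in> borel_measurable borel"
  using phi_cont by (rule borel_measurable_continuous_onI)

text \<open>The Fourier coefficient at \<xi> of g(u(t, .)), with the conjugate character written as
  \<open>e (- \<xi>)\<close>.\<close>

definition co :: "real^'n \<Rightarrow> (real \<Rightarrow> real) \<Rightarrow> real \<Rightarrow> complex" where
  "co \<xi> g t = (\<integral>y. of_real (g (u (t, y))) * e (- \<xi>) y \<partial>m)"

definition En :: "real \<Rightarrow> real \<Rightarrow> real" where
  "En k t = (\<integral>y. \<bar>u (t, y) - k\<bar> \<partial>m)"

text \<open>Bounds are asked on [-R, R] only, which contains the range of u, so that the identity
  and |w - k| are covered.\<close>

definition bdd_fun :: "(real \<Rightarrow> real) \<Rightarrow> bool" where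
  "bdd_fun g \<longleftrightarrow> g \<in> borel_measurable borel \<and> (\<exists>B. \<forall>w\<in>{-R..R}. \<bar>g w\<bar> \<le> B)"

lemma u_in: "u p \<in> {-R..R}" using u_bound[of p] by (auto simp: abs_le_iff)

lemma bdd_fun_continuous: assumes "continuous_on UNIV g" shows "bdd_fun g"
proof -
  have "compact (g ` {-R..R})" using assms by (meson compact_Icc compact_continuous_image continuous_on_subset subset_UNIV)
  then have "\<exists>B. \<forall>x\<in>g ` {-R..R}. norm x \<le> B" using compact_imp_bounded bounded_iff by blast
  then show ?thesis unfolding bdd_fun_def using assms by (auto intro: borel_measurable_continuous_onI)
qed

lemma bdd_fun_measurable: "bdd_fun g \<Longrightarrow> g \<in> borel_measurable borel"
  by (simp add: bdd_fun_def)

lemma bdd_funE: assumes "bdd_fun g" obtains B where "0 \<le> B" "\<And>p. \<bar>g (u p)\<bar> \<le> B"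
proof -
  obtain B where "\<forall>w\<in>{-R..R}. \<bar>g w\<bar> \<le> B" using assms bdd_fun_def by blast
  then have "\<bar>g (u p)\<bar> \<le> \<bar>B\<bar>" for p using u_in[of p] by (meson abs_ge_self order.trans)
  then show ?thesis by (intro that[of "\<bar>B\<bar>"]) auto
qed

lemma co_integrable: assumes "bdd_fun g" shows "integrable m (\<lambda>y. of_real (g (u (t, y))) * e l y)"
proof -
  note [measurable] = bdd_fun_measurable[OF assms]
  obtain B where B: "0 \<le> B" "\<And>p. \<bar>g (u p)\<bar> \<le> B" using bdd_funE[OF assms] by blast
  show ?thesis
    by (rule integrable_bdd[where B=B]) (use assms B e_norm in \<open>auto simp: norm_mult\<close>)
qed

lemma co_measurable: assumes "bdd_fun g" shows "co \<xi> g \<in> borel_measurable borel"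
proof -
  note [measurable] = bdd_fun_measurable[OF assms]
  show ?thesis unfolding co_def[abs_def] by measurable
qed

lemma co_bound: assumes "bdd_fun g" "\<And>w. w \<in> {-R..R} \<Longrightarrow> \<bar>g w\<bar> \<le> B" shows "norm (co \<xi> g t) \<le> B"
  unfolding co_def
proof (rule norm_integral_le)
  note [measurable] = bdd_fun_measurable[OF assms(1)]
  show "(\<lambda>y. of_real (g (u (t, y))) * e (- \<xi>) y) \<in> borel_measurable m" by measurable
qed (use assms(2)[OF u_in] e_norm in \<open>auto simp: norm_mult\<close>)

lemma co_lin: assumes "bdd_fun g" "bdd_fun h"
  shows "co \<xi> (\<lambda>w. a * g w + b * h w) t = of_real a * co \<xi> g t + of_real b * co \<xi> h t"
proof -
  have "co \<xi> (\<lambda>w. a * g w + b * h w) t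
    = (\<integral>y. of_real a * (of_real (g (u (t, y))) * e (- \<xi>) y) + of_real b * (of_real (h (u (t, y))) * e (- \<xi>) y) \<partial>m)"
    unfolding co_def by (intro Bochner_Integration.integral_cong) (auto simp: algebra_simps)
  also have "\<dots> = of_real a * co \<xi> g t + of_real b * co \<xi> h t"
    unfolding co_def
    by (subst Bochner_Integration.integral_add)
       (use co_integrable[OF assms(1)] co_integrable[OF assms(2)] in auto)
  finally show ?thesis .
qed

lemma co_const: assumes "\<xi> \<noteq> 0" shows "co \<xi> (\<lambda>w. c) t = 0"
  unfolding co_def using e_int[of "- \<xi>"] assms by simp

text \<open>Constants have no coefficient at a nonzero frequency. Functions of u that agree up to a
  constant are therefore interchangeable, which links entropies, truncations and fluxes
  below.\<close>

lemma co_affine: assumes "bdd_fun g" "\<xi> \<noteq> 0" "\<And>w. h w = a * g w + c"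
  shows "co \<xi> h t = of_real a * co \<xi> g t"
proof -
  have "h = (\<lambda>w. a * g w + 1 * c)" using assms(3) by auto
  then show ?thesis using co_lin[OF assms(1), of "\<lambda>_. c" \<xi> a 1 t] co_const[OF assms(2)]
    by (simp add: bdd_fun_continuous)
qed

text \<open>The mechanism by which a small set {a < u < b} makes coefficients small. It is applied
  to sources that vanish at both ends of [a, b] and beyond.\<close>

lemma co_small:
  assumes "bdd_fun g" "a < b" "0 \<le> H" "\<And>w. w \<in> {-R..R} \<Longrightarrow> \<bar>g w\<bar> \<le> (if a < w \<and> w < b then H else 0)"
  shows "norm (co \<xi> g t) \<le> H * measure m {y\<in>space m. a < u (t, y) \<and> u (t, y) < b}"
proof -
  let ?M = "{y\<in>space m. a < u (t, y) \<and> u (t, y) < b}"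
  have M: "?M \<in> sets m" by measurable
  have "norm (co \<xi> g t) \<le> (\<integral>y. H * indicator ?M y \<partial>m)"
    unfolding co_def
  proof (rule norm_integral_le_integral[OF co_integrable[OF assms(1)]])
    show "integrable m (\<lambda>y. H * indicator ?M y)"
      using M by (intro integrable_mult_right integrable_real_indicator) (auto simp: emeasure_eq_measure)
    fix y assume y: "y \<in> space m"
    then show "norm (of_real (g (u (t, y))) * e (- \<xi>) y) \<le> H * indicator ?M y"
      using assms(4)[OF u_in, of "(t, y)"] e_norm[OF y] by (auto simp: norm_mult indicator_def split: if_splits)
  qed
  also have "\<dots> = H * measure m ?M" using M by simp
  finally show ?thesis .
qed

lemma En_bounds: "0 \<le> En k t" "En k t \<le> R + \<bar>k\<bar>"
proof -
  have "\<bar>u p - k\<bar> \<le> R + \<bar>k\<bar>" for p using u_bound[of p] by linarith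
  then have "norm (En k t) \<le> R + \<bar>k\<bar>" unfolding En_def by (intro norm_integral_le) auto
  then show "En k t \<le> R + \<bar>k\<bar>" by simp
  show "0 \<le> En k t" unfolding En_def by (intro integral_nonneg_AE) auto
qed

lemma En_measurable[measurable]: "En k \<in> borel_measurable borel"
  unfolding En_def by measurable

text \<open>The test function is
  \<open>\<alpha> t * (1 + Re (c * tone \<sigma> t * e (- \<xi>) y))\<close>, nonnegative when |c|
  \<le> 1. It shows that \<open>En k + Re (c X)\<close> decreases up to the drift
  \<open>Re (c Y)\<close>. With Z the defect of the equation X' = Y over [s, t], this reads Re (c Z)
  \<le> \<open>En k s - En k t\<close>, and the values c = 0, 1, -1, i, -i give both claims.\<close>

lemma entropy_ode:
  fixes \<sigma> k :: real and \<xi> :: "real^'n"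
  defines "X \<equiv> \<lambda>t::real. tone \<sigma> t * co \<xi> (\<lambda>w. \<bar>w - k\<bar>) t"
    and "Y \<equiv> \<lambda>t::real. 2 * of_real pi * \<i> * tone \<sigma> t *
           co \<xi> (\<lambda>w. \<sigma> * \<bar>w - k\<bar> - sgn (w - k) * (\<xi> \<bullet> (\<phi> w - \<phi> k))) t"
  assumes xi: "\<xi> \<noteq> 0"
  shows "\<exists>N\<in>null_sets lborel. \<forall>s t. 0 < s \<longrightarrow> s < t \<longrightarrow> s \<notin> N \<longrightarrow> t \<notin> N \<longrightarrow>
    En k t \<le> En k s \<and>
    norm (X t - X s - (\<integral>r. indicator {s<..t} r * Y r \<partial>lborel)) \<le> 2 * (En k s - En k t)"
proof -
  let ?E = "tone \<sigma>"
  let ?Q = "\<lambda>w. \<sigma> * \<bar>w - k\<bar> - sgn (w - k) * (\<xi> \<bullet> (\<phi> w - \<phi> k))"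
  have b1: "bdd_fun (\<lambda>w. \<bar>w - k\<bar>)" by (intro bdd_fun_continuous continuous_intros)
  have b2: "bdd_fun ?Q"
  proof -
    have "bdd_fun (\<lambda>w. \<bar>\<xi> \<bullet> (\<phi> w - \<phi> k)\<bar> + \<bar>\<sigma>\<bar> * \<bar>w - k\<bar>)"
      using phi_cont by (intro bdd_fun_continuous continuous_intros)
    then obtain B where B: "\<And>w. w\<in>{-R..R} \<Longrightarrow> \<bar>\<bar>\<xi> \<bullet> (\<phi> w - \<phi> k)\<bar> + \<bar>\<sigma>\<bar> * \<bar>w - k\<bar>\<bar> \<le> B" unfolding bdd_fun_def by blast
    have "\<bar>?Q w\<bar> \<le> B" if "w \<in> {-R..R}" for w
    proof -
      have "\<bar>?Q w\<bar> \<le> \<bar>\<sigma> * \<bar>w - k\<bar>\<bar> + \<bar>sgn (w - k) * (\<xi> \<bullet> (\<phi> w - \<phi> k))\<bar>" by (rule abs_triangle_ineq4)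
      also have "\<dots> \<le> \<bar>\<sigma>\<bar> * \<bar>w - k\<bar> + \<bar>\<xi> \<bullet> (\<phi> w - \<phi> k)\<bar>" by (auto simp: abs_mult sgn_if)
      also have "\<dots> \<le> B" using B[OF that] by linarith
      finally show ?thesis .
    qed
    moreover have "?Q \<in> borel_measurable borel" by measurable
    ultimately show ?thesis unfolding bdd_fun_def by blast
  qed
  have nE: "norm (?E t) = 1" for t by simp
  obtain B1 where B1: "0 \<le> B1" "\<And>p. \<bar>\<bar>u p - k\<bar>\<bar> \<le> B1" using bdd_funE[OF b1] by blast
  obtain B2 where B2: "0 \<le> B2" "\<And>p. \<bar>?Q (u p)\<bar> \<le> B2" using bdd_funE[OF b2] by blast
  have coB: "norm (co \<xi> g t) \<le> B" if "bdd_fun g" "\<And>p. \<bar>g (u p)\<bar> \<le> B" for g B t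
    unfolding co_def
  proof (rule norm_integral_le)
    note [measurable] = bdd_fun_measurable[OF that(1)]
    show "(\<lambda>y. of_real (g (u (t, y))) * e (- \<xi>) y) \<in> borel_measurable m" by measurable
  qed (use that(2) e_norm in \<open>auto simp: norm_mult\<close>)
  have XB: "norm (X t) \<le> B1" for t unfolding X_def norm_mult nE using coB[OF b1 B1(2)] by simp
  have YB: "norm (Y t) \<le> 2 * pi * B2" for t unfolding Y_def norm_mult nE using coB[OF b2 B2(2)] by simp
  have Xm[measurable]: "X \<in> borel_measurable borel" unfolding X_def using co_measurable[OF b1, measurable] by measurable
  have Ym[measurable]: "Y \<in> borel_measurable borel" unfolding Y_def using co_measurable[OF b2, measurable] by measurable
  have main: "\<exists>N\<in>null_sets lborel. \<forall>s t. 0 < s \<longrightarrow> s < t \<longrightarrow> s \<notin> N \<longrightarrow> t \<notin> N \<longrightarrow>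
    (En k t + Re (c * X t)) \<le> (En k s + Re (c * X s)) + (\<integral>r. indicator {s<..t} r * Re (c * Y r) \<partial>lborel)"
    if c: "norm c \<le> 1" for c
  proof (rule ess_decreasing_drift)
    show "\<bar>En k t + Re (c * X t)\<bar> \<le> (R + \<bar>k\<bar>) + B1" for t
    proof -
      have "\<bar>Re (c * X t)\<bar> \<le> norm c * norm (X t)" using abs_Re_le_cmod norm_mult by metis
      also have "\<dots> \<le> 1 * B1" using c XB by (intro mult_mono) auto
      finally show ?thesis using En_bounds[of k t] by linarith
    qed
    show "\<bar>Re (c * Y t)\<bar> \<le> 2 * pi * B2" for t
    proof -
      have "\<bar>Re (c * Y t)\<bar> \<le> norm c * norm (Y t)" using abs_Re_le_cmod norm_mult by metis
      also have "\<dots> \<le> 1 * (2 * pi * B2)" using c YB by (intro mult_mono) auto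
      finally show ?thesis by simp
    qed
    fix \<alpha> \<alpha>' :: "real \<Rightarrow> real" assume C: "C1c \<alpha> \<alpha>'" and nn: "\<And>t. 0 \<le> \<alpha> t"
    obtain a b where ab: "0 < a" "\<And>t. t \<notin> {a..b} \<Longrightarrow> \<alpha> t = 0" and ab': "\<And>t. t \<notin> {a..b} \<Longrightarrow> \<alpha>' t = 0"
      using C1c_support[OF C] by blast
    have der: "(\<alpha> has_vector_derivative \<alpha>' t) (at t)" for t using C unfolding C1c_def by blast
    note cc = C1c_continuous(1)[OF C] and c' = C1c_continuous(2)[OF C]
    obtain A where A: "0 < A" "\<And>t. norm (\<alpha> t) \<le> A" using bounded_of_support[OF cc ab(2)] by blast
    obtain A' where A': "0 < A'" "\<And>t. norm (\<alpha>' t) \<le> A'" using bounded_of_support[OF c' ab'] by blast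
    have am[measurable]: "\<alpha> \<in> borel_measurable borel" "\<alpha>' \<in> borel_measurable borel"
      using cc c' by (auto intro: borel_measurable_continuous_onI)
    \<comment> \<open>Frequency 0 carries the constant 1 of the test function; the only other
      frequency at which these coefficients are used is - \<xi>.\<close>
    define AA where "AA l t = (if l = 0 then of_real (\<alpha> t) else of_real (\<alpha> t) * c * ?E t)" for l :: "real^'n" and t
    define AA' where "AA' l t = (if l = 0 then of_real (\<alpha>' t) else
        of_real (\<alpha>' t) * c * ?E t + of_real (\<alpha> t) * c * (2 * of_real pi * \<i> * \<sigma> * ?E t))" for l :: "real^'n" and t
    have CA: "C1c (AA l) (AA' l)" for l
    proof -
      have 1: "((\<lambda>t. of_real (\<alpha> t)) has_vector_derivative (of_real (\<alpha>' t) :: complex)) (at t)" for t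
        using bounded_linear.has_vector_derivative[OF bounded_linear_of_real der] .
      have 2: "(?E has_vector_derivative (2 * of_real pi * \<i> * \<sigma> * ?E t)) (at t)" for t
        by (rule tone_derivative)
      have 3: "((\<lambda>t. of_real (\<alpha> t) * c * ?E t) has_vector_derivative
          (of_real (\<alpha>' t) * c * ?E t + of_real (\<alpha> t) * c * (2 * of_real pi * \<i> * \<sigma> * ?E t))) (at t)" for t
        using has_vector_derivative_mult[OF has_vector_derivative_mult_left[OF 1, of c] 2, of t] by (simp add: add.commute)
      show ?thesis
      proof (cases "l = 0")
        case True
        then show ?thesis unfolding C1c_def AA_def AA'_def using 1 c' ab by (auto intro!: continuous_intros)
      next
        case False
        then have eq: "AA l = (\<lambda>t. of_real (\<alpha> t) * c * ?E t)"
          "AA' l = (\<lambda>t. of_real (\<alpha>' t) * c * ?E t + of_real (\<alpha> t) * c * (2 * of_real pi * \<i> * \<sigma> * ?E t))"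
          by (auto simp: AA_def AA'_def fun_eq_iff)
        show ?thesis unfolding C1c_def eq
        proof (intro conjI allI 3)
          show "continuous_on UNIV (\<lambda>t. of_real (\<alpha>' t) * c * ?E t + of_real (\<alpha> t) * c * (2 * of_real pi * \<i> * \<sigma> * ?E t))"
            using c' cc by (intro continuous_intros)
          show "\<exists>a>0. \<exists>b. \<forall>t. t \<notin> {a..b} \<longrightarrow> of_real (\<alpha> t) * c * ?E t = 0"
            using ab by (intro exI[of _ a]) auto
        qed
      qed
    qed
    have S: "(\<Sum>l\<in>{0, -\<xi>}. f l) = f 0 + f (- \<xi>)" for f :: "real^'n \<Rightarrow> complex" using xi by simp
    have "0 \<le> (\<integral>(t, y). \<bar>u (t, y) - k\<bar> * Re (\<Sum>l\<in>{0, -\<xi>}. AA' l t * e l y) +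
          sgn (u (t, y) - k) * Re (\<Sum>l\<in>{0, -\<xi>}. 2 * of_real pi * \<i> * AA l t * e l y * of_real (l \<bullet> (\<phi> (u (t, y)) - \<phi> k)))
          \<partial>(lborel \<Otimes>\<^sub>M m))"
    proof (rule entropy[OF _ CA])
      fix t y assume y: "y \<in> space m"
      have "\<bar>Re (c * ?E t * e (- \<xi>) y)\<bar> \<le> norm (c * ?E t * e (- \<xi>) y)" by (rule abs_Re_le_cmod)
      also have "\<dots> \<le> 1" using c e_norm[OF y] nE by (simp add: norm_mult)
      finally have "0 \<le> \<alpha> t * (1 + Re (c * ?E t * e (- \<xi>) y))" using nn[of t] by (intro mult_nonneg_nonneg) auto
      also have "\<dots> = Re (\<Sum>l\<in>{0, -\<xi>}. AA l t * e l y)"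
        unfolding S using xi e_zero[OF y] by (simp add: AA_def algebra_simps)
      finally show "0 \<le> Re (\<Sum>l\<in>{0, -\<xi>}. AA l t * e l y)" .
    qed simp
    also have "\<dots> = (\<integral>p. \<alpha>' (fst p) * \<bar>u p - k\<bar> + Re (of_real (\<alpha>' (fst p)) * c * (?E (fst p) * (of_real \<bar>u p - k\<bar> * e (- \<xi>) (snd p)))
        + of_real (\<alpha> (fst p)) * c * (2 * of_real pi * \<i> * ?E (fst p) * (of_real (?Q (u p)) * e (- \<xi>) (snd p)))) \<partial>(lborel \<Otimes>\<^sub>M m))"
    proof (rule Bochner_Integration.integral_cong[OF refl])
      fix p :: "real \<times> 'a" assume "p \<in> space (lborel \<Otimes>\<^sub>M m)"
      then obtain t y where p: "p = (t, y)" and y: "y \<in> space m" by (cases p) (auto simp: space_pair_measure)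
      have 0: "AA 0 = (\<lambda>t. of_real (\<alpha> t))" "AA' 0 = (\<lambda>t. of_real (\<alpha>' t))"
        "AA (-\<xi>) = (\<lambda>t. of_real (\<alpha> t) * c * ?E t)"
        "AA' (-\<xi>) = (\<lambda>t. of_real (\<alpha>' t) * c * ?E t + of_real (\<alpha> t) * c * (2 * of_real pi * \<i> * \<sigma> * ?E t))"
        using xi by (auto simp: AA_def AA'_def fun_eq_iff)
      have sc: "r * Re z = Re (of_real r * z)" for r z by simp
      have rr: "\<alpha>' t * \<bar>u (t, y) - k\<bar> = Re (of_real (\<alpha>' t) * of_real \<bar>u (t, y) - k\<bar>)" by simp
      show "(case p of (t, y) \<Rightarrow> \<bar>u (t, y) - k\<bar> * Re (\<Sum>l\<in>{0, -\<xi>}. AA' l t * e l y) +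
          sgn (u (t, y) - k) * Re (\<Sum>l\<in>{0, -\<xi>}. 2 * of_real pi * \<i> * AA l t * e l y * of_real (l \<bullet> (\<phi> (u (t, y)) - \<phi> k)))) =
        \<alpha>' (fst p) * \<bar>u p - k\<bar> + Re (of_real (\<alpha>' (fst p)) * c * (?E (fst p) * (of_real \<bar>u p - k\<bar> * e (- \<xi>) (snd p)))
        + of_real (\<alpha> (fst p)) * c * (2 * of_real pi * \<i> * ?E (fst p) * (of_real (?Q (u p)) * e (- \<xi>) (snd p))))"
        unfolding p S 0 prod.case fst_conv snd_conv e_zero[OF y] sc rr plus_complex.simps(1)[symmetric]
        by (rule arg_cong[of _ _ Re]) (simp add: algebra_simps)
    qed
    also have "\<dots> = (\<integral>t. \<integral>y. \<alpha>' t * \<bar>u (t,y) - k\<bar> + Re (of_real (\<alpha>' t) * c * (?E t * (of_real \<bar>u (t,y) - k\<bar> * e (- \<xi>) y))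
        + of_real (\<alpha> t) * c * (2 * of_real pi * \<i> * ?E t * (of_real (?Q (u (t,y))) * e (- \<xi>) y))) \<partial>m \<partial>lborel)"
    proof (subst slab_integral[OF integrable_slab[where a=a and b=b and B="A' * B1 + (A' * B1 + A * (2 * pi * B2))"]])
      fix t y assume y: "y \<in> space m"
      have "\<bar>\<alpha>' t * \<bar>u (t,y) - k\<bar>\<bar> \<le> A' * B1" using A'(2)[of t] B1(2)[of "(t,y)"] A'(1) by (auto simp: abs_mult intro!: mult_mono)
      moreover have "norm (of_real (\<alpha>' t) * c * (?E t * (of_real \<bar>u (t,y) - k\<bar> * e (- \<xi>) y))) \<le> A' * 1 * (1 * (B1 * 1))"
        unfolding norm_mult nE e_norm[OF y] using A'(1) A'(2)[of t] B1 c by (intro mult_mono) auto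
      moreover have "norm (of_real (\<alpha> t) * c * (2 * of_real pi * \<i> * ?E t * (of_real (?Q (u (t,y))) * e (- \<xi>) y))) \<le> A * 1 * (2 * pi * B2)"
      proof -
        have "norm (of_real (\<alpha> t) * c * (2 * of_real pi * \<i> * ?E t * (of_real (?Q (u (t,y))) * e (- \<xi>) y)))
          = \<bar>\<alpha> t\<bar> * norm c * (2 * pi * \<bar>?Q (u (t,y))\<bar>)"
          unfolding norm_mult nE e_norm[OF y] norm_of_real by simp
        also have "\<dots> \<le> A * 1 * (2 * pi * B2)"
          using A(1) A(2)[of t] B2(1) B2(2)[of "(t,y)"] c by (intro mult_mono) auto
        finally show ?thesis .
      qed
      ultimately show "norm (\<alpha>' (fst (t,y)) * \<bar>u (t,y) - k\<bar> + Re (of_real (\<alpha>' (fst (t,y))) * c * (?E (fst (t,y)) * (of_real \<bar>u (t,y) - k\<bar> * e (- \<xi>) (snd (t,y))))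
        + of_real (\<alpha> (fst (t,y))) * c * (2 * of_real pi * \<i> * ?E (fst (t,y)) * (of_real (?Q (u (t,y))) * e (- \<xi>) (snd (t,y)))))) \<le> A' * B1 + (A' * B1 + A * (2 * pi * B2))"
        unfolding fst_conv snd_conv real_norm_def
        by (intro order.trans[OF abs_triangle_ineq] add_mono order.trans[OF abs_Re_le_cmod] order.trans[OF norm_triangle_ineq]) auto
    qed (use ab ab' in auto)
    also have "\<dots> = (\<integral>t. \<alpha>' t * (En k t + Re (c * X t)) + \<alpha> t * Re (c * Y t) \<partial>lborel)"
    proof (rule Bochner_Integration.integral_cong[OF refl])
      fix t
      have i0: "integrable m (\<lambda>y. \<bar>u (t, y) - k\<bar>)"
        by (rule integrable_bdd[where B=B1]) (use B1 in auto)
      have i1: "integrable m (\<lambda>y. of_real \<bar>u (t,y) - k\<bar> * e (- \<xi>) y)" by (rule co_integrable[OF b1])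
      have i2: "integrable m (\<lambda>y. of_real (?Q (u (t,y))) * e (- \<xi>) y)" by (rule co_integrable[OF b2])
      have "(\<integral>y. \<alpha>' t * \<bar>u (t,y) - k\<bar> + Re (of_real (\<alpha>' t) * c * (?E t * (of_real \<bar>u (t,y) - k\<bar> * e (- \<xi>) y))
        + of_real (\<alpha> t) * c * (2 * of_real pi * \<i> * ?E t * (of_real (?Q (u (t,y))) * e (- \<xi>) y))) \<partial>m)
        = \<alpha>' t * En k t + Re (of_real (\<alpha>' t) * c * (?E t * co \<xi> (\<lambda>w. \<bar>w - k\<bar>) t) + of_real (\<alpha> t) * c * (2 * of_real pi * \<i> * ?E t * co \<xi> ?Q t))"
        unfolding co_def En_def
        by (subst Bochner_Integration.integral_add integral_Re,
            (intro integrable_mult_right i0 i1 i2 Bochner_Integration.integrable_add integrable_Re)+)+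
           (simp only: integral_mult_right_zero)
      also have "\<dots> = \<alpha>' t * (En k t + Re (c * X t)) + \<alpha> t * Re (c * Y t)"
        unfolding X_def Y_def by (simp add: algebra_simps)
      finally show "(\<integral>y. \<alpha>' t * \<bar>u (t,y) - k\<bar> + Re (of_real (\<alpha>' t) * c * (?E t * (of_real \<bar>u (t,y) - k\<bar> * e (- \<xi>) y))
        + of_real (\<alpha> t) * c * (2 * of_real pi * \<i> * ?E t * (of_real (?Q (u (t,y))) * e (- \<xi>) y))) \<partial>m)
        = \<alpha>' t * (En k t + Re (c * X t)) + \<alpha> t * Re (c * Y t)" .
    qed
    finally show "0 \<le> (\<integral>t. \<alpha>' t * (En k t + Re (c * X t)) + \<alpha> t * Re (c * Y t) \<partial>lborel)" .
  qed measurable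
  let ?P = "\<lambda>c N. N \<in> null_sets lborel \<and> (\<forall>s t. 0 < s \<longrightarrow> s < t \<longrightarrow> s \<notin> N \<longrightarrow> t \<notin> N \<longrightarrow>
    (En k t + Re (c * X t)) \<le> (En k s + Re (c * X s)) + (\<integral>r. indicator {s<..t} r * Re (c * Y r) \<partial>lborel))"
  have "\<forall>c\<in>{0, 1, -1, \<i>, -\<i>}. \<exists>N. ?P c N"
  proof (rule ballI)
    fix c :: complex assume "c \<in> {0, 1, -1, \<i>, -\<i>}"
    then have "norm c \<le> 1" by auto
    from main[OF this] show "\<exists>N. ?P c N" unfolding Bex_def .
  qed
  from bchoice[OF this] obtain NN where P: "\<forall>c\<in>{0, 1, -1, \<i>, -\<i>}. ?P c (NN c)" ..
  have NN: "\<And>c. c \<in> {0, 1, -1, \<i>, -\<i>} \<Longrightarrow> NN c \<in> null_sets lborel"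
    "\<And>c s t. c \<in> {0, 1, -1, \<i>, -\<i>} \<Longrightarrow> 0 < s \<Longrightarrow> s < t \<Longrightarrow> s \<notin> NN c \<Longrightarrow> t \<notin> NN c \<Longrightarrow>
    (En k t + Re (c * X t)) \<le> (En k s + Re (c * X s)) + (\<integral>r. indicator {s<..t} r * Re (c * Y r) \<partial>lborel)"
    using P by blast+
  show ?thesis
  proof (intro bexI[of _ "\<Union>c\<in>{0, 1, -1, \<i>, -\<i>}. NN c"] allI impI)
    fix s t :: real assume st: "0 < s" "s < t" "s \<notin> (\<Union>c\<in>{0, 1, -1, \<i>, -\<i>}. NN c)" "t \<notin> (\<Union>c\<in>{0, 1, -1, \<i>, -\<i>}. NN c)"
    define Z where "Z = X t - X s - (\<integral>r. indicator {s<..t} r * Y r \<partial>lborel)"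
    have iY: "integrable lborel (\<lambda>r. indicator {s<..t} r * Y r)"
      by (rule integrable_bounded_support[of _ "2 * pi * B2" s t])
         (use YB B2(1) in \<open>auto simp: norm_mult split: split_indicator\<close>)
    have ineq: "En k t + Re (c * Z) \<le> En k s" if c: "c \<in> {0, 1, -1, \<i>, -\<i>}" for c
    proof -
      have "(\<integral>r. indicator {s<..t} r * Re (c * Y r) \<partial>lborel) = (\<integral>r. Re (c * (indicator {s<..t} r * Y r)) \<partial>lborel)"
        by (intro Bochner_Integration.integral_cong) (auto split: split_indicator)
      also have "\<dots> = Re (c * (\<integral>r. indicator {s<..t} r * Y r \<partial>lborel))"
        using iY by (subst integral_Re) auto
      finally have "(\<integral>r. indicator {s<..t} r * Re (c * Y r) \<partial>lborel) = Re (c * (\<integral>r. indicator {s<..t} r * Y r \<partial>lborel))" .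
      moreover have "s \<notin> NN c" "t \<notin> NN c" using st c by blast+
      ultimately show ?thesis using NN(2)[OF c st(1,2)] unfolding Z_def right_diff_distrib minus_complex.simps(1) by linarith
    qed
    \<comment> \<open>Real and imaginary part are each at most the entropy drop, whence the factor
      2.\<close>
    have "norm Z \<le> \<bar>Re Z\<bar> + \<bar>Im Z\<bar>" by (rule cmod_le)
    also have "\<dots> \<le> 2 * (En k s - En k t)" using ineq[of 1] ineq[of "-1"] ineq[of "\<i>"] ineq[of "-\<i>"] by auto
    finally show "En k t \<le> En k s \<and> norm (X t - X s - (\<integral>r. indicator {s<..t} r * Y r \<partial>lborel)) \<le> 2 * (En k s - En k t)"
      using ineq[of 0] unfolding Z_def by simp
  next
    show "(\<Union>c\<in>{0, 1, -1, \<i>, -\<i>}. NN c) \<in> null_sets lborel"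
      by (rule null_sets.finite_UN) (use NN(1) in auto)
  qed
qed

end

section \<open>Decay of Fourier coefficients\<close>

lemma null_set_avoid:
  assumes "N \<in> null_sets lborel" "a < (b::real)"
  obtains t where "a < t" "t < b" "t \<notin> N"
proof -
  have "\<not> {a<..<b} \<subseteq> N"
  proof
    assume "{a<..<b} \<subseteq> N"
    then have "emeasure lborel {a<..<b} \<le> emeasure lborel N" using assms(1) by (intro emeasure_mono) auto
    then show False using assms by (auto simp: null_setsD1)
  qed
  then obtain t where "t \<in> {a<..<b}" "t \<notin> N" by blast
  then show ?thesis using that[of t] by simp
qed

lemma eventually_ae_ex:
  assumes "eventually_ae P" obtains t where "T < t" "P t"
proof -
  obtain N T' where N: "N \<in> null_sets lborel" "0 < T'" "\<And>t. T' < t \<Longrightarrow> t \<notin> N \<Longrightarrow> P t"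
    using assms by (rule eventually_aeE) blast
  obtain t where "max T T' < t" "t < max T T' + 1" "t \<notin> N"
    by (rule null_set_avoid[OF N(1), of "max T T'" "max T T' + 1"]) auto
  then show ?thesis using N(3)[of t] by (intro that[of t]) auto
qed

context trig_entropy
begin

lemma En_decreasing:
  "\<exists>N\<in>null_sets lborel. \<forall>s t. 0 < s \<longrightarrow> s < t \<longrightarrow> s \<notin> N \<longrightarrow> t \<notin> N \<longrightarrow> En k t \<le> En k s"
proof -
  \<comment> \<open>Some nonzero frequency is needed to call \<open>entropy_ode\<close>; its first
    conclusion does not depend on the choice.\<close>
  have "axis undefined 1 \<noteq> (0 :: real^'n)" by (simp add: axis_eq_0_iff)
  from entropy_ode[OF this, of k 0] show ?thesis by blast
qed

text \<open>The limit is the infimum of \<open>En k\<close> over positive times off the exceptional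
  set, where it is decreasing and bounded below.\<close>

lemma En_limit: obtains L where "\<And>\<eta>. 0 < \<eta> \<Longrightarrow> eventually_ae (\<lambda>t. \<bar>En k t - L\<bar> \<le> \<eta>)"
proof -
  obtain N where N: "N \<in> null_sets lborel" "\<And>s t. 0 < s \<Longrightarrow> s < t \<Longrightarrow> s \<notin> N \<Longrightarrow> t \<notin> N \<Longrightarrow> En k t \<le> En k s"
    using En_decreasing[of k] by blast
  define V where "V = En k ` ({0<..} - N)"
  obtain t0 where "0 < t0" "t0 < 1" "t0 \<notin> N" using null_set_avoid[OF N(1), of 0 1] by auto
  then have ne: "V \<noteq> {}" unfolding V_def by auto
  have bd: "bdd_below V" unfolding V_def by (rule bdd_belowI[of _ 0]) (use En_bounds in auto)
  show ?thesis
  proof (rule that[of "Inf V"])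
    fix \<eta> :: real assume "0 < \<eta>"
    then obtain v where "v \<in> V" "v < Inf V + \<eta>" using cInf_lessD[OF ne, of "Inf V + \<eta>"] by auto
    then obtain T where T: "0 < T" "T \<notin> N" "En k T < Inf V + \<eta>" unfolding V_def by auto
    show "eventually_ae (\<lambda>t. \<bar>En k t - Inf V\<bar> \<le> \<eta>)"
    proof (rule eventually_aeI[OF N(1)])
      fix t assume t: "T < t" "t \<notin> N"
      have "En k t \<le> En k T" using N(2) t T by auto
      moreover have "Inf V \<le> En k t" by (rule cInf_lower[OF _ bd]) (use t T in \<open>auto simp: V_def\<close>)
      ultimately show "\<bar>En k t - Inf V\<bar> \<le> \<eta>" using T(3) by auto
    qed
  qed
qed

lemma osc_integrable: assumes "bdd_fun g"
  shows "integrable lborel (\<lambda>r. indicator {s<..t} r * (tone \<sigma> r * co \<xi> g r))"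
proof -
  obtain B where B: "\<And>w. w \<in> {-R..R} \<Longrightarrow> \<bar>g w\<bar> \<le> B" using assms unfolding bdd_fun_def by blast
  have B0: "0 \<le> B" using B[of 0] R_pos by auto
  note [measurable] = co_measurable[OF assms]
  show ?thesis
    by (rule integrable_bounded_support[of _ B s t])
       (use co_bound[OF assms B] B0 in \<open>auto simp: norm_mult split: split_indicator\<close>)
qed

lemma osc_bound: assumes "bdd_fun g" "s < t" "AE r in lborel. r \<in> {s<..t} \<longrightarrow> norm (co \<xi> g r) \<le> K" "0 \<le> K"
  shows "norm (\<integral>r. indicator {s<..t} r * (tone \<sigma> r * co \<xi> g r) \<partial>lborel) \<le> K * (t - s)"
proof -
  have "norm (\<integral>r. indicator {s<..t} r * (tone \<sigma> r * co \<xi> g r) \<partial>lborel)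
    \<le> (\<integral>r. norm (indicator {s<..t} r * (tone \<sigma> r * co \<xi> g r)) \<partial>lborel)"
    by (rule integral_norm_bound)
  also have "\<dots> \<le> (\<integral>r. K * indicator {s<..t} r \<partial>lborel)"
  proof (rule integral_mono_AE)
    show "integrable lborel (\<lambda>r. K * indicator {s<..t} r)"
      using assms(2) by (intro integrable_mult_right integrable_real_indicator) auto
    show "AE r in lborel. norm (indicator {s<..t} r * (tone \<sigma> r * co \<xi> g r)) \<le> K * indicator {s<..t} r"
      using assms(3) by eventually_elim (use assms(4) in \<open>auto simp: norm_mult split: split_indicator\<close>)
  qed (intro integrable_norm osc_integrable assms)
  also have "\<dots> = K * (t - s)" using assms(2) unfolding integral_mult_right_zero by simp
  finally show ?thesis .
qed

definition clamp :: "real \<Rightarrow> real \<Rightarrow> real \<Rightarrow> real" where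
  "clamp a b w = max a (min b w)"

lemma clamp_continuous: "continuous_on A (clamp a b)"
  unfolding clamp_def by (intro continuous_intros)

lemma bdd_fun_comp_clamp: "continuous_on UNIV h \<Longrightarrow> bdd_fun (\<lambda>w. h (clamp a b w))"
  by (intro bdd_fun_continuous continuous_on_compose2[OF _ clamp_continuous]) auto

text \<open>For a < b one has |w - a| - |w - b| = 2 \<open>clamp a b w\<close> - a - b, so half the
  difference of \<open>entropy_ode\<close> at k = a and at k = b is an equation for the truncation.
  The fluxes subtract in the same way to - 2 G plus a constant, constants drop out as \<xi> is
  nonzero, and the dissipations of the two entropies add up.\<close>

lemma clamped_ode:
  fixes \<sigma> :: real
  assumes xi: "\<xi> \<noteq> 0" and ab: "a < b"
  defines "G \<equiv> \<lambda>w. \<xi> \<bullet> \<phi> (clamp a b w) - \<sigma> * clamp a b w"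
  shows "\<exists>N\<in>null_sets lborel. \<forall>s t. 0 < s \<longrightarrow> s < t \<longrightarrow> s \<notin> N \<longrightarrow> t \<notin> N \<longrightarrow>
    norm (tone \<sigma> t * co \<xi> (clamp a b) t - tone \<sigma> s * co \<xi> (clamp a b) s
       + 2 * of_real pi * \<i> * (\<integral>r. indicator {s<..t} r * (tone \<sigma> r * co \<xi> G r) \<partial>lborel))
      \<le> (En a s - En a t) + (En b s - En b t)"
proof -
  define Q where "Q k w = \<sigma> * \<bar>w - k\<bar> - sgn (w - k) * (\<xi> \<bullet> (\<phi> w - \<phi> k))" for k w
  have bG: "bdd_fun G" unfolding G_def using phi_cont
    by (intro bdd_fun_comp_clamp[where h="\<lambda>w. \<xi> \<bullet> \<phi> w - \<sigma> * w"] continuous_intros)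
  have bQ: "bdd_fun (Q k)" for k
  proof -
    have "bdd_fun (\<lambda>w. \<bar>\<xi> \<bullet> (\<phi> w - \<phi> k)\<bar> + \<bar>\<sigma>\<bar> * \<bar>w - k\<bar>)"
      using phi_cont by (intro bdd_fun_continuous continuous_intros)
    then obtain B where B: "\<And>w. w\<in>{-R..R} \<Longrightarrow> \<bar>\<bar>\<xi> \<bullet> (\<phi> w - \<phi> k)\<bar> + \<bar>\<sigma>\<bar> * \<bar>w - k\<bar>\<bar> \<le> B" unfolding bdd_fun_def by blast
    have "\<bar>Q k w\<bar> \<le> B" if "w \<in> {-R..R}" for w
    proof -
      have "\<bar>Q k w\<bar> \<le> \<bar>\<sigma> * \<bar>w - k\<bar>\<bar> + \<bar>sgn (w - k) * (\<xi> \<bullet> (\<phi> w - \<phi> k))\<bar>" unfolding Q_def by (rule abs_triangle_ineq4)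
      also have "\<dots> \<le> \<bar>\<sigma>\<bar> * \<bar>w - k\<bar> + \<bar>\<xi> \<bullet> (\<phi> w - \<phi> k)\<bar>" by (auto simp: abs_mult sgn_if)
      also have "\<dots> \<le> B" using B[OF that] by linarith
      finally show ?thesis .
    qed
    moreover have "Q k \<in> borel_measurable borel" unfolding Q_def[abs_def] by measurable
    ultimately show ?thesis unfolding bdd_fun_def by blast
  qed
  have bc: "bdd_fun (clamp a b)" by (intro bdd_fun_continuous clamp_continuous)
  have ba: "bdd_fun (\<lambda>w. \<bar>w - k\<bar>)" for k by (intro bdd_fun_continuous continuous_intros)
  have XT: "co \<xi> (\<lambda>w. \<bar>w - a\<bar>) t - co \<xi> (\<lambda>w. \<bar>w - b\<bar>) t = 2 * co \<xi> (clamp a b) t" for t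
  proof -
    have "co \<xi> (\<lambda>w. 1 * \<bar>w - a\<bar> + (-1) * \<bar>w - b\<bar>) t = of_real 2 * co \<xi> (clamp a b) t"
      by (rule co_affine[OF bc xi, where c="- a - b"]) (use ab in \<open>auto simp: clamp_def max_def min_def\<close>)
    then show ?thesis unfolding co_lin[OF ba ba] by simp
  qed
  have YT: "co \<xi> (Q a) t - co \<xi> (Q b) t = - 2 * co \<xi> G t" for t
  proof -
    have "co \<xi> (\<lambda>w. 1 * Q a w + (-1) * Q b w) t = of_real (-2) * co \<xi> G t"
      by (rule co_affine[OF bG xi, where c="- \<sigma> * (a + b) + \<xi> \<bullet> \<phi> a + \<xi> \<bullet> \<phi> b"])
         (use ab in \<open>auto simp: clamp_def max_def min_def G_def Q_def sgn_if inner_diff_right algebra_simps\<close>)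
    then show ?thesis unfolding co_lin[OF bQ bQ] by simp
  qed
  obtain Na where Na: "Na \<in> null_sets lborel" "\<forall>s t. 0 < s \<longrightarrow> s < t \<longrightarrow> s \<notin> Na \<longrightarrow> t \<notin> Na \<longrightarrow> En a t \<le> En a s \<and>
      norm (tone \<sigma> t * co \<xi> (\<lambda>w. \<bar>w - a\<bar>) t - tone \<sigma> s * co \<xi> (\<lambda>w. \<bar>w - a\<bar>) s
       - (\<integral>r. indicator {s<..t} r * (2 * of_real pi * \<i> * tone \<sigma> r * co \<xi> (Q a) r) \<partial>lborel)) \<le> 2 * (En a s - En a t)"
    using entropy_ode[OF xi, of a \<sigma>] unfolding Q_def[abs_def] by (rule bexE)
  obtain Nb where Nb: "Nb \<in> null_sets lborel" "\<forall>s t. 0 < s \<longrightarrow> s < t \<longrightarrow> s \<notin> Nb \<longrightarrow> t \<notin> Nb \<longrightarrow> En b t \<le> En b s \<and>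
      norm (tone \<sigma> t * co \<xi> (\<lambda>w. \<bar>w - b\<bar>) t - tone \<sigma> s * co \<xi> (\<lambda>w. \<bar>w - b\<bar>) s
       - (\<integral>r. indicator {s<..t} r * (2 * of_real pi * \<i> * tone \<sigma> r * co \<xi> (Q b) r) \<partial>lborel)) \<le> 2 * (En b s - En b t)"
    using entropy_ode[OF xi, of b \<sigma>] unfolding Q_def[abs_def] by (rule bexE)
  show ?thesis
  proof (intro bexI[of _ "Na \<union> Nb"] allI impI)
    fix s t :: real assume st: "0 < s" "s < t" "s \<notin> Na \<union> Nb" "t \<notin> Na \<union> Nb"
    let ?J = "\<lambda>g. (\<integral>r. indicator {s<..t} r * (tone \<sigma> r * co \<xi> g r) \<partial>lborel)"
    let ?c = "2 * of_real pi * \<i> :: complex"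
    have J: "(\<integral>r. indicator {s<..t} r * (?c * tone \<sigma> r * co \<xi> g r) \<partial>lborel) = ?c * ?J g" for g
      unfolding integral_mult_right_zero[symmetric] by (intro Bochner_Integration.integral_cong) auto
    have "?J (Q a) - ?J (Q b) = (\<integral>r. indicator {s<..t} r * (tone \<sigma> r * co \<xi> (Q a) r) - indicator {s<..t} r * (tone \<sigma> r * co \<xi> (Q b) r) \<partial>lborel)"
      by (rule Bochner_Integration.integral_diff[symmetric]) (intro osc_integrable bQ)+
    also have "\<dots> = (\<integral>r. (- 2) * (indicator {s<..t} r * (tone \<sigma> r * co \<xi> G r)) \<partial>lborel)"
    proof (intro Bochner_Integration.integral_cong refl)
      fix r
      have "indicator {s<..t} r * (tone \<sigma> r * co \<xi> (Q a) r) - indicator {s<..t} r * (tone \<sigma> r * co \<xi> (Q b) r)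
        = indicator {s<..t} r * (tone \<sigma> r * (co \<xi> (Q a) r - co \<xi> (Q b) r))" by (simp add: algebra_simps)
      then show "indicator {s<..t} r * (tone \<sigma> r * co \<xi> (Q a) r) - indicator {s<..t} r * (tone \<sigma> r * co \<xi> (Q b) r)
        = (- 2) * (indicator {s<..t} r * (tone \<sigma> r * co \<xi> G r))" unfolding YT by simp
    qed
    finally have JQ: "?J (Q a) - ?J (Q b) = - 2 * ?J G" by simp
    define Za where "Za = tone \<sigma> t * co \<xi> (\<lambda>w. \<bar>w - a\<bar>) t - tone \<sigma> s * co \<xi> (\<lambda>w. \<bar>w - a\<bar>) s - ?c * ?J (Q a)"
    define Zb where "Zb = tone \<sigma> t * co \<xi> (\<lambda>w. \<bar>w - b\<bar>) t - tone \<sigma> s * co \<xi> (\<lambda>w. \<bar>w - b\<bar>) s - ?c * ?J (Q b)"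
    have "norm Za \<le> 2 * (En a s - En a t)" using Na(2)[rule_format, of s t] st unfolding Za_def J by auto
    moreover have "norm Zb \<le> 2 * (En b s - En b t)" using Nb(2)[rule_format, of s t] st unfolding Zb_def J by auto
    moreover define Z where "Z = tone \<sigma> t * co \<xi> (clamp a b) t - tone \<sigma> s * co \<xi> (clamp a b) s + ?c * ?J G"
    moreover have "Za - Zb = 2 * (tone \<sigma> t * co \<xi> (clamp a b) t - tone \<sigma> s * co \<xi> (clamp a b) s + ?c * ?J G)"
    proof -
      have "Za - Zb = tone \<sigma> t * (co \<xi> (\<lambda>w. \<bar>w - a\<bar>) t - co \<xi> (\<lambda>w. \<bar>w - b\<bar>) t)
          - tone \<sigma> s * (co \<xi> (\<lambda>w. \<bar>w - a\<bar>) s - co \<xi> (\<lambda>w. \<bar>w - b\<bar>) s) - ?c * (?J (Q a) - ?J (Q b))"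
        unfolding Za_def Zb_def by (simp add: algebra_simps)
      then show ?thesis unfolding XT JQ by (simp add: algebra_simps)
    qed
    moreover have "norm (Za - Zb) \<le> norm Za + norm Zb" by (rule norm_triangle_ineq4)
    moreover have "norm (2 * Z) = 2 * norm Z" unfolding norm_mult by simp
    ultimately have "2 * norm Z \<le> 2 * (En a s - En a t) + 2 * (En b s - En b t)" by simp
    then have "norm Z \<le> (En a s - En a t) + (En b s - En b t)" by simp
    then show "norm (tone \<sigma> t * co \<xi> (clamp a b) t - tone \<sigma> s * co \<xi> (clamp a b) s + ?c * ?J G) \<le> (En a s - En a t) + (En b s - En b t)"
      unfolding Z_def .
  qed (use Na(1) Nb(1) in auto)
qed

text \<open>Over time windows of length about \<open>(b - a) / (H \<surd>\<epsilon>)\<close>, where \<open>H\<close> is the largest distance of \<open>\<xi> \<cdot> \<phi>\<close> from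
  its chord over \<open>[a, b]\<close>, the coefficient of the truncation to \<open>[a, x]\<close>, where that distance is attained at \<open>x\<close>, drifts by an amount proportional
  to the coefficient of the truncation to \<open>[a, b]\<close>, and being bounded this forces the latter to be small.\<close>

lemma coefficient_small:
  assumes xi: "\<xi> \<noteq> 0" and ab: "a < b" and na: "\<not> affine_fun_on {a<..<b} (\<lambda>w. \<xi> \<bullet> \<phi> w)"
    and eps: "0 < \<epsilon>" "\<epsilon> \<le> 2"
    and p: "eventually_ae (\<lambda>t. measure m {y\<in>space m. a < u (t, y) \<and> u (t, y) < b} \<le> \<epsilon>)"
  shows "eventually_ae (\<lambda>t. norm (co \<xi> (clamp a b) t) \<le> 11 * sqrt \<epsilon> * (b - a))"
proof -
  \<comment> \<open>The slope of the chord. The tone of this frequency absorbs the linear part of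
    the flux, and the remainder h vanishes at both ends.\<close>
  define \<sigma> where "\<sigma> = (\<xi> \<bullet> \<phi> b - \<xi> \<bullet> \<phi> a) / (b - a)"
  define h where "h w = \<xi> \<bullet> \<phi> w - \<xi> \<bullet> \<phi> a - \<sigma> * (w - a)" for w
  have hc: "continuous_on A h" for A unfolding h_def using phi_cont continuous_on_subset
    by (intro continuous_intros) blast
  have ha: "h a = 0" "h b = 0" using ab by (auto simp: h_def \<sigma>_def)
  have "\<exists>x\<in>{a..b}. \<forall>w\<in>{a..b}. \<bar>h w\<bar> \<le> \<bar>h x\<bar>"
    by (rule continuous_attains_sup) (use ab hc in \<open>auto intro: continuous_on_rabs\<close>)
  then obtain x where x: "x \<in> {a..b}" "\<And>w. w \<in> {a..b} \<Longrightarrow> \<bar>h w\<bar> \<le> \<bar>h x\<bar>" by blast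
  define H where "H = \<bar>h x\<bar>"
  \<comment> \<open>Here non-degeneracy enters: with H = 0 the function would coincide with its
    chord.\<close>
  have H: "0 < H"
  proof (rule ccontr)
    assume "\<not> 0 < H"
    then have "h w = 0" if "w \<in> {a..b}" for w using x(2)[OF that] by (simp add: H_def)
    then have "\<xi> \<bullet> \<phi> w = \<sigma> * w + (\<xi> \<bullet> \<phi> a - \<sigma> * a)" if "w \<in> {a<..<b}" for w
      using that by (force simp: h_def algebra_simps)
    then show False using na unfolding affine_fun_on_def by blast
  qed
  have xab: "a < x" "x < b" using x(1) ha H by (auto simp: H_def less_le)
  have hH: "\<bar>h w\<bar> \<le> H" if "w \<in> {a..b}" for w using x(2)[OF that] by (simp add: H_def)
  let ?c = "2 * of_real pi * \<i> :: complex"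
  have nc: "norm ?c = 2 * pi" by (simp add: norm_mult)
  have bh: "bdd_fun (\<lambda>w. h (clamp c d w))" for c d by (intro bdd_fun_comp_clamp hc)
  have bc: "bdd_fun (clamp c d)" for c d by (intro bdd_fun_continuous clamp_continuous)
  have coG: "co \<xi> (\<lambda>w. \<xi> \<bullet> \<phi> (clamp c d w) - \<sigma> * clamp c d w) = co \<xi> (\<lambda>w. h (clamp c d w))" for c d
  proof
    fix t show "co \<xi> (\<lambda>w. \<xi> \<bullet> \<phi> (clamp c d w) - \<sigma> * clamp c d w) t = co \<xi> (\<lambda>w. h (clamp c d w)) t"
      using co_affine[OF bh xi, of _ 1 c d "\<xi> \<bullet> \<phi> a - \<sigma> * a" t] by (simp add: h_def algebra_simps)
  qed
  define P where "P t = measure m {y\<in>space m. a < u (t, y) \<and> u (t, y) < b}" for t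
  have small1: "norm (co \<xi> (\<lambda>w. h (clamp a b w)) t) \<le> H * P t" for t
    unfolding P_def by (rule co_small[OF bh ab]) (use H hH ha ab in \<open>auto simp: clamp_def max_def min_def\<close>)
  \<comment> \<open>For w \<ge> x the function \<open>h (clamp a x w)\<close> stays at
    \<open>h x\<close>. The ramp \<open>(h x / (b - a)) * (clamp a b w - a)\<close> takes the same
    values for w \<le> a and for w \<ge> b, so the difference is supported in (a, b). Thus the
    source for the truncation to [a, x] is, up to a small error, a nonzero multiple of the
    coefficient to be estimated.\<close>
  have small2: "norm (co \<xi> (\<lambda>w. h (clamp a x w)) t - of_real (h x / (b - a)) * co \<xi> (clamp a b) t) \<le> 2 * H * P t" for t
  proof -
    let ?g = "\<lambda>w. h (clamp a x w) - (h x / (b - a)) * (clamp a b w - a)"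
    have bg: "bdd_fun ?g"
      by (intro bdd_fun_continuous continuous_intros continuous_on_compose2[OF hc clamp_continuous] clamp_continuous) auto
    have "norm (co \<xi> ?g t) \<le> 2 * H * P t"
      unfolding P_def
    proof (rule co_small[OF bg ab])
      fix w
      consider "w \<le> a" | "b \<le> w" | "a < w" "w < b" by linarith
      then show "\<bar>?g w\<bar> \<le> (if a < w \<and> w < b then 2 * H else 0)"
      proof cases
        case 1 then show ?thesis using ha ab xab by (auto simp: clamp_def max_def min_def)
      next
        case 2 then show ?thesis using ha ab xab by (auto simp: clamp_def max_def min_def)
      next
        case 3
        have "\<bar>h (clamp a x w)\<bar> \<le> H" by (rule hH) (use xab in \<open>auto simp: clamp_def max_def min_def\<close>)
        moreover have "\<bar>(h x / (b - a)) * (clamp a b w - a)\<bar> \<le> H"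
        proof -
          have "\<bar>(h x / (b - a)) * (clamp a b w - a)\<bar> = H * ((w - a) / (b - a))"
            using 3 ab by (simp add: H_def abs_mult clamp_def)
          also have "\<dots> \<le> H * 1" using 3 ab H by (intro mult_left_mono) auto
          finally show ?thesis by simp
        qed
        ultimately have "\<bar>?g w\<bar> \<le> H + H"
          by (intro order.trans[OF abs_triangle_ineq4] add_mono)
        then show ?thesis using 3 by simp
      qed
    qed (use H in auto)
    moreover have "co \<xi> ?g t = co \<xi> (\<lambda>w. h (clamp a x w)) t - of_real (h x / (b - a)) * co \<xi> (clamp a b) t"
    proof -
      have b0: "bdd_fun (\<lambda>w. 1 * h (clamp a x w) + (- (h x / (b - a))) * clamp a b w)"
        by (intro bdd_fun_continuous continuous_intros continuous_on_compose2[OF hc clamp_continuous] clamp_continuous) auto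
      have "co \<xi> ?g t = of_real 1 * co \<xi> (\<lambda>w. 1 * h (clamp a x w) + (- (h x / (b - a))) * clamp a b w) t"
        by (rule co_affine[OF b0 xi, where c="h x / (b - a) * a"])
          (simp add: right_diff_distrib del: times_divide_eq_left times_divide_eq_right)
      also have "\<dots> = co \<xi> (\<lambda>w. h (clamp a x w)) t - of_real (h x / (b - a)) * co \<xi> (clamp a b) t"
        unfolding co_lin[OF bh bc] by simp
      finally show ?thesis .
    qed
    ultimately show ?thesis by simp
  qed
  define q where "q = sqrt \<epsilon>"
  have q: "0 < q" "q * q = \<epsilon>" "q \<le> 3/2"
  proof -
    show "0 < q" "q * q = \<epsilon>" using eps by (auto simp: q_def)
    have "sqrt \<epsilon> \<le> sqrt ((3/2)^2)" by (rule real_sqrt_le_mono) (use eps in \<open>simp add: power2_eq_square\<close>)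
    then show "q \<le> 3/2" by (simp add: q_def)
  qed
  define D where "D = b - a"
  have D: "0 < D" using ab by (simp add: D_def)
  \<comment> \<open>Over a window of length L the coefficient drifts by about H \<epsilon> L, while
    the bound D for the other truncation limits its time average to about D D / (H L). With H L = D
    / q both are of order q D.\<close>
  define L where "L = D / (H * q)"
  have L: "0 < L" "H * L * q = D" using D H q by (auto simp: L_def)
  obtain N1 where N1: "N1 \<in> null_sets lborel" "\<And>s t. 0 < s \<Longrightarrow> s < t \<Longrightarrow> s \<notin> N1 \<Longrightarrow> t \<notin> N1 \<Longrightarrow>
      norm (tone \<sigma> t * co \<xi> (clamp a b) t - tone \<sigma> s * co \<xi> (clamp a b) s
       + ?c * (\<integral>r. indicator {s<..t} r * (tone \<sigma> r * co \<xi> (\<lambda>w. h (clamp a b w)) r) \<partial>lborel))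
      \<le> (En a s - En a t) + (En b s - En b t)"
    using clamped_ode[OF xi ab, of \<sigma>] unfolding coG by blast
  obtain N2 where N2: "N2 \<in> null_sets lborel" "\<And>s t. 0 < s \<Longrightarrow> s < t \<Longrightarrow> s \<notin> N2 \<Longrightarrow> t \<notin> N2 \<Longrightarrow>
      norm (tone \<sigma> t * co \<xi> (clamp a x) t - tone \<sigma> s * co \<xi> (clamp a x) s
       + ?c * (\<integral>r. indicator {s<..t} r * (tone \<sigma> r * co \<xi> (\<lambda>w. h (clamp a x w)) r) \<partial>lborel))
      \<le> (En a s - En a t) + (En x s - En x t)"
    using clamped_ode[OF xi xab(1), of \<sigma>] unfolding coG by blast
  \<comment> \<open>The tolerance for the entropies near their limits. Each defect collects at most
    four such errors, so dissipation costs only q D / 4.\<close>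
  define \<eta> where "\<eta> = q * D / 16"
  have eta: "0 < \<eta>" using q D by (simp add: \<eta>_def)
  obtain La where La: "eventually_ae (\<lambda>t. \<bar>En a t - La\<bar> \<le> \<eta>)" using En_limit[of a] eta by metis
  obtain Lb where Lb: "eventually_ae (\<lambda>t. \<bar>En b t - Lb\<bar> \<le> \<eta>)" using En_limit[of b] eta by metis
  obtain Lx where Lx: "eventually_ae (\<lambda>t. \<bar>En x t - Lx\<bar> \<le> \<eta>)" using En_limit[of x] eta by metis
  from p have "eventually_ae (\<lambda>t. P t \<le> \<epsilon>)" unfolding P_def .
  from eventually_ae_conj[OF this eventually_ae_conj[OF La eventually_ae_conj[OF Lb Lx]]]
  obtain N3 T where N3: "N3 \<in> null_sets lborel" "0 < T"
    "\<And>t. T < t \<Longrightarrow> t \<notin> N3 \<Longrightarrow> P t \<le> \<epsilon> \<and> \<bar>En a t - La\<bar> \<le> \<eta> \<and> \<bar>En b t - Lb\<bar> \<le> \<eta> \<and> \<bar>En x t - Lx\<bar> \<le> \<eta>"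
    by (rule eventually_aeE) blast
  define N where "N = N1 \<union> N2 \<union> N3"
  have N: "N \<in> null_sets lborel" using N1(1) N2(1) N3(1) by (auto simp: N_def)
  have AEN: "AE r in lborel. r \<notin> N" by (rule AE_not_in[OF N])
  define X where "X t = tone \<sigma> t * co \<xi> (clamp a b) t" for t
  define X2 where "X2 t = tone \<sigma> t * co \<xi> (clamp a x) t" for t
  \<comment> \<open>The source for [a, b] has size at most H \<epsilon>, so X varies little within
    the window.\<close>
  have drift: "norm (X r - X s) \<le> 2 * pi * (H * \<epsilon> * (r - s)) + 4 * \<eta>"
    if sr: "T < s" "s < r" "s \<notin> N" "r \<notin> N" for s r
  proof -
    let ?J = "(\<integral>r'. indicator {s<..r} r' * (tone \<sigma> r' * co \<xi> (\<lambda>w. h (clamp a b w)) r') \<partial>lborel)"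
    have "norm ?J \<le> (H * \<epsilon>) * (r - s)"
    proof (rule osc_bound[OF bh sr(2)])
      show "AE r' in lborel. r' \<in> {s<..r} \<longrightarrow> norm (co \<xi> (\<lambda>w. h (clamp a b w)) r') \<le> H * \<epsilon>"
        using AEN
      proof eventually_elim
        case (elim r')
        show ?case
        proof
          assume "r' \<in> {s<..r}"
          then have "P r' \<le> \<epsilon>" using N3(3)[of r'] elim sr by (auto simp: N_def)
          then have "H * P r' \<le> H * \<epsilon>" using H by simp
          then show "norm (co \<xi> (\<lambda>w. h (clamp a b w)) r') \<le> H * \<epsilon>" using small1[of r'] by linarith
        qed
      qed
    qed (use H eps in auto)
    then have "norm (?c * ?J) \<le> 2 * pi * (H * \<epsilon> * (r - s))" unfolding norm_mult[of ?c] nc by (intro mult_left_mono) auto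
    moreover have "norm (X r - X s + ?c * ?J) \<le> (En a s - En a r) + (En b s - En b r)"
      unfolding X_def using N1(2)[of s r] sr N3(2) by (auto simp: N_def)
    moreover have "(En a s - En a r) + (En b s - En b r) \<le> 4 * \<eta>"
      using N3(3)[of s] N3(3)[of r] sr by (auto simp: N_def abs_le_iff)
    moreover have "norm (X r - X s) \<le> norm (X r - X s + ?c * ?J) + norm (?c * ?J)"
      using norm_triangle_ineq4[of "X r - X s + ?c * ?J" "?c * ?J"] by simp
    ultimately show ?thesis by linarith
  qed
  have main: "norm (X s) \<le> 11 * q * D" if s: "T < s" "s \<notin> N" "s + L \<notin> N" for s
  proof -
    let ?t = "s + L"
    let ?J2 = "(\<integral>r. indicator {s<..?t} r * (tone \<sigma> r * co \<xi> (\<lambda>w. h (clamp a x w)) r) \<partial>lborel)"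
    let ?JX = "(\<integral>r. indicator {s<..?t} r * (tone \<sigma> r * co \<xi> (clamp a b) r) \<partial>lborel)"
    have st: "s < ?t" using L by simp
    \<comment> \<open>Subtracting the constant a, invisible at \<xi>, puts the truncation into
      [0, D].\<close>
    have X2b: "norm (X2 r) \<le> D" for r
    proof -
      have "co \<xi> (clamp a x) r = co \<xi> (\<lambda>w. clamp a x w - a) r"
        using co_affine[OF bc xi, of "\<lambda>w. clamp a x w - a" 1 a x "-a" r] by simp
      moreover have "norm (co \<xi> (\<lambda>w. clamp a x w - a) r) \<le> D"
      proof (rule co_bound)
        show "bdd_fun (\<lambda>w. clamp a x w - a)" by (intro bdd_fun_continuous continuous_intros clamp_continuous)
      qed (use xab in \<open>auto simp: clamp_def max_def min_def D_def\<close>)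
      ultimately show ?thesis by (simp add: X2_def norm_mult)
    qed
    have "norm (X2 ?t - X2 s + ?c * ?J2) \<le> (En a s - En a ?t) + (En x s - En x ?t)"
      unfolding X2_def using N2(2)[of s ?t] s st N3(2) by (auto simp: N_def)
    moreover have "(En a s - En a ?t) + (En x s - En x ?t) \<le> 4 * \<eta>"
      using N3(3)[of s] N3(3)[of ?t] s st by (auto simp: N_def abs_le_iff)
    moreover have "norm (?c * ?J2) \<le> norm (X2 ?t - X2 s + ?c * ?J2) + (norm (X2 ?t) + norm (X2 s))"
      using norm_triangle_ineq4[of "X2 ?t - X2 s + ?c * ?J2" "X2 ?t - X2 s"] norm_triangle_ineq4[of "X2 ?t" "X2 s"] by simp
    ultimately have "norm (?c * ?J2) \<le> 4 * \<eta> + 2 * D" using X2b[of ?t] X2b[of s] by linarith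
    then have J2: "2 * pi * norm ?J2 \<le> 4 * \<eta> + 2 * D" unfolding norm_mult[of ?c] nc .
    have "norm (?J2 - of_real (h x / D) * ?JX) \<le> 2 * H * \<epsilon> * L"
    proof -
      have 1: "?J2 - of_real (h x / D) * ?JX = (\<integral>r. indicator {s<..?t} r * (tone \<sigma> r * co \<xi> (\<lambda>w. h (clamp a x w)) r)
          - of_real (h x / D) * (indicator {s<..?t} r * (tone \<sigma> r * co \<xi> (clamp a b) r)) \<partial>lborel)"
        by (subst Bochner_Integration.integral_diff)
           (auto intro!: osc_integrable bh bc integrable_mult_right simp del: of_real_divide)
      have "norm (\<integral>r. indicator {s<..?t} r * (tone \<sigma> r * co \<xi> (\<lambda>w. h (clamp a x w)) r)
          - of_real (h x / D) * (indicator {s<..?t} r * (tone \<sigma> r * co \<xi> (clamp a b) r)) \<partial>lborel)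
        \<le> (\<integral>r. norm (indicator {s<..?t} r * (tone \<sigma> r * co \<xi> (\<lambda>w. h (clamp a x w)) r)
          - of_real (h x / D) * (indicator {s<..?t} r * (tone \<sigma> r * co \<xi> (clamp a b) r))) \<partial>lborel)"
        by (rule integral_norm_bound)
      also have "\<dots> \<le> (\<integral>r. (2 * H * \<epsilon>) * indicator {s<..?t} r \<partial>lborel)"
      proof (rule integral_mono_AE)
        show "integrable lborel (\<lambda>r. norm (indicator {s<..?t} r * (tone \<sigma> r * co \<xi> (\<lambda>w. h (clamp a x w)) r)
          - of_real (h x / D) * (indicator {s<..?t} r * (tone \<sigma> r * co \<xi> (clamp a b) r))))"
          by (intro integrable_norm Bochner_Integration.integrable_diff osc_integrable bh bc integrable_mult_right)
        show "integrable lborel (\<lambda>r. (2 * H * \<epsilon>) * indicator {s<..?t} r)"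
          using st by (intro integrable_mult_right integrable_real_indicator) auto
        show "AE r in lborel. norm (indicator {s<..?t} r * (tone \<sigma> r * co \<xi> (\<lambda>w. h (clamp a x w)) r)
          - of_real (h x / D) * (indicator {s<..?t} r * (tone \<sigma> r * co \<xi> (clamp a b) r))) \<le> (2 * H * \<epsilon>) * indicator {s<..?t} r"
          using AEN
        proof eventually_elim
          case (elim r)
          show ?case
          proof (cases "r \<in> {s<..?t}")
            case True
            then have "P r \<le> \<epsilon>" using N3(3)[of r] elim s by (auto simp: N_def)
            then have "2 * H * P r \<le> 2 * H * \<epsilon>" using H by simp
            moreover have "tone \<sigma> r * co \<xi> (\<lambda>w. h (clamp a x w)) r - of_real (h x / D) * (tone \<sigma> r * co \<xi> (clamp a b) r)
              = tone \<sigma> r * (co \<xi> (\<lambda>w. h (clamp a x w)) r - of_real (h x / (b - a)) * co \<xi> (clamp a b) r)"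
              by (simp add: D_def algebra_simps)
            ultimately show ?thesis using small2[of r] True by (simp add: norm_mult)
          qed simp
        qed
      qed
      also have "\<dots> = 2 * H * \<epsilon> * L" using st L unfolding integral_mult_right_zero by simp
      finally show ?thesis unfolding 1 .
    qed
    moreover have "norm (of_real (h x / D) * ?JX) = H / D * norm ?JX"
      using D by (simp add: norm_mult H_def norm_divide)
    moreover have "norm (of_real (h x / D) * ?JX) \<le> norm ?J2 + norm (?J2 - of_real (h x / D) * ?JX)"
      using norm_triangle_ineq4[of ?J2 "?J2 - of_real (h x / D) * ?JX"] by simp
    ultimately have JX: "H / D * norm ?JX \<le> norm ?J2 + 2 * H * \<epsilon> * L" by linarith
    \<comment> \<open>By the drift bound, the integral of X over the window is close to L times its
      value at the start.\<close>
    have "norm (of_real L * X s - ?JX) \<le> (2 * pi * (H * \<epsilon> * L) + 4 * \<eta>) * L"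
    proof -
      have i1: "integrable lborel (\<lambda>r. indicator {s<..?t} r * X s)"
        by (rule integrable_bounded_support[of _ "norm (X s)" s ?t]) (auto simp: norm_mult split: split_indicator)
      have "(\<integral>r. indicator {s<..?t} r * X s \<partial>lborel) = of_real L * X s"
      proof -
        have "(\<integral>r. indicator {s<..?t} r * X s \<partial>lborel) = (\<integral>r. indicator {s<..?t} r *\<^sub>R X s \<partial>lborel)"
          by (intro Bochner_Integration.integral_cong) (auto split: split_indicator)
        also have "\<dots> = measure lborel {s<..?t} *\<^sub>R X s"
          using st by (subst integral_scaleR_left) auto
        also have "\<dots> = of_real L * X s" using L by (simp add: scaleR_conv_of_real)
        finally show ?thesis .
      qed
      from this[symmetric] have 1: "of_real L * X s - ?JX = (\<integral>r. indicator {s<..?t} r * X s - indicator {s<..?t} r * (tone \<sigma> r * co \<xi> (clamp a b) r) \<partial>lborel)"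
        by (simp only:) (rule Bochner_Integration.integral_diff[OF i1 osc_integrable[OF bc], symmetric])
      have "norm (\<integral>r. indicator {s<..?t} r * X s - indicator {s<..?t} r * (tone \<sigma> r * co \<xi> (clamp a b) r) \<partial>lborel)
        \<le> (\<integral>r. norm (indicator {s<..?t} r * X s - indicator {s<..?t} r * (tone \<sigma> r * co \<xi> (clamp a b) r)) \<partial>lborel)"
        by (rule integral_norm_bound)
      also have "\<dots> \<le> (\<integral>r. (2 * pi * (H * \<epsilon> * L) + 4 * \<eta>) * indicator {s<..?t} r \<partial>lborel)"
      proof (rule integral_mono_AE)
        show "integrable lborel (\<lambda>r. norm (indicator {s<..?t} r * X s - indicator {s<..?t} r * (tone \<sigma> r * co \<xi> (clamp a b) r)))"
          by (intro integrable_norm Bochner_Integration.integrable_diff osc_integrable bc i1)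
        show "integrable lborel (\<lambda>r. (2 * pi * (H * \<epsilon> * L) + 4 * \<eta>) * indicator {s<..?t} r)"
          using st by (intro integrable_mult_right integrable_real_indicator) auto
        show "AE r in lborel. norm (indicator {s<..?t} r * X s - indicator {s<..?t} r * (tone \<sigma> r * co \<xi> (clamp a b) r))
            \<le> (2 * pi * (H * \<epsilon> * L) + 4 * \<eta>) * indicator {s<..?t} r"
          using AEN
        proof eventually_elim
          case (elim r)
          show ?case
          proof (cases "r \<in> {s<..?t}")
            case True
            have "norm (X r - X s) \<le> 2 * pi * (H * \<epsilon> * (r - s)) + 4 * \<eta>"
              by (rule drift) (use s True elim in auto)
            also have "\<dots> \<le> 2 * pi * (H * \<epsilon> * L) + 4 * \<eta>"
              using True H eps by (intro add_right_mono mult_left_mono) auto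
            finally show ?thesis using True by (simp add: X_def norm_minus_commute)
          qed simp
        qed
      qed
      also have "\<dots> = (2 * pi * (H * \<epsilon> * L) + 4 * \<eta>) * L" using st L unfolding integral_mult_right_zero by simp
      finally show ?thesis unfolding 1 .
    qed
    moreover have "norm (of_real L * X s) = L * norm (X s)" using L by (simp add: norm_mult)
    moreover have "norm (of_real L * X s) \<le> norm ?JX + norm (of_real L * X s - ?JX)"
      using norm_triangle_ineq[of ?JX "of_real L * X s - ?JX"] by simp
    ultimately have LX: "L * norm (X s) \<le> norm ?JX + (2 * pi * (H * \<epsilon> * L) + 4 * \<eta>) * L" by linarith
    have HL: "H * L = D / q" using L(2) q by (simp add: field_simps)
    have "norm ?JX = (D / H) * (H / D * norm ?JX)" using D H by simp
    also have "\<dots> \<le> (D / H) * (norm ?J2 + 2 * H * \<epsilon> * L)" using JX D H by (intro mult_left_mono) auto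
    also have "\<dots> \<le> (D / H) * ((4 * \<eta> + 2 * D) / (2 * pi) + 2 * H * \<epsilon> * L)"
      using J2 D H by (intro mult_left_mono add_right_mono) (auto simp: field_simps)
    finally have "norm ?JX / L \<le> (D / (H * L)) * ((4 * \<eta> + 2 * D) / (2 * pi) + 2 * (H * L) * \<epsilon>)"
      using L D H by (simp add: field_simps)
    also have "\<dots> = q * ((4 * \<eta> + 2 * D) / (2 * pi) + 2 * (D / q) * (q * q))" unfolding HL q(2) using D q by simp
    also have "\<dots> = q * ((4 * \<eta> + 2 * D) / (2 * pi)) + 2 * D * q * q" using q by (simp add: field_simps)
    finally have 1: "norm ?JX / L \<le> q * ((4 * \<eta> + 2 * D) / (2 * pi)) + 2 * D * q * q" .
    have 2: "q * ((4 * \<eta> + 2 * D) / (2 * pi)) \<le> q * D / 2"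
    proof -
      have "4 * \<eta> + 2 * D \<le> 3 * D" using q D by (simp add: \<eta>_def)
      then have "(4 * \<eta> + 2 * D) / (2 * pi) \<le> 3 * D / (2 * 3)"
        using pi_gt3 D eta by (intro frac_le) auto
      then have "q * ((4 * \<eta> + 2 * D) / (2 * pi)) \<le> q * (3 * D / (2 * 3))" by (rule mult_left_mono) (use q in simp)
      then show ?thesis by simp
    qed
    \<comment> \<open>The term quadratic in q is reduced to a linear one by q \<le> 3/2; this is the
      origin of the hypothesis \<epsilon> \<le> 2.\<close>
    have 3: "2 * D * q * q \<le> 3 * D * q"
    proof -
      have "2 * D * q * q \<le> 2 * D * q * (3/2)" by (rule mult_left_mono) (use q D in auto)
      then show ?thesis by simp
    qed
    have 4: "2 * pi * (H * \<epsilon> * L) \<le> 7 * (D * q)"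
    proof -
      have "H * \<epsilon> * L = (H * L) * (q * q)" using q by simp
      also have "\<dots> = D * q" unfolding HL using q(1) by (simp add: field_simps)
      finally have "2 * pi * (H * \<epsilon> * L) = 2 * pi * (D * q)" by simp
      also have "\<dots> \<le> 7 * (D * q)" using pi_less_4 D q pi_approx by (intro mult_right_mono) auto
      finally show ?thesis .
    qed
    have "norm (X s) \<le> norm ?JX / L + (2 * pi * (H * \<epsilon> * L) + 4 * \<eta>)" using LX L by (simp add: field_simps)
    \<comment> \<open>The coefficients 1/2, 3, 7 and 1/4 sum to 10.75, which explains the factor
      11.\<close>
    also have "\<dots> \<le> (q * D / 2 + 3 * D * q) + (7 * (D * q) + q * D / 4)" using 1 2 3 4 unfolding \<eta>_def by linarith
    also have "\<dots> \<le> 11 * q * D" using q D by (simp add: field_simps)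
    finally show ?thesis .
  qed
  \<comment> \<open>The estimate at t also uses the time t + L, so the exceptional set is joined
    with its translate.\<close>
  have NL: "(\<lambda>t. t + L) -` N \<inter> space lborel \<in> null_sets lborel"
  proof -
    have "{t. t - (- L) \<in> N} \<in> null_sets lborel" by (rule null_sets_translation[OF N])
    then show ?thesis by (simp add: vimage_def)
  qed
  show ?thesis
  proof (rule eventually_aeI)
    show "N \<union> ((\<lambda>t. t + L) -` N \<inter> space lborel) \<in> null_sets lborel" using N NL by blast
    fix t assume "T < t" "t \<notin> N \<union> ((\<lambda>t. t + L) -` N \<inter> space lborel)"
    then have "norm (X t) \<le> 11 * q * D" by (intro main) auto
    then show "norm (co \<xi> (clamp a b) t) \<le> 11 * sqrt \<epsilon> * (b - a)" by (simp add: X_def norm_mult q_def D_def)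
  qed
qed

text \<open>Cut [-R, R] into n intervals of length d. The truncations add up to u up to a constant,
  so the coefficient of u is at most the sum of 11 \<open>sqrt (pp i + 1 / real n)\<close> d, where
  \<open>pp i + 1 / real n\<close> eventually bounds the mass of the i-th slice. As the
  \<open>pp i\<close> sum to at most 2, the total is at most 44 R / sqrt n.\<close>

lemma coefficient_decay:
  assumes xi: "\<xi> \<noteq> 0" and na: "\<And>a b. a < b \<Longrightarrow> \<not> affine_fun_on {a<..<b} (\<lambda>w. \<xi> \<bullet> \<phi> w)" and eta: "0 < \<eta>"
  shows "eventually_ae (\<lambda>t. norm (co \<xi> (\<lambda>w. w) t) \<le> \<eta>)"
proof -
  have "\<forall>k. \<exists>L. \<forall>\<eta>>0. eventually_ae (\<lambda>t. \<bar>En k t - L\<bar> \<le> \<eta>)" using En_limit by metis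
  then obtain Li where Li: "\<And>k \<eta>. 0 < \<eta> \<Longrightarrow> eventually_ae (\<lambda>t. \<bar>En k t - Li k\<bar> \<le> \<eta>)" by metis
  \<comment> \<open>The entropies are 1-Lipschitz in k uniformly in time, hence so are their
    limits.\<close>
  have LiL: "\<bar>Li k - Li k'\<bar> \<le> \<bar>k - k'\<bar>" for k k'
  proof (rule field_le_epsilon)
    fix d :: real assume "0 < d"
    then obtain t where t: "\<bar>En k t - Li k\<bar> \<le> d/2" "\<bar>En k' t - Li k'\<bar> \<le> d/2"
      using eventually_ae_ex[OF eventually_ae_conj[OF Li[of "d/2" k] Li[of "d/2" k']], of 0] by auto
    have "norm (\<integral>y. \<bar>u (t, y) - k\<bar> - \<bar>u (t, y) - k'\<bar> \<partial>m) \<le> \<bar>k - k'\<bar>"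
      by (rule norm_integral_le) auto
    moreover have "(\<integral>y. \<bar>u (t, y) - k\<bar> - \<bar>u (t, y) - k'\<bar> \<partial>m) = En k t - En k' t"
      unfolding En_def
    proof (rule Bochner_Integration.integral_diff)
      have b: "\<bar>u p - k\<bar> \<le> R + \<bar>k\<bar>" for p k using u_bound[of p] by linarith
      show "integrable m (\<lambda>y. \<bar>u (t, y) - k\<bar>)" by (rule integrable_bdd[where B="R + \<bar>k\<bar>"]) (use b in auto)
      show "integrable m (\<lambda>y. \<bar>u (t, y) - k'\<bar>)" by (rule integrable_bdd[where B="R + \<bar>k'\<bar>"]) (use b in auto)
    qed
    ultimately show "\<bar>Li k - Li k'\<bar> \<le> \<bar>k - k'\<bar> + d" using t unfolding real_norm_def by linarith
  qed
  \<comment> \<open>The final bound 44 R / sqrt n is to be at most \<eta>.\<close>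
  obtain n0 :: nat where n0: "(44 * R / \<eta>)^2 < real n0" using reals_Archimedean2 by blast
  define n where "n = max n0 1"
  have n: "0 < n" "(44 * R / \<eta>)^2 < real n" using n0 by (auto simp: n_def)
  define d where "d = 2 * R / real n"
  have d: "0 < d" "real n * d = 2 * R" using R_pos n by (auto simp: d_def)
  define g where "g i = - R + real i * d" for i :: nat
  have gS: "g (Suc i) = g i + d" for i by (simp add: g_def algebra_simps)
  \<comment> \<open>The mass of a slice need not converge in time. It is dominated by the integral
    of the trapezoid that is 1 on [g i, g i + d] and 0 off [g i - d, g i + 2 d], and the trapezoid
    is a combination of four functions |w - k|, whose integrals converge. The limit is
    \<open>pp i\<close>.\<close>
  define pp where "pp i = (Li (g i - d) - Li (g i) - Li (g i + d) + Li (g i + 2 * d)) / (2 * d)" for i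
  have pm: "measure m {y\<in>space m. g i < u (t, y) \<and> u (t, y) < g i + d}
      \<le> (En (g i - d) t - En (g i) t - En (g i + d) t + En (g i + 2 * d) t) / (2 * d)" for i t
  proof -
    let ?M = "{y\<in>space m. g i < u (t, y) \<and> u (t, y) < g i + d}"
    have M: "?M \<in> sets m" by measurable
    let ?f = "\<lambda>w. (\<bar>w - (g i - d)\<bar> - \<bar>w - g i\<bar> - \<bar>w - (g i + d)\<bar> + \<bar>w - (g i + 2 * d)\<bar>) / (2 * d)"
    have i: "integrable m (\<lambda>y. \<bar>u (t, y) - k\<bar>)" for k
    proof (rule integrable_bdd[where B="R + \<bar>k\<bar>"])
      show "norm \<bar>u (t, y) - k\<bar> \<le> R + \<bar>k\<bar>" for y using u_bound[of "(t, y)"] by auto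
    qed auto
    have "measure m ?M = (\<integral>y. indicator ?M y \<partial>m)" using M by simp
    also have "\<dots> \<le> (\<integral>y. ?f (u (t, y)) \<partial>m)"
    proof (rule integral_mono)
      show "integrable m (indicat_real ?M)" using M by (intro integrable_real_indicator) (auto simp: emeasure_eq_measure)
      show "integrable m (\<lambda>y. ?f (u (t, y)))" using i by auto
      show "indicat_real ?M y \<le> ?f (u (t, y))" if "y \<in> space m" for y
        using d(1) by (auto simp: indicator_def field_simps)
    qed
    also have "\<dots> = (En (g i - d) t - En (g i) t - En (g i + d) t + En (g i + 2 * d) t) / (2 * d)"
      unfolding En_def using i by simp
    finally show ?thesis .
  qed
  \<comment> \<open>The slack 1 / n covers the approach to the limit and keeps the \<epsilon> passed
    to \<open>coefficient_small\<close> positive even if \<open>pp i\<close> is 0.\<close>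
  have ppe: "eventually_ae (\<lambda>t. measure m {y\<in>space m. g i < u (t, y) \<and> u (t, y) < g i + d} \<le> pp i + 1 / real n)" for i
  proof -
    let ?e = "d / (2 * real n)"
    have e: "0 < ?e" using d n by auto
    show ?thesis
    proof (rule eventually_ae_mono[OF eventually_ae_conj[OF eventually_ae_conj[OF Li[OF e, of "g i - d"] Li[OF e, of "g i"]]
            eventually_ae_conj[OF Li[OF e, of "g i + d"] Li[OF e, of "g i + 2 * d"]]]])
      fix t assume a: "(\<bar>En (g i - d) t - Li (g i - d)\<bar> \<le> ?e \<and> \<bar>En (g i) t - Li (g i)\<bar> \<le> ?e) \<and>
         \<bar>En (g i + d) t - Li (g i + d)\<bar> \<le> ?e \<and> \<bar>En (g i + 2 * d) t - Li (g i + 2 * d)\<bar> \<le> ?e"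
      have "(En (g i - d) t - En (g i) t - En (g i + d) t + En (g i + 2 * d) t)
          \<le> Li (g i - d) - Li (g i) - Li (g i + d) + Li (g i + 2 * d) + 4 * ?e"
        using a by linarith
      then have "(En (g i - d) t - En (g i) t - En (g i + d) t + En (g i + 2 * d) t) / (2 * d)
          \<le> (Li (g i - d) - Li (g i) - Li (g i + d) + Li (g i + 2 * d) + 4 * ?e) / (2 * d)"
        using d by (intro divide_right_mono) auto
      also have "\<dots> = pp i + 1 / real n" using d n by (simp add: pp_def add_divide_distrib)
      finally show "measure m {y\<in>space m. g i < u (t, y) \<and> u (t, y) < g i + d} \<le> pp i + 1 / real n" using pm[of i t] by linarith
    qed
  qed
  have pp0: "0 \<le> pp i" for i
  proof (rule field_le_epsilon)
    fix c :: real assume "0 < c"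
    let ?e = "d * c / 2"
    have e: "0 < ?e" using d \<open>0 < c\<close> by auto
    obtain t where a: "(\<bar>En (g i - d) t - Li (g i - d)\<bar> \<le> ?e \<and> \<bar>En (g i) t - Li (g i)\<bar> \<le> ?e) \<and>
         \<bar>En (g i + d) t - Li (g i + d)\<bar> \<le> ?e \<and> \<bar>En (g i + 2 * d) t - Li (g i + 2 * d)\<bar> \<le> ?e"
      using eventually_ae_ex[OF eventually_ae_conj[OF eventually_ae_conj[OF Li[OF e, of "g i - d"] Li[OF e, of "g i"]]
            eventually_ae_conj[OF Li[OF e, of "g i + d"] Li[OF e, of "g i + 2 * d"]]], of 0] by blast
    have "0 \<le> (En (g i - d) t - En (g i) t - En (g i + d) t + En (g i + 2 * d) t) / (2 * d)"
      using pm[of i t] by (meson measure_nonneg order.trans)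
    also have "\<dots> \<le> (Li (g i - d) - Li (g i) - Li (g i + d) + Li (g i + 2 * d) + 4 * ?e) / (2 * d)"
      using a d by (intro divide_right_mono) linarith+
    also have "\<dots> = pp i + c" using d by (simp add: pp_def add_divide_distrib)
    finally show "0 \<le> pp i + c" .
  qed
  have pp1: "pp i \<le> 1" for i
  proof -
    have "Li (g i - d) - Li (g i) - Li (g i + d) + Li (g i + 2 * d) \<le> 2 * d"
      using LiL[of "g i - d" "g i"] LiL[of "g i + d" "g i + 2 * d"] d(1) by auto
    then show ?thesis using d by (simp add: pp_def)
  qed
  \<comment> \<open>Both pairs of terms telescope, leaving two differences of \<open>Li\<close> at
    points 2 d apart.\<close>
  have sum_pp: "(\<Sum>i<n. pp i) \<le> 2"
  proof -
    have t1: "(\<Sum>i<n. Li (g i - d) - Li (g i)) = Li (g 0 - d) - Li (g n - d)"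
      using sum_lessThan_telescope'[of "\<lambda>i. Li (g i - d)" n] by (simp add: gS)
    have t2: "(\<Sum>i<n. Li (g i + 2 * d) - Li (g i + d)) = Li (g n + d) - Li (g 0 + d)"
      using sum_lessThan_telescope[of "\<lambda>i. Li (g i + d)" n] by (simp add: gS add.assoc)
    have "(\<Sum>i<n. pp i) = ((\<Sum>i<n. Li (g i - d) - Li (g i)) + (\<Sum>i<n. Li (g i + 2 * d) - Li (g i + d))) / (2 * d)"
      unfolding pp_def sum.distrib[symmetric] sum_divide_distrib[symmetric] by (simp add: algebra_simps)
    also have "\<dots> = (Li (g 0 - d) - Li (g 0 + d) + (Li (g n + d) - Li (g n - d))) / (2 * d)"
      unfolding t1 t2 by (simp add: algebra_simps)
    also have "\<dots> \<le> (2 * d + 2 * d) / (2 * d)"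
      using LiL[of "g 0 - d" "g 0 + d"] LiL[of "g n + d" "g n - d"] d by (intro divide_right_mono add_mono) auto
    also have "\<dots> = 2" using d by simp
    finally show ?thesis .
  qed
  have "eventually_ae (\<lambda>t. \<forall>i\<in>{..<n}. norm (co \<xi> (clamp (g i) (g i + d)) t) \<le> 11 * sqrt (pp i + 1 / real n) * d)"
  proof (rule eventually_ae_ball_finite)
    fix i assume "i \<in> {..<n}"
    have "eventually_ae (\<lambda>t. norm (co \<xi> (clamp (g i) (g i + d)) t) \<le> 11 * sqrt (pp i + 1 / real n) * (g i + d - g i))"
    proof (rule coefficient_small[OF xi _ na _ _ ppe])
      have "1 / real n \<le> 1" using n(1) by simp
      then show "pp i + 1 / real n \<le> 2" using pp1[of i] by linarith
      show "0 < pp i + 1 / real n" using pp0[of i] n by (simp add: add_nonneg_pos)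
    qed (use d in auto)
    then show "eventually_ae (\<lambda>t. norm (co \<xi> (clamp (g i) (g i + d)) t) \<le> 11 * sqrt (pp i + 1 / real n) * d)" by simp
  qed simp
  then show ?thesis
  proof (rule eventually_ae_mono)
    fix t assume A: "\<forall>i\<in>{..<n}. norm (co \<xi> (clamp (g i) (g i + d)) t) \<le> 11 * sqrt (pp i + 1 / real n) * d"
    \<comment> \<open>Adding the truncation to the next interval extends the truncation, up to the
      constant \<open>g k\<close>.\<close>
    have part: "(\<Sum>i<k. co \<xi> (clamp (g i) (g i + d)) t) = co \<xi> (clamp (- R) (g k)) t" for k
    proof (induction k)
      case 0
      have "co \<xi> (clamp (- R) (g 0)) t = of_real 0 * co \<xi> (clamp (- R) (g 0)) t"
        by (rule co_affine[OF bdd_fun_continuous[OF clamp_continuous] xi, where c="-R"]) (auto simp: clamp_def g_def max_def min_def)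
      then show ?case by simp
    next
      case (Suc k)
      have gk: "- R \<le> g k" using d by (simp add: g_def)
      have b: "bdd_fun (clamp a b)" for a b by (intro bdd_fun_continuous clamp_continuous)
      have b2: "bdd_fun (\<lambda>w. 1 * clamp (- R) (g k) w + 1 * clamp (g k) (g k + d) w)"
        by (intro bdd_fun_continuous continuous_intros clamp_continuous)
      have "co \<xi> (clamp (- R) (g (Suc k))) t = of_real 1 * co \<xi> (\<lambda>w. 1 * clamp (- R) (g k) w + 1 * clamp (g k) (g k + d) w) t"
        by (rule co_affine[OF b2 xi, where c="- g k"]) (use gk d in \<open>auto simp: clamp_def gS max_def min_def\<close>)
      then show ?case using Suc unfolding co_lin[OF b b] by simp
    qed
    have "co \<xi> (\<lambda>w. w) t = co \<xi> (clamp (- R) (g n)) t"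
      unfolding co_def
    proof (intro Bochner_Integration.integral_cong refl)
      fix y
      have "g n = R" using d by (simp add: g_def)
      then show "of_real (u (t, y)) * e (- \<xi>) y = of_real (clamp (- R) (g n) (u (t, y))) * e (- \<xi>) y"
        using u_in[of "(t, y)"] by (simp add: clamp_def max_def min_def)
    qed
    then have "norm (co \<xi> (\<lambda>w. w) t) \<le> (\<Sum>i<n. norm (co \<xi> (clamp (g i) (g i + d)) t))"
      unfolding part[symmetric] by (simp add: norm_sum)
    also have "\<dots> \<le> (\<Sum>i<n. 11 * sqrt (pp i + 1 / real n) * d)" by (rule sum_mono) (use A in auto)
    also have "\<dots> = 11 * d * (\<Sum>i<n. 1 * sqrt (pp i + 1 / real n))" by (simp add: sum_distrib_left mult_ac)
    also have "\<dots> \<le> 11 * d * sqrt (4 * real n)"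
    proof (rule mult_left_mono)
      have nn: "0 \<le> pp i + 1 / real n" for i using pp0[of i] by simp
      have "(\<Sum>i<n. 1 * sqrt (pp i + 1 / real n))^2 \<le> (\<Sum>i<n. 1^2) * (\<Sum>i<n. (sqrt (pp i + 1 / real n))^2)"
        by (rule Cauchy_Schwarz_ineq_sum)
      also have "\<dots> = real n * ((\<Sum>i<n. pp i) + 1)" using nn n by (simp add: sum.distrib)
      also have "\<dots> \<le> real n * 4" using sum_pp by (intro mult_left_mono) auto
      finally show "(\<Sum>i<n. 1 * sqrt (pp i + 1 / real n)) \<le> sqrt (4 * real n)"
        by (intro real_le_rsqrt) (simp add: mult.commute)
    qed (use d in auto)
    also have "\<dots> = 44 * R / sqrt (real n)"
    proof -
      have "sqrt (4 * real n) = 2 * sqrt (real n)" by (simp add: real_sqrt_mult)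
      moreover have "d = 2 * R / (sqrt (real n) * sqrt (real n))" by (simp add: d_def)
      moreover have "0 < sqrt (real n)" using n(1) by simp
      ultimately show ?thesis by (simp add: field_simps)
    qed
    also have "\<dots> \<le> \<eta>"
    proof -
      have "44 * R / \<eta> \<le> sqrt (real n)" using n(2) by (intro real_le_rsqrt) auto
      then show ?thesis using eta n by (simp add: field_simps)
    qed
    finally show "norm (co \<xi> (\<lambda>w. w) t) \<le> \<eta>" .
  qed
qed

end

section \<open>Trigonometric kernels\<close>

text \<open>One notion of trigonometric polynomial for three families: exponentials on R^n,
  characters on the compactification, and functions of y - z on pairs of points. Equality is asked
  on X only, since the multiplicative law of characters holds only on the underlying space.\<close>

definition tspan :: "(real^'n \<Rightarrow> 'b \<Rightarrow> complex) \<Rightarrow> (real^'n) set \<Rightarrow> 'b set \<Rightarrow> ('b \<Rightarrow> complex) \<Rightarrow> bool" where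
  "tspan E M X f \<longleftrightarrow> (\<exists>S a. finite S \<and> S \<subseteq> M \<and> (\<forall>x\<in>X. f x = (\<Sum>l\<in>S. a l * E l x)))"

lemma tspan_cong: "(\<And>x. x \<in> X \<Longrightarrow> f x = g x) \<Longrightarrow> tspan E M X f \<longleftrightarrow> tspan E M X g"
  unfolding tspan_def by auto

lemma tspan_single: assumes "l \<in> M" shows "tspan E M X (\<lambda>x. c * E l x)"
  unfolding tspan_def using assms by (intro exI[of _ "{l}"] exI[of _ "\<lambda>_. c"]) auto

lemma tspan_add:
  assumes "tspan E M X f" "tspan E M X g" shows "tspan E M X (\<lambda>x. f x + g x)"
proof -
  obtain S a where S: "finite S" "S \<subseteq> M" "\<And>x. x \<in> X \<Longrightarrow> f x = (\<Sum>l\<in>S. a l * E l x)"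
    using assms(1) unfolding tspan_def by blast
  obtain T b where T: "finite T" "T \<subseteq> M" "\<And>x. x \<in> X \<Longrightarrow> g x = (\<Sum>l\<in>T. b l * E l x)"
    using assms(2) unfolding tspan_def by blast
  show ?thesis
    unfolding tspan_def
  proof (intro exI[of _ "S \<union> T"] exI[of _ "\<lambda>l. (if l \<in> S then a l else 0) + (if l \<in> T then b l else 0)"] conjI ballI)
    fix x assume x: "x \<in> X"
    have "(\<Sum>l\<in>S \<union> T. (if l \<in> S then a l else 0) * E l x) = f x"
      unfolding S(3)[OF x] using S(1) T(1) by (intro sum.mono_neutral_cong_right) auto
    moreover have "(\<Sum>l\<in>S \<union> T. (if l \<in> T then b l else 0) * E l x) = g x"
      unfolding T(3)[OF x] using S(1) T(1) by (intro sum.mono_neutral_cong_right) auto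
    ultimately show "f x + g x = (\<Sum>l\<in>S \<union> T. ((if l \<in> S then a l else 0) + (if l \<in> T then b l else 0)) * E l x)"
      by (simp add: distrib_right sum.distrib)
  qed (use S T in auto)
qed

lemma tspan_cmult: assumes "tspan E M X f" shows "tspan E M X (\<lambda>x. c * f x)"
proof -
  obtain S a where S: "finite S" "S \<subseteq> M" "\<And>x. x \<in> X \<Longrightarrow> f x = (\<Sum>l\<in>S. a l * E l x)"
    using assms(1) unfolding tspan_def by blast
  then show ?thesis unfolding tspan_def
    by (intro exI[of _ S] exI[of _ "\<lambda>l. c * a l"]) (auto simp: sum_distrib_left mult.assoc)
qed

lemma tspan_mult:
  assumes "tspan E M X f" "tspan E M X g"
    and E: "\<And>l k x. x \<in> X \<Longrightarrow> E (l + k) x = E l x * E k x" and M: "\<And>l k. l \<in> M \<Longrightarrow> k \<in> M \<Longrightarrow> l + k \<in> M"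
  shows "tspan E M X (\<lambda>x. f x * g x)"
proof -
  obtain S a where S: "finite S" "S \<subseteq> M" "\<And>x. x \<in> X \<Longrightarrow> f x = (\<Sum>l\<in>S. a l * E l x)"
    using assms(1) unfolding tspan_def by blast
  obtain T b where T: "finite T" "T \<subseteq> M" "\<And>x. x \<in> X \<Longrightarrow> g x = (\<Sum>l\<in>T. b l * E l x)"
    using assms(2) unfolding tspan_def by blast
  \<comment> \<open>Distinct pairs of frequencies may have the same sum, so the coefficients of the
    product are collected over the fibres of addition.\<close>
  define c where "c n = (\<Sum>p\<in>{p \<in> S \<times> T. fst p + snd p = n}. a (fst p) * b (snd p))" for n
  show ?thesis
    unfolding tspan_def
  proof (intro exI[of _ "(\<lambda>p. fst p + snd p) ` (S \<times> T)"] exI[of _ c] conjI ballI)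
    fix x assume x: "x \<in> X"
    have "f x * g x = (\<Sum>p\<in>S \<times> T. (a (fst p) * b (snd p)) * E (fst p + snd p) x)"
      unfolding S(3)[OF x] T(3)[OF x] sum_product sum.cartesian_product
      by (intro sum.cong refl) (auto simp: E[OF x])
    also have "\<dots> = (\<Sum>n\<in>(\<lambda>p. fst p + snd p) ` (S \<times> T). \<Sum>p\<in>{p \<in> S \<times> T. fst p + snd p = n}. (a (fst p) * b (snd p)) * E (fst p + snd p) x)"
      by (rule sum.image_gen) (use S T in auto)
    also have "\<dots> = (\<Sum>n\<in>(\<lambda>p. fst p + snd p) ` (S \<times> T). c n * E n x)"
      unfolding c_def sum_distrib_right by (intro sum.cong refl) auto
    finally show "f x * g x = (\<Sum>n\<in>(\<lambda>p. fst p + snd p) ` (S \<times> T). c n * E n x)" .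
  next
    show "(\<lambda>p. fst p + snd p) ` (S \<times> T) \<subseteq> M" by (auto intro!: M[OF subsetD[OF S(2)] subsetD[OF T(2)]])
  qed (use S T in auto)
qed

lemma tspan_prod:
  assumes "finite I" "\<And>i. i \<in> I \<Longrightarrow> tspan E M X (f i)" "0 \<in> M" "\<And>x. x \<in> X \<Longrightarrow> E 0 x = 1"
    and E: "\<And>l k x. x \<in> X \<Longrightarrow> E (l + k) x = E l x * E k x" and M: "\<And>l k. l \<in> M \<Longrightarrow> k \<in> M \<Longrightarrow> l + k \<in> M"
  shows "tspan E M X (\<lambda>x. \<Prod>i\<in>I. f i x)"
  using assms(1,2)
proof (induction I rule: finite_induct)
  case empty
  have "tspan E M X (\<lambda>x. 1 * E 0 x)" by (rule tspan_single[OF assms(3)])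
  then show ?case using tspan_cong[of X "\<lambda>x. 1 * E 0 x" "\<lambda>x. 1" E M] assms(4) by simp
next
  case (insert i I)
  have "tspan E M X (f i)" "tspan E M X (\<lambda>x. \<Prod>i\<in>I. f i x)" using insert by auto
  from tspan_mult[OF this E M] show ?case using insert.hyps by simp
qed

lemma borel_measurable_cnj [measurable (raw)]:
  "f \<in> borel_measurable M \<Longrightarrow> (\<lambda>x. cnj (f x)) \<in> borel_measurable M"
  by (rule borel_measurable_continuous_on[of cnj]) (auto intro: continuous_intros)

context char_space
begin

sublocale square: pair_sigma_finite m m
  by unfold_locales

lemma square_integrable:
  fixes F :: "'a \<times> 'a \<Rightarrow> 'b::{banach, second_countable_topology}"
  assumes "F \<in> borel_measurable (m \<Otimes>\<^sub>M m)" "\<And>y z. y \<in> space m \<Longrightarrow> z \<in> space m \<Longrightarrow> norm (F (y, z)) \<le> B"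
  shows "integrable (m \<Otimes>\<^sub>M m) F"
proof (rule Bochner_Integration.integrable_bound)
  show "integrable (m \<Otimes>\<^sub>M m) (\<lambda>x. B * indicator (space m \<times> space m) x)"
    by (intro integrable_mult_right integrable_real_indicator)
       (auto simp: emeasure_pair_measure_Times ennreal_mult_less_top emeasure_eq_measure)
  show "AE x in m \<Otimes>\<^sub>M m. norm (F x) \<le> norm (B * indicat_real (space m \<times> space m) x)"
    using assms(2) by (intro AE_I2) (force simp: space_pair_measure intro: order.trans[OF assms(2)])
qed fact

lemma square_swap:
  fixes F :: "'a \<Rightarrow> 'a \<Rightarrow> 'b::{banach, second_countable_topology}"
  assumes "(\<lambda>(y, z). F y z) \<in> borel_measurable (m \<Otimes>\<^sub>M m)" "\<And>y z. y \<in> space m \<Longrightarrow> z \<in> space m \<Longrightarrow> norm (F y z) \<le> B"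
  shows "(\<integral>z. \<integral>y. F y z \<partial>m \<partial>m) = (\<integral>y. \<integral>z. F y z \<partial>m \<partial>m)"
  by (rule square.Fubini_integral, rule square_integrable[OF assms(1), of B]) (use assms(2) in auto)

lemma integral_mono_bdd:
  assumes "f \<in> borel_measurable m" "g \<in> borel_measurable m" "\<And>y. y \<in> space m \<Longrightarrow> \<bar>f y\<bar> \<le> B" "\<And>y. y \<in> space m \<Longrightarrow> \<bar>g y\<bar> \<le> D"
    "\<And>y. y \<in> space m \<Longrightarrow> f y \<le> (g y :: real)"
  shows "(\<integral>y. f y \<partial>m) \<le> (\<integral>y. g y \<partial>m)"
proof (rule integral_mono)
  show "integrable m f" by (rule integrable_bdd[where B=B]) (use assms in auto)
  show "integrable m g" by (rule integrable_bdd[where B=D]) (use assms in auto)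
qed (use assms in auto)

text \<open>Induction on F: the values of \<open>e l\<close> lie in the separable plane, so
  countably many preimages of small discs cover the current set, and one of them meets it in
  positive measure. The square \<open>A \<times> A\<close> plays the part of a neighbourhood of the
  diagonal, without any topology.\<close>

lemma small_oscillation_set:
  assumes "finite F" "0 < \<delta>"
  shows "\<exists>A\<in>sets m. 0 < measure m A \<and> (\<forall>l\<in>F. \<forall>y\<in>A. \<forall>z\<in>A. norm (e l y - e l z) \<le> \<delta>)"
  using assms(1)
proof (induction F rule: finite_induct)
  case empty
  show ?case using total by (intro bexI[of _ "space m"]) auto
next
  case (insert l F)
  obtain A where A: "A \<in> sets m" "0 < measure m A" "\<forall>l\<in>F. \<forall>y\<in>A. \<forall>z\<in>A. norm (e l y - e l z) \<le> \<delta>"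
    using insert.IH by blast
  obtain D :: "complex set" where D: "countable D" "\<And>X. open X \<Longrightarrow> X \<noteq> {} \<Longrightarrow> \<exists>d\<in>D. d \<in> X"
    using countable_dense_exists by blast
  define B where "B q = {y \<in> A. dist (e l y) q < \<delta> / 2}" for q
  have Bs: "B q \<in> sets m" for q
  proof -
    have "B q = A \<inter> {y \<in> space m. dist (e l y) q < \<delta> / 2}" using sets.sets_into_space[OF A(1)] by (auto simp: B_def)
    also have "\<dots> \<in> sets m" using A(1) by measurable
    finally show ?thesis .
  qed
  have "\<exists>q\<in>D. 0 < measure m (B q)"
  proof (rule ccontr)
    assume "\<not> ?thesis"
    then have "\<And>q. q \<in> D \<Longrightarrow> measure m (B q) = 0" by (force simp: zero_less_measure_iff)
    then have "\<And>q. q \<in> D \<Longrightarrow> B q \<in> null_sets m" using Bs by (auto simp: null_sets_def emeasure_eq_measure)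
    then have "(\<Union>q\<in>D. B q) \<in> null_sets m" by (rule null_sets_UN'[OF D(1)])
    moreover have "A \<subseteq> (\<Union>q\<in>D. B q)"
    proof
      fix y assume "y \<in> A"
      moreover obtain q where "q \<in> D" "q \<in> ball (e l y) (\<delta>/2)" using D(2)[of "ball (e l y) (\<delta>/2)"] assms(2) by auto
      ultimately show "y \<in> (\<Union>q\<in>D. B q)" by (auto simp: B_def)
    qed
    ultimately have "A \<in> null_sets m" using A(1) null_sets_subset by blast
    then show False using A(2) by (auto simp: null_sets_def emeasure_eq_measure)
  qed
  then obtain q where q: "0 < measure m (B q)" by blast
  have "norm (e l y - e l z) \<le> \<delta>" if "y \<in> B q" "z \<in> B q" for y z
    using that dist_triangle2[of "e l y" "e l z" q] by (auto simp: B_def dist_norm)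
  then show ?case using q Bs A(3) by (intro bexI[of _ "B q"]) (auto simp: B_def)
qed

text \<open>A nonnegative trigonometric polynomial of y - z, of mass one in each variable, with
  Fourier coefficients k. In the absence of a group law, dependence on y - z is expressed by the
  form of the expansion.\<close>

definition kernel_on :: "(real^'n) set \<Rightarrow> ('a \<Rightarrow> 'a \<Rightarrow> real) \<Rightarrow> (real^'n \<Rightarrow> complex) \<Rightarrow> bool" where
  "kernel_on S \<kappa> k \<longleftrightarrow> finite S \<and>
     (\<forall>y\<in>space m. \<forall>z\<in>space m. of_real (\<kappa> y z) = (\<Sum>l\<in>S. k l * (e l y * cnj (e l z))) \<and> 0 \<le> \<kappa> y z) \<and>
     (\<lambda>(y, z). \<kappa> y z) \<in> borel_measurable (m \<Otimes>\<^sub>M m) \<and>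
     (\<forall>z\<in>space m. (\<integral>y. \<kappa> y z \<partial>m) = 1) \<and> (\<forall>y\<in>space m. (\<integral>z. \<kappa> y z \<partial>m) = 1)"

lemma trig_integral:
  assumes "finite S"
  shows "(\<integral>y. (\<Sum>l\<in>S. a l * e l y) \<partial>m) = (if 0 \<in> S then a 0 else 0)"
proof -
  have i: "integrable m (\<lambda>y. a l * e l y)" for l
    by (intro integrable_mult_right integrable_bdd[where B=1]) (auto simp: e_norm)
  have "(\<integral>y. (\<Sum>l\<in>S. a l * e l y) \<partial>m) = (\<Sum>l\<in>S. a l * (\<integral>y. e l y \<partial>m))"
    using i by (subst Bochner_Integration.integral_sum) auto
  also have "\<dots> = (\<Sum>l\<in>S. if l = 0 then a 0 else 0)"
  proof (intro sum.cong refl)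
    fix l
    have "(\<integral>y. e 0 y \<partial>m) = (\<integral>y. 1 \<partial>m)" by (intro Bochner_Integration.integral_cong) (auto simp: e_zero)
    then show "a l * (\<integral>y. e l y \<partial>m) = (if l = 0 then a 0 else 0)" using e_int[of l] total by auto
  qed
  also have "\<dots> = (if 0 \<in> S then a 0 else 0)" using assms by simp
  finally show ?thesis .
qed

text \<open>The product W of the factors (1 + Re (e l y cnj (e l z))) / 2 = 1 - |e l y - e l z|^2 /
  4 is a trigonometric polynomial with values in [0, 1], close to 1 only where all characters of F
  nearly agree. Its normalized N-th power concentrates there: where some character differs by more
  than \<delta> one has W \<le> \<rho>, on a square \<open>A \<times> A\<close> of positive measure
  W \<ge> \<rho>' > \<rho>, and (\<rho> / \<rho>')^N tends to 0. The frequencies stay in M because M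
  is a group.\<close>

lemma kernel_exists:
  assumes F: "finite F" "F \<subseteq> M" and M: "0 \<in> M" "\<And>x y. x \<in> M \<Longrightarrow> y \<in> M \<Longrightarrow> x + y \<in> M" "\<And>x. x \<in> M \<Longrightarrow> - x \<in> M"
    and eps: "0 < \<epsilon>"
  shows "\<exists>S \<kappa> k. S \<subseteq> M \<and> kernel_on S \<kappa> k \<and> (\<forall>l\<in>F. (\<integral>z. \<integral>y. \<kappa> y z * norm (e l y - e l z) \<partial>m \<partial>m) \<le> \<epsilon>)"
proof -
  define X where "X = space m \<times> space m"
  define EE where "EE l p = e l (fst p) * cnj (e l (snd p))" for l p
  have EEadd: "EE (l + k) p = EE l p * EE k p" if "p \<in> X" for l k p
    using that by (auto simp: EE_def X_def e_add mult_ac)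
  have EE0: "EE 0 p = 1" if "p \<in> X" for p using that by (auto simp: EE_def X_def e_zero)
  define v where "v l y z = (1 + Re (e l y * cnj (e l z))) / 2" for l y z
  have v_eq: "v l y z = 1 - (norm (e l y - e l z))^2 / 4" if "y \<in> space m" "z \<in> space m" for l y z
  proof -
    have "(norm (e l y - e l z))^2 = (norm (e l y))^2 + (norm (e l z))^2 - 2 * Re (e l y * cnj (e l z))"
      unfolding cmod_power2 by (simp add: power2_eq_square algebra_simps)
    then show ?thesis using e_norm[OF that(1)] e_norm[OF that(2)] by (simp add: v_def field_simps)
  qed
  have v01: "0 \<le> v l y z" "v l y z \<le> 1" if "y \<in> space m" "z \<in> space m" for l y z
  proof -
    show "v l y z \<le> 1" unfolding v_eq[OF that] by simp
    have "\<bar>Re (e l y * cnj (e l z))\<bar> \<le> norm (e l y * cnj (e l z))" by (rule abs_Re_le_cmod)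
    also have "\<dots> = 1" using e_norm[OF that(1)] e_norm[OF that(2)] by (simp add: norm_mult)
    finally show "0 \<le> v l y z" by (simp add: v_def)
  qed
  define W where "W y z = (\<Prod>l\<in>F. v l y z)" for y z
  have W01: "0 \<le> W y z" "W y z \<le> 1" if "y \<in> space m" "z \<in> space m" for y z
    unfolding W_def using v01[OF that] by (auto intro!: prod_nonneg prod_le_1)
  have vm[measurable]: "(\<lambda>p. v l (fst p) (snd p)) \<in> borel_measurable (m \<Otimes>\<^sub>M m)" for l
    unfolding v_def by measurable
  have Wm[measurable]: "(\<lambda>p. W (fst p) (snd p)) \<in> borel_measurable (m \<Otimes>\<^sub>M m)"
    unfolding W_def by measurable
  have Wm1: "(\<lambda>y. W y z) \<in> borel_measurable m" if "z \<in> space m" for z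
    using measurable_compose[OF _ Wm, of "\<lambda>y. (y, z)" m] that by simp
  have Wm2: "(\<lambda>z. W y z) \<in> borel_measurable m" if "y \<in> space m" for y
    using measurable_compose[OF _ Wm, of "\<lambda>z. (y, z)" m] that by simp
  have span: "tspan EE M X (\<lambda>p. of_real (W (fst p) (snd p) ^ N))" for N
  proof -
    have 1: "tspan EE M X (\<lambda>p. of_real (v l (fst p) (snd p)))" if "l \<in> F" for l
    proof -
      have "l \<in> M" "- l \<in> M" using that F M by auto
      then have "tspan EE M X (\<lambda>p. (1/2) * EE 0 p + ((1/4) * EE l p + (1/4) * EE (- l) p))"
        using M by (intro tspan_add tspan_single) auto
      moreover have "(1/2) * EE 0 p + ((1/4) * EE l p + (1/4) * EE (- l) p) = of_real (v l (fst p) (snd p))" if "p \<in> X" for p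
      proof -
        have "EE (- l) p = cnj (EE l p)" using that by (auto simp: EE_def X_def e_uminus)
        moreover have "v l (fst p) (snd p) = (1 + Re (EE l p)) / 2" by (simp add: v_def EE_def)
        ultimately show ?thesis unfolding EE0[OF that]
          by (simp add: complex_eq_iff del: complex_cnj_mult)
      qed
      ultimately show ?thesis by (subst tspan_cong[of X _ "\<lambda>p. (1/2) * EE 0 p + ((1/4) * EE l p + (1/4) * EE (- l) p)"]) auto
    qed
    have 2: "tspan EE M X (\<lambda>p. \<Prod>l\<in>F. of_real (v l (fst p) (snd p)))"
      by (rule tspan_prod[OF F(1) 1 M(1) EE0 EEadd M(2)])
    have "tspan EE M X (\<lambda>p. \<Prod>i\<in>{..<N}. \<Prod>l\<in>F. of_real (v l (fst p) (snd p)))"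
      by (rule tspan_prod[OF finite_lessThan 2 M(1) EE0 EEadd M(2)])
    then show ?thesis by (simp add: W_def of_real_prod)
  qed
  \<comment> \<open>Integration in one variable keeps only the zero frequency, so both partial
    integrals equal the same constant.\<close>
  have const: "\<exists>S k. finite S \<and> S \<subseteq> M \<and> (\<forall>y\<in>space m. \<forall>z\<in>space m. of_real (W y z ^ N) = (\<Sum>l\<in>S. k l * (e l y * cnj (e l z)))) \<and>
     (\<exists>c. (\<forall>z\<in>space m. (\<integral>y. W y z ^ N \<partial>m) = c) \<and> (\<forall>y\<in>space m. (\<integral>z. W y z ^ N \<partial>m) = c))" for N
  proof -
    obtain S k where S: "finite S" "S \<subseteq> M" "\<forall>p\<in>X. of_real (W (fst p) (snd p) ^ N) = (\<Sum>l\<in>S. k l * EE l p)"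
      using span[of N] unfolding tspan_def by blast
    have eq: "of_real (W y z ^ N) = (\<Sum>l\<in>S. k l * (e l y * cnj (e l z)))" if "y \<in> space m" "z \<in> space m" for y z
      using S(3) that by (auto simp: X_def EE_def)
    define c where "c = (if 0 \<in> S then k 0 else 0)"
    have 1: "of_real (\<integral>y. W y z ^ N \<partial>m) = c" if z: "z \<in> space m" for z
    proof -
      have "of_real (\<integral>y. W y z ^ N \<partial>m) = (\<integral>y. of_real (W y z ^ N) \<partial>m :: complex)" by (rule integral_complex_of_real[symmetric])
      also have "\<dots> = (\<integral>y. (\<Sum>l\<in>S. (k l * cnj (e l z)) * e l y) \<partial>m)"
        by (intro Bochner_Integration.integral_cong) (auto simp: eq z mult_ac simp del: of_real_power)
      also have "\<dots> = c" unfolding trig_integral[OF S(1)] c_def using e_zero[OF z] by simp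
      finally show ?thesis .
    qed
    have 2: "of_real (\<integral>z. W y z ^ N \<partial>m) = c" if y: "y \<in> space m" for y
    proof -
      have "of_real (\<integral>z. W y z ^ N \<partial>m) = (\<integral>z. of_real (W y z ^ N) \<partial>m :: complex)" by (rule integral_complex_of_real[symmetric])
      also have "\<dots> = (\<integral>z. cnj (\<Sum>l\<in>S. (cnj (k l) * cnj (e l y)) * e l z) \<partial>m)"
        by (intro Bochner_Integration.integral_cong) (auto simp: eq y mult_ac simp del: of_real_power)
      also have "\<dots> = cnj (\<integral>z. (\<Sum>l\<in>S. (cnj (k l) * cnj (e l y)) * e l z) \<partial>m)" by (rule Bochner_Integration.integral_cnj)
      also have "\<dots> = cnj (if 0 \<in> S then cnj (k 0) * cnj (e 0 y) else 0)" by (subst trig_integral[OF S(1)]) (rule refl)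
      also have "\<dots> = c" unfolding c_def using e_zero[OF y] by simp
      finally show ?thesis .
    qed
    have 3: "\<forall>z\<in>space m. (\<integral>y. W y z ^ N \<partial>m) = Re c" "\<forall>y\<in>space m. (\<integral>z. W y z ^ N \<partial>m) = Re c"
      using 1 2 by (metis Re_complex_of_real)+
    show ?thesis
    proof (intro exI[of _ S] exI[of _ k] exI[of _ "Re c"] conjI ballI S(1,2))
      fix y z assume "y \<in> space m" "z \<in> space m" then show "of_real (W y z ^ N) = (\<Sum>l\<in>S. k l * (e l y * cnj (e l z)))" by (rule eq)
    qed (use 3 in blast)+
  qed
  define \<delta> where "\<delta> = min (\<epsilon> / 2) 1"
  have \<delta>: "0 < \<delta>" "\<delta> \<le> 1" "\<delta> \<le> \<epsilon> / 2" using eps by (auto simp: \<delta>_def)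
  \<comment> \<open>Small enough that card F errors \<delta>'^2 together stay below one \<delta>^2,
    which gives \<rho> < \<rho>'.\<close>
  define \<delta>' where "\<delta>' = \<delta> / (real (card F) + 1)"
  have \<delta>': "0 < \<delta>'" "\<delta>' \<le> \<delta>" using \<delta> by (auto simp: \<delta>'_def field_simps)
  define \<rho> where "\<rho> = 1 - \<delta>^2 / 4"
  define \<rho>' where "\<rho>' = 1 - real (card F) * \<delta>'^2 / 4"
  have d2: "\<delta>^2 \<le> 1" using \<delta> by (simp add: power_le_one)
  have \<rho>: "0 < \<rho>" "\<rho> < \<rho>'"
  proof -
    show "0 < \<rho>" using d2 by (simp add: \<rho>_def)
    have "real (card F) < (real (card F) + 1)^2" by (simp add: power2_eq_square algebra_simps add_pos_nonneg)
    then have "real (card F) * \<delta>'^2 < \<delta>^2" using \<delta> by (simp add: \<delta>'_def power_divide field_simps)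
    then show "\<rho> < \<rho>'" by (simp add: \<rho>_def \<rho>'_def)
  qed
  obtain A where A: "A \<in> sets m" "0 < measure m A" "\<And>l y z. l \<in> F \<Longrightarrow> y \<in> A \<Longrightarrow> z \<in> A \<Longrightarrow> norm (e l y - e l z) \<le> \<delta>'"
    using small_oscillation_set[OF F(1) \<delta>'(1)] by blast
  have Asp: "y \<in> space m" if "y \<in> A" for y using sets.sets_into_space[OF A(1)] that by blast
  have WA: "\<rho>' \<le> W y z" if "y \<in> A" "z \<in> A" for y z
  proof -
    have "\<delta>'^2 \<le> 1" using \<delta> \<delta>' by (intro power_le_one) auto
    then have "\<rho>' \<le> (1 - \<delta>'^2/4) ^ card F" using Bernoulli_inequality[of "- (\<delta>'^2/4)" "card F"] by (simp add: \<rho>'_def)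
    also have "\<dots> = (\<Prod>l\<in>F. 1 - \<delta>'^2/4)" by simp
    also have "\<dots> \<le> W y z" unfolding W_def
    proof (rule prod_mono, intro conjI)
      fix l assume l: "l \<in> F"
      show "0 \<le> 1 - \<delta>'^2/4" using \<open>\<delta>'^2 \<le> 1\<close> by simp
      have "(norm (e l y - e l z))^2 \<le> \<delta>'^2" using A(3)[OF l that] by (intro power_mono) auto
      then show "1 - \<delta>'^2/4 \<le> v l y z" unfolding v_eq[OF Asp[OF that(1)] Asp[OF that(2)]] by simp
    qed
    finally show ?thesis .
  qed
  have Wbad: "W y z \<le> \<rho>" if "y \<in> space m" "z \<in> space m" "l \<in> F" "\<delta> < norm (e l y - e l z)" for l y z
  proof -
    have "W y z = v l y z * (\<Prod>l\<in>F - {l}. v l y z)" unfolding W_def using F(1) that(3) by (rule prod.remove)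
    also have "\<dots> \<le> v l y z * 1" using v01[OF that(1,2)] by (intro mult_left_mono prod_le_1) auto
    also have "\<dots> \<le> \<rho>"
    proof -
      have "\<delta>^2 \<le> (norm (e l y - e l z))^2" using that(4) \<delta>(1) by (intro power_mono) auto
      then show ?thesis unfolding v_eq[OF that(1,2)] \<rho>_def by simp
    qed
    finally show ?thesis .
  qed
  \<comment> \<open>This bounds the share of the bad region in the normalized kernel: 2 is the
    largest distance of two unit numbers, and \<open>(measure m A)^2 * \<rho>'^N\<close> is a lower
    bound for the normalization.\<close>
  have "(\<lambda>N. 2 * (\<rho> / \<rho>')^N / (measure m A)^2) \<longlonglongrightarrow> 2 * 0 / (measure m A)^2"
    using \<rho> A(2) by (intro tendsto_intros LIMSEQ_realpow_zero) auto
  then have "eventually (\<lambda>N. 2 * (\<rho> / \<rho>')^N / (measure m A)^2 < \<epsilon> / 2) sequentially"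
    using eps by (intro order_tendstoD) auto
  then obtain N where N: "2 * (\<rho> / \<rho>')^N / (measure m A)^2 < \<epsilon> / 2" by (auto simp: eventually_sequentially)
  obtain S k c where S: "finite S" "S \<subseteq> M" "\<And>y z. y\<in>space m \<Longrightarrow> z\<in>space m \<Longrightarrow> of_real (W y z ^ N) = (\<Sum>l\<in>S. k l * (e l y * cnj (e l z)))"
    "\<And>z. z\<in>space m \<Longrightarrow> (\<integral>y. W y z ^ N \<partial>m) = c" "\<And>y. y\<in>space m \<Longrightarrow> (\<integral>z. W y z ^ N \<partial>m) = c"
    using const[of N] by blast
  have WN: "\<bar>W y z ^ N\<bar> \<le> 1" "0 \<le> W y z ^ N" if "y \<in> space m" "z \<in> space m" for y z
    using W01[OF that] by (auto intro: power_le_one)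
  have cint: "c = (\<integral>z. \<integral>y. W y z ^ N \<partial>m \<partial>m)"
  proof -
    have "(\<integral>z. \<integral>y. W y z ^ N \<partial>m \<partial>m) = (\<integral>z. c \<partial>m)" by (intro Bochner_Integration.integral_cong refl S(4))
    then show ?thesis using total by simp
  qed
  have clow: "(measure m A)^2 * \<rho>'^N \<le> c"
  proof -
    have Asub: "A \<subseteq> space m" using sets.sets_into_space[OF A(1)] .
    have in1: "(\<integral>y. \<rho>'^N * indicator A y \<partial>m) = \<rho>'^N * measure m A" using A(1) unfolding integral_mult_right_zero by simp
    have "(\<integral>z. (\<rho>'^N * measure m A) * indicator A z \<partial>m) \<le> (\<integral>z. c \<partial>m)"
    proof (rule integral_mono)
      fix z assume z: "z \<in> space m"
      show "(\<rho>'^N * measure m A) * indicator A z \<le> c"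
      proof (cases "z \<in> A")
        case True
        have "(\<integral>y. \<rho>'^N * indicator A y \<partial>m) \<le> (\<integral>y. W y z ^ N \<partial>m)"
        proof (rule integral_mono_bdd[where B="\<rho>'^N" and D=1])
          show "(\<lambda>y. W y z ^ N) \<in> borel_measurable m" using Wm1[OF z] by simp
          fix y assume y: "y \<in> space m"
          show "\<rho>'^N * indicator A y \<le> W y z ^ N"
            using WA[OF _ True, of y] \<rho> WN[OF y z] by (auto simp: indicator_def intro: power_mono)
        qed (use A(1) \<rho> WN z in \<open>auto simp: indicator_def\<close>)
        then have "\<rho>'^N * measure m A \<le> c" unfolding in1 S(4)[OF z] .
        then show ?thesis using True by simp
      next
        case False
        have "0 \<le> c" unfolding S(4)[OF z, symmetric] by (rule Bochner_Integration.integral_nonneg) (use WN z in auto)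
        then show ?thesis using False by simp
      qed
    qed (use A(1) in \<open>auto intro!: integrable_mult_right integrable_real_indicator simp: emeasure_eq_measure\<close>)
    also have "(\<integral>z. (\<rho>'^N * measure m A) * indicator A z \<partial>m) = (\<rho>'^N * measure m A) * measure m A"
      using A(1) unfolding integral_mult_right_zero by simp
    finally show ?thesis using total by (simp add: power2_eq_square mult_ac)
  qed
  have c: "0 < c" using clow A(2) \<rho> by (smt (verit) mult_pos_pos zero_less_power)
  define \<kappa> where "\<kappa> y z = W y z ^ N / c" for y z
  have K: "kernel_on S \<kappa> (\<lambda>l. k l / of_real c)"
    unfolding kernel_on_def
  proof (intro conjI ballI S(1))
    fix y z assume yz: "y \<in> space m" "z \<in> space m"
    show "of_real (\<kappa> y z) = (\<Sum>l\<in>S. k l / of_real c * (e l y * cnj (e l z)))"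
      unfolding \<kappa>_def of_real_divide S(3)[OF yz] sum_divide_distrib by (intro sum.cong) auto
    show "0 \<le> \<kappa> y z" using WN[OF yz] c by (simp add: \<kappa>_def)
  next
    show "(\<lambda>(y, z). \<kappa> y z) \<in> borel_measurable (m \<Otimes>\<^sub>M m)" unfolding \<kappa>_def split_beta by measurable
  next
    fix z assume z: "z \<in> space m"
    show "(\<integral>y. \<kappa> y z \<partial>m) = 1" unfolding \<kappa>_def integral_divide_zero S(4)[OF z] using c by simp
    show "(\<integral>x. \<kappa> z x \<partial>m) = 1" unfolding \<kappa>_def integral_divide_zero S(5)[OF z] using c by simp
  qed
  have "(\<integral>z. \<integral>y. \<kappa> y z * norm (e l y - e l z) \<partial>m \<partial>m) \<le> \<epsilon>" if l: "l \<in> F" for l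
  proof -
    have d: "norm (e l y - e l z) \<le> 2" if "y \<in> space m" "z \<in> space m" for y z
      using norm_triangle_ineq4[of "e l y" "e l z"] e_norm[OF that(1)] e_norm[OF that(2)] by simp
    have nb: "\<bar>W y z ^ N * norm (e l y - e l z)\<bar> \<le> 2" if "y \<in> space m" "z \<in> space m" for y z
      using mult_mono[OF WN(1)[OF that] d[OF that]] by (simp add: abs_mult)
    \<comment> \<open>The two summands stand for the two cases: the values are within \<delta> of
      each other, or W is at most \<rho>.\<close>
    have pw: "W y z ^ N * norm (e l y - e l z) \<le> \<delta> * W y z ^ N + 2 * \<rho>^N" if "y \<in> space m" "z \<in> space m" for y z
    proof (cases "\<delta> < norm (e l y - e l z)")
      case True
      have "W y z ^ N \<le> \<rho>^N" using Wbad[OF that l True] W01[OF that] by (intro power_mono) auto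
      then have "W y z ^ N * norm (e l y - e l z) \<le> \<rho>^N * 2" using d[OF that] \<rho> by (intro mult_mono) auto
      moreover have "0 \<le> \<delta> * W y z ^ N" using \<delta> WN[OF that] by simp
      ultimately show ?thesis by simp
    next
      case False
      then have "W y z ^ N * norm (e l y - e l z) \<le> W y z ^ N * \<delta>" using WN[OF that] by (intro mult_left_mono) auto
      moreover have "0 \<le> 2 * \<rho>^N" using \<rho> by simp
      ultimately show ?thesis by (simp add: mult.commute)
    qed
    have mz: "(\<lambda>y. W y z ^ N * norm (e l y - e l z)) \<in> borel_measurable m" if "z \<in> space m" for z
      using Wm1[OF that] by measurable
    have inner: "(\<integral>y. W y z ^ N * norm (e l y - e l z) \<partial>m) \<le> \<delta> * c + 2 * \<rho>^N" if z: "z \<in> space m" for z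
    proof -
      have iW: "integrable m (\<lambda>y. W y z ^ N)" by (rule integrable_bdd[where B=1]) (use Wm1[OF z] WN z in auto)
      have "(\<integral>y. W y z ^ N * norm (e l y - e l z) \<partial>m) \<le> (\<integral>y. \<delta> * W y z ^ N + 2 * \<rho>^N \<partial>m)"
      proof (rule integral_mono)
        show "integrable m (\<lambda>y. W y z ^ N * norm (e l y - e l z))"
          by (rule integrable_bdd[where B=2]) (use mz[OF z] nb z in auto)
        show "integrable m (\<lambda>y. \<delta> * W y z ^ N + 2 * \<rho> ^ N)" using iW by simp
      qed (use pw z in auto)
      also have "\<dots> = \<delta> * c + 2 * \<rho>^N" using iW total S(4)[OF z] by simp
      finally show ?thesis .
    qed
    have "(\<integral>z. \<integral>y. \<kappa> y z * norm (e l y - e l z) \<partial>m \<partial>m) = (\<integral>z. (\<integral>y. W y z ^ N * norm (e l y - e l z) \<partial>m) / c \<partial>m)"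
      unfolding integral_divide_zero[symmetric] by (intro Bochner_Integration.integral_cong refl) (simp add: \<kappa>_def)
    also have "\<dots> \<le> (\<integral>z. (\<delta> * c + 2 * \<rho>^N) / c \<partial>m)"
    proof (rule integral_mono_bdd[where B="2 / c" and D="(\<delta> * c + 2 * \<rho>^N) / c"])
      show "(\<lambda>z. (\<integral>y. W y z ^ N * norm (e l y - e l z) \<partial>m) / c) \<in> borel_measurable m"
      proof -
        have "(\<lambda>(z, y). W y z ^ N * norm (e l y - e l z)) \<in> borel_measurable (m \<Otimes>\<^sub>M m)"
        proof -
          have "(\<lambda>p. W (snd p) (fst p)) \<in> borel_measurable (m \<Otimes>\<^sub>M m)"
            using measurable_compose[OF measurable_pair_swap' Wm] by (simp add: split_beta')
          then show ?thesis unfolding split_beta by measurable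
        qed
        then show ?thesis by measurable
      qed
      fix z assume z: "z \<in> space m"
      show "\<bar>(\<integral>y. W y z ^ N * norm (e l y - e l z) \<partial>m) / c\<bar> \<le> 2 / c"
        using norm_integral_le[OF mz[OF z], of 2] nb[OF _ z] c by (simp add: abs_divide divide_right_mono)
      show "\<bar>(\<delta> * c + 2 * \<rho>^N) / c\<bar> \<le> (\<delta> * c + 2 * \<rho>^N) / c" using c \<delta> \<rho> by simp
      show "(\<integral>y. W y z ^ N * norm (e l y - e l z) \<partial>m) / c \<le> (\<delta> * c + 2 * \<rho>^N) / c"
        using inner[OF z] c by (simp add: divide_right_mono)
    qed auto
    also have "\<dots> = \<delta> + 2 * \<rho>^N / c" using total c by (simp add: field_simps)
    also have "2 * \<rho>^N / c \<le> 2 * \<rho>^N / ((measure m A)^2 * \<rho>'^N)"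
      using clow A(2) \<rho> c by (intro divide_left_mono) auto
    also have "\<dots> = 2 * (\<rho> / \<rho>')^N / (measure m A)^2" by (simp add: power_divide)
    finally show ?thesis using N \<delta> by linarith
  qed
  then show ?thesis using S(2) K by blast
qed

end

section \<open>Doubling of variables and decay\<close>

text \<open>The square of the positive part of t (c - t) is continuously differentiable. Its support
  begins at 0, so it becomes an admissible test only after a shift to positive time.\<close>

lemma C1c_bump:
  assumes "0 < (c::real)"
  shows "\<exists>\<beta> \<beta>'. (\<forall>t. (\<beta> has_vector_derivative \<beta>' t) (at t)) \<and> continuous_on UNIV \<beta>' \<and> (\<forall>t. 0 \<le> \<beta> t) \<and>
    (\<forall>t. t \<notin> {0<..<c} \<longrightarrow> \<beta> t = (0::real)) \<and> (\<integral>t. \<beta> t \<partial>lborel) = 1"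
proof -
  define f where "f t = max 0 (t * (c - t))" for t
  define g where "g t = (f t)^2" for t
  have fs: "f t = 0" if "t \<notin> {0<..<c}" for t
  proof -
    have "t * (c - t) \<le> 0"
      using that assms by (auto simp: mult_le_0_iff)
    then show ?thesis by (simp add: f_def)
  qed
  \<comment> \<open>The delicate point is 0, where the difference quotient is at most |h| in
    modulus.\<close>
  have m2: "((\<lambda>x::real. (max 0 x)^2) has_real_derivative 2 * max 0 x) (at x)" for x
  proof (cases "x = 0")
    case False
    then consider "x < 0" | "0 < x" by linarith
    then show ?thesis
    proof cases
      case 1
      have "((\<lambda>x::real. (max 0 x)^2) has_real_derivative 0) (at x)"
        by (rule has_field_derivative_transform_within_open[where f="\<lambda>_. 0" and S="{..<0}"]) (use 1 in auto)
      then show ?thesis using 1 by simp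
    next
      case 2
      have "((\<lambda>x::real. x^2) has_real_derivative 2 * x) (at x)" by (auto intro!: derivative_eq_intros)
      then have "((\<lambda>x::real. (max 0 x)^2) has_real_derivative 2 * x) (at x)"
        by (rule has_field_derivative_transform_within_open[where S="{0<..}"]) (use 2 in auto)
      then show ?thesis using 2 by simp
    qed
  next
    case True
    have "(\<lambda>h::real. ((max 0 (0 + h))^2 - (max 0 0)^2) / h) \<midarrow>0\<rightarrow> 0"
    proof (rule LIM_I)
      fix r :: real assume "0 < r"
      have "\<bar>(max 0 h)^2 / h\<bar> < r" if "h \<noteq> 0" "\<bar>h\<bar> < r" for h :: real
        using that by (auto simp: max_def power2_eq_square)
      then show "\<exists>s>0. \<forall>h::real. h \<noteq> 0 \<and> norm (h - 0) < s \<longrightarrow> norm (((max 0 (0 + h))^2 - (max 0 0)^2) / h - 0) < r"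
        using \<open>0 < r\<close> by (intro exI[of _ r]) auto
    qed
    then show ?thesis unfolding DERIV_def True by simp
  qed
  have dg: "(g has_vector_derivative (2 * f t * (c - 2 * t))) (at t)" for t
  proof -
    have d: "((\<lambda>t. t * (c - t)) has_real_derivative (c - 2 * t)) (at t)" by (auto intro!: derivative_eq_intros)
    show ?thesis
      using DERIV_chain[OF m2 d] unfolding g_def[abs_def] f_def has_real_derivative_iff_has_vector_derivative comp_def
      by simp
  qed
  have cf: "continuous_on UNIV f" unfolding f_def by (intro continuous_intros)
  have cg: "continuous_on UNIV g" unfolding g_def using cf by (intro continuous_intros)
  have gs: "g t = 0" if "t \<notin> {0..c}" for t using fs[of t] that by (auto simp: g_def)
  obtain B where B: "0 < B" "\<And>t. norm (g t) \<le> B" using bounded_of_support[OF cg gs] by blast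
  have gi: "integrable lborel g"
    by (rule integrable_bounded_support[OF borel_measurable_continuous_onI[OF cg] B(2) gs])
  have gn: "0 \<le> g t" for t by (simp add: g_def)
  have J: "0 < (\<integral>t. g t \<partial>lborel)"
  proof (rule ccontr)
    assume "\<not> ?thesis"
    then have "(\<integral>t. g t \<partial>lborel) = 0"
      using Bochner_Integration.integral_nonneg[of lborel g] gn by fastforce
    then have "AE t in lborel. g t = 0"
      using integral_nonneg_eq_0_iff_AE[OF gi] gn by simp
    moreover have "g t \<noteq> 0" if "t \<in> {0<..<c}" for t using that by (auto simp: f_def g_def max_def)
    ultimately have "AE t in lborel. t \<notin> {0<..<c}" by (auto elim: eventually_mono)
    then have "emeasure lborel {0<..<c} = 0"
      by (subst (asm) AE_iff_measurable[of "{0<..<c}"]) auto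
    then show False using assms by simp
  qed
  define J where "J = (\<integral>t. g t \<partial>lborel)"
  show ?thesis
  proof (rule exI[of _ "\<lambda>t. g t / J"], rule exI[of _ "\<lambda>t. 2 * f t * (c - 2 * t) / J"], intro conjI allI impI)
    show "((\<lambda>t. g t / J) has_vector_derivative 2 * f t * (c - 2 * t) / J) (at t)" for t
      using dg[of t] unfolding has_real_derivative_iff_has_vector_derivative[symmetric] by (rule DERIV_cdivide)
    show "continuous_on UNIV (\<lambda>t. 2 * f t * (c - 2 * t) / J)" using cf J by (intro continuous_intros) (auto simp: J_def)
    show "(\<integral>t. g t / J \<partial>lborel) = 1" using J by (simp add: J_def)
  qed (use gn J fs in \<open>auto simp: J_def g_def\<close>)
qed

section \<open>Doubling of variables with a fixed kernel\<close>

context trig_entropy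
begin

text \<open>The two times are kept apart: doubling controls the average of \<open>dd\<close> against
  a weight in t - s, not its value at t = s.\<close>

definition dd :: "('a \<Rightarrow> 'a \<Rightarrow> real) \<Rightarrow> real \<Rightarrow> real \<Rightarrow> real" where
  "dd \<kappa> t s = (\<integral>z. \<integral>y. \<kappa> y z * \<bar>u (t, y) - u (s, z)\<bar> \<partial>m \<partial>m)"

lemma kernel_measurable:
  assumes "kernel_on S \<kappa> k"
  shows "(\<lambda>p. \<kappa> (fst p) (snd p)) \<in> borel_measurable (m \<Otimes>\<^sub>M m)"
    "z \<in> space m \<Longrightarrow> (\<lambda>y. \<kappa> y z) \<in> borel_measurable m" "y \<in> space m \<Longrightarrow> (\<lambda>z. \<kappa> y z) \<in> borel_measurable m"
proof -
  show K: "(\<lambda>p. \<kappa> (fst p) (snd p)) \<in> borel_measurable (m \<Otimes>\<^sub>M m)"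
    using assms unfolding kernel_on_def by (simp add: split_beta')
  show "z \<in> space m \<Longrightarrow> (\<lambda>y. \<kappa> y z) \<in> borel_measurable m"
    using measurable_compose[OF _ K, of "\<lambda>y. (y, z)" m] by simp
  show "y \<in> space m \<Longrightarrow> (\<lambda>z. \<kappa> y z) \<in> borel_measurable m"
    using measurable_compose[OF _ K, of "\<lambda>z. (y, z)" m] by simp
qed

lemma kernel_bounded:
  assumes "kernel_on S \<kappa> k"
  obtains B where "0 \<le> B" "\<And>y z. y \<in> space m \<Longrightarrow> z \<in> space m \<Longrightarrow> 0 \<le> \<kappa> y z \<and> \<kappa> y z \<le> B"
proof (rule that[of "\<Sum>l\<in>S. norm (k l)"])
  show "0 \<le> (\<Sum>l\<in>S. norm (k l))" by (intro sum_nonneg) auto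
  fix y z assume yz: "y \<in> space m" "z \<in> space m"
  have K: "of_real (\<kappa> y z) = (\<Sum>l\<in>S. k l * (e l y * cnj (e l z)))" "0 \<le> \<kappa> y z"
    using assms yz unfolding kernel_on_def by blast+
  have "norm (of_real (\<kappa> y z) :: complex) \<le> (\<Sum>l\<in>S. norm (k l * (e l y * cnj (e l z))))"
    unfolding K(1) by (rule norm_sum)
  also have "\<dots> = (\<Sum>l\<in>S. norm (k l))" using e_norm yz by (intro sum.cong) (auto simp: norm_mult)
  finally show "0 \<le> \<kappa> y z \<and> \<kappa> y z \<le> (\<Sum>l\<in>S. norm (k l))" using K(2) by (simp add: norm_of_real)
qed

lemma double_integrable:
  fixes F :: "(real \<times> 'a) \<times> (real \<times> 'a) \<Rightarrow> real"
  assumes "F \<in> borel_measurable ((lborel \<Otimes>\<^sub>M m) \<Otimes>\<^sub>M (lborel \<Otimes>\<^sub>M m))"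
    and "\<And>t y s z. y \<in> space m \<Longrightarrow> z \<in> space m \<Longrightarrow> \<bar>F ((t, y), (s, z))\<bar> \<le> B"
    and "\<And>t y s z. t \<notin> {a..b} \<or> s \<notin> {a..b} \<Longrightarrow> F ((t, y), (s, z)) = 0"
  shows "integrable ((lborel \<Otimes>\<^sub>M m) \<Otimes>\<^sub>M (lborel \<Otimes>\<^sub>M m)) F"
proof (rule Bochner_Integration.integrable_bound)
  interpret P: sigma_finite_measure "lborel \<Otimes>\<^sub>M m" by (rule slab.sigma_finite_measure_axioms)
  let ?R = "({a..b} \<times> space m) \<times> ({a..b} \<times> space m)"
  have e1: "emeasure (lborel \<Otimes>\<^sub>M m) ({a..b} \<times> space m) < \<infinity>"
    by (auto simp: emeasure_pair_measure_Times emeasure_lborel_Icc_eq ennreal_mult_less_top emeasure_eq_measure)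
  show "integrable ((lborel \<Otimes>\<^sub>M m) \<Otimes>\<^sub>M (lborel \<Otimes>\<^sub>M m)) (\<lambda>x. B * indicator ?R x)"
  proof (intro integrable_mult_right integrable_real_indicator)
    show "?R \<in> sets ((lborel \<Otimes>\<^sub>M m) \<Otimes>\<^sub>M (lborel \<Otimes>\<^sub>M m))" by (intro pair_measureI) auto
    show "emeasure ((lborel \<Otimes>\<^sub>M m) \<Otimes>\<^sub>M (lborel \<Otimes>\<^sub>M m)) ?R < \<infinity>"
      using e1 by (subst slab.P.emeasure_pair_measure_Times) (auto simp: ennreal_mult_less_top)
  qed
  show "AE x in (lborel \<Otimes>\<^sub>M m) \<Otimes>\<^sub>M (lborel \<Otimes>\<^sub>M m). norm (F x) \<le> norm (B * indicat_real ?R x)"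
  proof (rule AE_I2)
    fix x :: "(real \<times> 'a) \<times> (real \<times> 'a)" assume "x \<in> space ((lborel \<Otimes>\<^sub>M m) \<Otimes>\<^sub>M (lborel \<Otimes>\<^sub>M m))"
    then obtain t y s z where x: "x = ((t, y), (s, z))" "y \<in> space m" "z \<in> space m"
      by (auto simp: space_pair_measure)
    show "norm (F x) \<le> norm (B * indicat_real ?R x)"
      using assms(2)[OF x(2,3), of t s] assms(3)[of t s y z] x by (auto simp: indicator_def)
  qed
qed fact

lemma dd_measurable: assumes "kernel_on S \<kappa> k"
  shows "(\<lambda>p. dd \<kappa> (fst p) (snd p)) \<in> borel_measurable (borel \<Otimes>\<^sub>M borel)"
proof -
  note [measurable] = kernel_measurable(1)[OF assms]
  have K: "(\<lambda>x. \<kappa> (f x) (g x)) \<in> borel_measurable N" if "f \<in> measurable N m" "g \<in> measurable N m" for f g and N :: "'z measure"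
    using measurable_compose[OF measurable_Pair[OF that] kernel_measurable(1)[OF assms]] by simp
  have "(\<lambda>((p, z), y). \<kappa> y z * \<bar>u (fst p, y) - u (snd p, z)\<bar>) \<in> borel_measurable (((borel \<Otimes>\<^sub>M borel) \<Otimes>\<^sub>M m) \<Otimes>\<^sub>M m)"
    unfolding split_beta by (intro borel_measurable_times K) measurable
  then have "(\<lambda>(p, z). \<integral>y. \<kappa> y z * \<bar>u (fst p, y) - u (snd p, z)\<bar> \<partial>m) \<in> borel_measurable ((borel \<Otimes>\<^sub>M borel) \<Otimes>\<^sub>M m)"
    using borel_measurable_lebesgue_integral[of "\<lambda>q y. \<kappa> y (snd q) * \<bar>u (fst (fst q), y) - u (snd (fst q), snd q)\<bar>"]
    by (simp add: split_beta')
  then show ?thesis unfolding dd_def[abs_def]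
    using borel_measurable_lebesgue_integral[of "\<lambda>p z. \<integral>y. \<kappa> y z * \<bar>u (fst p, y) - u (snd p, z)\<bar> \<partial>m" "borel \<Otimes>\<^sub>M borel"]
    by simp
qed

lemma dd_bounds: assumes "kernel_on S \<kappa> k" shows "0 \<le> dd \<kappa> t s" "dd \<kappa> t s \<le> 2 * R"
proof -
  have b: "\<bar>u p - u q\<bar> \<le> 2 * R" for p q using u_bound[of p] u_bound[of q] by linarith
  obtain B where B: "0 \<le> B" "\<And>y z. y \<in> space m \<Longrightarrow> z \<in> space m \<Longrightarrow> 0 \<le> \<kappa> y z \<and> \<kappa> y z \<le> B"
    using kernel_bounded[OF assms] by blast
  show "0 \<le> dd \<kappa> t s" unfolding dd_def
    by (intro Bochner_Integration.integral_nonneg mult_nonneg_nonneg) (use B in auto)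
  have inner: "(\<integral>y. \<kappa> y z * \<bar>u (t, y) - u (s, z)\<bar> \<partial>m) \<le> 2 * R" if z: "z \<in> space m" for z
  proof -
    note [measurable] = kernel_measurable(2)[OF assms z]
    have "(\<integral>y. \<kappa> y z * \<bar>u (t, y) - u (s, z)\<bar> \<partial>m) \<le> (\<integral>y. \<kappa> y z * (2 * R) \<partial>m)"
    proof (rule integral_mono_bdd[where B="B * (2 * R)" and D="B * (2 * R)"])
      fix y assume y: "y \<in> space m"
      show "\<bar>\<kappa> y z * \<bar>u (t, y) - u (s, z)\<bar>\<bar> \<le> B * (2 * R)" using B(2)[OF y z] b by (auto simp: abs_mult intro!: mult_mono)
      show "\<bar>\<kappa> y z * (2 * R)\<bar> \<le> B * (2 * R)" using B(2)[OF y z] R_pos by (auto simp: abs_mult intro!: mult_mono)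
      show "\<kappa> y z * \<bar>u (t, y) - u (s, z)\<bar> \<le> \<kappa> y z * (2 * R)" using B(2)[OF y z] b by (intro mult_left_mono) auto
    qed measurable
    also have "\<dots> = 2 * R" using assms z unfolding kernel_on_def by simp
    finally show ?thesis .
  qed
  show "dd \<kappa> t s \<le> 2 * R"
  proof (cases "integrable m (\<lambda>z. \<integral>y. \<kappa> y z * \<bar>u (t, y) - u (s, z)\<bar> \<partial>m)")
    case True
    have "dd \<kappa> t s \<le> (\<integral>z. 2 * R \<partial>m)" unfolding dd_def by (rule integral_mono[OF True]) (use inner in auto)
    then show ?thesis using total by simp
  next
    case False
    then show ?thesis using R_pos by (simp add: dd_def not_integrable_integral_eq)
  qed
qed

lemma C1cI:
  assumes "\<And>t. (\<alpha> has_vector_derivative \<alpha>' t) (at t)" "continuous_on UNIV \<alpha>'" "0 < a" "\<And>t. t \<notin> {a..b} \<Longrightarrow> \<alpha> t = 0"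
  shows "C1c \<alpha> \<alpha>'"
  unfolding C1c_def using assms by blast

text \<open>Kruzhkov's doubling: the inequality in (t, y) with k = u(s, z), and the one in (s, z)
  with k = u(t, y), are both tested with \<alpha>(s) \<beta>(t - s) \<kappa>(y, z). As \<beta>
  depends on t - s and \<kappa> on y - z, the terms with \<beta>' and the flux terms cancel in the
  sum, and only the term with \<alpha>' survives. Neither \<beta> nor \<kappa> is sent to a
  limit.\<close>

lemma doubling:
  assumes K: "kernel_on S \<kappa> k"
    and \<beta>: "\<And>t. (\<beta> has_vector_derivative \<beta>' t) (at t)" "continuous_on UNIV \<beta>'" "\<And>t. 0 \<le> \<beta> t" "\<And>t. t \<notin> {0<..<c} \<Longrightarrow> \<beta> t = (0::real)"
    and \<alpha>: "C1c \<alpha> \<alpha>'" "\<And>t. 0 \<le> \<alpha> t"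
  shows "0 \<le> (\<integral>s. \<alpha>' s * (\<integral>t. \<beta> (t - s) * dd \<kappa> t s \<partial>lborel) \<partial>lborel)"
proof -
  interpret P: sigma_finite_measure "lborel \<Otimes>\<^sub>M m" by (rule slab.sigma_finite_measure_axioms)
  interpret PP: pair_sigma_finite "lborel \<Otimes>\<^sub>M m" "lborel \<Otimes>\<^sub>M m" by unfold_locales
  let ?P = "lborel \<Otimes>\<^sub>M m"
  have Sf: "finite S" using K by (simp add: kernel_on_def)
  have Keq: "of_real (\<kappa> y z) = (\<Sum>l\<in>S. k l * (e l y * cnj (e l z)))" "0 \<le> \<kappa> y z" if "y \<in> space m" "z \<in> space m" for y z
    using K that unfolding kernel_on_def by auto
  obtain BK where BK: "0 \<le> BK" "\<And>y z. y \<in> space m \<Longrightarrow> z \<in> space m \<Longrightarrow> 0 \<le> \<kappa> y z \<and> \<kappa> y z \<le> BK"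
    using kernel_bounded[OF K] by blast
  obtain a b where ab: "0 < a" "\<And>t. t \<notin> {a..b} \<Longrightarrow> \<alpha> t = 0" and ab': "\<And>t. t \<notin> {a..b} \<Longrightarrow> \<alpha>' t = 0"
    using C1c_support[OF \<alpha>(1)] by blast
  have der: "(\<alpha> has_vector_derivative \<alpha>' t) (at t)" for t using \<alpha>(1) unfolding C1c_def by blast
  note cc = C1c_continuous(1)[OF \<alpha>(1)] and c' = C1c_continuous(2)[OF \<alpha>(1)]
  have c\<beta>: "continuous_on UNIV \<beta>" using \<beta>(1) has_vector_derivative_continuous
    by (metis continuous_at_imp_continuous_on)
  have \<beta>s: "\<beta> t = 0" if "t \<notin> {0..c}" for t using \<beta>(4)[of t] that by auto
  have \<beta>s': "\<beta>' t = 0" if "t \<notin> {0..c}" for t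
    by (rule vector_derivative_zero_outside[OF \<beta>(1) \<beta>s that])
  obtain A where A: "0 < A" "\<And>t. norm (\<alpha> t) \<le> A" using bounded_of_support[OF cc ab(2)] by blast
  obtain A' where A': "0 < A'" "\<And>t. norm (\<alpha>' t) \<le> A'" using bounded_of_support[OF c' ab'] by blast
  obtain D where D: "0 < D" "\<And>t. norm (\<beta> t) \<le> D" using bounded_of_support[OF c\<beta> \<beta>s] by blast
  obtain D' where D': "0 < D'" "\<And>t. norm (\<beta>' t) \<le> D'" using bounded_of_support[OF \<beta>(2) \<beta>s'] by blast
  have am[measurable]: "\<alpha> \<in> borel_measurable borel" "\<alpha>' \<in> borel_measurable borel" "\<beta> \<in> borel_measurable borel" "\<beta>' \<in> borel_measurable borel"
    using cc c' c\<beta> \<beta>(2) by (auto intro: borel_measurable_continuous_onI)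
  define w where "w l y z = k l * (e l y * cnj (e l z))" for l y z
  \<comment> \<open>The gradient of \<kappa> in y applied to the flux difference; the gradient in z
    is its negative.\<close>
  define V where "V p q = Re (\<Sum>l\<in>S. 2 * of_real pi * \<i> * w l (snd p) (snd q) * of_real (l \<bullet> (\<phi> (u p) - \<phi> (u q))))" for p q
  define I1 where "I1 p q = \<bar>u p - u q\<bar> * (\<alpha> (fst q) * \<beta>' (fst p - fst q) * \<kappa> (snd p) (snd q))
      + sgn (u p - u q) * (\<alpha> (fst q) * \<beta> (fst p - fst q) * V p q)" for p q
  define I2 where "I2 p q = \<bar>u p - u q\<bar> * ((\<alpha>' (fst q) * \<beta> (fst p - fst q) - \<alpha> (fst q) * \<beta>' (fst p - fst q)) * \<kappa> (snd p) (snd q))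
      - sgn (u p - u q) * (\<alpha> (fst q) * \<beta> (fst p - fst q) * V p q)" for p q
  have w_sum: "Re (\<Sum>l\<in>S. of_real r * w l y z) = r * \<kappa> y z" if "y \<in> space m" "z \<in> space m" for r y z
  proof -
    have "(\<Sum>l\<in>S. of_real r * w l y z) = of_real (r * \<kappa> y z)"
      unfolding sum_distrib_left[symmetric] w_def Keq(1)[OF that, symmetric] by simp
    then show ?thesis by simp
  qed
  have ineq1: "0 \<le> (\<integral>p. I1 p q \<partial>?P)" if q: "q \<in> space ?P" for q
  proof -
    obtain s z where qq: "q = (s, z)" and z: "z \<in> space m" using q by (cases q) (auto simp: space_pair_measure)
    have "0 \<le> (\<integral>(t, y). \<bar>u (t, y) - u q\<bar> * Re (\<Sum>l\<in>S. (of_real (\<alpha> s * \<beta>' (t - s)) * (k l * cnj (e l z))) * e l y) +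
          sgn (u (t, y) - u q) * Re (\<Sum>l\<in>S. 2 * of_real pi * \<i> * (of_real (\<alpha> s * \<beta> (t - s)) * (k l * cnj (e l z))) * e l y * of_real (l \<bullet> (\<phi> (u (t, y)) - \<phi> (u q))))
          \<partial>?P)"
    proof (rule entropy[OF Sf])
      fix l assume "l \<in> S"
      have 1: "((\<lambda>t. \<beta> (t - s)) has_vector_derivative \<beta>' (t - s)) (at t)" for t
      proof -
        have "((\<lambda>t. t - s) has_vector_derivative 1) (at t)" by (auto intro!: derivative_eq_intros)
        from vector_diff_chain_at[OF this \<beta>(1)] show ?thesis by (simp add: comp_def)
      qed
      show "C1c (\<lambda>t. of_real (\<alpha> s * \<beta> (t - s)) * (k l * cnj (e l z))) (\<lambda>t. of_real (\<alpha> s * \<beta>' (t - s)) * (k l * cnj (e l z)))"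
      \<comment> \<open>For s < a the factor \<open>\<alpha> s\<close> is zero, so the support may
        be taken to begin at \<open>max s a\<close>, which is positive.\<close>
      proof (rule C1cI[where a="max s a" and b="s + c"])
        show "((\<lambda>t. of_real (\<alpha> s * \<beta> (t - s)) * (k l * cnj (e l z))) has_vector_derivative of_real (\<alpha> s * \<beta>' (t - s)) * (k l * cnj (e l z))) (at t)" for t
          by (intro has_vector_derivative_mult_left bounded_linear.has_vector_derivative[OF bounded_linear_of_real]
              has_vector_derivative_mult_right 1)
        show "continuous_on UNIV (\<lambda>t. complex_of_real (\<alpha> s * \<beta>' (t - s)) * (k l * cnj (e l z)))"
          by (intro continuous_intros continuous_on_compose2[OF \<beta>(2)]) auto
        fix t assume "t \<notin> {max s a..s + c}"
        then show "complex_of_real (\<alpha> s * \<beta> (t - s)) * (k l * cnj (e l z)) = 0"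
          using \<beta>s[of "t - s"] ab(2)[of s] by (cases "a \<le> s") auto
      qed (use ab in auto)
    next
      fix t y assume y: "y \<in> space m"
      have "0 \<le> (\<alpha> s * \<beta> (t - s)) * \<kappa> y z" using \<alpha>(2) \<beta>(3) Keq(2)[OF y z] by simp
      also have "\<dots> = Re (\<Sum>l\<in>S. of_real (\<alpha> s * \<beta> (t - s)) * (k l * cnj (e l z)) * e l y)"
        unfolding w_sum[OF y z, symmetric] w_def by (intro arg_cong[of _ _ Re] sum.cong) (auto simp: mult_ac)
      finally show "0 \<le> Re (\<Sum>l\<in>S. of_real (\<alpha> s * \<beta> (t - s)) * (k l * cnj (e l z)) * e l y)" .
    qed
    also have "\<dots> = (\<integral>p. I1 p q \<partial>?P)"
    proof (rule Bochner_Integration.integral_cong[OF refl])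
      fix p :: "real \<times> 'a" assume "p \<in> space ?P"
      then obtain t y where p: "p = (t, y)" and y: "y \<in> space m" by (cases p) (auto simp: space_pair_measure)
      have 1: "Re (\<Sum>l\<in>S. (of_real (\<alpha> s * \<beta>' (t - s)) * (k l * cnj (e l z))) * e l y) = (\<alpha> s * \<beta>' (t - s)) * \<kappa> y z"
        unfolding w_sum[OF y z, symmetric] w_def by (intro arg_cong[of _ _ Re] sum.cong) (auto simp: mult_ac)
      have 2: "Re (\<Sum>l\<in>S. 2 * of_real pi * \<i> * (of_real (\<alpha> s * \<beta> (t - s)) * (k l * cnj (e l z))) * e l y * of_real (l \<bullet> (\<phi> (u (t, y)) - \<phi> (u q))))
        = (\<alpha> s * \<beta> (t - s)) * V p q"
      proof -
        have "(\<Sum>l\<in>S. 2 * of_real pi * \<i> * (of_real (\<alpha> s * \<beta> (t - s)) * (k l * cnj (e l z))) * e l y * of_real (l \<bullet> (\<phi> (u (t, y)) - \<phi> (u q))))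
          = of_real (\<alpha> s * \<beta> (t - s)) * (\<Sum>l\<in>S. 2 * of_real pi * \<i> * w l (snd p) (snd q) * of_real (l \<bullet> (\<phi> (u p) - \<phi> (u q))))"
          unfolding sum_distrib_left p qq w_def by (intro sum.cong) (auto simp: mult_ac)
        then show ?thesis unfolding V_def by simp
      qed
      show "(case p of (t, y) \<Rightarrow> \<bar>u (t, y) - u q\<bar> * Re (\<Sum>l\<in>S. (of_real (\<alpha> s * \<beta>' (t - s)) * (k l * cnj (e l z))) * e l y) +
          sgn (u (t, y) - u q) * Re (\<Sum>l\<in>S. 2 * of_real pi * \<i> * (of_real (\<alpha> s * \<beta> (t - s)) * (k l * cnj (e l z))) * e l y * of_real (l \<bullet> (\<phi> (u (t, y)) - \<phi> (u q)))))
        = I1 p q"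
        unfolding I1_def p prod.case 1 2[unfolded p] by (simp add: qq)
    qed
    finally show ?thesis .
  qed
  have ineq2: "0 \<le> (\<integral>q. I2 p q \<partial>?P)" if p: "p \<in> space ?P" for p
  proof -
    obtain t y where pp: "p = (t, y)" and y: "y \<in> space m" using p by (cases p) (auto simp: space_pair_measure)
    \<comment> \<open>Being real, \<kappa> equals the conjugate of its expansion, which is a
      polynomial in z with coefficients \<open>cnj (k l * e l y)\<close>.\<close>
    have "0 \<le> (\<integral>(s, z). \<bar>u (s, z) - u p\<bar> * Re (\<Sum>l\<in>S. (of_real (\<alpha>' s * \<beta> (t - s) - \<alpha> s * \<beta>' (t - s)) * cnj (k l * e l y)) * e l z) +
          sgn (u (s, z) - u p) * Re (\<Sum>l\<in>S. 2 * of_real pi * \<i> * (of_real (\<alpha> s * \<beta> (t - s)) * cnj (k l * e l y)) * e l z * of_real (l \<bullet> (\<phi> (u (s, z)) - \<phi> (u p))))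
          \<partial>?P)"
    proof (rule entropy[OF Sf])
      fix l assume "l \<in> S"
      have 1: "((\<lambda>s. \<beta> (t - s)) has_vector_derivative - \<beta>' (t - s)) (at s)" for s
      proof -
        have "((\<lambda>s. t - s) has_vector_derivative - 1) (at s)" by (auto intro!: derivative_eq_intros)
        from vector_diff_chain_at[OF this \<beta>(1)] show ?thesis by (simp add: comp_def)
      qed
      have 2: "((\<lambda>s. \<alpha> s * \<beta> (t - s)) has_vector_derivative (\<alpha>' s * \<beta> (t - s) - \<alpha> s * \<beta>' (t - s))) (at s)" for s
        using has_vector_derivative_mult[OF der[of s] 1[of s]] by (simp add: algebra_simps)
      show "C1c (\<lambda>s. of_real (\<alpha> s * \<beta> (t - s)) * cnj (k l * e l y)) (\<lambda>s. of_real (\<alpha>' s * \<beta> (t - s) - \<alpha> s * \<beta>' (t - s)) * cnj (k l * e l y))"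
      proof (rule C1cI[where a=a and b=b])
        show "((\<lambda>s. of_real (\<alpha> s * \<beta> (t - s)) * cnj (k l * e l y)) has_vector_derivative of_real (\<alpha>' s * \<beta> (t - s) - \<alpha> s * \<beta>' (t - s)) * cnj (k l * e l y)) (at s)" for s
          by (intro has_vector_derivative_mult_left bounded_linear.has_vector_derivative[OF bounded_linear_of_real] 2)
        show "continuous_on UNIV (\<lambda>s. of_real (\<alpha>' s * \<beta> (t - s) - \<alpha> s * \<beta>' (t - s)) * cnj (k l * e l y))"
          by (intro continuous_intros continuous_on_compose2[OF \<beta>(2)] continuous_on_compose2[OF c\<beta>] cc c') auto
      qed (use ab in auto)
    next
      fix s z assume z: "z \<in> space m"
      have "0 \<le> (\<alpha> s * \<beta> (t - s)) * \<kappa> y z" using \<alpha>(2) \<beta>(3) Keq(2)[OF y z] by simp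
      also have "\<dots> = Re (cnj (\<Sum>l\<in>S. of_real (\<alpha> s * \<beta> (t - s)) * w l y z))" unfolding w_sum[OF y z, symmetric] by simp
      also have "\<dots> = Re (\<Sum>l\<in>S. of_real (\<alpha> s * \<beta> (t - s)) * cnj (k l * e l y) * e l z)"
        unfolding w_def cnj_sum by (intro arg_cong[of _ _ Re] sum.cong) (auto simp: mult_ac)
      finally show "0 \<le> Re (\<Sum>l\<in>S. of_real (\<alpha> s * \<beta> (t - s)) * cnj (k l * e l y) * e l z)" .
    qed
    also have "\<dots> = (\<integral>q. I2 p q \<partial>?P)"
    proof (rule Bochner_Integration.integral_cong[OF refl])
      fix q :: "real \<times> 'a" assume "q \<in> space ?P"
      then obtain s z where q: "q = (s, z)" and z: "z \<in> space m" by (cases q) (auto simp: space_pair_measure)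
      have 1: "Re (\<Sum>l\<in>S. (of_real r * cnj (k l * e l y)) * e l z) = r * \<kappa> y z" for r
      proof -
        have "Re (\<Sum>l\<in>S. (of_real r * cnj (k l * e l y)) * e l z) = Re (cnj (\<Sum>l\<in>S. of_real r * w l y z))"
          unfolding w_def cnj_sum by (intro arg_cong[of _ _ Re] sum.cong) (auto simp: mult_ac)
        then show ?thesis unfolding w_sum[OF y z, symmetric] by simp
      qed
      have 2: "Re (\<Sum>l\<in>S. 2 * of_real pi * \<i> * (of_real (\<alpha> s * \<beta> (t - s)) * cnj (k l * e l y)) * e l z * of_real (l \<bullet> (\<phi> (u (s, z)) - \<phi> (u p))))
        = (\<alpha> s * \<beta> (t - s)) * V p q"
      proof -
        have "(\<Sum>l\<in>S. 2 * of_real pi * \<i> * (of_real (\<alpha> s * \<beta> (t - s)) * cnj (k l * e l y)) * e l z * of_real (l \<bullet> (\<phi> (u (s, z)) - \<phi> (u p))))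
          = cnj (of_real (\<alpha> s * \<beta> (t - s)) * (\<Sum>l\<in>S. 2 * of_real pi * \<i> * w l (snd p) (snd q) * of_real (l \<bullet> (\<phi> (u p) - \<phi> (u q)))))"
          unfolding sum_distrib_left cnj_sum pp q w_def by (intro sum.cong) (auto simp: mult_ac inner_diff_right algebra_simps)
        then show ?thesis unfolding V_def by simp
      qed
      show "(case q of (s, z) \<Rightarrow> \<bar>u (s, z) - u p\<bar> * Re (\<Sum>l\<in>S. (of_real (\<alpha>' s * \<beta> (t - s) - \<alpha> s * \<beta>' (t - s)) * cnj (k l * e l y)) * e l z) +
          sgn (u (s, z) - u p) * Re (\<Sum>l\<in>S. 2 * of_real pi * \<i> * (of_real (\<alpha> s * \<beta> (t - s)) * cnj (k l * e l y)) * e l z * of_real (l \<bullet> (\<phi> (u (s, z)) - \<phi> (u p)))))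
        = I2 p q"
        unfolding I2_def q prod.case 1 2[unfolded q] using sgn_minus[of "u p - u (s, z)"] by (simp add: pp abs_minus_commute)
    qed
    finally show ?thesis .
  qed
  have Kc: "(\<lambda>x. \<kappa> (f x) (g x)) \<in> borel_measurable N" if "f \<in> measurable N m" "g \<in> measurable N m" for f g and N :: "'z measure"
    using measurable_compose[OF measurable_Pair[OF that] kernel_measurable(1)[OF K]] by simp
  have Kc2[measurable]: "(\<lambda>x. \<kappa> (snd (fst x)) (snd (snd x))) \<in> borel_measurable (?P \<Otimes>\<^sub>M ?P)"
    by (rule Kc) measurable
  have Vm[measurable]: "(\<lambda>x. V (fst x) (snd x)) \<in> borel_measurable (?P \<Otimes>\<^sub>M ?P)"
    unfolding V_def w_def by measurable
  have bdu: "\<bar>u p - u q\<bar> \<le> 2 * R" for p q using u_bound[of p] u_bound[of q] by linarith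
  have "\<exists>BV. 0 \<le> BV \<and> (\<forall>t y s z. y \<in> space m \<longrightarrow> z \<in> space m \<longrightarrow> \<bar>V (t, y) (s, z)\<bar> \<le> BV)"
  proof -
    have "bdd_fun (\<lambda>w. norm (\<phi> w))" by (intro bdd_fun_continuous continuous_intros phi_cont)
    then obtain L where L: "0 \<le> L" "\<And>p. \<bar>norm (\<phi> (u p))\<bar> \<le> L" using bdd_funE by blast
    have "\<bar>V (t, y) (s, z)\<bar> \<le> (\<Sum>l\<in>S. 2 * pi * norm (k l) * (norm l * (2 * L)))" if "y \<in> space m" "z \<in> space m" for t y s z
    proof -
      have "\<bar>V (t, y) (s, z)\<bar> \<le> norm (\<Sum>l\<in>S. 2 * of_real pi * \<i> * w l y z * of_real (l \<bullet> (\<phi> (u (t, y)) - \<phi> (u (s, z)))))"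
        unfolding V_def snd_conv by (rule abs_Re_le_cmod)
      also have "\<dots> \<le> (\<Sum>l\<in>S. norm (2 * of_real pi * \<i> * w l y z * of_real (l \<bullet> (\<phi> (u (t, y)) - \<phi> (u (s, z))))))" by (rule norm_sum)
      also have "\<dots> \<le> (\<Sum>l\<in>S. 2 * pi * norm (k l) * (norm l * (2 * L)))"
      proof (rule sum_mono)
        fix l
        have "norm (2 * of_real pi * \<i> * w l y z * of_real (l \<bullet> (\<phi> (u (t, y)) - \<phi> (u (s, z)))))
          = 2 * pi * norm (k l) * \<bar>l \<bullet> (\<phi> (u (t, y)) - \<phi> (u (s, z)))\<bar>"
          using e_norm that by (simp add: norm_mult w_def)
        also have "\<dots> \<le> 2 * pi * norm (k l) * (norm l * (2 * L))"
        proof (rule mult_left_mono)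
          have "\<bar>l \<bullet> (\<phi> (u (t, y)) - \<phi> (u (s, z)))\<bar> \<le> norm l * norm (\<phi> (u (t, y)) - \<phi> (u (s, z)))" by (rule Cauchy_Schwarz_ineq2)
          also have "\<dots> \<le> norm l * (2 * L)"
            using norm_triangle_ineq4[of "\<phi> (u (t, y))" "\<phi> (u (s, z))"] L(2)[of "(t, y)"] L(2)[of "(s, z)"] by (intro mult_left_mono) auto
          finally show "\<bar>l \<bullet> (\<phi> (u (t, y)) - \<phi> (u (s, z)))\<bar> \<le> norm l * (2 * L)" .
        qed auto
        finally show "norm (2 * of_real pi * \<i> * w l y z * of_real (l \<bullet> (\<phi> (u (t, y)) - \<phi> (u (s, z))))) \<le> 2 * pi * norm (k l) * (norm l * (2 * L))" .
      qed
      finally show ?thesis .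
    qed
    moreover have "0 \<le> (\<Sum>l\<in>S. 2 * pi * norm (k l) * (norm l * (2 * L)))" using L by (intro sum_nonneg) auto
    ultimately show ?thesis by blast
  qed
  then obtain BV where BV: "0 \<le> BV" "\<And>t y s z. y \<in> space m \<Longrightarrow> z \<in> space m \<Longrightarrow> \<bar>V (t, y) (s, z)\<bar> \<le> BV" by blast
  \<comment> \<open>From s in [a, b] and t - s in [0, c] follows t in [a, b + c]; with absolute
    values one interval serves both time variables.\<close>
  let ?b = "\<bar>b\<bar> + \<bar>c\<bar>"
  have supp: "\<alpha> s * \<beta> (t - s) = 0" "\<alpha> s * \<beta>' (t - s) = 0" "\<alpha>' s * \<beta> (t - s) = 0" if "t \<notin> {a..?b} \<or> s \<notin> {a..?b}" for s t
  proof -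
    have "s \<notin> {a..b} \<or> t - s \<notin> {0..c}" using that by auto
    then show "\<alpha> s * \<beta> (t - s) = 0" "\<alpha> s * \<beta>' (t - s) = 0" "\<alpha>' s * \<beta> (t - s) = 0"
      using ab(2)[of s] ab'[of s] \<beta>s[of "t - s"] \<beta>s'[of "t - s"] by auto
  qed
  have bsgn: "\<bar>sgn (x::real)\<bar> \<le> 1" for x by (simp add: sgn_if)
  have int1: "integrable (?P \<Otimes>\<^sub>M ?P) (\<lambda>x. I1 (fst x) (snd x))"
  proof (rule double_integrable[where a=a and b="?b" and B="2 * R * (A * D' * BK) + 1 * (A * D * BV)"])
    show "(\<lambda>x. I1 (fst x) (snd x)) \<in> borel_measurable (?P \<Otimes>\<^sub>M ?P)" unfolding I1_def by measurable
    fix t y s z assume yz: "y \<in> space m" "z \<in> space m"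
    have "\<bar>\<bar>u (t,y) - u (s,z)\<bar> * (\<alpha> s * \<beta>' (t - s) * \<kappa> y z)\<bar> \<le> 2 * R * (A * D' * BK)"
      unfolding abs_mult using bdu[of "(t,y)" "(s,z)"] A(2)[of s] D'(2)[of "t - s"] BK(2)[OF yz] R_pos A(1) D'(1)
      by (intro mult_mono) auto
    moreover have "\<bar>sgn (u (t,y) - u (s,z)) * (\<alpha> s * \<beta> (t - s) * V (t,y) (s,z))\<bar> \<le> 1 * (A * D * BV)"
      unfolding abs_mult using bsgn A(2)[of s] D(2)[of "t - s"] BV(2)[OF yz] A(1) D(1) BV(1)
      by (intro mult_mono) auto
    ultimately show "\<bar>I1 (fst ((t, y), (s, z))) (snd ((t, y), (s, z)))\<bar> \<le> 2 * R * (A * D' * BK) + 1 * (A * D * BV)"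
      unfolding I1_def fst_conv snd_conv by (intro order.trans[OF abs_triangle_ineq] add_mono)
  next
    fix t y s z assume "t \<notin> {a..?b} \<or> s \<notin> {a..?b}"
    from supp[OF this] show "I1 (fst ((t, y), (s, z))) (snd ((t, y), (s, z))) = 0"
      by (simp only: I1_def fst_conv snd_conv mult_zero_left mult_zero_right add_0_left)
  qed
  have int2: "integrable (?P \<Otimes>\<^sub>M ?P) (\<lambda>x. I2 (fst x) (snd x))"
  proof (rule double_integrable[where a=a and b="?b" and B="2 * R * ((A' * D + A * D') * BK) + 1 * (A * D * BV)"])
    show "(\<lambda>x. I2 (fst x) (snd x)) \<in> borel_measurable (?P \<Otimes>\<^sub>M ?P)" unfolding I2_def by measurable
    fix t y s z assume yz: "y \<in> space m" "z \<in> space m"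
    have 0: "\<bar>\<alpha>' s * \<beta> (t - s) - \<alpha> s * \<beta>' (t - s)\<bar> \<le> A' * D + A * D'"
      using A(2)[of s] A'(2)[of s] D'(2)[of "t - s"] D(2)[of "t - s"] A(1) A'(1) D(1) D'(1)
      by (intro order.trans[OF abs_triangle_ineq4] add_mono) (auto simp: abs_mult intro!: mult_mono)
    have "\<bar>\<bar>u (t,y) - u (s,z)\<bar> * ((\<alpha>' s * \<beta> (t - s) - \<alpha> s * \<beta>' (t - s)) * \<kappa> y z)\<bar> \<le> 2 * R * ((A' * D + A * D') * BK)"
      unfolding abs_mult[of "\<bar>_\<bar>"] abs_mult[of "_ - _"] using bdu[of "(t,y)" "(s,z)"] 0 BK(2)[OF yz] R_pos A(1) A'(1) D(1) D'(1)
      by (intro mult_mono) auto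
    moreover have "\<bar>sgn (u (t,y) - u (s,z)) * (\<alpha> s * \<beta> (t - s) * V (t,y) (s,z))\<bar> \<le> 1 * (A * D * BV)"
      unfolding abs_mult using bsgn A(2)[of s] D(2)[of "t - s"] BV(2)[OF yz] A(1) D(1) BV(1)
      by (intro mult_mono) auto
    ultimately show "\<bar>I2 (fst ((t, y), (s, z))) (snd ((t, y), (s, z)))\<bar> \<le> 2 * R * ((A' * D + A * D') * BK) + 1 * (A * D * BV)"
      unfolding I2_def fst_conv snd_conv by (intro order.trans[OF abs_triangle_ineq4] add_mono)
  next
    fix t y s z assume "t \<notin> {a..?b} \<or> s \<notin> {a..?b}"
    from supp[OF this] show "I2 (fst ((t, y), (s, z))) (snd ((t, y), (s, z))) = 0"
      by (simp only: I2_def fst_conv snd_conv mult_zero_left mult_zero_right diff_zero)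
  qed
  have sum: "I1 p q + I2 p q = \<alpha>' (fst q) * (\<beta> (fst p - fst q) * (\<kappa> (snd p) (snd q) * \<bar>u p - u q\<bar>))" for p q
    unfolding I1_def I2_def by (simp add: algebra_simps)
  have "0 \<le> (\<integral>x. I1 (fst x) (snd x) \<partial>(?P \<Otimes>\<^sub>M ?P))"
  proof -
    have "(\<integral>x. I1 (fst x) (snd x) \<partial>(?P \<Otimes>\<^sub>M ?P)) = (\<integral>q. \<integral>p. I1 p q \<partial>?P \<partial>?P)"
      using PP.integral_snd[of I1] int1 by (simp add: split_beta')
    then show ?thesis using ineq1 by (simp add: Bochner_Integration.integral_nonneg)
  qed
  moreover have "0 \<le> (\<integral>x. I2 (fst x) (snd x) \<partial>(?P \<Otimes>\<^sub>M ?P))"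
  proof -
    have "(\<integral>x. I2 (fst x) (snd x) \<partial>(?P \<Otimes>\<^sub>M ?P)) = (\<integral>p. \<integral>q. I2 p q \<partial>?P \<partial>?P)"
      using PP.integral_fst'[OF int2] by simp
    then show ?thesis using ineq2 by (simp add: Bochner_Integration.integral_nonneg)
  qed
  ultimately have "0 \<le> (\<integral>x. I1 (fst x) (snd x) + I2 (fst x) (snd x) \<partial>(?P \<Otimes>\<^sub>M ?P))"
    using int1 int2 by simp
  also have "\<dots> = (\<integral>q. \<integral>p. I1 p q + I2 p q \<partial>?P \<partial>?P)"
    using PP.integral_snd[of "\<lambda>p q. I1 p q + I2 p q"] Bochner_Integration.integrable_add[OF int1 int2] by (simp add: split_beta')
  also have "\<dots> = (\<integral>s. \<integral>z. (\<integral>p. I1 p (s, z) + I2 p (s, z) \<partial>?P) \<partial>m \<partial>lborel)"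
  proof (rule slab_integral)
    show "integrable ?P (\<lambda>q. \<integral>p. I1 p q + I2 p q \<partial>?P)"
      using PP.integrable_snd[of "\<lambda>p q. I1 p q + I2 p q"] Bochner_Integration.integrable_add[OF int1 int2] by (simp add: split_beta')
  qed
  also have "\<dots> = (\<integral>s. \<alpha>' s * (\<integral>t. \<beta> (t - s) * dd \<kappa> t s \<partial>lborel) \<partial>lborel)"
  proof (rule Bochner_Integration.integral_cong[OF refl])
    fix s :: real
    define H where "H z t = \<beta> (t - s) * (\<integral>y. \<kappa> y z * \<bar>u (t, y) - u (s, z)\<bar> \<partial>m)" for z t
    have 1: "(\<integral>p. I1 p (s, z) + I2 p (s, z) \<partial>?P) = \<alpha>' s * (\<integral>t. H z t \<partial>lborel)" if z: "z \<in> space m" for z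
    proof -
      note [measurable] = kernel_measurable(2)[OF K z]
      have "(\<integral>p. I1 p (s, z) + I2 p (s, z) \<partial>?P) = (\<integral>p. \<alpha>' s * (\<beta> (fst p - s) * (\<kappa> (snd p) z * \<bar>u p - u (s, z)\<bar>)) \<partial>?P)"
        unfolding sum by simp
      also have "\<dots> = (\<integral>t. \<integral>y. \<alpha>' s * (\<beta> (t - s) * (\<kappa> y z * \<bar>u (t, y) - u (s, z)\<bar>)) \<partial>m \<partial>lborel)"
      proof (subst slab_integral[OF integrable_slab[where a=s and b="s + c" and B="A' * (D * (BK * (2 * R)))"]])
        fix t y assume y: "y \<in> space m"
        show "norm (\<alpha>' s * (\<beta> (fst (t, y) - s) * (\<kappa> (snd (t, y)) z * \<bar>u (t, y) - u (s, z)\<bar>))) \<le> A' * (D * (BK * (2 * R)))"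
          unfolding fst_conv snd_conv real_norm_def abs_mult
          using A' D BK(2)[OF y z] BK(1) bdu R_pos by (intro mult_mono) auto
      qed (use \<beta>s in auto)
      also have "\<dots> = (\<integral>t. \<alpha>' s * H z t \<partial>lborel)"
        unfolding H_def by simp
      also have "\<dots> = \<alpha>' s * (\<integral>t. H z t \<partial>lborel)" by simp
      finally show ?thesis .
    qed
    have Hm: "(\<lambda>(t, z). H z t) \<in> borel_measurable (lborel \<Otimes>\<^sub>M m)"
    proof -
      have "(\<lambda>(q, y). \<kappa> y (snd q) * \<bar>u (fst q, y) - u (s, snd q)\<bar>) \<in> borel_measurable (?P \<Otimes>\<^sub>M m)"
        unfolding split_beta by (intro borel_measurable_times Kc) measurable
      then have "(\<lambda>q. \<integral>y. \<kappa> y (snd q) * \<bar>u (fst q, y) - u (s, snd q)\<bar> \<partial>m) \<in> borel_measurable ?P"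
        by (rule borel_measurable_lebesgue_integral)
      then show ?thesis unfolding H_def split_beta by measurable
    qed
    have inner: "\<bar>\<integral>y. \<kappa> y z * \<bar>u (t, y) - u (s, z)\<bar> \<partial>m\<bar> \<le> BK * (2 * R)" if z: "z \<in> space m" for t z
    proof -
      note [measurable] = kernel_measurable(2)[OF K z]
      have "norm (\<integral>y. \<kappa> y z * \<bar>u (t, y) - u (s, z)\<bar> \<partial>m) \<le> BK * (2 * R)"
        by (rule norm_integral_le) (use BK z bdu in \<open>auto simp: abs_mult intro!: mult_mono\<close>)
      then show ?thesis by simp
    qed
    have Hi: "integrable (lborel \<Otimes>\<^sub>M m) (\<lambda>(t, z). H z t)"
    proof (rule integrable_slab[OF Hm, where a=s and b="s + c" and B="D * (BK * (2 * R))"])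
      fix t z assume z: "z \<in> space m"
      show "norm (case (t, z) of (t, z) \<Rightarrow> H z t) \<le> D * (BK * (2 * R))"
        unfolding H_def prod.case real_norm_def abs_mult using D inner[OF z] by (intro mult_mono) auto
    qed (use \<beta>s in \<open>auto simp: H_def\<close>)
    have "(\<integral>z. (\<integral>p. I1 p (s, z) + I2 p (s, z) \<partial>?P) \<partial>m) = (\<integral>z. \<alpha>' s * (\<integral>t. H z t \<partial>lborel) \<partial>m)"
      by (intro Bochner_Integration.integral_cong refl 1)
    also have "\<dots> = \<alpha>' s * (\<integral>z. (\<integral>t. H z t \<partial>lborel) \<partial>m)" by simp
    also have "(\<integral>z. (\<integral>t. H z t \<partial>lborel) \<partial>m) = (\<integral>t. (\<integral>z. H z t \<partial>m) \<partial>lborel)"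
      by (rule slab.Fubini_integral[OF Hi])
    also have "\<dots> = (\<integral>t. \<beta> (t - s) * dd \<kappa> t s \<partial>lborel)" unfolding H_def dd_def by simp
    finally show "(\<integral>z. (\<integral>p. I1 p (s, z) + I2 p (s, z) \<partial>?P) \<partial>m) = \<alpha>' s * (\<integral>t. \<beta> (t - s) * dd \<kappa> t s \<partial>lborel)" .
  qed
  finally show ?thesis .
qed

end

section \<open>Contraction in time and convolution with the kernel\<close>

context trig_entropy
begin

text \<open>Doubling is fed into \<open>ess_decreasing\<close>; it is the average over t - s that
  becomes monotone in s.\<close>

lemma contraction_average:
  assumes K: "kernel_on S \<kappa> k"
    and \<beta>: "\<And>t. (\<beta> has_vector_derivative \<beta>' t) (at t)" "continuous_on UNIV \<beta>'" "\<And>t. 0 \<le> \<beta> t" "\<And>t. t \<notin> {0<..<c} \<Longrightarrow> \<beta> t = (0::real)"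
  defines "G \<equiv> \<lambda>s. \<integral>t. \<beta> (t - s) * dd \<kappa> t s \<partial>lborel"
  shows "\<exists>N\<in>null_sets lborel. \<forall>s t. 0 < s \<longrightarrow> s < t \<longrightarrow> s \<notin> N \<longrightarrow> t \<notin> N \<longrightarrow> G t \<le> G s"
    and "integrable lborel (\<lambda>t. \<beta> (t - s) * dd \<kappa> t s)"
proof -
  have c\<beta>: "continuous_on UNIV \<beta>" using \<beta>(1) has_vector_derivative_continuous
    by (metis continuous_at_imp_continuous_on)
  have \<beta>s: "\<beta> t = 0" if "t \<notin> {0..c}" for t using \<beta>(4)[of t] that by auto
  obtain D where D: "0 < D" "\<And>t. norm (\<beta> t) \<le> D" using bounded_of_support[OF c\<beta> \<beta>s] by blast
  have [measurable]: "\<beta> \<in> borel_measurable borel" using c\<beta> by (rule borel_measurable_continuous_onI)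
  note ddm[measurable] = dd_measurable[OF K]
  have dds[measurable]: "(\<lambda>t. dd \<kappa> t s) \<in> borel_measurable borel" for s
    using measurable_compose[OF _ ddm, of "\<lambda>t. (t, s)" borel] by simp
  have ddb: "\<bar>dd \<kappa> t s\<bar> \<le> 2 * R" for t s using dd_bounds[OF K, of t s] by simp
  have b: "\<bar>\<beta> (t - s) * dd \<kappa> t s\<bar> \<le> D * (2 * R)" for t s
    using D ddb[of t s] R_pos by (auto simp: abs_mult intro!: mult_mono)
  have int: "integrable lborel (\<lambda>t. \<beta> (t - s) * dd \<kappa> t s)" for s
    by (rule integrable_bounded_support[where B="D * (2 * R)" and a=s and b="s + c"])
       (use b \<beta>s in auto)
  then show "integrable lborel (\<lambda>t. \<beta> (t - s) * dd \<kappa> t s)" .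
  show "\<exists>N\<in>null_sets lborel. \<forall>s t. 0 < s \<longrightarrow> s < t \<longrightarrow> s \<notin> N \<longrightarrow> t \<notin> N \<longrightarrow> G t \<le> G s"
  proof (rule ess_decreasing)
    have "(\<lambda>(s, t). \<beta> (t - s) * dd \<kappa> t s) \<in> borel_measurable (borel \<Otimes>\<^sub>M lborel)"
    proof -
      have "(\<lambda>p. dd \<kappa> (snd p) (fst p)) \<in> borel_measurable (borel \<Otimes>\<^sub>M lborel)"
        using measurable_compose[OF _ ddm, of "\<lambda>p. (snd p, fst p)" "borel \<Otimes>\<^sub>M lborel"] by simp
      then show ?thesis unfolding split_beta by measurable
    qed
    then show "G \<in> borel_measurable borel" unfolding G_def
      by (rule lborel.borel_measurable_lebesgue_integral)
    have "\<bar>G s\<bar> \<le> D * (2 * R) * \<bar>c\<bar>" for s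
    proof (cases "c \<le> 0")
      case True
      then have "\<beta> t = 0" for t using \<beta>(4)[of t] by auto
      then show ?thesis using D R_pos by (simp add: G_def)
    next
      case False
      have "norm (G s) \<le> (\<integral>t. (D * (2 * R)) * indicator {s<..s+c} t \<partial>lborel)"
        unfolding G_def
      proof (rule norm_integral_le_integral[OF int])
        show "integrable lborel (\<lambda>t. (D * (2 * R)) * indicator {s<..s+c} t)"
          using False by (intro integrable_mult_right integrable_real_indicator) auto
        fix t
        show "norm (\<beta> (t - s) * dd \<kappa> t s) \<le> (D * (2 * R)) * indicator {s<..s+c} t"
          using b[of t s] \<beta>(4)[of "t - s"] by (auto simp: indicator_def)
      qed
      also have "\<dots> = D * (2 * R) * \<bar>c\<bar>" using False unfolding integral_mult_right_zero by simp
      finally show ?thesis by simp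
    qed
    then show "\<exists>B. \<forall>t\<in>{0<..<T}. \<bar>G t\<bar> \<le> B" for T by blast
    fix \<alpha> \<alpha>' :: "real \<Rightarrow> real" assume "C1c \<alpha> \<alpha>'" "\<And>t. 0 \<le> \<alpha> t"
    from doubling[OF K \<beta> this] show "0 \<le> (\<integral>t. \<alpha>' t * G t \<partial>lborel)" unfolding G_def .
  qed
qed

text \<open>As \<kappa> has mass one in z, the difference of f(y) and the convolution is the average
  of f(y) - g(z) with weight \<kappa>.\<close>

lemma kernel_convolution_close:
  assumes K: "kernel_on S \<kappa> k" and [measurable]: "f \<in> borel_measurable m" "g \<in> borel_measurable m"
    and b: "\<And>y. \<bar>f y\<bar> \<le> B" "\<And>y. \<bar>g y\<bar> \<le> B"
  shows "(\<integral>y. \<bar>f y - (\<integral>z. \<kappa> y z * g z \<partial>m)\<bar> \<partial>m) \<le> (\<integral>z. \<integral>y. \<kappa> y z * \<bar>f y - g z\<bar> \<partial>m \<partial>m)"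
proof -
  obtain BK where BK: "0 \<le> BK" "\<And>y z. y \<in> space m \<Longrightarrow> z \<in> space m \<Longrightarrow> 0 \<le> \<kappa> y z \<and> \<kappa> y z \<le> BK"
    using kernel_bounded[OF K] by blast
  have B: "0 \<le> B" using b(1)[of undefined] by linarith
  note [measurable] = kernel_measurable(1)[OF K]
  have d: "\<bar>f y - g z\<bar> \<le> 2 * B" for y z using b(1)[of y] b(2)[of z] by linarith
  have nb: "norm (\<kappa> y z * \<bar>f y - g z\<bar>) \<le> BK * (2 * B)" if "y \<in> space m" "z \<in> space m" for y z
    using BK(2)[OF that] BK(1) d by (auto simp: abs_mult intro!: mult_mono)
  have meas: "(\<lambda>(y, z). \<kappa> y z * \<bar>f y - g z\<bar>) \<in> borel_measurable (m \<Otimes>\<^sub>M m)" unfolding split_beta by measurable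
  have "(\<integral>z. \<integral>y. \<kappa> y z * \<bar>f y - g z\<bar> \<partial>m \<partial>m) = (\<integral>y. \<integral>z. \<kappa> y z * \<bar>f y - g z\<bar> \<partial>m \<partial>m)"
    by (rule square_swap[OF meas nb])
  moreover have "(\<integral>y. \<bar>f y - (\<integral>z. \<kappa> y z * g z \<partial>m)\<bar> \<partial>m) \<le> (\<integral>y. \<integral>z. \<kappa> y z * \<bar>f y - g z\<bar> \<partial>m \<partial>m)"
  proof (rule integral_mono_bdd[where B="B + BK * B" and D="BK * (2 * B)"])
    have "(\<lambda>(y, z). \<kappa> y z * g z) \<in> borel_measurable (m \<Otimes>\<^sub>M m)" unfolding split_beta by measurable
    then have [measurable]: "(\<lambda>y. \<integral>z. \<kappa> y z * g z \<partial>m) \<in> borel_measurable m" by (rule borel_measurable_lebesgue_integral)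
    show "(\<lambda>y. \<bar>f y - (\<integral>z. \<kappa> y z * g z \<partial>m)\<bar>) \<in> borel_measurable m" by measurable
    show "(\<lambda>y. \<integral>z. \<kappa> y z * \<bar>f y - g z\<bar> \<partial>m) \<in> borel_measurable m" using meas by (rule borel_measurable_lebesgue_integral)
    fix y assume y: "y \<in> space m"
    note [measurable] = kernel_measurable(3)[OF K y]
    have 1: "norm (\<integral>z. \<kappa> y z * g z \<partial>m) \<le> BK * B"
      by (rule norm_integral_le) (use BK y b in \<open>auto simp: abs_mult intro!: mult_mono\<close>)
    show "\<bar>\<bar>f y - (\<integral>z. \<kappa> y z * g z \<partial>m)\<bar>\<bar> \<le> B + BK * B" using 1 b(1)[of y] unfolding real_norm_def by linarith
    have "norm (\<integral>z. \<kappa> y z * \<bar>f y - g z\<bar> \<partial>m) \<le> BK * (2 * B)"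
      by (rule norm_integral_le) (use nb y in auto)
    then show "\<bar>\<integral>z. \<kappa> y z * \<bar>f y - g z\<bar> \<partial>m\<bar> \<le> BK * (2 * B)" by simp
    have i1: "integrable m (\<lambda>z. \<kappa> y z)" by (rule integrable_bdd[where B=BK]) (use BK y in auto)
    have i2: "integrable m (\<lambda>z. \<kappa> y z * g z)"
      by (rule integrable_bdd[where B="BK * B"]) (use BK y b in \<open>auto simp: abs_mult intro!: mult_mono\<close>)
    have "f y - (\<integral>z. \<kappa> y z * g z \<partial>m) = (\<integral>z. \<kappa> y z * (f y - g z) \<partial>m)"
    proof -
      have "(\<integral>z. \<kappa> y z * (f y - g z) \<partial>m) = (\<integral>z. \<kappa> y z * f y - \<kappa> y z * g z \<partial>m)" by (simp add: right_diff_distrib)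
      also have "\<dots> = (\<integral>z. \<kappa> y z * f y \<partial>m) - (\<integral>z. \<kappa> y z * g z \<partial>m)" using i1 i2 by (intro Bochner_Integration.integral_diff) auto
      also have "(\<integral>z. \<kappa> y z * f y \<partial>m) = f y" using K y by (simp add: kernel_on_def)
      finally show ?thesis by simp
    qed
    also have "\<bar>\<dots>\<bar> \<le> (\<integral>z. \<bar>\<kappa> y z * (f y - g z)\<bar> \<partial>m)" by (rule integral_abs_bound)
    also have "\<dots> = (\<integral>z. \<kappa> y z * \<bar>f y - g z\<bar> \<partial>m)"
      using BK y by (intro Bochner_Integration.integral_cong) (auto simp: abs_mult)
    finally show "\<bar>f y - (\<integral>z. \<kappa> y z * g z \<partial>m)\<bar> \<le> (\<integral>z. \<kappa> y z * \<bar>f y - g z\<bar> \<partial>m)" .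
  qed
  ultimately show ?thesis by simp
qed

text \<open>The triangle inequality under the double integral. In the two terms that depend on one
  variable only, the unit mass of \<kappa> in the other variable removes the kernel.\<close>

lemma kernel_triangle:
  assumes K: "kernel_on S \<kappa> k" and [measurable]: "f \<in> borel_measurable m" "g \<in> borel_measurable m" "f' \<in> borel_measurable m" "g' \<in> borel_measurable m"
    and b: "\<And>y. y \<in> space m \<Longrightarrow> norm (f y) \<le> B" "\<And>y. y \<in> space m \<Longrightarrow> norm (g y) \<le> B"
      "\<And>y. y \<in> space m \<Longrightarrow> norm (f' y) \<le> B" "\<And>y. y \<in> space m \<Longrightarrow> norm (g' y :: 'b::{banach,second_countable_topology}) \<le> B"
  shows "(\<integral>z. \<integral>y. \<kappa> y z * norm (f y - g z) \<partial>m \<partial>m)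
    \<le> (\<integral>y. norm (f y - f' y) \<partial>m) + (\<integral>z. \<integral>y. \<kappa> y z * norm (f' y - g' z) \<partial>m \<partial>m) + (\<integral>z. norm (g z - g' z) \<partial>m)"
proof -
  obtain BK where BK: "0 \<le> BK" "\<And>y z. y \<in> space m \<Longrightarrow> z \<in> space m \<Longrightarrow> 0 \<le> \<kappa> y z \<and> \<kappa> y z \<le> BK"
    using kernel_bounded[OF K] by blast
  note [measurable] = kernel_measurable(1)[OF K]
  have tot1: "(\<integral>z. \<kappa> y z \<partial>m) = 1" if "y \<in> space m" for y using K that by (simp add: kernel_on_def)
  have tot2: "(\<integral>y. \<kappa> y z \<partial>m) = 1" if "z \<in> space m" for z using K that by (simp add: kernel_on_def)
  define F0 where "F0 y z = \<kappa> y z * norm (f y - g z)" for y z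
  define F1 where "F1 y z = \<kappa> y z * norm (f y - f' y)" for y z
  define F2 where "F2 y z = \<kappa> y z * norm (f' y - g' z)" for y z
  define F3 where "F3 y z = \<kappa> y z * norm (g z - g' z)" for y z
  have mm: "(\<lambda>(y, z). F0 y z) \<in> borel_measurable (m \<Otimes>\<^sub>M m)" "(\<lambda>(y, z). F1 y z) \<in> borel_measurable (m \<Otimes>\<^sub>M m)"
    "(\<lambda>(y, z). F2 y z) \<in> borel_measurable (m \<Otimes>\<^sub>M m)" "(\<lambda>(y, z). F3 y z) \<in> borel_measurable (m \<Otimes>\<^sub>M m)"
    unfolding split_beta F0_def F1_def F2_def F3_def by measurable
  have bb: "norm (\<kappa> y z * norm (v - w)) \<le> BK * (2 * B)" if "y \<in> space m" "z \<in> space m" "norm v \<le> B" "norm w \<le> B" for y z and v w :: 'b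
    using BK(2)[OF that(1,2)] BK(1) norm_triangle_ineq4[of v w] that by (auto simp: abs_mult intro!: mult_mono)
  have b0: "norm (F0 y z) \<le> BK * (2 * B)" and b1: "norm (F1 y z) \<le> BK * (2 * B)"
    and b2: "norm (F2 y z) \<le> BK * (2 * B)" and b3: "norm (F3 y z) \<le> BK * (2 * B)" if "y \<in> space m" "z \<in> space m" for y z
    unfolding F0_def F1_def F2_def F3_def using that b by (auto intro!: bb simp del: real_norm_def)
  have iF: "integrable (m \<Otimes>\<^sub>M m) (\<lambda>(y, z). F0 y z)" "integrable (m \<Otimes>\<^sub>M m) (\<lambda>(y, z). F1 y z)"
    "integrable (m \<Otimes>\<^sub>M m) (\<lambda>(y, z). F2 y z)" "integrable (m \<Otimes>\<^sub>M m) (\<lambda>(y, z). F3 y z)"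
    using mm b0 b1 b2 b3 by (auto intro!: square_integrable[where B="BK * (2 * B)"] simp del: real_norm_def)
  have it: "(\<integral>z. \<integral>y. F y z \<partial>m \<partial>m) = (\<integral>x. (\<lambda>(y, z). F y z) x \<partial>(m \<Otimes>\<^sub>M m))" if "integrable (m \<Otimes>\<^sub>M m) (\<lambda>(y, z). F y z)" for F :: "'a \<Rightarrow> 'a \<Rightarrow> real"
    by (rule square.integral_snd[OF that])
  have "(\<integral>x. (\<lambda>(y, z). F0 y z) x \<partial>(m \<Otimes>\<^sub>M m))
    \<le> (\<integral>x. (\<lambda>(y, z). F1 y z) x + (\<lambda>(y, z). F2 y z) x + (\<lambda>(y, z). F3 y z) x \<partial>(m \<Otimes>\<^sub>M m))"
  proof (rule integral_mono)
    fix x assume "x \<in> space (m \<Otimes>\<^sub>M m)"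
    then obtain y z where x: "x = (y, z)" "y \<in> space m" "z \<in> space m" by (auto simp: space_pair_measure)
    have "norm (f y - g z) \<le> norm (f y - f' y) + norm (f' y - g' z) + norm (g z - g' z)"
      using norm_triangle_ineq[of "f y - f' y" "f' y - g z"] norm_triangle_ineq[of "f' y - g' z" "g' z - g z"]
      by (simp add: norm_minus_commute)
    then have "\<kappa> y z * norm (f y - g z) \<le> \<kappa> y z * (norm (f y - f' y) + norm (f' y - g' z) + norm (g z - g' z))"
      using BK(2)[OF x(2,3)] by (intro mult_left_mono) auto
    then show "(\<lambda>(y, z). F0 y z) x \<le> (\<lambda>(y, z). F1 y z) x + (\<lambda>(y, z). F2 y z) x + (\<lambda>(y, z). F3 y z) x"
      by (simp add: x F0_def F1_def F2_def F3_def distrib_left)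
  qed (use iF in auto)
  also have "\<dots> = (\<integral>x. (\<lambda>(y, z). F1 y z) x \<partial>(m \<Otimes>\<^sub>M m)) + (\<integral>x. (\<lambda>(y, z). F2 y z) x \<partial>(m \<Otimes>\<^sub>M m)) + (\<integral>x. (\<lambda>(y, z). F3 y z) x \<partial>(m \<Otimes>\<^sub>M m))"
    using iF by (simp add: Bochner_Integration.integral_add Bochner_Integration.integrable_add)
  also have "(\<integral>x. (\<lambda>(y, z). F1 y z) x \<partial>(m \<Otimes>\<^sub>M m)) = (\<integral>y. norm (f y - f' y) \<partial>m)"
  proof -
    have "(\<integral>x. (\<lambda>(y, z). F1 y z) x \<partial>(m \<Otimes>\<^sub>M m)) = (\<integral>y. \<integral>z. F1 y z \<partial>m \<partial>m)"
      using square.integral_fst'[OF iF(2)] by simp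
    also have "\<dots> = (\<integral>y. norm (f y - f' y) \<partial>m)"
      by (intro Bochner_Integration.integral_cong refl) (simp add: F1_def tot1)
    finally show ?thesis .
  qed
  also have "(\<integral>x. (\<lambda>(y, z). F3 y z) x \<partial>(m \<Otimes>\<^sub>M m)) = (\<integral>z. norm (g z - g' z) \<partial>m)"
  proof -
    have "(\<integral>x. (\<lambda>(y, z). F3 y z) x \<partial>(m \<Otimes>\<^sub>M m)) = (\<integral>z. \<integral>y. F3 y z \<partial>m \<partial>m)"
      by (rule it[OF iF(4), symmetric])
    also have "\<dots> = (\<integral>z. norm (g z - g' z) \<partial>m)"
      by (intro Bochner_Integration.integral_cong refl) (simp add: F3_def tot2)
    finally show ?thesis .
  qed
  finally show ?thesis using it[OF iF(1)] it[OF iF(3)] unfolding F0_def F2_def by simp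
qed

lemma kernel_trig:
  assumes K: "kernel_on S \<kappa> k" and T: "finite T" "\<And>l. l \<in> T \<Longrightarrow> (\<integral>z. \<integral>y. \<kappa> y z * norm (e l y - e l z) \<partial>m \<partial>m) \<le> \<epsilon>"
  shows "(\<integral>z. \<integral>y. \<kappa> y z * norm ((\<Sum>l\<in>T. a l * e l y) - (\<Sum>l\<in>T. a l * e l z)) \<partial>m \<partial>m) \<le> (\<Sum>l\<in>T. norm (a l)) * \<epsilon>"
proof -
  obtain BK where BK: "0 \<le> BK" "\<And>y z. y \<in> space m \<Longrightarrow> z \<in> space m \<Longrightarrow> 0 \<le> \<kappa> y z \<and> \<kappa> y z \<le> BK"
    using kernel_bounded[OF K] by blast
  note [measurable] = kernel_measurable(1)[OF K]
  define F where "F l y z = \<kappa> y z * norm (e l y - e l z)" for l y z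
  define G where "G y z = \<kappa> y z * norm ((\<Sum>l\<in>T. a l * e l y) - (\<Sum>l\<in>T. a l * e l z))" for y z
  have iF: "integrable (m \<Otimes>\<^sub>M m) (\<lambda>(y, z). F l y z)" for l
  proof (rule square_integrable[where B="BK * 2"])
    show "(\<lambda>(y, z). F l y z) \<in> borel_measurable (m \<Otimes>\<^sub>M m)" unfolding F_def split_beta by measurable
    fix y z assume yz: "y \<in> space m" "z \<in> space m"
    have "norm (e l y - e l z) \<le> 2" using norm_triangle_ineq4[of "e l y" "e l z"] e_norm yz by simp
    then show "norm (case (y, z) of (y, z) \<Rightarrow> F l y z) \<le> BK * 2"
      using BK(2)[OF yz] BK(1) by (auto simp: F_def abs_mult intro!: mult_mono)
  qed
  have pw: "G y z \<le> (\<Sum>l\<in>T. norm (a l) * F l y z)" if "y \<in> space m" "z \<in> space m" for y z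
  proof -
    have "norm ((\<Sum>l\<in>T. a l * e l y) - (\<Sum>l\<in>T. a l * e l z)) = norm (\<Sum>l\<in>T. a l * (e l y - e l z))"
      by (simp add: sum_subtractf right_diff_distrib)
    also have "\<dots> \<le> (\<Sum>l\<in>T. norm (a l * (e l y - e l z)))" by (rule norm_sum)
    finally have "G y z \<le> \<kappa> y z * (\<Sum>l\<in>T. norm (a l * (e l y - e l z)))"
      unfolding G_def using BK(2)[OF that] by (intro mult_left_mono) auto
    also have "\<dots> = (\<Sum>l\<in>T. norm (a l) * F l y z)" by (simp add: F_def sum_distrib_left norm_mult mult_ac)
    finally show ?thesis .
  qed
  have F0: "0 \<le> F l y z" if "y \<in> space m" "z \<in> space m" for l y z using BK(2)[OF that] by (simp add: F_def)
  have iS: "integrable (m \<Otimes>\<^sub>M m) (\<lambda>x. \<Sum>l\<in>T. norm (a l) * (\<lambda>(y, z). F l y z) x)"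
    using iF by (intro Bochner_Integration.integrable_sum integrable_mult_right)
  have iG: "integrable (m \<Otimes>\<^sub>M m) (\<lambda>(y, z). G y z)"
  proof (rule Bochner_Integration.integrable_bound[OF iS])
    show "(\<lambda>(y, z). G y z) \<in> borel_measurable (m \<Otimes>\<^sub>M m)" unfolding G_def split_beta by measurable
    show "AE x in m \<Otimes>\<^sub>M m. norm (case x of (y, z) \<Rightarrow> G y z) \<le> norm (\<Sum>l\<in>T. norm (a l) * (case x of (y, z) \<Rightarrow> F l y z))"
    proof (rule AE_I2)
      fix x assume "x \<in> space (m \<Otimes>\<^sub>M m)"
      then obtain y z where x: "x = (y, z)" "y \<in> space m" "z \<in> space m" by (auto simp: space_pair_measure)
      have "0 \<le> G y z" using BK(2)[OF x(2,3)] by (simp add: G_def)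
      then show "norm (case x of (y, z) \<Rightarrow> G y z) \<le> norm (\<Sum>l\<in>T. norm (a l) * (case x of (y, z) \<Rightarrow> F l y z))"
        using pw[OF x(2,3)] by (simp add: x)
    qed
  qed
  have "(\<integral>z. \<integral>y. G y z \<partial>m \<partial>m) = (\<integral>x. (\<lambda>(y, z). G y z) x \<partial>(m \<Otimes>\<^sub>M m))"
    by (rule square.integral_snd[OF iG])
  also have "\<dots> \<le> (\<integral>x. (\<Sum>l\<in>T. norm (a l) * (\<lambda>(y, z). F l y z) x) \<partial>(m \<Otimes>\<^sub>M m))"
  proof (rule integral_mono[OF iG iS])
    fix x assume "x \<in> space (m \<Otimes>\<^sub>M m)"
    then obtain y z where x: "x = (y, z)" "y \<in> space m" "z \<in> space m" by (auto simp: space_pair_measure)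
    then show "(case x of (y, z) \<Rightarrow> G y z) \<le> (\<Sum>l\<in>T. norm (a l) * (case x of (y, z) \<Rightarrow> F l y z))" using pw by simp
  qed
  also have "\<dots> = (\<Sum>l\<in>T. norm (a l) * (\<integral>x. (\<lambda>(y, z). F l y z) x \<partial>(m \<Otimes>\<^sub>M m)))"
    using iF by (subst Bochner_Integration.integral_sum) auto
  also have "\<dots> = (\<Sum>l\<in>T. norm (a l) * (\<integral>z. \<integral>y. F l y z \<partial>m \<partial>m))"
    unfolding square.integral_snd[OF iF] ..
  also have "\<dots> \<le> (\<Sum>l\<in>T. norm (a l) * \<epsilon>)"
    using T(2) unfolding F_def by (intro sum_mono mult_left_mono) auto
  finally show ?thesis unfolding G_def sum_distrib_right .
qed

text \<open>Density provides polynomials near the data, but with arbitrary frequencies, while the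
  kernel must have its frequencies in M. Hence two stages: a kernel with unrestricted frequencies is
  convolved with u0, which gives a polynomial near u0 whose frequencies belong to the spectrum of u0
  and so to M; the kernel adapted to this polynomial is the one required.\<close>

lemma kernel_for_data:
  assumes M: "0 \<in> M" "\<And>x y. x \<in> M \<Longrightarrow> y \<in> M \<Longrightarrow> x + y \<in> M" "\<And>x. x \<in> M \<Longrightarrow> - x \<in> M"
    and u0[measurable]: "u0 \<in> borel_measurable m" "\<And>y. \<bar>u0 y\<bar> \<le> R"
    and spec: "\<And>l. (\<integral>y. of_real (u0 y) * cnj (e l y) \<partial>m) \<noteq> 0 \<Longrightarrow> l \<in> M"
    and dense: "\<And>\<epsilon>. 0 < \<epsilon> \<Longrightarrow> \<exists>S a. finite S \<and> (\<integral>y. norm (of_real (u0 y) - (\<Sum>l\<in>S. a l * e l y)) \<partial>m) \<le> \<epsilon>"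
    and eps: "0 < \<epsilon>"
  shows "\<exists>S \<kappa> k. S \<subseteq> M \<and> kernel_on S \<kappa> k \<and> (\<integral>z. \<integral>y. \<kappa> y z * \<bar>u0 y - u0 z\<bar> \<partial>m \<partial>m) \<le> \<epsilon>"
proof -
  define v where "v y = complex_of_real (u0 y)" for y
  have vm[measurable]: "v \<in> borel_measurable m" unfolding v_def by measurable
  have vb: "norm (v y) \<le> R" for y using u0(2) by (simp add: v_def)
  have trigb: "norm (\<Sum>l\<in>T. a l * e l y) \<le> (\<Sum>l\<in>T. norm (a l))" if "y \<in> space m" for T a y
    by (rule order.trans[OF norm_sum]) (use e_norm[OF that] in \<open>auto simp: norm_mult intro!: sum_mono\<close>)
  \<comment> \<open>The term 2 d pays for replacing v by a polynomial in both variables, and r for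
    the oscillation of that polynomial under the kernel.\<close>
  have approx: "(\<integral>z. \<integral>y. \<kappa> y z * norm (v y - v z) \<partial>m \<partial>m) \<le> 2 * d + r"
    if K: "kernel_on S \<kappa> k" and T: "finite T" "\<And>l. l \<in> T \<Longrightarrow> (\<integral>z. \<integral>y. \<kappa> y z * norm (e l y - e l z) \<partial>m \<partial>m) \<le> r / ((\<Sum>l\<in>T. norm (a l)) + 1)"
      and q: "(\<integral>y. norm (v y - (\<Sum>l\<in>T. a l * e l y)) \<partial>m) \<le> d" and r: "0 \<le> r" for S \<kappa> k T a d r
  proof -
    let ?q = "\<lambda>y. \<Sum>l\<in>T. a l * e l y"
    let ?N = "\<Sum>l\<in>T. norm (a l)"
    have N: "0 \<le> ?N" by (intro sum_nonneg) auto
    have "(\<integral>z. \<integral>y. \<kappa> y z * norm (v y - v z) \<partial>m \<partial>m)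
      \<le> (\<integral>y. norm (v y - ?q y) \<partial>m) + (\<integral>z. \<integral>y. \<kappa> y z * norm (?q y - ?q z) \<partial>m \<partial>m) + (\<integral>z. norm (v z - ?q z) \<partial>m)"
      by (rule kernel_triangle[OF K, where B="R + ?N"]) (use vb trigb R_pos N in \<open>auto intro: add_increasing add_increasing2 order.trans\<close>)
    also have "(\<integral>z. \<integral>y. \<kappa> y z * norm (?q y - ?q z) \<partial>m \<partial>m) \<le> ?N * (r / (?N + 1))"
      by (rule kernel_trig[OF K T])
    also have "\<dots> \<le> r" using N r by (simp add: field_simps)
    finally show ?thesis using q by linarith
  qed
  obtain T a where T: "finite T" "(\<integral>y. norm (v y - (\<Sum>l\<in>T. a l * e l y)) \<partial>m) \<le> \<epsilon> / 9"
    using dense[of "\<epsilon> / 9"] eps unfolding v_def by auto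
  have pos: "0 < (\<epsilon> / 9) / ((\<Sum>l\<in>T. norm (a l)) + 1)" using eps by (intro divide_pos_pos add_nonneg_pos sum_nonneg) auto
  \<comment> \<open>The first stage admits all frequencies.\<close>
  obtain S1 \<kappa>1 k1 where K1: "kernel_on S1 \<kappa>1 k1" "\<And>l. l \<in> T \<Longrightarrow> (\<integral>z. \<integral>y. \<kappa>1 y z * norm (e l y - e l z) \<partial>m \<partial>m) \<le> (\<epsilon> / 9) / ((\<Sum>l\<in>T. norm (a l)) + 1)"
    using kernel_exists[OF T(1), of UNIV, OF _ _ _ _ pos] by auto
  \<comment> \<open>Three times \<epsilon> / 9 is the \<epsilon> / 3 that serves as the L1 error of
    the second stage, where again three equal parts add up to \<epsilon>.\<close>
  have c1: "(\<integral>z. \<integral>y. \<kappa>1 y z * norm (v y - v z) \<partial>m \<partial>m) \<le> 2 * (\<epsilon> / 9) + \<epsilon> / 9"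
    by (rule approx[OF K1(1) T(1) K1(2) T(2)]) (use eps in auto)
  define b where "b l = k1 l * (\<integral>z. v z * cnj (e l z) \<partial>m)" for l
  \<comment> \<open>Convolution multiplies the Fourier coefficients of the data, so frequencies
    outside the spectrum of u0 disappear.\<close>
  define T2 where "T2 = {l \<in> S1. (\<integral>z. v z * cnj (e l z) \<partial>m) \<noteq> 0}"
  have S1f: "finite S1" using K1(1) by (simp add: kernel_on_def)
  have T2: "finite T2" "T2 \<subseteq> M" using S1f spec unfolding T2_def v_def by auto
  have p: "of_real (\<integral>z. \<kappa>1 y z * u0 z \<partial>m) = (\<Sum>l\<in>T2. b l * e l y)" if y: "y \<in> space m" for y
  proof -
    have iv: "integrable m (\<lambda>z. v z * cnj (e l z))" for l
      by (rule integrable_bdd[where B=R]) (use vb e_norm in \<open>auto simp: norm_mult\<close>)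
    have "of_real (\<integral>z. \<kappa>1 y z * u0 z \<partial>m) = (\<integral>z. of_real (\<kappa>1 y z * u0 z) \<partial>m :: complex)" by (rule integral_complex_of_real[symmetric])
    also have "\<dots> = (\<integral>z. (\<Sum>l\<in>S1. (k1 l * e l y) * (v z * cnj (e l z))) \<partial>m)"
    proof (intro Bochner_Integration.integral_cong refl)
      fix z assume z: "z \<in> space m"
      have "of_real (\<kappa>1 y z) = (\<Sum>l\<in>S1. k1 l * (e l y * cnj (e l z)))" using K1(1) y z unfolding kernel_on_def by blast
      from this show "of_real (\<kappa>1 y z * u0 z) = (\<Sum>l\<in>S1. (k1 l * e l y) * (v z * cnj (e l z)))"
        by (simp only: of_real_mult sum_distrib_left v_def mult_ac)
    qed
    also have "\<dots> = (\<Sum>l\<in>S1. (k1 l * e l y) * (\<integral>z. v z * cnj (e l z) \<partial>m))"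
      using iv by (subst Bochner_Integration.integral_sum) auto
    also have "\<dots> = (\<Sum>l\<in>S1. b l * e l y)" by (simp add: b_def mult_ac)
    also have "\<dots> = (\<Sum>l\<in>T2. b l * e l y)"
      using S1f by (intro sum.mono_neutral_right) (auto simp: T2_def b_def)
    finally show ?thesis .
  qed
  have d2: "(\<integral>y. norm (v y - (\<Sum>l\<in>T2. b l * e l y)) \<partial>m) \<le> \<epsilon> / 3"
  proof -
    have "(\<integral>y. norm (v y - (\<Sum>l\<in>T2. b l * e l y)) \<partial>m) = (\<integral>y. \<bar>u0 y - (\<integral>z. \<kappa>1 y z * u0 z \<partial>m)\<bar> \<partial>m)"
    proof (intro Bochner_Integration.integral_cong refl)
      fix y assume y: "y \<in> space m"
      show "norm (v y - (\<Sum>l\<in>T2. b l * e l y)) = \<bar>u0 y - (\<integral>z. \<kappa>1 y z * u0 z \<partial>m)\<bar>"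
        unfolding p[OF y, symmetric] v_def of_real_diff[symmetric] norm_of_real ..
    qed
    also have "\<dots> \<le> (\<integral>z. \<integral>y. \<kappa>1 y z * \<bar>u0 y - u0 z\<bar> \<partial>m \<partial>m)"
      by (rule kernel_convolution_close[OF K1(1) u0(1) u0(1) u0(2) u0(2)])
    also have "\<dots> = (\<integral>z. \<integral>y. \<kappa>1 y z * norm (v y - v z) \<partial>m \<partial>m)"
      unfolding v_def of_real_diff[symmetric] norm_of_real ..
    finally show ?thesis using c1 by simp
  qed
  have pos2: "0 < (\<epsilon> / 3) / ((\<Sum>l\<in>T2. norm (b l)) + 1)" using eps by (intro divide_pos_pos add_nonneg_pos sum_nonneg) auto
  obtain S \<kappa> k where K: "S \<subseteq> M" "kernel_on S \<kappa> k" "\<And>l. l \<in> T2 \<Longrightarrow> (\<integral>z. \<integral>y. \<kappa> y z * norm (e l y - e l z) \<partial>m \<partial>m) \<le> (\<epsilon> / 3) / ((\<Sum>l\<in>T2. norm (b l)) + 1)"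
    using kernel_exists[OF T2 M pos2] by auto
  have "(\<integral>z. \<integral>y. \<kappa> y z * norm (v y - v z) \<partial>m \<partial>m) \<le> 2 * (\<epsilon> / 3) + \<epsilon> / 3"
    by (rule approx[OF K(2) T2(1) K(3) d2]) (use eps in auto)
  moreover have "(\<integral>z. \<integral>y. \<kappa> y z * norm (v y - v z) \<partial>m \<partial>m) = (\<integral>z. \<integral>y. \<kappa> y z * \<bar>u0 y - u0 z\<bar> \<partial>m \<partial>m)"
    unfolding v_def of_real_diff[symmetric] norm_of_real ..
  ultimately show ?thesis using K(1,2) by (intro exI[of _ S] exI[of _ \<kappa>] exI[of _ k]) auto
qed

text \<open>For k = R and k = - R the entropies are R - u and R + u. Both integrals decrease, so the
  mean of u neither increases nor decreases, and the initial condition identifies it.\<close>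

lemma mean_conserved:
  assumes u0[measurable]: "u0 \<in> borel_measurable m" "\<And>y. \<bar>u0 y\<bar> \<le> R"
    and init: "\<And>\<epsilon>. 0 < \<epsilon> \<Longrightarrow> \<exists>\<delta>>0. AE t in lborel. 0 < t \<and> t < \<delta> \<longrightarrow> (\<integral>y. \<bar>u (t, y) - u0 y\<bar> \<partial>m) \<le> \<epsilon>"
  shows "\<exists>N\<in>null_sets lborel. \<forall>t>0. t \<notin> N \<longrightarrow> (\<integral>y. u (t, y) \<partial>m) = (\<integral>y. u0 y \<partial>m)"
proof -
  have iu: "integrable m (\<lambda>y. u (t, y))" for t by (rule integrable_bdd[where B=R]) (use u_bound in auto)
  have iu0: "integrable m u0" by (rule integrable_bdd[where B=R]) (use u0 in auto)
  have E1: "En R t = R - (\<integral>y. u (t, y) \<partial>m)" for t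
  proof -
    have "En R t = (\<integral>y. R - u (t, y) \<partial>m)" unfolding En_def
      by (intro Bochner_Integration.integral_cong refl) (use u_in in auto)
    then show ?thesis using iu[of t] total by simp
  qed
  have E2: "En (- R) t = R + (\<integral>y. u (t, y) \<partial>m)" for t
  proof -
    have "En (- R) t = (\<integral>y. R + u (t, y) \<partial>m)" unfolding En_def
    proof (intro Bochner_Integration.integral_cong refl)
      fix y show "\<bar>u (t, y) - - R\<bar> = R + u (t, y)" using u_in[of "(t, y)"] by auto
    qed
    then show ?thesis using iu[of t] total by simp
  qed
  obtain N1 where N1: "N1 \<in> null_sets lborel" "\<And>s t. 0 < s \<Longrightarrow> s < t \<Longrightarrow> s \<notin> N1 \<Longrightarrow> t \<notin> N1 \<Longrightarrow> En R t \<le> En R s"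
    using En_decreasing[of R] by blast
  obtain N2 where N2: "N2 \<in> null_sets lborel" "\<And>s t. 0 < s \<Longrightarrow> s < t \<Longrightarrow> s \<notin> N2 \<Longrightarrow> t \<notin> N2 \<Longrightarrow> En (-R) t \<le> En (-R) s"
    using En_decreasing[of "-R"] by blast
  show ?thesis
  proof (intro bexI[of _ "N1 \<union> N2"] allI impI)
    fix t :: real assume t: "0 < t" "t \<notin> N1 \<union> N2"
    have "\<bar>(\<integral>y. u (t, y) \<partial>m) - (\<integral>y. u0 y \<partial>m)\<bar> \<le> 0"
    proof (rule field_le_epsilon)
      fix \<epsilon> :: real assume "0 < \<epsilon>"
      then obtain \<delta> where d: "0 < \<delta>" "AE t in lborel. 0 < t \<and> t < \<delta> \<longrightarrow> (\<integral>y. \<bar>u (t, y) - u0 y\<bar> \<partial>m) \<le> \<epsilon>" using init by blast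
      obtain N3 where N3: "N3 \<in> null_sets lborel" "{t \<in> space lborel. \<not> (0 < t \<and> t < \<delta> \<longrightarrow> (\<integral>y. \<bar>u (t, y) - u0 y\<bar> \<partial>m) \<le> \<epsilon>)} \<subseteq> N3"
        using d(2) unfolding eventually_ae_filter by blast
      obtain s where s: "0 < s" "s < min \<delta> t" "s \<notin> N1 \<union> N2 \<union> N3"
        by (rule null_set_avoid[of "N1 \<union> N2 \<union> N3" 0 "min \<delta> t"]) (use N1(1) N2(1) N3(1) d(1) t(1) in auto)
      have sm: "(\<integral>y. \<bar>u (s, y) - u0 y\<bar> \<partial>m) \<le> \<epsilon>" using N3(2) s by auto
      have "(\<integral>y. u (t, y) \<partial>m) = (\<integral>y. u (s, y) \<partial>m)"
        using N1(2)[of s t] N2(2)[of s t] s t unfolding E1 E2 by auto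
      moreover have "\<bar>(\<integral>y. u (s, y) \<partial>m) - (\<integral>y. u0 y \<partial>m)\<bar> \<le> (\<integral>y. \<bar>u (s, y) - u0 y\<bar> \<partial>m)"
        using integral_abs_bound[of m "\<lambda>y. u (s, y) - u0 y"] iu[of s] iu0 by simp
      ultimately show "\<bar>(\<integral>y. u (t, y) \<partial>m) - (\<integral>y. u0 y \<partial>m)\<bar> \<le> 0 + \<epsilon>" using sm by linarith
    qed
    then show "(\<integral>y. u (t, y) \<partial>m) = (\<integral>y. u0 y \<partial>m)" by simp
  qed (use N1(1) N2(1) in auto)
qed

text \<open>The average G decreases from at most 3 \<epsilon> near time 0. At late times the
  convolution of \<kappa> with u(s) is uniformly within \<epsilon> of C, so
  \<open>dd \<kappa> t s\<close> is at least the L1 distance of u(t) from C minus \<epsilon>. Hence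
  that distance is at most 4 \<epsilon> = \<eta>.\<close>

theorem decay:
  assumes M: "0 \<in> M" "\<And>x y. x \<in> M \<Longrightarrow> y \<in> M \<Longrightarrow> x + y \<in> M" "\<And>x. x \<in> M \<Longrightarrow> - x \<in> M"
    and u0[measurable]: "u0 \<in> borel_measurable m" "\<And>y. \<bar>u0 y\<bar> \<le> R"
    and spec: "\<And>l. (\<integral>y. of_real (u0 y) * cnj (e l y) \<partial>m) \<noteq> 0 \<Longrightarrow> l \<in> M"
    and dense: "\<And>\<epsilon>. 0 < \<epsilon> \<Longrightarrow> \<exists>S a. finite S \<and> (\<integral>y. norm (of_real (u0 y) - (\<Sum>l\<in>S. a l * e l y)) \<partial>m) \<le> \<epsilon>"
    and init: "\<And>\<epsilon>. 0 < \<epsilon> \<Longrightarrow> \<exists>\<delta>>0. AE t in lborel. 0 < t \<and> t < \<delta> \<longrightarrow> (\<integral>y. \<bar>u (t, y) - u0 y\<bar> \<partial>m) \<le> \<epsilon>"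
    and nondeg: "\<And>\<xi> a b. \<xi> \<in> M \<Longrightarrow> \<xi> \<noteq> 0 \<Longrightarrow> a < b \<Longrightarrow> \<not> affine_fun_on {a<..<b} (\<lambda>w. \<xi> \<bullet> \<phi> w)"
    and eta: "0 < \<eta>"
  shows "eventually_ae (\<lambda>t. (\<integral>y. \<bar>u (t, y) - (\<integral>z. u0 z \<partial>m)\<bar> \<partial>m) \<le> \<eta>)"
proof -
  define C where "C = (\<integral>z. u0 z \<partial>m)"
  define \<epsilon> where "\<epsilon> = \<eta> / 4"
  have eps: "0 < \<epsilon>" using eta by (simp add: \<epsilon>_def)
  obtain S \<kappa> k where K: "S \<subseteq> M" "kernel_on S \<kappa> k" "(\<integral>z. \<integral>y. \<kappa> y z * \<bar>u0 y - u0 z\<bar> \<partial>m \<partial>m) \<le> \<epsilon>"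
    using kernel_for_data[OF M u0 spec dense eps] by blast
  have Sf: "finite S" using K(2) by (simp add: kernel_on_def)
  have iu: "integrable m (\<lambda>y. u (t, y))" for t by (rule integrable_bdd[where B=R]) (use u_bound in auto)
  obtain \<delta> where d: "0 < \<delta>" "AE t in lborel. 0 < t \<and> t < \<delta> \<longrightarrow> (\<integral>y. \<bar>u (t, y) - u0 y\<bar> \<partial>m) \<le> \<epsilon>" using init[OF eps] by blast
  \<comment> \<open>Then s < c and t - s < c keep t below \<delta>, where u is still close to the
    data.\<close>
  define c where "c = \<delta> / 2"
  have c: "0 < c" using d by (simp add: c_def)
  obtain \<beta> \<beta>' where B: "\<And>t. (\<beta> has_vector_derivative \<beta>' t) (at t)" "continuous_on UNIV \<beta>'" "\<And>t. 0 \<le> \<beta> t"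
    "\<And>t. t \<notin> {0<..<c} \<Longrightarrow> \<beta> t = (0::real)" "(\<integral>t. \<beta> t \<partial>lborel) = 1"
    using C1c_bump[OF c] by blast
  define G where "G s = (\<integral>t. \<beta> (t - s) * dd \<kappa> t s \<partial>lborel)" for s
  have iG: "integrable lborel (\<lambda>t. \<beta> (t - s) * dd \<kappa> t s)" for s by (rule contraction_average(2)[OF K(2) B(1-4)])
  have c\<beta>: "continuous_on UNIV \<beta>" using B(1) has_vector_derivative_continuous
    by (metis continuous_at_imp_continuous_on)
  \<comment> \<open>The integral of a function that is not integrable is 0 by convention, so a unit
    integral already implies integrability.\<close>
  have i\<beta>0: "integrable lborel \<beta>" using B(5) not_integrable_integral_eq by fastforce
  have i\<beta>: "integrable lborel (\<lambda>t. \<beta> (t - s))" for s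
    using lborel_integrable_real_affine[OF i\<beta>0, of 1 "-s"] by simp
  have t\<beta>: "(\<integral>t. \<beta> (t - s) \<partial>lborel) = 1" for s
    using lborel_integral_real_affine[of 1 \<beta> "-s"] B(5) by simp
  obtain N1 where N1: "N1 \<in> null_sets lborel" "\<And>s t. 0 < s \<Longrightarrow> s < t \<Longrightarrow> s \<notin> N1 \<Longrightarrow> t \<notin> N1 \<Longrightarrow> G t \<le> G s"
    using contraction_average(1)[OF K(2) B(1-4)] unfolding G_def by blast
  obtain N2 where N2: "N2 \<in> null_sets lborel" "{t \<in> space lborel. \<not> (0 < t \<and> t < \<delta> \<longrightarrow> (\<integral>y. \<bar>u (t, y) - u0 y\<bar> \<partial>m) \<le> \<epsilon>)} \<subseteq> N2"
    using d(2) unfolding eventually_ae_filter by blast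
  have N2': "(\<integral>y. \<bar>u (t, y) - u0 y\<bar> \<partial>m) \<le> \<epsilon>" if "0 < t" "t < \<delta>" "t \<notin> N2" for t using N2(2) that by auto
  have start: "G s \<le> 3 * \<epsilon>" if s: "0 < s" "s < c" "s \<notin> N2" for s
  proof -
    have "G s \<le> (\<integral>t. \<beta> (t - s) * (3 * \<epsilon>) \<partial>lborel)"
      unfolding G_def
    proof (rule integral_mono_AE[OF iG])
      show "integrable lborel (\<lambda>t. \<beta> (t - s) * (3 * \<epsilon>))" using i\<beta> by simp
      show "AE t in lborel. \<beta> (t - s) * dd \<kappa> t s \<le> \<beta> (t - s) * (3 * \<epsilon>)"
        using AE_not_in[OF N2(1)]
      proof eventually_elim
        case (elim t)
        show ?case
        proof (cases "t - s \<in> {0<..<c}")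
          case True
          have "dd \<kappa> t s \<le> (\<integral>y. norm (u (t, y) - u0 y) \<partial>m) + (\<integral>z. \<integral>y. \<kappa> y z * norm (u0 y - u0 z) \<partial>m \<partial>m) + (\<integral>z. norm (u (s, z) - u0 z) \<partial>m)"
            unfolding dd_def real_norm_def[symmetric]
            by (rule kernel_triangle[OF K(2), where B=R]) (use u_bound u0(2) in auto)
          then have "dd \<kappa> t s \<le> 3 * \<epsilon>" using N2'[of t] N2'[of s] elim s True K(3) by (auto simp: c_def)
          then show ?thesis using B(3) by (intro mult_left_mono) auto
        qed (use B(4) in auto)
      qed
    qed
    also have "\<dots> = 3 * \<epsilon>" using t\<beta> by simp
    finally show ?thesis .
  qed
  obtain s0 where s0: "0 < s0" "s0 < c" "s0 \<notin> N1 \<union> N2"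
    by (rule null_set_avoid[of "N1 \<union> N2" 0 c]) (use N1(1) N2(1) c in auto)
  have Gb: "G s \<le> 3 * \<epsilon>" if "c < s" "s \<notin> N1" for s
    using N1(2)[of s0 s] start[of s0] s0 that by auto
  \<comment> \<open>Q exceeds the sum of the moduli of the kernel's coefficients, so that
    coefficients of u of size \<epsilon> / Q contribute at most \<epsilon> to the convolution; the
    summand 1 keeps it positive.\<close>
  define Q where "Q = (\<Sum>l\<in>S. norm (k l)) + 1"
  have Q: "0 < Q" unfolding Q_def by (intro add_nonneg_pos sum_nonneg) auto
  have "eventually_ae (\<lambda>t. \<forall>l\<in>S - {0}. norm (co l (\<lambda>w. w) t) \<le> \<epsilon> / Q)"
    by (rule eventually_ae_ball_finite) (use Sf K(1) eps Q nondeg in \<open>auto intro!: coefficient_decay\<close>)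
  then obtain N3 T3 where N3: "N3 \<in> null_sets lborel" "0 < T3" "\<And>t l. T3 < t \<Longrightarrow> t \<notin> N3 \<Longrightarrow> l \<in> S - {0} \<Longrightarrow> norm (co l (\<lambda>w. w) t) \<le> \<epsilon> / Q"
    by (rule eventually_aeE) blast
  obtain N4 where N4: "N4 \<in> null_sets lborel" "\<And>t. 0 < t \<Longrightarrow> t \<notin> N4 \<Longrightarrow> (\<integral>y. u (t, y) \<partial>m) = C"
    using mean_conserved[OF u0 init] unfolding C_def by blast
  obtain N5 where N5: "N5 \<in> null_sets lborel" "\<And>s t. 0 < s \<Longrightarrow> s < t \<Longrightarrow> s \<notin> N5 \<Longrightarrow> t \<notin> N5 \<Longrightarrow> En C t \<le> En C s"
    using En_decreasing[of C] by blast
  \<comment> \<open>Unit mass forces the coefficient 1 at frequency 0, so the zeroth term of the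
    convolution is exactly the mean.\<close>
  have k0: "0 \<in> S" "k 0 = 1"
  proof -
    obtain y where y: "y \<in> space m" using total by fastforce
    have "1 = of_real (\<integral>z. \<kappa> z y \<partial>m)" using K(2) y by (simp add: kernel_on_def)
    also have "\<dots> = (\<integral>z. of_real (\<kappa> z y) \<partial>m :: complex)" by (rule integral_complex_of_real[symmetric])
    also have "\<dots> = (\<integral>z. (\<Sum>l\<in>S. (k l * cnj (e l y)) * e l z) \<partial>m)"
    proof (intro Bochner_Integration.integral_cong refl)
      fix z assume z: "z \<in> space m"
      have "of_real (\<kappa> z y) = (\<Sum>l\<in>S. k l * (e l z * cnj (e l y)))" using K(2) y z unfolding kernel_on_def by blast
      then show "of_real (\<kappa> z y) = (\<Sum>l\<in>S. (k l * cnj (e l y)) * e l z)" by (simp add: mult_ac)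
    qed
    also have "\<dots> = (if 0 \<in> S then k 0 * cnj (e 0 y) else 0)" by (rule trig_integral[OF Sf])
    finally show "0 \<in> S" "k 0 = 1" using e_zero[OF y] by (auto split: if_splits)
  qed
  have conv: "\<bar>(\<integral>z. \<kappa> y z * u (s, z) \<partial>m) - C\<bar> \<le> \<epsilon>" if s: "T3 < s" "s \<notin> N3 \<union> N4" and y: "y \<in> space m" for s y
  proof -
    have ie: "integrable m (\<lambda>z. of_real (u (s, z)) * cnj (e l z))" for l
      by (rule integrable_bdd[where B=R]) (use u_bound e_norm in \<open>auto simp: norm_mult\<close>)
    have coe: "(\<integral>z. of_real (u (s, z)) * cnj (e l z) \<partial>m) = co l (\<lambda>w. w) s" for l
      unfolding co_def by (intro Bochner_Integration.integral_cong refl) (simp add: e_uminus)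
    have co0: "co 0 (\<lambda>w. w) s = of_real C"
    proof -
      have "co 0 (\<lambda>w. w) s = (\<integral>z. of_real (u (s, z)) \<partial>m)"
        unfolding co_def by (intro Bochner_Integration.integral_cong refl) (simp add: e_zero)
      also have "\<dots> = of_real (\<integral>z. u (s, z) \<partial>m)" by (rule integral_complex_of_real)
      finally show ?thesis using N4(2)[of s] s N3(2) by auto
    qed
    have "of_real (\<integral>z. \<kappa> y z * u (s, z) \<partial>m) = (\<integral>z. of_real (\<kappa> y z * u (s, z)) \<partial>m :: complex)" by (rule integral_complex_of_real[symmetric])
    also have "\<dots> = (\<integral>z. (\<Sum>l\<in>S. (k l * e l y) * (of_real (u (s, z)) * cnj (e l z))) \<partial>m)"
    proof (intro Bochner_Integration.integral_cong refl)
      fix z assume z: "z \<in> space m"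
      have "of_real (\<kappa> y z) = (\<Sum>l\<in>S. k l * (e l y * cnj (e l z)))" using K(2) y z unfolding kernel_on_def by blast
      then show "of_real (\<kappa> y z * u (s, z)) = (\<Sum>l\<in>S. (k l * e l y) * (of_real (u (s, z)) * cnj (e l z)))"
        by (simp only: of_real_mult sum_distrib_left mult_ac)
    qed
    also have "\<dots> = (\<Sum>l\<in>S. (k l * e l y) * co l (\<lambda>w. w) s)"
      using ie by (subst Bochner_Integration.integral_sum) (auto simp: coe)
    also have "\<dots> = of_real C + (\<Sum>l\<in>S - {0}. (k l * e l y) * co l (\<lambda>w. w) s)"
      using k0 e_zero[OF y] co0 by (subst sum.remove[OF Sf, of 0]) auto
    finally have eq: "of_real ((\<integral>z. \<kappa> y z * u (s, z) \<partial>m) - C) = (\<Sum>l\<in>S - {0}. (k l * e l y) * co l (\<lambda>w. w) s)" by simp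
    have "\<bar>(\<integral>z. \<kappa> y z * u (s, z) \<partial>m) - C\<bar> = norm (of_real ((\<integral>z. \<kappa> y z * u (s, z) \<partial>m) - C) :: complex)" by (simp only: norm_of_real)
    also have "\<dots> \<le> (\<Sum>l\<in>S - {0}. norm ((k l * e l y) * co l (\<lambda>w. w) s))" unfolding eq by (rule norm_sum)
    also have "\<dots> \<le> (\<Sum>l\<in>S - {0}. norm (k l) * (\<epsilon> / Q))"
    proof (rule sum_mono)
      fix l assume l: "l \<in> S - {0}"
      have "norm ((k l * e l y) * co l (\<lambda>w. w) s) = norm (k l) * norm (co l (\<lambda>w. w) s)"
        using e_norm[OF y] by (simp add: norm_mult)
      also have "\<dots> \<le> norm (k l) * (\<epsilon> / Q)" using N3(3)[OF s(1) _ l] s by (intro mult_left_mono) auto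
      finally show "norm ((k l * e l y) * co l (\<lambda>w. w) s) \<le> norm (k l) * (\<epsilon> / Q)" .
    qed
    also have "\<dots> \<le> Q * (\<epsilon> / Q)"
      unfolding sum_distrib_right[symmetric]
    proof (rule mult_right_mono)
      have "(\<Sum>l\<in>S - {0}. norm (k l)) \<le> (\<Sum>l\<in>S. norm (k l))" using Sf by (intro sum_mono2) auto
      then show "(\<Sum>l\<in>S - {0}. norm (k l)) \<le> Q" by (simp add: Q_def)
    qed (use eps Q in auto)
    also have "\<dots> = \<epsilon>" using Q by simp
    finally show ?thesis .
  qed
  have low: "En C t - \<epsilon> \<le> dd \<kappa> t s" if s: "T3 < s" "s \<notin> N3 \<union> N4" for s t
  proof -
    have m1: "(\<lambda>y. \<integral>z. \<kappa> y z * u (s, z) \<partial>m) \<in> borel_measurable m"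
    proof -
      note [measurable] = kernel_measurable(1)[OF K(2)]
      have "(\<lambda>(y, z). \<kappa> y z * u (s, z)) \<in> borel_measurable (m \<Otimes>\<^sub>M m)" unfolding split_beta by measurable
      then show ?thesis by (rule borel_measurable_lebesgue_integral)
    qed
    note [measurable] = m1
    have "En C t - \<epsilon> = (\<integral>y. \<bar>u (t, y) - C\<bar> - \<epsilon> \<partial>m)"
    proof -
      have "integrable m (\<lambda>y. \<bar>u (t, y) - C\<bar>)" using iu by auto
      then show ?thesis using total by (simp add: En_def)
    qed
    also have "\<dots> \<le> (\<integral>y. \<bar>u (t, y) - (\<integral>z. \<kappa> y z * u (s, z) \<partial>m)\<bar> \<partial>m)"
    proof (rule integral_mono_bdd[where B="R + \<bar>C\<bar> + \<epsilon>" and D="R + \<bar>C\<bar> + \<epsilon>"])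
      fix y assume y: "y \<in> space m"
      have 1: "\<bar>(\<integral>z. \<kappa> y z * u (s, z) \<partial>m) - C\<bar> \<le> \<epsilon>" by (rule conv[OF s y])
      show "\<bar>\<bar>u (t, y) - C\<bar> - \<epsilon>\<bar> \<le> R + \<bar>C\<bar> + \<epsilon>" using u_bound[of "(t, y)"] eps by linarith
      show "\<bar>\<bar>u (t, y) - (\<integral>z. \<kappa> y z * u (s, z) \<partial>m)\<bar>\<bar> \<le> R + \<bar>C\<bar> + \<epsilon>" using 1 u_bound[of "(t, y)"] by linarith
      show "\<bar>u (t, y) - C\<bar> - \<epsilon> \<le> \<bar>u (t, y) - (\<integral>z. \<kappa> y z * u (s, z) \<partial>m)\<bar>" using 1 by linarith
    qed measurable
    also have "\<dots> \<le> dd \<kappa> t s" unfolding dd_def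
      by (rule kernel_convolution_close[OF K(2), where B=R]) (use u_bound in auto)
    finally show ?thesis .
  qed
  define N where "N = N1 \<union> N3 \<union> N4 \<union> N5"
  have N: "N \<in> null_sets lborel" using N1(1) N3(1) N4(1) N5(1) by (auto simp: N_def)
  have N': "{t. t - c \<in> N} \<in> null_sets lborel" by (rule null_sets_translation[OF N])
  have fin: "En C t \<le> \<eta>" if t: "max T3 c + c < t" "t \<notin> N" "t \<notin> {t. t - c \<in> N}" for t
  proof -
    \<comment> \<open>The average defining \<open>G s\<close> runs over r in (s, t). Since
      \<open>En C\<close> decreases, its value at t is below its values at almost all such r, which
      turns the averaged bound into one at t.\<close>
    define s where "s = t - c"
    have s: "T3 < s" "c < s" "s \<notin> N" "t = s + c" using t by (auto simp: s_def)
    have "(\<integral>r. \<beta> (r - s) * (En C t - \<epsilon>) \<partial>lborel) \<le> G s"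
      unfolding G_def
    proof (rule integral_mono_AE[OF _ iG])
      show "integrable lborel (\<lambda>r. \<beta> (r - s) * (En C t - \<epsilon>))" using i\<beta> by simp
      show "AE r in lborel. \<beta> (r - s) * (En C t - \<epsilon>) \<le> \<beta> (r - s) * dd \<kappa> r s"
        using AE_not_in[OF N]
      proof eventually_elim
        case (elim r)
        show ?case
        proof (cases "r - s \<in> {0<..<c}")
          case True
          have "En C t \<le> En C r" using N5(2)[of r t] True s elim t c by (auto simp: N_def)
          moreover have "En C r - \<epsilon> \<le> dd \<kappa> r s" by (rule low) (use s in \<open>auto simp: N_def\<close>)
          ultimately show ?thesis using B(3) by (intro mult_left_mono) auto
        qed (use B(4) in auto)
      qed
    qed
    moreover have "(\<integral>r. \<beta> (r - s) * (En C t - \<epsilon>) \<partial>lborel) = En C t - \<epsilon>" using t\<beta> by simp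
    moreover have "G s \<le> 3 * \<epsilon>" using Gb[of s] s by (auto simp: N_def)
    ultimately have "En C t \<le> 4 * \<epsilon>" by linarith
    then show ?thesis by (simp add: \<epsilon>_def)
  qed
  show ?thesis
  proof (rule eventually_aeI)
    show "N \<union> {t. t - c \<in> N} \<in> null_sets lborel" using N N' by blast
    fix t assume "max T3 c + c < t" "t \<notin> N \<union> {t. t - c \<in> N}"
    then show "(\<integral>y. \<bar>u (t, y) - (\<integral>z. u0 z \<partial>m)\<bar> \<partial>m) \<le> \<eta>"
      using fin[of t] unfolding En_def C_def by blast
  qed
qed

end

section \<open>The Bohr compactification\<close>

lemma bohr_exp_add: "bohr_exp (l + k) x = bohr_exp l x * bohr_exp k x"
  by (simp add: bohr_exp_def inner_add_left distrib_left exp_add)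

lemma bohr_exp_shift: "bohr_exp l (x + z) = bohr_exp l x * bohr_exp l z"
  by (simp add: bohr_exp_def inner_add_right distrib_left exp_add)

lemma bohr_exp_zero [simp]: "bohr_exp 0 x = 1" "bohr_exp l 0 = 1"
  by (auto simp: bohr_exp_def)

lemma norm_bohr_exp [simp]: "norm (bohr_exp l x) = 1"
  by (simp add: bohr_exp_def norm_exp_eq_Re)

lemma trig_polys_iff: "p \<in> trig_polys \<longleftrightarrow> tspan bohr_exp UNIV UNIV p"
  unfolding trig_polys_def tspan_def by (auto simp: fun_eq_iff)

lemma AP_iff: "f \<in> AP \<longleftrightarrow> (\<forall>\<epsilon>>0. \<exists>p\<in>trig_polys. \<forall>x. norm (f x - p x) \<le> \<epsilon>)"
proof
  assume "f \<in> AP"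
  then obtain p where p: "\<And>k. p k \<in> trig_polys" "uniform_limit UNIV p f sequentially" unfolding AP_def by blast
  show "\<forall>\<epsilon>>0. \<exists>p\<in>trig_polys. \<forall>x. norm (f x - p x) \<le> \<epsilon>"
  proof (intro allI impI)
    fix \<epsilon> :: real assume "0 < \<epsilon>"
    from uniform_limitD[OF p(2) this] obtain k where "\<And>x. dist (p k x) (f x) < \<epsilon>" by (auto simp: eventually_sequentially)
    then show "\<exists>p\<in>trig_polys. \<forall>x. norm (f x - p x) \<le> \<epsilon>"
      using p(1) by (intro bexI[of _ "p k"]) (auto simp: dist_norm norm_minus_commute less_imp_le)
  qed
next
  assume a: "\<forall>\<epsilon>>0. \<exists>p\<in>trig_polys. \<forall>x. norm (f x - p x) \<le> \<epsilon>"
  have "\<forall>k::nat. \<exists>p. p \<in> trig_polys \<and> (\<forall>x. norm (f x - p x) \<le> 1 / real (Suc k))"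
    using a by (simp add: Bex_def)
  then obtain p where p: "\<And>k. p k \<in> trig_polys" "\<And>k x. norm (f x - p k x) \<le> 1 / real (Suc k)" by metis
  have "uniform_limit UNIV p f sequentially"
  proof (rule uniform_limitI)
    fix e :: real assume "0 < e"
    then obtain n where n: "inverse (real (Suc n)) < e" using reals_Archimedean by blast
    have "dist (p k x) (f x) < e" if "k \<ge> n" for k x
    proof -
      have "norm (f x - p k x) \<le> 1 / real (Suc k)" by (rule p)
      also have "\<dots> \<le> 1 / real (Suc n)" using that by (intro divide_left_mono) auto
      finally show ?thesis using n by (simp add: dist_norm norm_minus_commute inverse_eq_divide)
    qed
    then show "\<forall>\<^sub>F n in sequentially. \<forall>x\<in>UNIV. dist (p n x) (f x) < e" by (auto simp: eventually_sequentially)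
  qed
  then show "f \<in> AP" unfolding AP_def using p(1) by blast
qed

lemma trig_polys_AP: "p \<in> trig_polys \<Longrightarrow> p \<in> AP"
  unfolding AP_iff by (intro allI impI bexI[of _ p]) auto

lemma bohr_exp_trig: "bohr_exp l \<in> trig_polys"
  using tspan_single[of l UNIV bohr_exp UNIV 1] by (simp add: trig_polys_iff)

lemma bohr_exp_AP [simp]: "bohr_exp l \<in> AP" and bohr_exp_AP' [simp]: "(\<lambda>x. bohr_exp l x) \<in> AP"
  by (auto intro: trig_polys_AP bohr_exp_trig)

lemma const_trig: "(\<lambda>x. c) \<in> trig_polys"
  using tspan_single[of 0 UNIV bohr_exp UNIV c] by (simp add: trig_polys_iff)

lemma const_AP [simp]: "(\<lambda>x. c) \<in> AP"
  by (rule trig_polys_AP[OF const_trig])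

lemma trig_polys_bounded:
  assumes "p \<in> trig_polys" shows "\<exists>B. \<forall>x. norm (p x) \<le> B"
proof -
  obtain S a where p: "p = (\<lambda>x. \<Sum>l\<in>S. a l * bohr_exp l x)" using assms unfolding trig_polys_def by blast
  have "norm (p x) \<le> (\<Sum>l\<in>S. norm (a l))" for x
    unfolding p by (rule order.trans[OF norm_sum]) (auto simp: norm_mult)
  then show ?thesis by blast
qed

lemma AP_bounded: assumes "f \<in> AP" obtains B where "0 \<le> B" "\<And>x. norm (f x) \<le> B"
proof -
  obtain p where p: "p \<in> trig_polys" "\<And>x. norm (f x - p x) \<le> 1" using assms unfolding AP_iff by (meson zero_less_one)
  obtain B where B: "\<And>x. norm (p x) \<le> B" using trig_polys_bounded[OF p(1)] by blast
  have "norm (f x) \<le> \<bar>B\<bar> + 1" for x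
    using norm_triangle_ineq[of "f x - p x" "p x"] p(2)[of x] B[of x] by simp
  then show ?thesis by (intro that[of "\<bar>B\<bar> + 1"]) auto
qed

lemma AP_closed: assumes "\<And>\<epsilon>. 0 < \<epsilon> \<Longrightarrow> \<exists>g\<in>AP. \<forall>x. norm (f x - g x) \<le> \<epsilon>" shows "f \<in> AP"
  unfolding AP_iff
proof (intro allI impI)
  fix \<epsilon> :: real assume "0 < \<epsilon>"
  then obtain g where g: "g \<in> AP" "\<And>x. norm (f x - g x) \<le> \<epsilon> / 2" using assms[of "\<epsilon> / 2"] by auto
  obtain p where p: "p \<in> trig_polys" "\<And>x. norm (g x - p x) \<le> \<epsilon> / 2" using g(1) \<open>0 < \<epsilon>\<close> unfolding AP_iff by (meson half_gt_zero)
  have "norm (f x - p x) \<le> \<epsilon>" for x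
    using norm_triangle_ineq[of "f x - g x" "g x - p x"] g(2)[of x] p(2)[of x] by simp
  then show "\<exists>p\<in>trig_polys. \<forall>x. norm (f x - p x) \<le> \<epsilon>" using p(1) by blast
qed

lemma AP_add: assumes "f \<in> AP" "g \<in> AP" shows "(\<lambda>x. f x + g x) \<in> AP"
  unfolding AP_iff
proof (intro allI impI)
  fix \<epsilon> :: real assume e: "0 < \<epsilon>"
  obtain p where p: "p \<in> trig_polys" "\<And>x. norm (f x - p x) \<le> \<epsilon> / 2" using assms(1) e unfolding AP_iff by (meson half_gt_zero)
  obtain q where q: "q \<in> trig_polys" "\<And>x. norm (g x - q x) \<le> \<epsilon> / 2" using assms(2) e unfolding AP_iff by (meson half_gt_zero)
  have "norm (f x + g x - (p x + q x)) \<le> \<epsilon>" for x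
    using norm_triangle_ineq[of "f x - p x" "g x - q x"] p(2)[of x] q(2)[of x] by (simp add: algebra_simps)
  moreover have "(\<lambda>x. p x + q x) \<in> trig_polys" using p(1) q(1) unfolding trig_polys_iff by (rule tspan_add)
  ultimately show "\<exists>p\<in>trig_polys. \<forall>x. norm (f x + g x - p x) \<le> \<epsilon>" by (intro bexI[of _ "\<lambda>x. p x + q x"] allI)
qed

lemma trig_polys_mult: "p \<in> trig_polys \<Longrightarrow> q \<in> trig_polys \<Longrightarrow> (\<lambda>x. p x * q x) \<in> trig_polys"
  unfolding trig_polys_iff by (rule tspan_mult) (auto simp: bohr_exp_add)

lemma AP_mult: assumes "f \<in> AP" "g \<in> AP" shows "(\<lambda>x. f x * g x) \<in> AP"
  unfolding AP_iff
proof (intro allI impI)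
  fix \<epsilon> :: real assume e: "0 < \<epsilon>"
  obtain B where B: "0 \<le> B" "\<And>x. norm (f x) \<le> B" using AP_bounded[OF assms(1)] by blast
  obtain q where q: "q \<in> trig_polys" "\<And>x. norm (g x - q x) \<le> \<epsilon> / (2 * (B + 1))"
    using assms(2) e B(1) unfolding AP_iff by (metis add_nonneg_pos divide_pos_pos mult_pos_pos zero_less_numeral zero_less_one)
  obtain D where D: "\<And>x. norm (q x) \<le> D" using trig_polys_bounded[OF q(1)] by blast
  have D0: "0 \<le> D" using D[of 0] norm_ge_zero order.trans by blast
  obtain p where p: "p \<in> trig_polys" "\<And>x. norm (f x - p x) \<le> \<epsilon> / (2 * (D + 1))"
    using assms(1) e D0 unfolding AP_iff by (metis add_nonneg_pos divide_pos_pos mult_pos_pos zero_less_numeral zero_less_one)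
  have "norm (f x * g x - p x * q x) \<le> \<epsilon>" for x
  proof -
    have "f x * g x - p x * q x = f x * (g x - q x) + (f x - p x) * q x" by (simp add: algebra_simps)
    also have "norm \<dots> \<le> norm (f x) * norm (g x - q x) + norm (f x - p x) * norm (q x)"
      using norm_triangle_ineq norm_mult by metis
    also have "\<dots> \<le> B * (\<epsilon> / (2 * (B + 1))) + (\<epsilon> / (2 * (D + 1))) * D"
      using B(2)[of x] q(2)[of x] p(2)[of x] D[of x] B(1) D0 e by (intro add_mono mult_mono) auto
    also have "\<dots> \<le> \<epsilon> / 2 + \<epsilon> / 2" using B(1) D0 e by (intro add_mono) (auto simp: field_simps)
    finally show ?thesis by simp
  qed
  then show "\<exists>p\<in>trig_polys. \<forall>x. norm (f x * g x - p x) \<le> \<epsilon>" using trig_polys_mult[OF p(1) q(1)] by (intro bexI[of _ "\<lambda>x. p x * q x"] allI)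
qed

lemma AP_cmult: "f \<in> AP \<Longrightarrow> (\<lambda>x. c * f x) \<in> AP"
  using AP_mult[of "\<lambda>x. c" f] by simp

lemma AP_sum: "(\<And>i. i \<in> I \<Longrightarrow> f i \<in> AP) \<Longrightarrow> (\<lambda>x. \<Sum>i\<in>I. f i x) \<in> AP"
  by (induction I rule: infinite_finite_induct) (auto intro: AP_add)

lemma AP_power: "f \<in> AP \<Longrightarrow> (\<lambda>x. f x ^ n) \<in> AP"
  by (induction n) (auto intro: AP_mult)

lemma trig_polys_shift: assumes "p \<in> trig_polys" shows "(\<lambda>x. p (x + d)) \<in> trig_polys"
proof -
  obtain S a where p: "finite S" "p = (\<lambda>x. \<Sum>l\<in>S. a l * bohr_exp l x)" using assms unfolding trig_polys_def by blast
  have "(\<lambda>x. p (x + d)) = (\<lambda>x. \<Sum>l\<in>S. (a l * bohr_exp l d) * bohr_exp l x)"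
    unfolding p bohr_exp_shift by (simp add: mult_ac)
  then show ?thesis unfolding trig_polys_def using p(1) by (intro CollectI exI conjI) auto
qed

lemma AP_shift: assumes "f \<in> AP" shows "(\<lambda>x. f (x + d)) \<in> AP"
  unfolding AP_iff
proof (intro allI impI)
  fix \<epsilon> :: real assume e: "0 < \<epsilon>"
  obtain p where p: "p \<in> trig_polys" "\<And>x. norm (f x - p x) \<le> \<epsilon>" using assms(1) e unfolding AP_iff by blast
  then show "\<exists>p\<in>trig_polys. \<forall>x. norm (f (x + d) - p x) \<le> \<epsilon>" using trig_polys_shift[OF p(1), of d] by (intro bexI[of _ "\<lambda>x. p (x + d)"]) auto
qed

lemma AP_shift': "f \<in> AP \<Longrightarrow> (\<lambda>x. f (d + x)) \<in> AP"
  using AP_shift[of f d] by (simp add: add.commute)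

section \<open>Multiplicative functionals on the almost periodic functions\<close>

lemma bohrD:
  assumes "h \<in> bohr"
  shows "h \<in> extensional AP" "f \<in> AP \<Longrightarrow> g \<in> AP \<Longrightarrow> h (\<lambda>x. f x + g x) = h f + h g"
    "f \<in> AP \<Longrightarrow> h (\<lambda>x. c * f x) = c * h f" "f \<in> AP \<Longrightarrow> g \<in> AP \<Longrightarrow> h (\<lambda>x. f x * g x) = h f * h g" "h (\<lambda>x. 1) = 1"
proof -
  show "h \<in> extensional AP" "f \<in> AP \<Longrightarrow> g \<in> AP \<Longrightarrow> h (\<lambda>x. f x + g x) = h f + h g"
    "f \<in> AP \<Longrightarrow> h (\<lambda>x. c * f x) = c * h f" "f \<in> AP \<Longrightarrow> g \<in> AP \<Longrightarrow> h (\<lambda>x. f x * g x) = h f * h g"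
    using assms unfolding bohr_def by auto
  have m: "h (\<lambda>x. f x * g x) = h f * h g" if "f \<in> AP" "g \<in> AP" for f g
    using assms that unfolding bohr_def by auto
  obtain f where f: "f \<in> AP" "h f \<noteq> 0" using assms unfolding bohr_def by blast
  have "h f = h (\<lambda>x. 1) * h f" using m[of "\<lambda>x. 1" f] f(1) by simp
  then show "h (\<lambda>x. 1) = 1" using f(2) by simp
qed

lemma bohrI:
  assumes "h \<in> extensional AP" "\<And>f g. f \<in> AP \<Longrightarrow> g \<in> AP \<Longrightarrow> h (\<lambda>x. f x + g x) = h f + h g"
    "\<And>c f. f \<in> AP \<Longrightarrow> h (\<lambda>x. c * f x) = c * h f" "\<And>f g. f \<in> AP \<Longrightarrow> g \<in> AP \<Longrightarrow> h (\<lambda>x. f x * g x) = h f * h g" "h (\<lambda>x. 1) = 1"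
  shows "h \<in> bohr"
  unfolding bohr_def using assms by (auto intro!: bexI[of _ "\<lambda>x. 1"])

lemma bohr_sum: assumes h: "h \<in> bohr" and "finite I" "\<And>i. i \<in> I \<Longrightarrow> f i \<in> AP"
  shows "h (\<lambda>x. \<Sum>i\<in>I. f i x) = (\<Sum>i\<in>I. h (f i))"
  using assms(2,3)
proof (induction I rule: finite_induct)
  case empty
  show ?case using bohrD(3)[OF h, of "\<lambda>x. 1" 0] by simp
next
  case (insert i I)
  have "(\<lambda>x. \<Sum>i\<in>I. f i x) \<in> AP" using insert by (intro AP_sum) auto
  then show ?case using insert bohrD(2)[OF h, of "f i" "\<lambda>x. \<Sum>i\<in>I. f i x"] by simp
qed

lemma bohr_diff: assumes h: "h \<in> bohr" and "f \<in> AP" "g \<in> AP" shows "h (\<lambda>x. f x - g x) = h f - h g"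
proof -
  have "(\<lambda>x. f x - g x) = (\<lambda>x. f x + (-1) * g x)" by auto
  then show ?thesis using bohrD(2)[OF h assms(2) AP_cmult[OF assms(3)], of "-1"] bohrD(3)[OF h assms(3), of "-1"] by simp
qed

lemma AP_diff: "f \<in> AP \<Longrightarrow> g \<in> AP \<Longrightarrow> (\<lambda>x. f x - g x) \<in> AP"
  using AP_add[of f "\<lambda>x. (-1) * g x"] AP_cmult[of g "-1"] by simp

text \<open>If \<open>|h f|\<close> exceeded the supremum of \<open>f\<close>, then \<open>1 - f / h f\<close> would be invertible (Neumann series) in the kernel of \<open>h\<close>.\<close>

lemma bohr_norm_le:
  assumes h: "h \<in> bohr" and f: "f \<in> AP" and B: "\<And>x. norm (f x) \<le> B"
  shows "norm (h f) \<le> B"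
proof (rule ccontr)
  assume n: "\<not> norm (h f) \<le> B"
  have B0: "0 \<le> B" using B[of 0] norm_ge_zero order.trans by blast
  define c where "c = h f"
  have c: "B < norm c" "c \<noteq> 0" using n B0 by (auto simp: c_def)
  define q where "q x = (1 / c) * f x" for x
  define r where "r = B / norm c"
  have r: "0 \<le> r" "r < 1" using c B0 by (auto simp: r_def)
  have q: "q \<in> AP" unfolding q_def[abs_def] by (rule AP_cmult[OF f])
  have qr: "norm (q x) \<le> r" for x using B[of x] c by (simp add: q_def r_def norm_mult norm_divide divide_right_mono)
  have q1: "q x \<noteq> 1" for x using qr[of x] r by auto
  define g where "g x = 1 / (1 - q x)" for x
  have gAP: "g \<in> AP"
  proof (rule AP_closed)
    fix \<epsilon> :: real assume e: "0 < \<epsilon>"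
    have "(\<lambda>N. r ^ N / (1 - r)) \<longlonglongrightarrow> 0 / (1 - r)" using r by (intro tendsto_intros LIMSEQ_realpow_zero) auto
    then have "eventually (\<lambda>N. r ^ N / (1 - r) < \<epsilon>) sequentially" using e by (intro order_tendstoD) auto
    then obtain N where N: "r ^ N / (1 - r) < \<epsilon>" by (auto simp: eventually_sequentially)
    have "norm (g x - (\<Sum>i<N. q x ^ i)) \<le> \<epsilon>" for x
    proof -
      have "(\<Sum>i<N. q x ^ i) = (1 - q x ^ N) / (1 - q x)" using sum_gp_strict[of "q x" N] q1[of x] by simp
      then have "g x - (\<Sum>i<N. q x ^ i) = q x ^ N / (1 - q x)" by (simp add: g_def diff_divide_distrib)
      then have "norm (g x - (\<Sum>i<N. q x ^ i)) = norm (q x) ^ N / norm (1 - q x)" by (simp add: norm_divide norm_power)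
      also have "\<dots> \<le> r ^ N / (1 - r)"
        using qr[of x] r norm_triangle_ineq2[of 1 "q x"] by (intro frac_le power_mono) auto
      finally show ?thesis using N by simp
    qed
    moreover have "(\<lambda>x. \<Sum>i<N. q x ^ i) \<in> AP" by (intro AP_sum AP_power q)
    ultimately show "\<exists>p\<in>AP. \<forall>x. norm (g x - p x) \<le> \<epsilon>" by (intro bexI[of _ "\<lambda>x. \<Sum>i<N. q x ^ i"]) auto
  qed
  have d: "(\<lambda>x. 1 - q x) \<in> AP" by (intro AP_diff q) simp
  have "(\<lambda>x. (1 - q x) * g x) = (\<lambda>x. 1)" using q1 by (auto simp: g_def fun_eq_iff)
  then have "1 = h (\<lambda>x. 1 - q x) * h g" using bohrD(4)[OF h d gAP] bohrD(5)[OF h] by simp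
  moreover have "h (\<lambda>x. 1 - q x) = 0"
    using bohr_diff[OF h const_AP q, of 1] bohrD(3)[OF h f, of "1 / c"] bohrD(5)[OF h] c by (simp add: q_def[abs_def] c_def)
  ultimately show False by simp
qed

text \<open>The modulus is 1 because the values at l and at - l both have modulus at most 1 and
  their product is 1.\<close>

lemma bohr_exp_values:
  assumes h: "h \<in> bohr"
  shows "h (bohr_exp (l + k)) = h (bohr_exp l) * h (bohr_exp k)" "norm (h (bohr_exp l)) = 1"
proof -
  have add: "h (bohr_exp (l + k)) = h (bohr_exp l) * h (bohr_exp k)" for l k
  proof -
    have "bohr_exp (l + k) = (\<lambda>x. bohr_exp l x * bohr_exp k x)" by (simp add: fun_eq_iff bohr_exp_add)
    then show ?thesis using bohrD(4)[OF h, of "bohr_exp l" "bohr_exp k"] by simp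
  qed
  then show "h (bohr_exp (l + k)) = h (bohr_exp l) * h (bohr_exp k)" .
  have le: "norm (h (bohr_exp l)) \<le> 1" for l by (rule bohr_norm_le[OF h]) auto
  have "bohr_exp 0 = (\<lambda>x::real^'a. 1)" by (simp add: fun_eq_iff)
  then have "h (bohr_exp l) * h (bohr_exp (- l)) = 1" using add[of l "- l"] bohrD(5)[OF h] by simp
  then have "norm (h (bohr_exp l)) * norm (h (bohr_exp (- l))) = 1" by (metis norm_mult norm_one)
  then show "norm (h (bohr_exp l)) = 1" using le[of l] le[of "- l"]
    by (metis antisym mult.right_neutral mult_left_mono norm_ge_zero)
qed

lemma bohr_trig: assumes "h \<in> bohr" "finite S" shows "h (\<lambda>x. \<Sum>l\<in>S. a l * bohr_exp l x) = (\<Sum>l\<in>S. a l * h (bohr_exp l))"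
  using bohr_sum[OF assms, of "\<lambda>l x. a l * bohr_exp l x"] bohrD(3)[OF assms(1)] by (simp add: AP_cmult)

lemma topspace_bohr [simp]: "topspace bohr_topology = bohr"
  unfolding bohr_topology_def by (auto simp: bohr_def PiE_def)

lemma continuous_gelfand: assumes "f \<in> AP" shows "continuous_map bohr_topology euclidean (\<lambda>y. y f)"
  unfolding bohr_topology_def
  by (intro continuous_map_from_subtopology continuous_map_product_coordinates assms)

text \<open>As in the Banach-Alaoglu theorem: the defining identities are closed conditions in the
  product topology, and the bound by the supremum of f puts the spectrum into a product of closed
  discs, compact by Tychonoff's theorem.\<close>

lemma compact_bohr: "compact_space (bohr_topology :: 'n::finite bohr_point topology)"
proof -
  let ?P = "product_topology (\<lambda>_. euclidean) AP :: 'n bohr_point topology"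
  have ts: "topspace ?P = extensional AP" by (auto simp: PiE_def)
  have cl: "closedin ?P {h \<in> topspace ?P. F h = 0}" if "continuous_map ?P euclidean F" for F :: "'n bohr_point \<Rightarrow> complex"
    using closedin_continuous_map_preimage[OF that, of "{0}"] by simp
  have coord: "continuous_map ?P euclidean (\<lambda>h. h f)" if "f \<in> AP" for f by (rule continuous_map_product_coordinates[OF that])
  have mult: "continuous_map ?P euclidean (\<lambda>h. F h * G h)" if "continuous_map ?P euclidean F" "continuous_map ?P euclidean G" for F G :: "'n bohr_point \<Rightarrow> complex"
  proof -
    have "continuous_map ?P euclidean ((\<lambda>p. fst p * snd p) \<circ> (\<lambda>h. (F h, G h)))"
    proof (rule continuous_map_compose)
      show "continuous_map ?P (prod_topology euclidean euclidean) (\<lambda>h. (F h, G h))" by (intro continuous_map_paired[THEN iffD2] conjI that)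
      show "continuous_map (prod_topology euclidean euclidean) euclidean (\<lambda>p. fst p * snd p :: complex)"
        unfolding euclidean_product_topology by (auto intro!: continuous_intros)
    qed
    then show ?thesis by (simp add: comp_def)
  qed
  define A1 where "A1 = (\<Inter>p\<in>AP \<times> AP. {h \<in> topspace ?P. h (\<lambda>x. fst p x + snd p x) - (h (fst p) + h (snd p)) = 0})"
  define A2 where "A2 = (\<Inter>p\<in>UNIV \<times> AP. {h \<in> topspace ?P. h (\<lambda>x. fst p * snd p x) - fst p * h (snd p) = 0})"
  define A3 where "A3 = (\<Inter>p\<in>AP \<times> AP. {h \<in> topspace ?P. h (\<lambda>x. fst p x * snd p x) - h (fst p) * h (snd p) = 0})"
  \<comment> \<open>Being nonzero is not a closed condition; for multiplicative functionals it
    amounts to the value 1 at the constant 1, which is one.\<close>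
  define A4 where "A4 = {h \<in> topspace ?P. h (\<lambda>x. 1) - 1 = 0}"
  have ne: "(AP :: (real^'n \<Rightarrow> complex) set) \<noteq> {}" using const_AP[of 0] by blast
  have cI: "closedin ?P (\<Inter>p\<in>I. {h \<in> topspace ?P. F p h = 0})"
    if "I \<noteq> {}" "\<And>p. p \<in> I \<Longrightarrow> continuous_map ?P euclidean (F p)" for I and F :: "'z \<Rightarrow> 'n bohr_point \<Rightarrow> complex"
    by (rule closedin_INT[OF that(1)]) (rule cl[OF that(2)])
  have c1: "closedin ?P A1" unfolding A1_def
    by (rule cI) (use ne in \<open>auto intro!: continuous_map_diff continuous_map_add coord AP_add simp del: topspace_product_topology\<close>)
  have c2: "closedin ?P A2" unfolding A2_def
    by (rule cI) (use ne in \<open>auto intro!: continuous_map_diff mult coord AP_cmult simp del: topspace_product_topology\<close>)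
  have c3: "closedin ?P A3" unfolding A3_def
    by (rule cI) (use ne in \<open>auto intro!: continuous_map_diff mult coord AP_mult simp del: topspace_product_topology\<close>)
  have c4: "closedin ?P A4" unfolding A4_def
    by (rule cl) (auto intro!: continuous_map_diff coord)
  note cA = c1 c2 c3 c4
  have clb: "closedin ?P bohr"
  proof -
    have "A1 \<inter> A2 \<inter> A3 \<inter> A4 = bohr"
    proof
      show "bohr \<subseteq> A1 \<inter> A2 \<inter> A3 \<inter> A4"
      proof
        fix h :: "'n bohr_point" assume h: "h \<in> bohr"
        note b = bohrD[OF h]
        show "h \<in> A1 \<inter> A2 \<inter> A3 \<inter> A4"
          unfolding A1_def A2_def A3_def A4_def ts using b by auto
      qed
      show "A1 \<inter> A2 \<inter> A3 \<inter> A4 \<subseteq> bohr"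
      proof
        fix h assume h: "h \<in> A1 \<inter> A2 \<inter> A3 \<inter> A4"
        show "h \<in> bohr"
        proof (rule bohrI)
          show "h \<in> extensional AP" "h (\<lambda>x. 1) = 1" using h ts unfolding A4_def by auto
          show "h (\<lambda>x. f x + g x) = h f + h g" if "f \<in> AP" "g \<in> AP" for f g
            using h that unfolding A1_def by force
          show "h (\<lambda>x. f x * g x) = h f * h g" if "f \<in> AP" "g \<in> AP" for f g
            using h that unfolding A3_def by force
          show "h (\<lambda>x. c * f x) = c * h f" if "f \<in> AP" for c f
            using h that unfolding A2_def by force
        qed
      qed
    qed
    then show ?thesis using cA by (metis closedin_Int)
  qed
  have "\<forall>f\<in>AP::(real^'n \<Rightarrow> complex) set. \<exists>B. \<forall>x. norm (f x) \<le> B" using AP_bounded by blast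
  from bchoice[OF this] obtain B where B: "\<And>(f::real^'n \<Rightarrow> complex) x. f \<in> AP \<Longrightarrow> norm (f x) \<le> B f" by blast
  have "compactin ?P (\<Pi>\<^sub>E f\<in>AP. cball 0 (B f))"
    by (subst compactin_PiE) auto
  moreover have "bohr \<subseteq> (\<Pi>\<^sub>E f\<in>AP. cball 0 (B f))"
  proof
    fix h :: "'n bohr_point" assume h: "h \<in> bohr"
    have "norm (h f) \<le> B f" if "f \<in> AP" for f by (rule bohr_norm_le[OF h that B[OF that]])
    then show "h \<in> (\<Pi>\<^sub>E f\<in>AP. cball 0 (B f))" using bohrD(1)[OF h] by (auto simp: PiE_iff)
  qed
  ultimately have "compactin ?P bohr" using clb closed_compactin by blast
  then show ?thesis unfolding bohr_topology_def by (simp add: compact_space_subtopology)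
qed

text \<open>Translation by a vector of R^n: the group law with one argument in R^n. That argument
  stands on the right in the derivatives in x and on the left in the invariance of Haar measure;
  \<open>bohr_add_right\<close> and \<open>bohr_add_left\<close> identify both with this
  map.\<close>

definition bohr_shift :: "real^'n \<Rightarrow> 'n::finite bohr_point \<Rightarrow> 'n bohr_point" where
  "bohr_shift d y = restrict (\<lambda>f. y (\<lambda>x. f (x + d))) AP"

lemma bohr_in_in [simp]: "bohr_in x \<in> bohr"
  by (rule bohrI) (auto simp: bohr_in_def AP_add AP_mult AP_cmult)

lemma bohr_shift_in [simp]: assumes "y \<in> bohr" shows "bohr_shift d y \<in> bohr"
  by (rule bohrI)
     (use bohrD[OF assms] in \<open>auto simp: bohr_shift_def AP_add AP_mult AP_cmult AP_shift\<close>)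

lemma bohr_shift_apply: "f \<in> AP \<Longrightarrow> bohr_shift d y f = y (\<lambda>x. f (x + d))"
  by (simp add: bohr_shift_def)

lemma bohr_add_right: assumes "y \<in> bohr" shows "bohr_add y (bohr_in d) = bohr_shift d y"
proof
  fix f show "bohr_add y (bohr_in d) f = bohr_shift d y f"
    by (cases "f \<in> AP") (simp_all add: bohr_add_def bohr_shift_def bohr_in_def AP_shift')
qed

text \<open>Trigonometric polynomials are mapped to trigonometric polynomials, and h does not
  increase the supremum norm. Membership in \<open>AP\<close> matters because
  \<open>bohr_in d\<close> is \<open>undefined\<close> outside it.\<close>

lemma bohr_orbit_AP: assumes h: "h \<in> bohr" and f: "f \<in> AP" shows "(\<lambda>x. h (\<lambda>z. f (x + z))) \<in> AP"
  unfolding AP_iff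
proof (intro allI impI)
  fix \<epsilon> :: real assume e: "0 < \<epsilon>"
  obtain p where p: "p \<in> trig_polys" "\<And>x. norm (f x - p x) \<le> \<epsilon>" using f e unfolding AP_iff by blast
  obtain S a where S: "finite S" "p = (\<lambda>x. \<Sum>l\<in>S. a l * bohr_exp l x)" using p(1) unfolding trig_polys_def by blast
  have ps: "h (\<lambda>z. p (x + z)) = (\<Sum>l\<in>S. (a l * h (bohr_exp l)) * bohr_exp l x)" for x
  proof -
    have "(\<lambda>z. p (x + z)) = (\<lambda>z. \<Sum>l\<in>S. (a l * bohr_exp l x) * bohr_exp l z)" unfolding S(2) bohr_exp_shift by (simp add: mult_ac)
    then have "h (\<lambda>z. p (x + z)) = (\<Sum>l\<in>S. (a l * bohr_exp l x) * h (bohr_exp l))" using bohr_trig[OF h S(1), of "\<lambda>l. a l * bohr_exp l x"] by simp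
    then show ?thesis by (simp add: mult_ac)
  qed
  have "norm (h (\<lambda>z. f (x + z)) - h (\<lambda>z. p (x + z))) \<le> \<epsilon>" for x
  proof -
    have pAP: "p \<in> AP" by (rule trig_polys_AP[OF p(1)])
    have "h (\<lambda>z. f (x + z)) - h (\<lambda>z. p (x + z)) = h (\<lambda>z. f (x + z) - p (x + z))"
      using bohr_diff[OF h AP_shift'[OF f] AP_shift'[OF pAP]] by simp
    then show ?thesis using bohr_norm_le[OF h AP_diff[OF AP_shift'[OF f] AP_shift'[OF pAP]]] p(2) by simp
  qed
  moreover have "(\<lambda>x. h (\<lambda>z. p (x + z))) \<in> trig_polys"
    unfolding ps trig_polys_def using S(1)
    by (intro CollectI exI[of _ S] exI[of _ "\<lambda>l. a l * h (bohr_exp l)"] conjI refl)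
  ultimately show "\<exists>p\<in>trig_polys. \<forall>x. norm (h (\<lambda>z. f (x + z)) - p x) \<le> \<epsilon>"
    by (intro bexI[of _ "\<lambda>x. h (\<lambda>z. p (x + z))"] allI)
qed

lemma bohr_add_left: assumes "y \<in> bohr" shows "bohr_add (bohr_in d) y = bohr_shift d y"
proof
  fix f show "bohr_add (bohr_in d) y f = bohr_shift d y f"
  proof (cases "f \<in> AP")
    case True
    then show ?thesis using bohr_orbit_AP[OF assms True]
      by (simp add: bohr_add_def bohr_shift_def bohr_in_def add.commute)
  qed (simp add: bohr_add_def bohr_shift_def)
qed

lemma bohr_shift_shift: assumes "y \<in> bohr" shows "bohr_shift d (bohr_shift c y) = bohr_shift (c + d) y"
proof
  fix f show "bohr_shift d (bohr_shift c y) f = bohr_shift (c + d) y f"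
    by (cases "f \<in> AP") (simp_all add: bohr_shift_def AP_shift add_ac)
qed

lemma bohr_shift_zero: assumes "y \<in> bohr" shows "bohr_shift 0 y = y"
proof
  fix f show "bohr_shift 0 y f = y f"
    using bohrD(1)[OF assms] by (cases "f \<in> AP") (simp_all add: bohr_shift_def extensional_def)
qed

lemma bohr_shift_exp: assumes "y \<in> bohr" shows "bohr_shift d y (bohr_exp l) = bohr_exp l d * y (bohr_exp l)"
proof -
  have "bohr_shift d y (bohr_exp l) = y (\<lambda>x. bohr_exp l d * bohr_exp l x)"
    by (simp add: bohr_shift_def bohr_exp_shift mult.commute)
  also have "\<dots> = bohr_exp l d * y (bohr_exp l)" by (rule bohrD(3)[OF assms]) simp
  finally show ?thesis .
qed

lemma continuous_bohr_shift: "continuous_map bohr_topology bohr_topology (bohr_shift d)"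
proof -
  have "continuous_map bohr_topology (product_topology (\<lambda>_. euclidean) AP) (bohr_shift d)"
    unfolding continuous_map_componentwise
  proof (intro conjI ballI)
    show "bohr_shift d ` topspace bohr_topology \<subseteq> extensional AP" by (auto simp: bohr_shift_def)
    fix f :: "real^'a \<Rightarrow> complex" assume "f \<in> AP"
    then show "continuous_map bohr_topology euclidean (\<lambda>y. bohr_shift d y f)"
      using continuous_gelfand[OF AP_shift[of f d]] by (simp add: bohr_shift_apply)
  qed
  then show ?thesis unfolding bohr_topology_def[where 'n='a]
    by (subst continuous_map_in_subtopology) (auto simp: bohr_topology_def[symmetric])
qed

section \<open>Characters and Haar measure\<close>

definition bohr_char :: "real^'n \<Rightarrow> 'n::finite bohr_point \<Rightarrow> complex" where
  "bohr_char l y = y (bohr_exp l)"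

text \<open>The uniform closure of the trigonometric polynomials on the compactification. It is an
  algebra closed under composition with continuous real functions, which is enough to build Urysohn
  functions in it.\<close>

definition unif_approx :: "('n::finite bohr_point \<Rightarrow> complex) \<Rightarrow> bool" where
  "unif_approx F \<longleftrightarrow> (\<forall>\<epsilon>>0. \<exists>g. tspan bohr_char UNIV bohr g \<and> (\<forall>y\<in>bohr. norm (F y - g y) \<le> \<epsilon>))"

lemma bohr_char_add: "y \<in> bohr \<Longrightarrow> bohr_char (l + k) y = bohr_char l y * bohr_char k y"
  by (simp add: bohr_char_def bohr_exp_values)

lemma norm_bohr_char: "y \<in> bohr \<Longrightarrow> norm (bohr_char l y) = 1"
  by (simp add: bohr_char_def bohr_exp_values)

lemma bohr_char_zero: "y \<in> bohr \<Longrightarrow> bohr_char 0 y = 1"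
proof -
  assume y: "y \<in> bohr"
  have "bohr_exp 0 = (\<lambda>x::real^'a. 1)" by (simp add: fun_eq_iff)
  then show ?thesis using bohrD(5)[OF y] by (simp add: bohr_char_def)
qed

lemma bohr_char_uminus: assumes "y \<in> bohr" shows "bohr_char (- l) y = cnj (bohr_char l y)"
proof -
  have "bohr_char (- l) y * bohr_char l y = 1" using bohr_char_add[OF assms, of "- l" l] bohr_char_zero[OF assms] by simp
  moreover have "cnj (bohr_char l y) * bohr_char l y = 1"
    using norm_bohr_char[OF assms, of l] by (metis complex_norm_square mult.commute of_real_1 power_one)
  moreover have "bohr_char l y \<noteq> 0" using norm_bohr_char[OF assms, of l] by auto
  ultimately show ?thesis by (metis mult_right_cancel)
qed

lemma tspan_bohr_bounded: assumes "tspan bohr_char UNIV bohr g" shows "\<exists>B\<ge>0. \<forall>y\<in>bohr. norm (g y) \<le> B"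
proof -
  obtain S a where S: "finite S" "\<And>y. y \<in> bohr \<Longrightarrow> g y = (\<Sum>l\<in>S. a l * bohr_char l y)"
    using assms unfolding tspan_def by blast
  have "norm (g y) \<le> (\<Sum>l\<in>S. norm (a l))" if "y \<in> bohr" for y
    unfolding S(2)[OF that] by (rule order.trans[OF norm_sum]) (use norm_bohr_char[OF that] in \<open>auto simp: norm_mult\<close>)
  moreover have "0 \<le> (\<Sum>l\<in>S. norm (a l))" by (intro sum_nonneg) auto
  ultimately show ?thesis by blast
qed

lemma tspan_bohr_cnj: assumes "tspan bohr_char UNIV bohr g" shows "tspan bohr_char UNIV bohr (\<lambda>y. cnj (g y))"
proof -
  obtain S a where S: "finite S" "\<And>y. y \<in> bohr \<Longrightarrow> g y = (\<Sum>l\<in>S. a l * bohr_char l y)"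
    using assms unfolding tspan_def by blast
  have "cnj (g y) = (\<Sum>l\<in>uminus ` S. cnj (a (- l)) * bohr_char l y)" if "y \<in> bohr" for y
    unfolding S(2)[OF that] by (subst sum.reindex) (auto simp: bohr_char_uminus[OF that] inj_on_def)
  then show ?thesis unfolding tspan_def using S(1) by (intro exI[of _ "uminus ` S"] exI) auto
qed

lemma unif_approx_tspan: "tspan bohr_char UNIV bohr g \<Longrightarrow> unif_approx g"
  unfolding unif_approx_def by (intro allI impI exI[of _ g]) auto

lemma unif_approx_bounded: assumes "unif_approx F" obtains B where "0 \<le> B" "\<And>y. y \<in> bohr \<Longrightarrow> norm (F y) \<le> B"
proof -
  obtain g where g: "tspan bohr_char UNIV bohr g" "\<And>y. y \<in> bohr \<Longrightarrow> norm (F y - g y) \<le> 1"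
    using assms unfolding unif_approx_def by (meson zero_less_one)
  obtain B where B: "0 \<le> B" "\<And>y. y \<in> bohr \<Longrightarrow> norm (g y) \<le> B" using tspan_bohr_bounded[OF g(1)] by blast
  have "norm (F y) \<le> B + 1" if "y \<in> bohr" for y
    using norm_triangle_ineq[of "F y - g y" "g y"] g(2)[OF that] B(2)[OF that] by simp
  then show ?thesis using B(1) by (intro that[of "B + 1"]) auto
qed

lemma unif_approx_const: "unif_approx (\<lambda>y. c)"
proof -
  have "tspan bohr_char UNIV bohr (\<lambda>y. c * bohr_char 0 y)" by (rule tspan_single) simp
  then have "tspan bohr_char UNIV bohr (\<lambda>y. c)" by (subst tspan_cong[of _ _ "\<lambda>y. c * bohr_char 0 y"]) (auto simp: bohr_char_zero)
  then show ?thesis by (rule unif_approx_tspan)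
qed

lemma unif_approx_add: assumes "unif_approx F" "unif_approx G" shows "unif_approx (\<lambda>y. F y + G y)"
  unfolding unif_approx_def
proof (intro allI impI)
  fix \<epsilon> :: real assume e: "0 < \<epsilon>"
  obtain f where f: "tspan bohr_char UNIV bohr f" "\<And>y. y \<in> bohr \<Longrightarrow> norm (F y - f y) \<le> \<epsilon> / 2"
    using assms(1) e unfolding unif_approx_def by (meson half_gt_zero)
  obtain g where g: "tspan bohr_char UNIV bohr g" "\<And>y. y \<in> bohr \<Longrightarrow> norm (G y - g y) \<le> \<epsilon> / 2"
    using assms(2) e unfolding unif_approx_def by (meson half_gt_zero)
  have "norm (F y + G y - (f y + g y)) \<le> \<epsilon>" if "y \<in> bohr" for y
    using norm_triangle_ineq[of "F y - f y" "G y - g y"] f(2)[OF that] g(2)[OF that] by (simp add: algebra_simps)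
  then show "\<exists>g. tspan bohr_char UNIV bohr g \<and> (\<forall>y\<in>bohr. norm (F y + G y - g y) \<le> \<epsilon>)"
    using tspan_add[OF f(1) g(1)] by (intro exI[of _ "\<lambda>y. f y + g y"] conjI ballI)
qed

lemma unif_approx_mult: assumes "unif_approx F" "unif_approx G" shows "unif_approx (\<lambda>y. F y * G y)"
  unfolding unif_approx_def
proof (intro allI impI)
  fix \<epsilon> :: real assume e: "0 < \<epsilon>"
  obtain B where B: "0 \<le> B" "\<And>y. y \<in> bohr \<Longrightarrow> norm (F y) \<le> B" using unif_approx_bounded[OF assms(1)] by blast
  have "0 < \<epsilon> / (2 * (B + 1))" using e B by simp
  then obtain g where g: "tspan bohr_char UNIV bohr g" "\<And>y. y \<in> bohr \<Longrightarrow> norm (G y - g y) \<le> \<epsilon> / (2 * (B + 1))"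
    using assms(2) unfolding unif_approx_def by meson
  obtain D where D: "0 \<le> D" "\<And>y. y \<in> bohr \<Longrightarrow> norm (g y) \<le> D" using tspan_bohr_bounded[OF g(1)] by blast
  have "0 < \<epsilon> / (2 * (D + 1))" using e D by simp
  then obtain f where f: "tspan bohr_char UNIV bohr f" "\<And>y. y \<in> bohr \<Longrightarrow> norm (F y - f y) \<le> \<epsilon> / (2 * (D + 1))"
    using assms(1) unfolding unif_approx_def by meson
  have "norm (F y * G y - f y * g y) \<le> \<epsilon>" if y: "y \<in> bohr" for y
  proof -
    have "F y * G y - f y * g y = F y * (G y - g y) + (F y - f y) * g y" by (simp add: algebra_simps)
    also have "norm \<dots> \<le> norm (F y) * norm (G y - g y) + norm (F y - f y) * norm (g y)"
      using norm_triangle_ineq norm_mult by metis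
    also have "\<dots> \<le> B * (\<epsilon> / (2 * (B + 1))) + (\<epsilon> / (2 * (D + 1))) * D"
      using B(2)[OF y] D(2)[OF y] f(2)[OF y] g(2)[OF y] B(1) D(1) e by (intro add_mono mult_mono) auto
    also have "\<dots> \<le> \<epsilon> / 2 + \<epsilon> / 2" using B(1) D(1) e by (intro add_mono) (auto simp: field_simps)
    finally show ?thesis by simp
  qed
  then show "\<exists>g. tspan bohr_char UNIV bohr g \<and> (\<forall>y\<in>bohr. norm (F y * G y - g y) \<le> \<epsilon>)"
    using tspan_mult[OF f(1) g(1) bohr_char_add] by (intro exI[of _ "\<lambda>y. f y * g y"] conjI ballI) auto
qed

lemma unif_approx_cnj: assumes "unif_approx F" shows "unif_approx (\<lambda>y. cnj (F y))"
  unfolding unif_approx_def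
proof (intro allI impI)
  fix \<epsilon> :: real assume e: "0 < \<epsilon>"
  obtain f where f: "tspan bohr_char UNIV bohr f" "\<And>y. y \<in> bohr \<Longrightarrow> norm (F y - f y) \<le> \<epsilon>"
    using assms(1) e unfolding unif_approx_def by meson
  have "norm (cnj (F y) - cnj (f y)) \<le> \<epsilon>" if "y \<in> bohr" for y
    using f(2)[OF that] by (metis complex_cnj_diff complex_mod_cnj)
  then show "\<exists>g. tspan bohr_char UNIV bohr g \<and> (\<forall>y\<in>bohr. norm (cnj (F y) - g y) \<le> \<epsilon>)"
    using tspan_bohr_cnj[OF f(1)] by (intro exI[of _ "\<lambda>y. cnj (f y)"] conjI ballI)
qed

lemma unif_approx_limit:
  assumes "\<And>\<epsilon>. 0 < \<epsilon> \<Longrightarrow> \<exists>G. unif_approx G \<and> (\<forall>y\<in>bohr. norm (F y - G y) \<le> \<epsilon>)" shows "unif_approx F"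
  unfolding unif_approx_def
proof (intro allI impI)
  fix \<epsilon> :: real assume e: "0 < \<epsilon>"
  obtain G where G: "unif_approx G" "\<And>y. y \<in> bohr \<Longrightarrow> norm (F y - G y) \<le> \<epsilon> / 2" using assms[of "\<epsilon> / 2"] e by auto
  obtain g where g: "tspan bohr_char UNIV bohr g" "\<And>y. y \<in> bohr \<Longrightarrow> norm (G y - g y) \<le> \<epsilon> / 2"
    using G(1) e unfolding unif_approx_def by (meson half_gt_zero)
  have "norm (F y - g y) \<le> \<epsilon>" if "y \<in> bohr" for y
    using norm_triangle_ineq[of "F y - G y" "G y - g y"] G(2)[OF that] g(2)[OF that] by simp
  then show "\<exists>g. tspan bohr_char UNIV bohr g \<and> (\<forall>y\<in>bohr. norm (F y - g y) \<le> \<epsilon>)" using g(1) by blast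
qed

lemma unif_approx_sum: "(\<And>i. i \<in> I \<Longrightarrow> unif_approx (F i)) \<Longrightarrow> unif_approx (\<lambda>y. \<Sum>i\<in>I. F i y)"
  by (induction I rule: infinite_finite_induct) (auto intro: unif_approx_add unif_approx_const)

lemma unif_approx_prod: "(\<And>i. i \<in> I \<Longrightarrow> unif_approx (F i)) \<Longrightarrow> unif_approx (\<lambda>y. \<Prod>i\<in>I. F i y)"
  by (induction I rule: infinite_finite_induct) (auto intro: unif_approx_mult unif_approx_const)

lemma unif_approx_gelfand: assumes "f \<in> AP" shows "unif_approx (\<lambda>y. y f)"
  unfolding unif_approx_def
proof (intro allI impI)
  fix \<epsilon> :: real assume e: "0 < \<epsilon>"
  obtain p where p: "p \<in> trig_polys" "\<And>x. norm (f x - p x) \<le> \<epsilon>" using assms e unfolding AP_iff by blast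
  obtain S a where S: "finite S" "p = (\<lambda>x. \<Sum>l\<in>S. a l * bohr_exp l x)" using p(1) unfolding trig_polys_def by blast
  have "norm (y f - y p) \<le> \<epsilon>" if y: "y \<in> bohr" for y
  proof -
    have pAP: "p \<in> AP" by (rule trig_polys_AP[OF p(1)])
    show ?thesis using bohr_norm_le[OF y AP_diff[OF assms pAP] p(2)] bohr_diff[OF y assms pAP] by simp
  qed
  moreover have "tspan bohr_char UNIV bohr (\<lambda>y. y p)"
    unfolding tspan_def S(2) using S(1) bohr_trig[OF _ S(1)] by (auto simp: bohr_char_def)
  ultimately show "\<exists>g. tspan bohr_char UNIV bohr g \<and> (\<forall>y\<in>bohr. norm (y f - g y) \<le> \<epsilon>)"
    by (intro exI[of _ "\<lambda>y. y p"]) auto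
qed

lemma unif_approx_polynomial:
  assumes "real_polynomial_function (g :: real \<Rightarrow> real)" "unif_approx (\<lambda>y. of_real (q y))"
  shows "unif_approx (\<lambda>y. of_real (g (q y)))"
  using assms(1)
proof (induction g rule: real_polynomial_function.induct)
  case (linear f)
  then obtain c where "f = (\<lambda>x. x * c)" using real_bounded_linear by blast
  then show ?case using unif_approx_mult[OF assms(2) unif_approx_const, of "of_real c"] by simp
qed (auto intro: unif_approx_const unif_approx_add unif_approx_mult)

text \<open>On the bounded range of q, g is a uniform limit of polynomials by Weierstrass' theorem,
  and polynomials of q stay in the algebra.\<close>

lemma unif_approx_continuous:
  assumes c: "continuous_on UNIV (g :: real \<Rightarrow> real)" and q: "unif_approx (\<lambda>y. of_real (q y))"
  shows "unif_approx (\<lambda>y. of_real (g (q y)))"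
proof (rule unif_approx_limit)
  fix \<epsilon> :: real assume e: "0 < \<epsilon>"
  obtain B where B: "0 \<le> B" "\<And>y. y \<in> bohr \<Longrightarrow> norm (of_real (q y) :: complex) \<le> B" using unif_approx_bounded[OF q] by blast
  obtain p where p: "real_polynomial_function p" "\<And>x. x \<in> {-B..B} \<Longrightarrow> \<bar>g x - p x\<bar> < \<epsilon>"
  proof (rule Stone_Weierstrass_real_polynomial_function[of "{-B..B}" g \<epsilon>])
    show "continuous_on {-B..B} g" using c continuous_on_subset by blast
  qed (use e in auto)
  have "norm (of_real (g (q y)) - of_real (p (q y)) :: complex) \<le> \<epsilon>" if "y \<in> bohr" for y
    using p(2)[of "q y"] B(2)[OF that] unfolding of_real_diff[symmetric] norm_of_real by (auto simp: abs_le_iff)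
  then show "\<exists>G. unif_approx G \<and> (\<forall>y\<in>bohr. norm (of_real (g (q y)) - G y) \<le> \<epsilon>)"
    using unif_approx_polynomial[OF p(1) q] by (intro exI[of _ "\<lambda>y. of_real (p (q y))"]) auto
qed

section \<open>Urysohn functions that are uniform limits of trigonometric polynomials\<close>

lemma bohr_open_nhd:
  assumes U: "openin bohr_topology U" and y: "y \<in> U"
  shows "\<exists>J \<delta>. finite J \<and> J \<subseteq> AP \<and> 0 < \<delta> \<and> (\<forall>z\<in>bohr. (\<forall>f\<in>J. norm (z f - y f) < \<delta>) \<longrightarrow> z \<in> U)"
proof -
  obtain T where T: "openin (product_topology (\<lambda>_. euclidean) AP) T" "U = T \<inter> bohr"
    using U unfolding bohr_topology_def openin_subtopology by blast
  obtain V where V: "finite {i \<in> AP. V i \<noteq> UNIV}" "\<And>i. i \<in> AP \<Longrightarrow> open (V i)" "y \<in> Pi\<^sub>E AP V" "Pi\<^sub>E AP V \<subseteq> T"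
    using T y unfolding openin_product_topology_alt by auto
  define J where "J = {i \<in> AP. V i \<noteq> UNIV}"
  have "\<forall>f\<in>J. \<exists>d>0. ball (y f) d \<subseteq> V f"
    using V(2,3) unfolding J_def by (auto simp: PiE_iff open_contains_ball)
  from bchoice[OF this] obtain d where d: "\<And>f. f \<in> J \<Longrightarrow> 0 < d f \<and> ball (y f) (d f) \<subseteq> V f" by blast
  \<comment> \<open>The inserted 1 covers the case of a neighbourhood without constraints.\<close>
  define \<delta> where "\<delta> = Min (insert 1 (d ` J))"
  have fJ: "finite J" using V(1) by (simp add: J_def)
  have dp: "0 < \<delta>" unfolding \<delta>_def using fJ d by (subst Min_gr_iff) auto
  have dl: "\<delta> \<le> d f" if "f \<in> J" for f unfolding \<delta>_def using fJ that by (intro Min_le) auto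
  have "z \<in> U" if z: "z \<in> bohr" "\<forall>f\<in>J. norm (z f - y f) < \<delta>" for z
  proof -
    have "z f \<in> V f" if f: "f \<in> AP" for f
    proof (cases "f \<in> J")
      case True
      then have "z f \<in> ball (y f) (d f)" using z(2) dl[OF True] by (force simp: dist_norm norm_minus_commute)
      then show ?thesis using d[OF True] by blast
    qed (use f in \<open>auto simp: J_def\<close>)
    then have "z \<in> Pi\<^sub>E AP V" using bohrD(1)[OF z(1)] by (auto simp: PiE_iff)
    then show ?thesis using V(4) T(2) z(1) by blast
  qed
  then show ?thesis using fJ dp by (intro exI[of _ J] exI[of _ \<delta>]) (auto simp: J_def)
qed

text \<open>Around each y in K a normalized sum of squares \<open>q y\<close> of finitely many |z f
  - y f| lies in the algebra, vanishes at y, and is below 1 only inside U. Finitely many sets where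
  it is below 1/2 cover K, and one minus the product of cut-offs of these functions is the desired
  function.\<close>

lemma bohr_urysohn:
  assumes K: "compactin bohr_topology K" and U: "openin bohr_topology U" "K \<subseteq> U"
  shows "\<exists>F :: 'n::finite bohr_point \<Rightarrow> real. unif_approx (\<lambda>y. of_real (F y)) \<and> (\<forall>y. 0 \<le> F y \<and> F y \<le> 1) \<and> (\<forall>y\<in>K. F y = 1) \<and> (\<forall>y\<in>bohr - U. F y = 0)"
proof -
  have Kb: "K \<subseteq> bohr" using compactin_subset_topspace[OF K] by simp
  have "\<forall>y\<in>K. \<exists>J \<delta>. finite J \<and> J \<subseteq> AP \<and> 0 < \<delta> \<and> (\<forall>z\<in>bohr. (\<forall>f\<in>J. norm (z f - y f) < \<delta>) \<longrightarrow> z \<in> U)"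
    using bohr_open_nhd[OF U(1)] U(2) by blast
  from bchoice[OF this] obtain J where J: "\<forall>y\<in>K. \<exists>\<delta>. finite (J y) \<and> J y \<subseteq> AP \<and> 0 < \<delta> \<and> (\<forall>z\<in>bohr. (\<forall>f\<in>J y. norm (z f - y f) < \<delta>) \<longrightarrow> z \<in> U)" ..
  from bchoice[OF J] obtain d where d: "\<forall>y\<in>K. finite (J y) \<and> J y \<subseteq> AP \<and> 0 < d y \<and> (\<forall>z\<in>bohr. (\<forall>f\<in>J y. norm (z f - y f) < d y) \<longrightarrow> z \<in> U)" ..
  define q where "q y z = (\<Sum>f\<in>J y. (norm (z f - y f))^2) / (d y)^2" for y z :: "'n bohr_point"
  have q0: "0 \<le> q y z" for y z unfolding q_def by (intro divide_nonneg_nonneg sum_nonneg) auto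
  have qU: "z \<in> U" if "y \<in> K" "z \<in> bohr" "q y z < 1" for y z
  proof -
    have dy: "0 < d y" "finite (J y)" using d that(1) by auto
    have "norm (z f - y f) < d y" if f: "f \<in> J y" for f
    proof -
      have "(norm (z f - y f))^2 \<le> (\<Sum>f\<in>J y. (norm (z f - y f))^2)" using dy f by (intro member_le_sum) auto
      also have "\<dots> < (d y)^2" using \<open>q y z < 1\<close> dy by (simp add: q_def divide_less_eq)
      finally show ?thesis using dy by (simp add: power_less_imp_less_base[of _ 2])
    qed
    then show ?thesis using d that by blast
  qed
  have qua: "unif_approx (\<lambda>z. of_real (q y z))" if "y \<in> K" for y
  proof -
    have "unif_approx (\<lambda>z. of_real (1 / (d y)^2) * (\<Sum>f\<in>J y. (z f + (- y f)) * cnj (z f + (- y f))))"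
      using d that by (intro unif_approx_mult unif_approx_const unif_approx_sum unif_approx_add unif_approx_cnj unif_approx_gelfand) auto
    moreover have "of_real (1 / (d y)^2) * (\<Sum>f\<in>J y. (z f + (- y f)) * cnj (z f + (- y f))) = complex_of_real (q y z)" for z
      unfolding q_def by (simp add: complex_norm_square[symmetric] del: complex_cnj_add complex_cnj_diff)
    ultimately show ?thesis by simp
  qed
  define W where "W y = {z \<in> bohr. q y z < 1/2}" for y
  have Wo: "openin bohr_topology (W y)" if "y \<in> K" for y
  proof -
    have "continuous_map bohr_topology euclidean (q y)"
      unfolding q_def
    proof (intro continuous_map_real_divide continuous_map_sum)
      fix f assume "f \<in> J y"
      then have f: "f \<in> AP" using d that by auto
      have "continuous_map bohr_topology euclidean ((\<lambda>w. (norm (w - y f))^2) \<circ> (\<lambda>z. z f))"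
        by (rule continuous_map_compose[OF continuous_gelfand[OF f]]) (auto intro!: continuous_intros)
      then show "continuous_map bohr_topology euclidean (\<lambda>z. (norm (z f - y f))^2)" by (simp add: comp_def)
    qed (use d that in auto)
    from openin_continuous_map_preimage[OF this, of "{..<1/2}"] show ?thesis by (simp add: W_def)
  qed
  have "K \<subseteq> \<Union>(W ` K)"
  proof
    fix y assume y: "y \<in> K"
    then have "q y y = 0" by (simp add: q_def)
    then show "y \<in> \<Union>(W ` K)" using y Kb by (auto simp: W_def intro!: bexI[of _ y])
  qed
  then obtain \<F> where F: "finite \<F>" "\<F> \<subseteq> W ` K" "K \<subseteq> \<Union>\<F>"
    using K Wo unfolding compactin_def by (metis (no_types, lifting) imageE)
  then obtain Y where Y: "finite Y" "Y \<subseteq> K" "\<F> = W ` Y" by (meson finite_subset_image)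
  \<comment> \<open>Zero up to 1/2 and one from 1 on: a point of K makes one factor of the product
    vanish, a point outside U leaves all factors equal to 1.\<close>
  define \<psi> :: "real \<Rightarrow> real" where "\<psi> x = max 0 (min 1 (2 * x - 1))" for x
  have pc: "continuous_on UNIV \<psi>" unfolding \<psi>_def by (intro continuous_intros)
  have p01: "0 \<le> \<psi> x" "\<psi> x \<le> 1" for x by (auto simp: \<psi>_def)
  define Fn where "Fn z = 1 - (\<Prod>y\<in>Y. \<psi> (q y z))" for z
  show ?thesis
  proof (intro exI[of _ Fn] conjI allI ballI)
    have "unif_approx (\<lambda>z. 1 + (-1) * (\<Prod>y\<in>Y. of_real (\<psi> (q y z))))"
      using Y(2) by (intro unif_approx_add unif_approx_mult unif_approx_const unif_approx_prod unif_approx_continuous[OF pc] qua) auto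
    then show "unif_approx (\<lambda>y. of_real (Fn y))" by (simp add: Fn_def)
    show "0 \<le> Fn y" "Fn y \<le> 1" for y using p01 by (auto simp: Fn_def intro!: prod_le_1 prod_nonneg)
    show "Fn z = 1" if z: "z \<in> K" for z
    proof -
      obtain y where y: "y \<in> Y" "z \<in> W y" using F(3) Y(3) z by blast
      then have "\<psi> (q y z) = 0" by (auto simp: W_def \<psi>_def)
      then have "(\<Prod>y\<in>Y. \<psi> (q y z)) = 0" using Y(1) y(1) by (intro prod_zero) auto
      then show ?thesis by (simp add: Fn_def)
    qed
    show "Fn z = 0" if z: "z \<in> bohr - U" for z
    proof -
      have "\<psi> (q y z) = 1" if "y \<in> Y" for y
        using qU[of y z] z that Y(2) by (force simp: \<psi>_def)
      then show ?thesis by (simp add: Fn_def)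
    qed
  qed
qed

section \<open>Haar measure, orthogonality of characters and density of trigonometric
  polynomials\<close>

locale haar_space =
  fixes m :: "'n::finite bohr_point measure"
  assumes haar: "normalized_haar m"
begin

lemma space_m: "space m = bohr" and sets_m: "sets m = sigma_sets bohr {U. openin bohr_topology U}"
  and emeasure_m: "emeasure m bohr = 1"
  and outer: "A \<in> sets m \<Longrightarrow> emeasure m A = (INF U\<in>{U. openin bohr_topology U \<and> A \<subseteq> U}. emeasure m U)"
  and inner: "A \<in> sets m \<Longrightarrow> emeasure m A = (SUP K\<in>{K. compactin bohr_topology K \<and> K \<subseteq> A \<and> K \<in> sets m}. emeasure m K)"
  and invariant: "g \<in> bohr \<Longrightarrow> A \<in> sets m \<Longrightarrow> emeasure m (bohr_add g ` A) = emeasure m A"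
  using haar unfolding normalized_haar_def by blast+

sublocale finite_measure m
  by (rule finite_measureI) (simp add: space_m emeasure_m)

lemma open_sets: "openin bohr_topology U \<Longrightarrow> U \<in> sets m"
  unfolding sets_m by auto

lemma borel_measurable_continuous_map:
  fixes f :: "'n bohr_point \<Rightarrow> 'b::topological_space"
  assumes "continuous_map bohr_topology euclidean f" shows "f \<in> borel_measurable m"
proof (rule borel_measurableI)
  fix S :: "'b set" assume "open S"
  then have "openin bohr_topology {x \<in> bohr. f x \<in> S}" using openin_continuous_map_preimage[OF assms, of S] by simp
  moreover have "f -` S \<inter> space m = {x \<in> bohr. f x \<in> S}" by (auto simp: space_m)
  ultimately show "f -` S \<inter> space m \<in> sets m" using open_sets by simp
qed

lemma bohr_char_measurable[measurable]: "bohr_char l \<in> borel_measurable m"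
  unfolding bohr_char_def by (intro borel_measurable_continuous_map continuous_gelfand) simp

lemma bohr_shift_measurable[measurable]: "bohr_shift d \<in> measurable m m"
proof (rule measurable_sigma_sets[OF sets_m])
  show "{U. openin bohr_topology U} \<subseteq> Pow bohr" using openin_subset by fastforce
  show "bohr_shift d \<in> space m \<rightarrow> bohr" by (auto simp: space_m)
  fix U :: "'n bohr_point set" assume "U \<in> {U. openin bohr_topology U}"
  then have "openin bohr_topology {y \<in> bohr. bohr_shift d y \<in> U}"
    using openin_continuous_map_preimage[OF continuous_bohr_shift, of U d] by simp
  moreover have "bohr_shift d -` U \<inter> space m = {y \<in> bohr. bohr_shift d y \<in> U}" by (auto simp: space_m)
  ultimately show "bohr_shift d -` U \<inter> space m \<in> sets m" using open_sets by simp
qed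

lemma distr_bohr_shift: "distr m m (bohr_shift d) = m"
proof (rule measure_eqI)
  fix A assume "A \<in> sets (distr m m (bohr_shift d))"
  then have A: "A \<in> sets m" by simp
  then have Ab: "A \<subseteq> bohr" using sets.sets_into_space space_m by blast
  \<comment> \<open>Invariance is given for images while a push-forward needs preimages: the
    preimage under the shift by d is the translate by - d.\<close>
  have "bohr_shift d -` A \<inter> space m = bohr_add (bohr_in (- d)) ` A"
  proof
    show "bohr_shift d -` A \<inter> space m \<subseteq> bohr_add (bohr_in (- d)) ` A"
    proof
      fix y assume y: "y \<in> bohr_shift d -` A \<inter> space m"
      then have yb: "y \<in> bohr" by (simp add: space_m)
      then have "y = bohr_add (bohr_in (- d)) (bohr_shift d y)"
        by (simp add: bohr_add_left bohr_shift_shift bohr_shift_zero)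
      then show "y \<in> bohr_add (bohr_in (- d)) ` A" using y by blast
    qed
    show "bohr_add (bohr_in (- d)) ` A \<subseteq> bohr_shift d -` A \<inter> space m"
    proof
      fix y assume "y \<in> bohr_add (bohr_in (- d)) ` A"
      then obtain z where z: "z \<in> A" "y = bohr_add (bohr_in (- d)) z" by blast
      then have zb: "z \<in> bohr" using Ab by blast
      then show "y \<in> bohr_shift d -` A \<inter> space m"
        using z by (simp add: bohr_add_left bohr_shift_shift bohr_shift_zero space_m)
    qed
  qed
  then show "emeasure (distr m m (bohr_shift d)) A = emeasure m A"
    using A invariant[OF bohr_in_in A] by (simp add: emeasure_distr)
qed simp

lemma integral_bohr_shift:
  fixes f :: "'n bohr_point \<Rightarrow> 'b::{banach, second_countable_topology}"
  assumes "f \<in> borel_measurable m" shows "(\<integral>y. f (bohr_shift d y) \<partial>m) = (\<integral>y. f y \<partial>m)"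
  using integral_distr[OF bohr_shift_measurable assms, of d] by (simp add: distr_bohr_shift)

lemma bohr_char_integral: assumes "l \<noteq> 0" shows "(\<integral>y. bohr_char l y \<partial>m) = 0"
proof -
  \<comment> \<open>Chosen so that \<open>l \<bullet> x\<close> is 1/2: translation by x changes the
    sign of the character, whose integral is therefore zero.\<close>
  define x where "x = (1 / (2 * (l \<bullet> l))) *\<^sub>R l"
  have lx: "l \<bullet> x = 1 / 2" using assms by (simp add: x_def)
  have "2 * of_real pi * \<i> * complex_of_real (l \<bullet> x) = \<i> * of_real pi" unfolding lx by simp
  then have x: "bohr_exp l x = - 1" unfolding bohr_exp_def by (simp only: exp_pi_i')
  have "(\<integral>y. bohr_char l y \<partial>m) = (\<integral>y. bohr_char l (bohr_shift x y) \<partial>m)"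
    by (rule integral_bohr_shift[symmetric]) simp
  also have "\<dots> = (\<integral>y. - bohr_char l y \<partial>m)"
    by (intro Bochner_Integration.integral_cong) (auto simp: bohr_char_def bohr_shift_exp space_m x)
  also have "\<dots> = - (\<integral>y. bohr_char l y \<partial>m)" by (rule integral_minus)
  finally show ?thesis by simp
qed

sublocale char_space m bohr_char
proof
  show "measure m (space m) = 1" by (simp add: measure_def space_m emeasure_m)
qed (auto simp: space_m norm_bohr_char bohr_char_add bohr_char_integral)

lemma tspan_measurable: assumes "tspan bohr_char UNIV bohr g" shows "g \<in> borel_measurable m"
proof -
  obtain S a where S: "finite S" "\<And>y. y \<in> bohr \<Longrightarrow> g y = (\<Sum>l\<in>S. a l * bohr_char l y)"
    using assms unfolding tspan_def by blast
  have "(\<lambda>y. \<Sum>l\<in>S. a l * bohr_char l y) \<in> borel_measurable m" by measurable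
  then show ?thesis using measurable_cong[of m g "\<lambda>y. \<Sum>l\<in>S. a l * bohr_char l y"] S(2) by (simp add: space_m)
qed

lemma tspan_integrable: assumes "tspan bohr_char UNIV bohr g" shows "integrable m g"
proof -
  obtain B where "0 \<le> B" "\<And>y. y \<in> bohr \<Longrightarrow> norm (g y) \<le> B" using tspan_bohr_bounded[OF assms] by blast
  then show ?thesis by (intro integrable_bdd[where B=B] tspan_measurable[OF assms]) (auto simp: space_m)
qed

text \<open>Regularity squeezes A between a compact K and an open U whose difference has measure
  below 2 \<epsilon> / 3. A Urysohn function for K and U differs from the indicator of A on
  \<open>U - K\<close> only, and replacing it by a trigonometric polynomial costs the remaining
  \<epsilon> / 3.\<close>

lemma dense_indicator:
  assumes A: "A \<in> sets m" and e: "0 < \<epsilon>"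
  shows "\<exists>g. tspan bohr_char UNIV bohr g \<and> (\<integral>y. norm (indicator A y - g y) \<partial>m) \<le> \<epsilon>"
proof -
  have e3: "0 < \<epsilon> / 3" using e by simp
  have fin: "emeasure m A \<noteq> \<infinity>" using emeasure_finite[of A] by simp
  obtain U where U: "openin bohr_topology U" "A \<subseteq> U" "emeasure m U < emeasure m A + ennreal (\<epsilon> / 3)"
    using INF_approx_ennreal[OF e3 outer[OF A] fin] by blast
  obtain K where K: "compactin bohr_topology K" "K \<subseteq> A" "K \<in> sets m" "emeasure m A < emeasure m K + ennreal (\<epsilon> / 3)"
  proof -
    have "{K. compactin bohr_topology K \<and> K \<subseteq> A \<and> K \<in> sets m} \<noteq> {}" by (auto intro!: exI[of _ "{}"])
    from SUP_approx_ennreal[OF e3 this inner[OF A] fin] show ?thesis using that by blast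
  qed
  have Us: "U \<in> sets m" by (rule open_sets[OF U(1)])
  have mU: "measure m U < measure m A + \<epsilon> / 3"
    using U(3) e unfolding emeasure_eq_measure by (simp add: ennreal_plus[symmetric] ennreal_less_iff del: ennreal_plus)
  have mK: "measure m A < measure m K + \<epsilon> / 3"
    using K(4) e unfolding emeasure_eq_measure by (simp add: ennreal_plus[symmetric] ennreal_less_iff del: ennreal_plus)
  obtain F where F: "unif_approx (\<lambda>y. of_real (F y))" "\<And>y. 0 \<le> F y \<and> F y \<le> (1::real)" "\<And>y. y \<in> K \<Longrightarrow> F y = 1" "\<And>y. y \<in> bohr - U \<Longrightarrow> F y = 0"
    using bohr_urysohn[OF K(1) U(1)] K(2) U(2) by blast
  obtain g where g: "tspan bohr_char UNIV bohr g" "\<And>y. y \<in> bohr \<Longrightarrow> norm (of_real (F y) - g y) \<le> \<epsilon> / 3"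
    using F(1) e unfolding unif_approx_def by (metis divide_pos_pos zero_less_numeral)
  have UK: "U - K \<in> sets m" using Us K(3) by auto
  have mUK: "measure m (U - K) = measure m U - measure m K"
    using Us K U by (intro finite_measure_Diff) auto
  have pw: "norm (indicator A y - g y) \<le> indicator (U - K) y + \<epsilon> / 3" if y: "y \<in> space m" for y
  proof -
    have yb: "y \<in> bohr" using y by (simp add: space_m)
    have "norm (indicator A y - of_real (F y) :: complex) \<le> indicator (U - K) y"
    proof -
      have "norm (indicator A y - of_real (F y) :: complex) = \<bar>indicator A y - F y\<bar>"
        by (metis norm_of_real of_real_diff of_real_indicator real_norm_def)
      also have "\<dots> \<le> indicator (U - K) y"
        using F(2)[of y] F(3)[of y] F(4)[of y] yb K(2) U(2) by (auto simp: indicator_def split: if_splits)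
      finally show ?thesis .
    qed
    then show ?thesis using g(2)[OF yb] norm_triangle_ineq[of "indicator A y - of_real (F y)" "of_real (F y) - g y"] by simp
  qed
  have ig: "integrable m g" by (rule tspan_integrable[OF g(1)])
  have iA: "integrable m (indicator A :: _ \<Rightarrow> complex)"
    by (rule integrable_bdd[where B=1]) (use A in \<open>auto simp: indicator_def\<close>)
  have iUK: "integrable m (indicator (U - K) :: _ \<Rightarrow> real)" using UK by (intro integrable_real_indicator) (auto simp: emeasure_eq_measure)
  have "(\<integral>y. norm (indicator A y - g y) \<partial>m) \<le> (\<integral>y. indicator (U - K) y + \<epsilon> / 3 \<partial>m)"
    by (rule integral_mono) (use ig iA iUK pw in auto)
  also have "\<dots> = measure m (U - K) + \<epsilon> / 3"
    using iUK UK total by simp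
  also have "\<dots> \<le> \<epsilon>" unfolding mUK using mU mK by simp
  finally show ?thesis using g(1) by blast
qed

lemma dense_L1:
  fixes f :: "'n bohr_point \<Rightarrow> complex"
  assumes "integrable m f"
  shows "\<forall>\<epsilon>>0. \<exists>g. tspan bohr_char UNIV bohr g \<and> (\<integral>y. norm (f y - g y) \<partial>m) \<le> \<epsilon>"
  using assms
proof (induct rule: integrable_induct)
  case (base A c)
  show ?case
  proof (intro allI impI)
    fix \<epsilon> :: real assume e: "0 < \<epsilon>"
    have "0 < \<epsilon> / (norm c + 1)" using e by (intro divide_pos_pos add_nonneg_pos) auto
    from dense_indicator[OF base(1) this] obtain g where g: "tspan bohr_char UNIV bohr g" "(\<integral>y. norm (indicator A y - g y) \<partial>m) \<le> \<epsilon> / (norm c + 1)" by blast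
    have "(\<integral>y. norm (indicator A y *\<^sub>R c - c * g y) \<partial>m) = (\<integral>y. norm c * norm (indicator A y - g y) \<partial>m)"
    proof (intro Bochner_Integration.integral_cong refl)
      fix y
      have "indicator A y *\<^sub>R c - c * g y = c * (indicator A y - g y)" by (auto simp: indicator_def algebra_simps)
      then show "norm (indicator A y *\<^sub>R c - c * g y) = norm c * norm (indicator A y - g y)" by (simp add: norm_mult)
    qed
    also have "\<dots> = norm c * (\<integral>y. norm (indicator A y - g y) \<partial>m)" by simp
    also have "\<dots> \<le> norm c * (\<epsilon> / (norm c + 1))" by (rule mult_left_mono[OF g(2)]) simp
    also have "\<dots> \<le> \<epsilon>"
    proof -
      have "0 < norm c + 1" by (simp add: add_nonneg_pos)
      then have "norm c / (norm c + 1) * \<epsilon> \<le> 1 * \<epsilon>" using e by (intro mult_right_mono) auto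
      then show ?thesis by simp
    qed
    finally show "\<exists>g. tspan bohr_char UNIV bohr g \<and> (\<integral>y. norm (indicator A y *\<^sub>R c - g y) \<partial>m) \<le> \<epsilon>"
      using tspan_cmult[OF g(1)] by blast
  qed
next
  case (add f1 f2)
  show ?case
  proof (intro allI impI)
    fix \<epsilon> :: real assume e: "0 < \<epsilon>"
    obtain g1 where g1: "tspan bohr_char UNIV bohr g1" "(\<integral>y. norm (f1 y - g1 y) \<partial>m) \<le> \<epsilon> / 2" using add(2) e by (meson half_gt_zero)
    obtain g2 where g2: "tspan bohr_char UNIV bohr g2" "(\<integral>y. norm (f2 y - g2 y) \<partial>m) \<le> \<epsilon> / 2" using add(4) e by (meson half_gt_zero)
    note i = add(1,3) tspan_integrable[OF g1(1)] tspan_integrable[OF g2(1)]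
    have "(\<integral>y. norm (f1 y + f2 y - (g1 y + g2 y)) \<partial>m) \<le> (\<integral>y. norm (f1 y - g1 y) + norm (f2 y - g2 y) \<partial>m)"
    proof (rule integral_mono)
      show "norm (f1 y + f2 y - (g1 y + g2 y)) \<le> norm (f1 y - g1 y) + norm (f2 y - g2 y)" for y
        using norm_triangle_ineq[of "f1 y - g1 y" "f2 y - g2 y"] by (simp add: algebra_simps)
    qed (use i in auto)
    also have "\<dots> = (\<integral>y. norm (f1 y - g1 y) \<partial>m) + (\<integral>y. norm (f2 y - g2 y) \<partial>m)" using i by simp
    also have "\<dots> \<le> \<epsilon>" using g1(2) g2(2) by simp
    finally show "\<exists>g. tspan bohr_char UNIV bohr g \<and> (\<integral>y. norm (f1 y + f2 y - g y) \<partial>m) \<le> \<epsilon>"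
      using tspan_add[OF g1(1) g2(1)] by blast
  qed
next
  case (lim f s)
  show ?case
  proof (intro allI impI)
    fix \<epsilon> :: real assume e: "0 < \<epsilon>"
    have "(\<lambda>i. \<integral>y. norm (f y - s i y) \<partial>m) \<longlonglongrightarrow> (\<integral>y. 0 \<partial>m)"
    \<comment> \<open>The simple functions are bounded by 2 |f|, hence the factor 3.\<close>
    proof (rule integral_dominated_convergence[where w="\<lambda>y. 3 * norm (f y)"])
      show "(\<lambda>y. norm (f y - s i y)) \<in> borel_measurable m" for i using lim(1)[of i] lim(5) by auto
      show "integrable m (\<lambda>y. 3 * norm (f y))" using lim(5) by auto
      show "AE y in m. (\<lambda>i. norm (f y - s i y)) \<longlonglongrightarrow> 0"
        using lim(3) by (intro AE_I2 tendsto_eq_intros) (auto intro!: tendsto_eq_intros)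
      show "AE y in m. norm (norm (f y - s i y)) \<le> 3 * norm (f y)" for i
      proof (rule AE_I2)
        fix y assume "y \<in> space m"
        then show "norm (norm (f y - s i y)) \<le> 3 * norm (f y)"
          using lim(4)[of y i] norm_triangle_ineq4[of "f y" "s i y"] by simp
      qed
    qed auto
    then have "eventually (\<lambda>i. (\<integral>y. norm (f y - s i y) \<partial>m) < \<epsilon> / 2) sequentially"
      using e by (intro order_tendstoD) auto
    then obtain i where i: "(\<integral>y. norm (f y - s i y) \<partial>m) < \<epsilon> / 2" by (auto simp: eventually_sequentially)
    obtain g where g: "tspan bohr_char UNIV bohr g" "(\<integral>y. norm (s i y - g y) \<partial>m) \<le> \<epsilon> / 2" using lim(2)[of i] e by (meson half_gt_zero)
    note ii = lim(5) lim(1)[of i] tspan_integrable[OF g(1)]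
    have "(\<integral>y. norm (f y - g y) \<partial>m) \<le> (\<integral>y. norm (f y - s i y) + norm (s i y - g y) \<partial>m)"
    proof (rule integral_mono)
      show "norm (f y - g y) \<le> norm (f y - s i y) + norm (s i y - g y)" for y
        using norm_triangle_ineq[of "f y - s i y" "s i y - g y"] by simp
    qed (use ii in auto)
    also have "\<dots> = (\<integral>y. norm (f y - s i y) \<partial>m) + (\<integral>y. norm (s i y - g y) \<partial>m)" using ii by simp
    also have "\<dots> \<le> \<epsilon>" using i g(2) by simp
    finally show "\<exists>g. tspan bohr_char UNIV bohr g \<and> (\<integral>y. norm (f y - g y) \<partial>m) \<le> \<epsilon>" using g(1) by blast
  qed
qed

end

section \<open>Sufficiency\<close>

lemma C1c_common_support:
  assumes "finite S" "\<And>l. l \<in> S \<Longrightarrow> C1c (A l) (A' l)"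
  shows "\<exists>a>0. \<exists>b. \<forall>l\<in>S. \<forall>t. t \<notin> {a..b} \<longrightarrow> A l t = 0 \<and> A' l t = 0"
  using assms
proof (induction S rule: finite_induct)
  case empty
  show ?case by (intro exI[of _ 1]) auto
next
  case (insert l S)
  then obtain a b where ab: "0 < a" "\<forall>l\<in>S. \<forall>t. t \<notin> {a..b} \<longrightarrow> A l t = 0 \<and> A' l t = 0" by auto
  obtain c d where cd: "0 < c" "\<And>t. t \<notin> {c..d} \<Longrightarrow> A l t = 0" "\<And>t. t \<notin> {c..d} \<Longrightarrow> A' l t = 0"
    using C1c_support[of "A l" "A' l"] insert.prems by auto
  have "\<forall>k\<in>insert l S. \<forall>t. t \<notin> {min a c..max b d} \<longrightarrow> A k t = 0 \<and> A' k t = 0"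
  proof (intro ballI allI impI)
    fix k t assume k: "k \<in> insert l S" and t: "t \<notin> {min a c..max b d}"
    have t': "t \<notin> {a..b}" "t \<notin> {c..d}" using t by auto
    show "A k t = 0 \<and> A' k t = 0"
      using k ab(2) cd(2,3)[OF t'(2)] t'(1) by blast
  qed
  moreover have "0 < min a c" using ab(1) cd(1) by simp
  ultimately show ?case by blast
qed

lemma continuous_map_complex_mult:
  fixes F G :: "'z \<Rightarrow> complex"
  assumes "continuous_map X euclidean F" "continuous_map X euclidean G"
  shows "continuous_map X euclidean (\<lambda>h. F h * G h)"
proof -
  have "continuous_map X euclidean ((\<lambda>p. fst p * snd p) \<circ> (\<lambda>h. (F h, G h)))"
  proof (rule continuous_map_compose)
    show "continuous_map X (prod_topology euclidean euclidean) (\<lambda>h. (F h, G h))"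
      by (intro continuous_map_paired[THEN iffD2] conjI assms)
    show "continuous_map (prod_topology euclidean euclidean) euclidean (\<lambda>p. fst p * snd p :: complex)"
      unfolding euclidean_product_topology by (auto intro!: continuous_intros)
  qed
  then show ?thesis by (simp add: comp_def)
qed

lemma topspace_cyl [simp]: "topspace cyl_topology = {0<..} \<times> bohr"
  by (simp add: cyl_topology_def)

lemma trig_continuous_cyl:
  assumes "finite S" "\<And>l. l \<in> S \<Longrightarrow> continuous_on UNIV (B l)"
  shows "continuous_map cyl_topology euclidean (\<lambda>p. Re (\<Sum>l\<in>S. B l (fst p) * bohr_char l (snd p)))"
proof -
  have "continuous_map cyl_topology euclidean (\<lambda>p. \<Sum>l\<in>S. B l (fst p) * bohr_char l (snd p))"
  proof (intro continuous_map_sum continuous_map_complex_mult assms(1))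
    fix l assume l: "l \<in> S"
    have "continuous_map cyl_topology euclidean (B l \<circ> fst)"
      unfolding cyl_topology_def
      by (rule continuous_map_compose[OF continuous_map_fst]) (use assms(2)[OF l] continuous_on_subset in auto)
    then show "continuous_map cyl_topology euclidean (\<lambda>p. B l (fst p))" by (simp add: comp_def)
    have "continuous_map cyl_topology euclidean (bohr_char l \<circ> snd)"
      unfolding cyl_topology_def bohr_char_def
      by (rule continuous_map_compose[OF continuous_map_snd]) (intro continuous_gelfand bohr_exp_AP)
    then show "continuous_map cyl_topology euclidean (\<lambda>p. bohr_char l (snd p))" by (simp add: comp_def)
  qed
  then have "continuous_map cyl_topology euclidean (Re \<circ> (\<lambda>p. \<Sum>l\<in>S. B l (fst p) * bohr_char l (snd p)))"
    by (rule continuous_map_compose) (auto intro!: continuous_intros)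
  then show ?thesis by (simp add: comp_def)
qed

text \<open>Translation by \<delta> in the j-th direction multiplies the character of frequency l by
  \<open>tone (l $ j) \<delta>\<close>, so the derivatives along R^n are derivatives of exponentials
  in \<delta>.\<close>

lemma trig_test_function:
  fixes S :: "(real^'n::finite) set"
  assumes S: "finite S" and A: "\<And>l. l \<in> S \<Longrightarrow> C1c (A l) (A' l)"
  defines "f \<equiv> \<lambda>p. Re (\<Sum>l\<in>S. A l (fst p) * bohr_char l (snd p))"
  shows "f \<in> C10"
    and "\<And>t y. y \<in> bohr \<Longrightarrow> partial_t f (t, y) = Re (\<Sum>l\<in>S. A' l t * bohr_char l y)"
    and "\<And>t y. y \<in> bohr \<Longrightarrow> grad_x f (t, y) = (\<Sum>l\<in>S. Re (2 * of_real pi * \<i> * A l t * bohr_char l y) *\<^sub>R l)"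
proof -
  have qt: "(quot_t f (t, y) \<longlongrightarrow> Re (\<Sum>l\<in>S. A' l t * bohr_char l y)) (at 0)" for t y
  proof -
    have "((\<lambda>s. Re (\<Sum>l\<in>S. A l s * bohr_char l y)) has_vector_derivative Re (\<Sum>l\<in>S. A' l t * bohr_char l y)) (at t)"
      using A unfolding C1c_def
      by (intro bounded_linear.has_vector_derivative[OF bounded_linear_Re] has_vector_derivative_sum has_vector_derivative_mult_left) auto
    then have "((\<lambda>s. Re (\<Sum>l\<in>S. A l s * bohr_char l y)) has_real_derivative Re (\<Sum>l\<in>S. A' l t * bohr_char l y)) (at t)"
      by (simp add: has_real_derivative_iff_has_vector_derivative)
    then show ?thesis unfolding DERIV_def quot_t_def f_def by simp
  qed
  have qx: "(quot_x j f (t, y) \<longlongrightarrow> Re (\<Sum>l\<in>S. (2 * of_real pi * \<i> * of_real (l $ j) * A l t) * bohr_char l y)) (at 0)" if y: "y \<in> bohr" for t y j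
  proof -
    have sh: "bohr_char l (bohr_add y (bohr_in (\<delta> *\<^sub>R axis j 1))) = tone (l $ j) \<delta> * bohr_char l y" for l \<delta>
      by (simp add: bohr_add_right[OF y] bohr_char_def bohr_shift_exp[OF y] bohr_exp_def tone_def inner_axis mult_ac)
    have "((\<lambda>s. Re (\<Sum>l\<in>S. (A l t * bohr_char l y) * tone (l $ j) s)) has_vector_derivative
        Re (\<Sum>l\<in>S. (A l t * bohr_char l y) * (2 * of_real pi * \<i> * of_real (l $ j) * tone (l $ j) 0))) (at 0)"
      by (intro bounded_linear.has_vector_derivative[OF bounded_linear_Re] has_vector_derivative_sum has_vector_derivative_mult_right tone_derivative)
    moreover have "tone s 0 = 1" for s by (simp add: tone_def)
    ultimately have "((\<lambda>s. Re (\<Sum>l\<in>S. (A l t * bohr_char l y) * tone (l $ j) s)) has_real_derivative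
        Re (\<Sum>l\<in>S. (2 * of_real pi * \<i> * of_real (l $ j) * A l t) * bohr_char l y)) (at 0)"
      by (simp add: has_real_derivative_iff_has_vector_derivative mult_ac)
    then show ?thesis unfolding DERIV_def quot_x_def f_def
      by (simp add: sh mult_ac \<open>\<And>s. tone s 0 = 1\<close>)
  qed
  show pt: "partial_t f (t, y) = Re (\<Sum>l\<in>S. A' l t * bohr_char l y)" if "y \<in> bohr" for t y
    unfolding partial_t_def by (rule tendsto_Lim[OF _ qt]) simp
  have px: "partial_x j f (t, y) = Re (\<Sum>l\<in>S. (2 * of_real pi * \<i> * of_real (l $ j) * A l t) * bohr_char l y)" if "y \<in> bohr" for t y j
    unfolding partial_x_def by (rule tendsto_Lim[OF _ qx[OF that]]) simp
  show "grad_x f (t, y) = (\<Sum>l\<in>S. Re (2 * of_real pi * \<i> * A l t * bohr_char l y) *\<^sub>R l)" if "y \<in> bohr" for t y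
  proof (rule vec_eq_iff[THEN iffD2], rule allI)
    fix j
    have "Re ((2 * of_real pi * \<i> * of_real (l $ j) * A l t) * bohr_char l y) = Re (2 * of_real pi * \<i> * A l t * bohr_char l y) * l $ j" for l
    proof -
      have "(2 * of_real pi * \<i> * of_real (l $ j) * A l t) * bohr_char l y = (2 * of_real pi * \<i> * A l t * bohr_char l y) * of_real (l $ j)"
        by (simp add: mult_ac)
      moreover have "Re (z * of_real r) = Re z * r" for z r by (simp only: times_complex.simps Re_complex_of_real Im_complex_of_real mult_zero_right diff_zero)
      ultimately show ?thesis by (simp only:)
    qed
    then show "grad_x f (t, y) $ j = (\<Sum>l\<in>S. Re (2 * of_real pi * \<i> * A l t * bohr_char l y) *\<^sub>R l) $ j"
      unfolding grad_x_def by (simp only: vec_lambda_beta px[OF that] Re_sum sum_component vector_scaleR_component real_scaleR_def)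
  qed
  obtain a b where ab: "0 < a" "\<And>l t. l \<in> S \<Longrightarrow> t \<notin> {a..b} \<Longrightarrow> A l t = 0"
    using C1c_common_support[of S A A'] S A by blast
  have cA: "continuous_on UNIV (A l)" "continuous_on UNIV (A' l)" if "l \<in> S" for l using C1c_continuous[OF A[OF that]] .
  show "f \<in> C10"
    unfolding C10_def
  proof (intro CollectI conjI allI ballI)
    show "continuous_map cyl_topology euclidean f" unfolding f_def by (rule trig_continuous_cyl[OF S cA(1)])
    show "continuous_map cyl_topology euclidean (partial_t f)"
      by (rule continuous_map_eq[OF trig_continuous_cyl[OF S cA(2)]]) (auto simp: pt)
    show "continuous_map cyl_topology euclidean (partial_x j f)" for j
    proof (rule continuous_map_eq[OF trig_continuous_cyl[OF S, of "\<lambda>l t. 2 * of_real pi * \<i> * of_real (l $ j) * A l t"]])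
      show "continuous_on UNIV (\<lambda>t. 2 * of_real pi * \<i> * of_real (l $ j) * A l t)" if "l \<in> S" for l
        using cA(1)[OF that] by (intro continuous_intros)
    qed (auto simp: px)
    show "(quot_t f p \<longlongrightarrow> partial_t f p) (at 0)" if "p \<in> topspace cyl_topology" for p
      using that qt by (cases p) (auto simp: pt)
    show "(quot_x j f p \<longlongrightarrow> partial_x j f p) (at 0)" if "p \<in> topspace cyl_topology" for p j
      using that qx by (cases p) (auto simp: px)
    have K: "compactin cyl_topology ({a..b} \<times> (bohr :: 'n bohr_point set))"
      unfolding cyl_topology_def compactin_Times
      using ab(1) compact_bohr by (auto simp: compactin_subtopology compact_space_def)
    have cl: "closedin cyl_topology ({a..b} \<times> (bohr :: 'n bohr_point set))"
      unfolding cyl_topology_def closedin_prod_Times_iff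
      using ab(1) closedin_topspace[of bohr_topology] by (auto intro!: closedin_subset_topspace closedin_closed_subset)
    have "cyl_topology closure_of {p \<in> topspace cyl_topology. f p \<noteq> 0} \<subseteq> {a..b} \<times> bohr"
    proof (rule closure_of_minimal[OF _ cl])
      show "{p \<in> topspace cyl_topology. f p \<noteq> 0} \<subseteq> {a..b} \<times> bohr"
      proof
        fix p assume p: "p \<in> {p \<in> topspace cyl_topology. f p \<noteq> 0}"
        have "fst p \<in> {a..b}"
        proof (rule ccontr)
          assume "fst p \<notin> {a..b}"
          then have "f p = 0" unfolding f_def using ab(2) by simp
          then show False using p by simp
        qed
        then show "p \<in> {a..b} \<times> bohr" using p by (cases p) auto
      qed
    qed
    then show "compactin cyl_topology (cyl_topology closure_of {p \<in> topspace cyl_topology. f p \<noteq> 0})"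
      using closed_compactin[OF K] closedin_closure_of by blast
  qed
qed

section \<open>Entropy solutions as instances of the abstract setting\<close>

context haar_space
begin

text \<open>Turns integrals over the half-line cylinder into integrals over the full one, on which
  the abstract setting lives, with an indicator as factor.\<close>

lemma cyl_measure_restrict: "cyl_measure m = restrict_space (lborel \<Otimes>\<^sub>M m) ({0<..} \<times> space m)"
  unfolding cyl_measure_def
proof (rule pair_measure_eqI)
  let ?\<Omega> = "{0<..} \<times> space m :: (real \<times> 'n bohr_point) set"
  let ?L = "restrict_space lborel {0<..} :: real measure"
  show "sigma_finite_measure ?L" by (rule sigma_finite_measure_restrict_space) (auto intro: lborel.sigma_finite_measure_axioms)
  show "sigma_finite_measure m" by unfold_locales
  have O: "?\<Omega> \<in> sets (lborel \<Otimes>\<^sub>M m)" by (intro pair_measureI) auto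
  have L: "A \<in> sets lborel" "A \<subseteq> {0<..}" if "A \<in> sets ?L" for A
    using that sets_restrict_space_iff[of "{0<..}" lborel A] by auto
  have idm: "(\<lambda>x. x) \<in> measurable (?L \<Otimes>\<^sub>M m) (lborel \<Otimes>\<^sub>M m)"
  proof -
    have "(\<lambda>x. (fst x, snd x)) \<in> measurable (?L \<Otimes>\<^sub>M m) (lborel \<Otimes>\<^sub>M m)"
    proof (rule measurable_Pair)
      have "fst \<in> measurable (?L \<Otimes>\<^sub>M m) ?L" by (rule measurable_fst)
      moreover have "(\<lambda>x. x) \<in> measurable ?L lborel" by (rule measurable_restrict_space1) simp
      ultimately show "fst \<in> measurable (?L \<Otimes>\<^sub>M m) lborel" by (rule measurable_compose)
    qed (rule measurable_snd)
    then show ?thesis by simp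
  qed
  show sets: "sets (?L \<Otimes>\<^sub>M m) = sets (restrict_space (lborel \<Otimes>\<^sub>M m) ?\<Omega>)"
  proof
    show "sets (?L \<Otimes>\<^sub>M m) \<subseteq> sets (restrict_space (lborel \<Otimes>\<^sub>M m) ?\<Omega>)"
    proof (rule sets_pair_in_sets)
      fix A B assume A: "A \<in> sets ?L" and B: "B \<in> sets m"
      note AB = L[OF A] B
      then have "A \<times> B \<in> sets (lborel \<Otimes>\<^sub>M m)" "A \<times> B \<subseteq> ?\<Omega>" using sets.sets_into_space[OF AB(3)] by auto
      then show "A \<times> B \<in> sets (restrict_space (lborel \<Otimes>\<^sub>M m) ?\<Omega>)" using O by (subst sets_restrict_space_iff) auto
    qed
    show "sets (restrict_space (lborel \<Otimes>\<^sub>M m) ?\<Omega>) \<subseteq> sets (?L \<Otimes>\<^sub>M m)"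
    proof
      fix X assume "X \<in> sets (restrict_space (lborel \<Otimes>\<^sub>M m) ?\<Omega>)"
      then have X: "X \<in> sets (lborel \<Otimes>\<^sub>M m)" "X \<subseteq> ?\<Omega>" using O by (auto simp: sets_restrict_space_iff)
      have "(\<lambda>x. x) -` X \<inter> space (?L \<Otimes>\<^sub>M m) \<in> sets (?L \<Otimes>\<^sub>M m)" by (rule measurable_sets[OF idm X(1)])
      moreover have "(\<lambda>x. x) -` X \<inter> space (?L \<Otimes>\<^sub>M m) = X" using X(2) by (auto simp: space_pair_measure)
      ultimately show "X \<in> sets (?L \<Otimes>\<^sub>M m)" by simp
    qed
  qed
  fix A B assume A: "A \<in> sets ?L" and B: "B \<in> sets m"
  note AB = L[OF A] B
  then have "A \<times> B \<subseteq> ?\<Omega>" using sets.sets_into_space[OF AB(3)] by auto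
  then show "emeasure ?L A * emeasure m B = emeasure (restrict_space (lborel \<Otimes>\<^sub>M m) ?\<Omega>) (A \<times> B)"
    using AB O by (simp add: emeasure_restrict_space emeasure_pair_measure_Times)
qed

lemma slab_set: "{0::real<..} \<times> space m \<in> sets (lborel \<Otimes>\<^sub>M m)"
  by (intro pair_measureI) auto

text \<open>Here u is v cut off at R and set to 0 for t \<le> 0, which gives bounds at every point.
  The cut-off alters v on a null set only, and the extension concerns times at which the test
  functions and their derivatives vanish.\<close>

lemma entropy_solution_trig:
  fixes \<phi> :: "real \<Rightarrow> real^'n"
  assumes phi: "continuous_on UNIV \<phi>" and sol: "entropy_solution m \<phi> v0 v" and K: "0 < R" "AE p in cyl_measure m. \<bar>v p\<bar> \<le> R"
  defines "u \<equiv> \<lambda>p. if p \<in> {0<..} \<times> space m then max (- R) (min R (v p)) else 0"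
  shows "trig_entropy m bohr_char \<phi> u R"
proof
  let ?\<Omega> = "{0<..} \<times> space m :: (real \<times> 'n bohr_point) set"
  have O: "?\<Omega> \<inter> space (lborel \<Otimes>\<^sub>M m) \<in> sets (lborel \<Otimes>\<^sub>M m)" using slab_set by auto
  have vm[measurable]: "v \<in> borel_measurable (cyl_measure m)"
    using sol unfolding entropy_solution_def Linf_def by blast
  have cm[measurable]: "(\<lambda>p. max (- R) (min R (v p))) \<in> borel_measurable (cyl_measure m)" by measurable
  have phim[measurable]: "\<phi> \<in> borel_measurable borel" using phi by (rule borel_measurable_continuous_onI)
  show "continuous_on UNIV \<phi>" "0 < R" by fact+
  show um: "u \<in> borel_measurable (lborel \<Otimes>\<^sub>M m)"
    using cm unfolding cyl_measure_restrict u_def by (subst (asm) measurable_restrict_space_iff[OF O, of 0]) auto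
  show "\<bar>u p\<bar> \<le> R" for p using K(1) by (auto simp: u_def)
  fix k :: real and S :: "(real^'n) set" and A A'
  assume S: "finite S" and A: "\<And>l. l \<in> S \<Longrightarrow> C1c (A l) (A' l)"
    and nn: "\<And>t y. y \<in> space m \<Longrightarrow> 0 \<le> Re (\<Sum>l\<in>S. A l t * bohr_char l y)"
  define f where "f p = Re (\<Sum>l\<in>S. A l (fst p) * bohr_char l (snd p))" for p :: "real \<times> 'n bohr_point"
  have f: "f \<in> C10" "\<And>t y. y \<in> bohr \<Longrightarrow> partial_t f (t, y) = Re (\<Sum>l\<in>S. A' l t * bohr_char l y)"
    "\<And>t y. y \<in> bohr \<Longrightarrow> grad_x f (t, y) = (\<Sum>l\<in>S. Re (2 * of_real pi * \<i> * A l t * bohr_char l y) *\<^sub>R l)"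
    using trig_test_function[of S A A'] S A unfolding f_def[abs_def] by blast+
  have "\<forall>p \<in> topspace cyl_topology. 0 \<le> f p" using nn by (auto simp: f_def space_m)
  then have "0 \<le> (\<integral>p. \<bar>v p - k\<bar> * partial_t f p + (sgn (v p - k) *\<^sub>R (\<phi> (v p) - \<phi> k)) \<bullet> grad_x f p \<partial>cyl_measure m)"
    using sol f(1) unfolding entropy_solution_def by blast
  define I where "I w p = \<bar>w - k\<bar> * Re (\<Sum>l\<in>S. A' l (fst p) * bohr_char l (snd p)) +
      sgn (w - k) * Re (\<Sum>l\<in>S. 2 * of_real pi * \<i> * A l (fst p) * bohr_char l (snd p) * of_real (l \<bullet> (\<phi> w - \<phi> k)))"
    for w and p :: "real \<times> 'n bohr_point"
  have spc: "space (cyl_measure m) = ?\<Omega>" unfolding cyl_measure_restrict by (auto simp: space_restrict_space space_pair_measure)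
  note \<open>0 \<le> (\<integral>p. \<bar>v p - k\<bar> * partial_t f p + (sgn (v p - k) *\<^sub>R (\<phi> (v p) - \<phi> k)) \<bullet> grad_x f p \<partial>cyl_measure m)\<close>
  also have "(\<integral>p. \<bar>v p - k\<bar> * partial_t f p + (sgn (v p - k) *\<^sub>R (\<phi> (v p) - \<phi> k)) \<bullet> grad_x f p \<partial>cyl_measure m)
      = (\<integral>p. I (v p) p \<partial>cyl_measure m)"
  proof (rule Bochner_Integration.integral_cong[OF refl])
    fix p assume "p \<in> space (cyl_measure m)"
    then obtain t y where p: "p = (t, y)" "y \<in> bohr" unfolding spc space_m by blast
    have "(sgn (v p - k) *\<^sub>R (\<phi> (v p) - \<phi> k)) \<bullet> grad_x f p =
      sgn (v p - k) * (\<Sum>l\<in>S. Re (2 * of_real pi * \<i> * A l t * bohr_char l y) * (l \<bullet> (\<phi> (v p) - \<phi> k)))"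
      unfolding p(1) f(3)[OF p(2)] inner_scaleR_left inner_sum_right inner_scaleR_right sum_distrib_left
      by (intro sum.cong refl) (simp only: inner_commute mult_ac)
    also have "(\<Sum>l\<in>S. Re (2 * of_real pi * \<i> * A l t * bohr_char l y) * (l \<bullet> (\<phi> (v p) - \<phi> k))) =
      Re (\<Sum>l\<in>S. 2 * of_real pi * \<i> * A l t * bohr_char l y * of_real (l \<bullet> (\<phi> (v p) - \<phi> k)))"
      unfolding Re_sum by (intro sum.cong refl) (simp only: times_complex.simps Re_complex_of_real Im_complex_of_real mult_zero_right diff_zero)
    finally show "\<bar>v p - k\<bar> * partial_t f p + (sgn (v p - k) *\<^sub>R (\<phi> (v p) - \<phi> k)) \<bullet> grad_x f p = I (v p) p"
      using f(2)[OF p(2)] by (simp add: I_def p)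
  qed
  also have "\<dots> = (\<integral>p. I (max (- R) (min R (v p))) p \<partial>cyl_measure m)"
  proof (rule integral_cong_AE)
    have [measurable]: "A l \<in> borel_measurable borel" "A' l \<in> borel_measurable borel" if "l \<in> S" for l
      using C1c_continuous[OF A[OF that]] by (auto intro: borel_measurable_continuous_onI)
    have [measurable]: "fst \<in> measurable (cyl_measure m) borel" "snd \<in> measurable (cyl_measure m) m"
      unfolding cyl_measure_def by (auto intro!: measurable_compose[OF measurable_fst measurable_restrict_space1] simp: measurable_ident_sets)
    show "(\<lambda>p. I (v p) p) \<in> borel_measurable (cyl_measure m)" unfolding I_def by measurable
    show "(\<lambda>p. I (max (- R) (min R (v p))) p) \<in> borel_measurable (cyl_measure m)" unfolding I_def by measurable
    show "AE p in cyl_measure m. I (v p) p = I (max (- R) (min R (v p))) p"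
      using K(2)
    proof eventually_elim
      case (elim p)
      then have "max (- R) (min R (v p)) = v p" by auto
      then show ?case by simp
    qed
  qed
  also have "\<dots> = (\<integral>p. indicator ?\<Omega> p *\<^sub>R I (max (- R) (min R (v p))) p \<partial>(lborel \<Otimes>\<^sub>M m))"
    unfolding cyl_measure_restrict by (rule integral_restrict_space[OF O])
  also have "\<dots> = (\<integral>p. I (u p) p \<partial>(lborel \<Otimes>\<^sub>M m))"
  proof (rule Bochner_Integration.integral_cong[OF refl])
    fix p :: "real \<times> 'n bohr_point" assume "p \<in> space (lborel \<Otimes>\<^sub>M m)"
    then obtain t y where p: "p = (t, y)" "y \<in> space m" by (cases p) (auto simp: space_pair_measure)
    obtain a b where ab: "0 < a" "\<And>l t. l \<in> S \<Longrightarrow> t \<notin> {a..b} \<Longrightarrow> A l t = 0 \<and> A' l t = 0"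
      using C1c_common_support[of S A A'] S A by blast
    show "indicator ?\<Omega> p *\<^sub>R I (max (- R) (min R (v p))) p = I (u p) p"
    proof (cases "0 < t")
      case True
      then show ?thesis using p by (simp add: u_def)
    next
      case False
      then have "t \<notin> {a..b}" using ab(1) by auto
      then have "I (u p) p = 0" using ab(2) p by (simp add: I_def)
      then show ?thesis using False p by simp
    qed
  qed
  finally show "0 \<le> (\<integral>(t, y). \<bar>u (t, y) - k\<bar> * Re (\<Sum>l\<in>S. A' l t * bohr_char l y) +
          sgn (u (t, y) - k) * Re (\<Sum>l\<in>S. 2 * of_real pi * \<i> * A l t * bohr_char l y * of_real (l \<bullet> (\<phi> (u (t, y)) - \<phi> k)))
          \<partial>(lborel \<Otimes>\<^sub>M m))"
    unfolding I_def split_beta prod.collapse by simp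
qed

text \<open>The null set may depend on \<eta>, while \<open>ess_tendsto\<close> asks for a single
  one; the union over the values \<eta> = 1 / (n + 1) serves.\<close>

lemma ess_tendsto_at_topI:
  assumes "\<And>\<eta>. 0 < \<eta> \<Longrightarrow> eventually_ae (\<lambda>t. \<bar>g t\<bar> \<le> \<eta>)"
  shows "ess_tendsto g 0 at_top"
proof -
  have "\<forall>n::nat. \<exists>N T. N \<in> null_sets lborel \<and> (\<forall>t>T. t \<notin> N \<longrightarrow> \<bar>g t\<bar> \<le> 1 / real (Suc n))"
    using assms unfolding eventually_ae_iff by (metis divide_pos_pos of_nat_0_less_iff zero_less_Suc zero_less_one)
  then obtain N T where N: "\<And>n. N n \<in> null_sets lborel" "\<And>n t. t > T n \<Longrightarrow> t \<notin> N n \<Longrightarrow> \<bar>g t\<bar> \<le> 1 / real (Suc n)" by metis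
  have "(\<Union>n. N n) \<in> null_sets lborel" using N(1) by (intro null_sets_UN) auto
  moreover have "(g \<longlongrightarrow> 0) (inf at_top (principal (- (\<Union>n. N n))))"
  proof (rule tendstoI)
    fix e :: real assume "0 < e"
    then obtain n where n: "inverse (real (Suc n)) < e" using reals_Archimedean by blast
    have "\<forall>\<^sub>F t in at_top. t \<in> - (\<Union>n. N n) \<longrightarrow> dist (g t) 0 < e"
      using eventually_gt_at_top[of "T n"]
    proof eventually_elim
      case (elim t)
      show ?case using N(2)[OF elim] n by (force simp: inverse_eq_divide)
    qed
    then show "\<forall>\<^sub>F t in inf at_top (principal (- (\<Union>n. N n))). dist (g t) 0 < e"
      unfolding eventually_inf_principal .
  qed
  ultimately show ?thesis unfolding ess_tendsto_def by blast
qed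

text \<open>The work is the passage between v and its bounded version u, and between v0 and u0. By
  Fubini, u and v agree for almost every t > 0 at almost every y, so L1 distances coincide at almost
  every time, and the data have the same spectrum and mean.\<close>

theorem nondegenerate_decay:
  fixes \<phi> :: "real \<Rightarrow> real^'n"
  assumes phi: "continuous_on UNIV \<phi>"
    and M: "0 \<in> M" "\<And>x y. x \<in> M \<Longrightarrow> y \<in> M \<Longrightarrow> x + y \<in> M" "\<And>x. x \<in> M \<Longrightarrow> - x \<in> M"
    and nd: "nondegenerate \<phi> M" and v0: "v0 \<in> Linf m" and sp: "Sp m v0 \<subseteq> M" and sol: "entropy_solution m \<phi> v0 v"
  shows "ess_tendsto (\<lambda>t. \<integral>y. \<bar>v (t, y) - (\<integral>z. v0 z \<partial>m)\<bar> \<partial>m) 0 at_top"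
proof -
  let ?\<Omega> = "{0<..} \<times> space m :: (real \<times> 'n bohr_point) set"
  have O: "?\<Omega> \<inter> space (lborel \<Otimes>\<^sub>M m) \<in> sets (lborel \<Otimes>\<^sub>M m)" using slab_set by auto
  obtain R1 where R1: "AE y in m. \<bar>v0 y\<bar> \<le> R1" using v0 unfolding Linf_def by blast
  obtain R2 where R2: "AE p in cyl_measure m. \<bar>v p\<bar> \<le> R2" using sol unfolding entropy_solution_def Linf_def by blast
  define R where "R = \<bar>R1\<bar> + \<bar>R2\<bar> + 1"
  have R: "0 < R" "AE y in m. \<bar>v0 y\<bar> \<le> R" "AE p in cyl_measure m. \<bar>v p\<bar> \<le> R"
  proof -
    show "AE y in m. \<bar>v0 y\<bar> \<le> R" using R1 by eventually_elim (simp add: R_def)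
    show "AE p in cyl_measure m. \<bar>v p\<bar> \<le> R" using R2 by eventually_elim (simp add: R_def)
  qed (simp add: R_def)
  define u where "u p = (if p \<in> ?\<Omega> then max (- R) (min R (v p)) else 0)" for p
  interpret T: trig_entropy m bohr_char \<phi> u R
    unfolding u_def[abs_def] by (rule entropy_solution_trig[OF phi sol R(1,3)])
  have v0m[measurable]: "v0 \<in> borel_measurable m" using v0 unfolding Linf_def by blast
  define u0 where "u0 y = max (- R) (min R (v0 y))" for y
  have u0: "u0 \<in> borel_measurable m" "\<And>y. \<bar>u0 y\<bar> \<le> R" unfolding u0_def using R(1) by (measurable, auto)
  have eq0: "AE y in m. u0 y = v0 y" using R(2) by eventually_elim (auto simp: u0_def)
  have C: "(\<integral>y. u0 y \<partial>m) = (\<integral>y. v0 y \<partial>m)" using eq0 u0(1) by (intro integral_cong_AE) auto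
  have vm: "(\<lambda>y. v (t, y)) \<in> borel_measurable m" if "0 < t" for t
  proof -
    have "v \<in> borel_measurable (restrict_space lborel {0<..} \<Otimes>\<^sub>M m)"
      using sol unfolding entropy_solution_def Linf_def cyl_measure_def by blast
    then show ?thesis by (rule measurable_Pair2) (use that in auto)
  qed
  have "AE p in lborel \<Otimes>\<^sub>M m. p \<in> ?\<Omega> \<longrightarrow> u p = v p"
    using R(3) unfolding cyl_measure_restrict AE_restrict_space_iff[OF O]
    by eventually_elim (auto simp: u_def)
  from slab.AE_pair[OF this] have uv: "AE t in lborel. AE y in m. 0 < t \<longrightarrow> u (t, y) = v (t, y)"
    by (auto elim!: eventually_mono simp: space_pair_measure AE_conjI)
  have cong: "AE t in lborel. 0 < t \<longrightarrow> (\<integral>y. \<bar>u (t, y) - g y\<bar> \<partial>m) = (\<integral>y. \<bar>v (t, y) - h y\<bar> \<partial>m)"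
    if gh: "g \<in> borel_measurable m" "h \<in> borel_measurable m" "AE y in m. g y = h y" for g h
    using uv
  proof eventually_elim
    case (elim t)
    show ?case
    proof
      assume t: "0 < t"
      note [measurable] = vm[OF t] gh(1,2)
      show "(\<integral>y. \<bar>u (t, y) - g y\<bar> \<partial>m) = (\<integral>y. \<bar>v (t, y) - h y\<bar> \<partial>m)"
      proof (rule integral_cong_AE)
        show "AE y in m. \<bar>u (t, y) - g y\<bar> = \<bar>v (t, y) - h y\<bar>" using elim gh(3) by eventually_elim (use t in auto)
      qed measurable
    qed
  qed
  show ?thesis
  proof (rule ess_tendsto_at_topI)
    fix \<eta> :: real assume eta: "0 < \<eta>"
    have "eventually_ae (\<lambda>t. (\<integral>y. \<bar>u (t, y) - (\<integral>z. u0 z \<partial>m)\<bar> \<partial>m) \<le> \<eta>)"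
    proof (rule T.decay[OF M u0 _ _ _ _ eta])
      fix l assume l: "(\<integral>y. of_real (u0 y) * cnj (bohr_char l y) \<partial>m) \<noteq> 0"
      have "(\<integral>y. of_real (u0 y) * cnj (bohr_char l y) \<partial>m) = (\<integral>y. of_real (v0 y) * cnj (bohr_char l y) \<partial>m)"
      proof (rule integral_cong_AE)
        show "AE y in m. of_real (u0 y) * cnj (bohr_char l y) = of_real (v0 y) * cnj (bohr_char l y)"
          using eq0 by eventually_elim simp
      qed (use u0(1) in measurable)
      then have "l \<in> Sp m v0" using l by (simp add: Sp_def gelfand_def bohr_char_def)
      then show "l \<in> M" using sp by blast
    next
      fix \<epsilon> :: real assume "0 < \<epsilon>"
      have "integrable m (\<lambda>y. complex_of_real (u0 y))"
        by (rule integrable_bdd[where B=R]) (use u0 in auto)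
      from dense_L1[OF this] \<open>0 < \<epsilon>\<close> obtain g where g: "tspan bohr_char UNIV bohr g" "(\<integral>y. norm (of_real (u0 y) - g y) \<partial>m) \<le> \<epsilon>" by blast
      obtain S a where S: "finite S" "\<And>y. y \<in> bohr \<Longrightarrow> g y = (\<Sum>l\<in>S. a l * bohr_char l y)"
        using g(1) unfolding tspan_def by blast
      have "(\<integral>y. norm (of_real (u0 y) - g y) \<partial>m) = (\<integral>y. norm (of_real (u0 y) - (\<Sum>l\<in>S. a l * bohr_char l y)) \<partial>m)"
        by (intro Bochner_Integration.integral_cong refl) (simp add: S(2) space_m)
      then show "\<exists>S a. finite S \<and> (\<integral>y. norm (of_real (u0 y) - (\<Sum>l\<in>S. a l * bohr_char l y)) \<partial>m) \<le> \<epsilon>"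
        using g(2) S(1) by auto
    next
      fix \<epsilon> :: real assume e: "0 < \<epsilon>"
      obtain N where N: "N \<in> null_sets lborel" "((\<lambda>t. \<integral>y. \<bar>v (t, y) - v0 y\<bar> \<partial>m) \<longlongrightarrow> 0) (inf (at_right 0) (principal (- N)))"
        using sol unfolding entropy_solution_def ess_tendsto_def by blast
      have "\<forall>\<^sub>F t in at_right 0. t \<in> - N \<longrightarrow> dist (\<integral>y. \<bar>v (t, y) - v0 y\<bar> \<partial>m) 0 < \<epsilon>"
        using tendstoD[OF N(2) e] unfolding eventually_inf_principal .
      then obtain d where d: "0 < d" "\<And>t. 0 < t \<Longrightarrow> t < d \<Longrightarrow> t \<notin> N \<Longrightarrow> \<bar>\<integral>y. \<bar>v (t, y) - v0 y\<bar> \<partial>m\<bar> < \<epsilon>"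
        unfolding eventually_at_right_field by auto
      show "\<exists>\<delta>>0. AE t in lborel. 0 < t \<and> t < \<delta> \<longrightarrow> (\<integral>y. \<bar>u (t, y) - u0 y\<bar> \<partial>m) \<le> \<epsilon>"
      proof (intro exI conjI)
        show "AE t in lborel. 0 < t \<and> t < d \<longrightarrow> (\<integral>y. \<bar>u (t, y) - u0 y\<bar> \<partial>m) \<le> \<epsilon>"
          using cong[OF u0(1) v0m eq0] AE_not_in[OF N(1)]
        proof eventually_elim
          case (elim t)
          then show ?case using d(2)[of t] by auto
        qed
      qed (rule d(1))
    next
      fix \<xi> a b assume "\<xi> \<in> M" "\<xi> \<noteq> 0" "a < (b::real)"
      then show "\<not> affine_fun_on {a<..<b} (\<lambda>w. \<xi> \<bullet> \<phi> w)"
        using nd unfolding nondegenerate_def by (auto simp: is_interval_oo)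
    qed
    moreover have "AE t in lborel. 0 < t \<longrightarrow> (\<integral>y. \<bar>u (t, y) - (\<integral>z. u0 z \<partial>m)\<bar> \<partial>m) = (\<integral>y. \<bar>v (t, y) - (\<integral>z. v0 z \<partial>m)\<bar> \<partial>m)"
      by (rule cong) (auto simp: C)
    then have "eventually_ae (\<lambda>t. 0 < t \<longrightarrow> (\<integral>y. \<bar>u (t, y) - (\<integral>z. u0 z \<partial>m)\<bar> \<partial>m) = (\<integral>y. \<bar>v (t, y) - (\<integral>z. v0 z \<partial>m)\<bar> \<partial>m))"
      unfolding eventually_ae_def by (rule filter_leD[rotated]) simp
    moreover have "eventually_ae (\<lambda>t. 0 < t)"
      by (rule eventually_aeI[of "{}" 0]) auto
    ultimately have "eventually_ae (\<lambda>t. (\<integral>y. \<bar>u (t, y) - (\<integral>z. u0 z \<partial>m)\<bar> \<partial>m) \<le> \<eta> \<and>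
      (0 < t \<longrightarrow> (\<integral>y. \<bar>u (t, y) - (\<integral>z. u0 z \<partial>m)\<bar> \<partial>m) = (\<integral>y. \<bar>v (t, y) - (\<integral>z. v0 z \<partial>m)\<bar> \<partial>m)) \<and> 0 < t)"
      by (intro eventually_ae_conj)
    then show "eventually_ae (\<lambda>t. \<bar>\<integral>y. \<bar>v (t, y) - (\<integral>z. v0 z \<partial>m)\<bar> \<partial>m\<bar> \<le> \<eta>)"
      by (rule eventually_ae_mono) auto
  qed
qed

end

section \<open>Necessity\<close>

text \<open>Since the flow preserves the measure, differences of \<open>f\<close> along the flow turn into differences of \<open>V\<close>, which
  depend on the direction only through the speed \<open>c\<close> of the phase. Hence no chain rule for \<open>V\<close> is needed, and \<open>V\<close> may be discontinuous.\<close>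

lemma flow_derivative:
  fixes \<tau> :: "real \<Rightarrow> 'a \<Rightarrow> 'a" and V :: "real \<Rightarrow> 'a \<Rightarrow> real"
  assumes \<tau>: "\<And>s. \<tau> s \<in> measurable M M" "\<And>s. distr M M (\<tau> s) = M" "\<And>p. p \<in> space M \<Longrightarrow> \<tau> 0 p = p"
    and V: "\<And>\<theta>. V \<theta> \<in> borel_measurable M" "\<And>\<theta> p. p \<in> space M \<Longrightarrow> \<bar>V \<theta> p\<bar> \<le> K"
      "\<And>s p. p \<in> space M \<Longrightarrow> V (- (c * s)) (\<tau> s p) = V 0 p"
    and f: "integrable M f" and w: "integrable M w"
      "\<And>s p. p \<in> space M \<Longrightarrow> s \<noteq> 0 \<Longrightarrow> \<bar>s\<bar> \<le> 1 \<Longrightarrow> \<bar>(f (\<tau> s p) - f p) / s\<bar> \<le> w p"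
    and g: "\<And>p. p \<in> space M \<Longrightarrow> ((\<lambda>s. f (\<tau> s p)) has_real_derivative g p) (at 0)"
  shows "integrable M (\<lambda>p. V 0 p * g p)" (is ?int)
    and "((\<lambda>s. \<integral>p. V (- (c * s)) p * f p \<partial>M) has_real_derivative (\<integral>p. V 0 p * g p \<partial>M)) (at 0)" (is ?der)
proof -
  note [measurable] = \<tau>(1) V(1)
  have fm[measurable]: "f \<in> borel_measurable M" using f by auto
  \<comment> \<open>V stands outside the difference quotient, so only f is differentiated, and w
    dominates the quotient.\<close>
  define Q where "Q s p = V 0 p * ((f (\<tau> s p) - f p) / s)" for s p
  have Qm: "Q s \<in> borel_measurable M" for s unfolding Q_def[abs_def] by measurable
  have K: "integrable M (\<lambda>p. \<bar>K\<bar> * w p)" using w(1) by simp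
  have Qb: "norm (Q s p) \<le> \<bar>K\<bar> * w p" if "p \<in> space M" "s \<noteq> 0" "\<bar>s\<bar> \<le> 1" for s p
  proof -
    have "\<bar>V 0 p\<bar> \<le> \<bar>K\<bar>" using V(2)[OF that(1), of 0] by simp
    then show ?thesis unfolding Q_def real_norm_def abs_mult by (intro mult_mono w(2) that) auto
  qed
  have Ql: "((\<lambda>s. Q s p) \<longlongrightarrow> V 0 p * g p) (at 0)" if "p \<in> space M" for p
    using g[OF that] unfolding DERIV_def Q_def by (intro tendsto_mult tendsto_const) (simp add: \<tau>(3)[OF that])
  have lim: "(\<lambda>n. Q (S n) p) \<longlonglongrightarrow> V 0 p * g p" if "p \<in> space M" "\<And>n. S n \<noteq> 0" "S \<longlonglongrightarrow> 0" for S p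
    by (rule filterlim_compose[OF Ql[OF that(1)]]) (use that(2,3) in \<open>auto simp: filterlim_at\<close>)
  have dom: "integrable M (\<lambda>p. V 0 p * g p)" "(\<lambda>n. \<integral>p. Q (S n) p \<partial>M) \<longlonglongrightarrow> (\<integral>p. V 0 p * g p \<partial>M)"
    if S: "\<And>n. S n \<noteq> 0" "\<And>n. \<bar>S n\<bar> \<le> 1" "S \<longlonglongrightarrow> 0" for S
  proof -
    have m: "(\<lambda>p. V 0 p * g p) \<in> borel_measurable M"
      by (rule borel_measurable_LIMSEQ_real[OF lim[OF _ S(1,3)] Qm])
    have l: "AE p in M. (\<lambda>n. Q (S n) p) \<longlonglongrightarrow> V 0 p * g p" using lim[OF _ S(1,3)] by (intro AE_I2)
    have b: "AE p in M. norm (Q (S n) p) \<le> \<bar>K\<bar> * w p" for n using Qb[OF _ S(1,2)] by (intro AE_I2)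
    show "integrable M (\<lambda>p. V 0 p * g p)" "(\<lambda>n. \<integral>p. Q (S n) p \<partial>M) \<longlonglongrightarrow> (\<integral>p. V 0 p * g p \<partial>M)"
      using integrable_dominated_convergence[OF m Qm K l b] integral_dominated_convergence[OF m Qm K l b] by blast+
  qed
  have S0: "(\<lambda>n. 1 / real (Suc n)) \<longlonglongrightarrow> 0" by (rule LIMSEQ_Suc[OF lim_1_over_n])
  show ?int by (rule dom(1)[OF _ _ S0]) auto
  \<comment> \<open>Change of variables along the flow: it preserves the measure and carries
    \<open>V (- (c * s))\<close> to \<open>V 0\<close>.\<close>
  have eq: "(\<integral>p. V (- (c * s)) p * f p \<partial>M) = (\<integral>p. V 0 p * f (\<tau> s p) \<partial>M)" for s
  proof -
    have "(\<integral>p. V (- (c * s)) p * f p \<partial>M) = (\<integral>p. V (- (c * s)) p * f p \<partial>(distr M M (\<tau> s)))" by (simp add: \<tau>(2))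
    also have "\<dots> = (\<integral>p. V (- (c * s)) (\<tau> s p) * f (\<tau> s p) \<partial>M)" by (rule integral_distr) measurable
    also have "\<dots> = (\<integral>p. V 0 p * f (\<tau> s p) \<partial>M)" by (rule Bochner_Integration.integral_cong) (simp_all add: V(3))
    finally show ?thesis .
  qed
  have int: "integrable M (\<lambda>p. V 0 p * f (\<tau> s p))" for s
  proof (rule Bochner_Integration.integrable_bound)
    have "integrable (distr M M (\<tau> s)) f" using f by (simp add: \<tau>(2))
    then have "integrable M (\<lambda>p. f (\<tau> s p))" by (rule integrable_distr[OF \<tau>(1)])
    then show "integrable M (\<lambda>p. \<bar>K\<bar> * f (\<tau> s p))" by simp
    show "AE p in M. norm (V 0 p * f (\<tau> s p)) \<le> norm (\<bar>K\<bar> * f (\<tau> s p))"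
      by (intro AE_I2) (auto simp: abs_mult intro!: mult_right_mono order.trans[OF V(2)])
  qed measurable
  have quot: "((\<integral>p. V (- (c * s)) p * f p \<partial>M) - (\<integral>p. V (- (c * 0)) p * f p \<partial>M)) / s = (\<integral>p. Q s p \<partial>M)" for s
  proof -
    have "(\<integral>p. Q s p \<partial>M) = (\<integral>p. (V 0 p * f (\<tau> s p) - V 0 p * f (\<tau> 0 p)) / s \<partial>M)"
      by (rule Bochner_Integration.integral_cong) (simp_all add: Q_def \<tau>(3) right_diff_distrib)
    also have "\<dots> = ((\<integral>p. V 0 p * f (\<tau> s p) \<partial>M) - (\<integral>p. V 0 p * f (\<tau> 0 p) \<partial>M)) / s"
      using int by simp
    finally show ?thesis unfolding eq by simp
  qed
  show ?der
    unfolding DERIV_def add_0 quot LIMSEQ_SEQ_conv[symmetric]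
  proof (intro allI impI)
    fix S :: "nat \<Rightarrow> real" assume S: "(\<forall>n. S n \<noteq> 0) \<and> S \<longlonglongrightarrow> 0"
    then have "eventually (\<lambda>n. \<bar>S n\<bar> < 1) sequentially" using tendstoD[of S 0 sequentially 1] by simp
    then obtain N where N: "\<And>n. n \<ge> N \<Longrightarrow> \<bar>S n\<bar> < 1" by (auto simp: eventually_sequentially)
    have "(\<lambda>n. \<integral>p. Q (S (n + N)) p \<partial>M) \<longlonglongrightarrow> (\<integral>p. V 0 p * g p \<partial>M)"
      using S N by (intro dom(2) LIMSEQ_ignore_initial_segment) (auto intro: less_imp_le)
    then show "(\<lambda>n. \<integral>p. Q (S n) p \<partial>M) \<longlonglongrightarrow> (\<integral>p. V 0 p * g p \<partial>M)" by (rule LIMSEQ_offset)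
  qed
qed

text \<open>Let H_i(\<theta>) be the integral of \<open>V i \<theta>\<close> times f. The previous
  lemma along direction i shows that the integral of \<open>V i 0\<close> times \<open>g i\<close>
  is - c_i H_i'(0). The sum over i is minus the derivative of the sum of the c_i H_i, which is
  constant because the corresponding combination of the V is.\<close>

lemma flow_derivatives_cancel:
  fixes \<tau> :: "'i::finite \<Rightarrow> real \<Rightarrow> 'a \<Rightarrow> 'a" and V :: "'i \<Rightarrow> real \<Rightarrow> 'a \<Rightarrow> real"
  assumes \<tau>: "\<And>i s. \<tau> i s \<in> measurable M M" "\<And>i s. distr M M (\<tau> i s) = M" "\<And>i p. p \<in> space M \<Longrightarrow> \<tau> i 0 p = p"
    and V: "\<And>i \<theta>. V i \<theta> \<in> borel_measurable M" "\<And>i \<theta> p. p \<in> space M \<Longrightarrow> \<bar>V i \<theta> p\<bar> \<le> K"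
      "\<And>i j s p. p \<in> space M \<Longrightarrow> V j (- (c i * s)) (\<tau> i s p) = V j 0 p"
    and f: "integrable M f" and w: "integrable M w"
      "\<And>i s p. p \<in> space M \<Longrightarrow> s \<noteq> 0 \<Longrightarrow> \<bar>s\<bar> \<le> 1 \<Longrightarrow> \<bar>(f (\<tau> i s p) - f p) / s\<bar> \<le> w p"
    and g: "\<And>i p. p \<in> space M \<Longrightarrow> ((\<lambda>s. f (\<tau> i s p)) has_real_derivative g i p) (at 0)"
    and c: "c i0 \<noteq> 0"
    and const: "\<And>\<theta> p. p \<in> space M \<Longrightarrow> (\<Sum>i\<in>UNIV. c i * V i \<theta> p) = C"
  shows "(\<integral>p. (\<Sum>i\<in>UNIV. V i 0 p * g i p) \<partial>M) = 0"
proof -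
  define H where "H i \<theta> = (\<integral>p. V i \<theta> p * f p \<partial>M)" for i \<theta>
  have fd: "integrable M (\<lambda>p. V j 0 p * g i p)"
      "((\<lambda>s. H j (- (c i * s))) has_real_derivative (\<integral>p. V j 0 p * g i p \<partial>M)) (at 0)" for i j
    using flow_derivative[where M=M and \<tau>="\<tau> i" and V="V j" and K=K and c="c i" and f=f and w=w and g="g i"]
      \<tau> V f w g unfolding H_def by blast+
  \<comment> \<open>Differentiability of every \<open>H j\<close> at 0 is obtained along the one
    direction i0 of nonzero speed, since the direction j itself may have speed 0.\<close>
  define D where "D j = - (\<integral>p. V j 0 p * g i0 p \<partial>M) / c i0" for j
  have D: "(H j has_real_derivative D j) (at 0)" for j
  proof -
    have "((\<lambda>s. H j (- (c i0 * s))) \<circ> (\<lambda>x. - x / c i0) has_real_derivative (\<integral>p. V j 0 p * g i0 p \<partial>M) * (- 1 / c i0)) (at 0)"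
      by (rule DERIV_chain) (use fd(2)[of j i0] c in \<open>auto intro!: derivative_eq_intros\<close>)
    moreover have "(\<lambda>s. H j (- (c i0 * s))) \<circ> (\<lambda>x. - x / c i0) = H j" using c by (auto simp: fun_eq_iff)
    ultimately show ?thesis by (simp add: D_def)
  qed
  have T: "(\<integral>p. V i 0 p * g i p \<partial>M) = - (c i * D i)" for i
  proof -
    have "(H i \<circ> (\<lambda>s. - (c i * s)) has_real_derivative D i * (- c i)) (at 0)"
      by (rule DERIV_chain) (use D[of i] in \<open>auto intro!: derivative_eq_intros\<close>)
    then show ?thesis using DERIV_unique[OF fd(2)[of i i]] by (simp add: comp_def)
  qed
  have iV: "integrable M (\<lambda>p. V i \<theta> p * f p)" for i \<theta>
  proof (rule Bochner_Integration.integrable_bound)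
    show "integrable M (\<lambda>p. \<bar>K\<bar> * f p)" using f by simp
    show "AE p in M. norm (V i \<theta> p * f p) \<le> norm (\<bar>K\<bar> * f p)"
      by (intro AE_I2) (auto simp: abs_mult intro!: mult_right_mono order.trans[OF V(2)])
  qed (use V(1) f in measurable)
  have "(\<Sum>i\<in>UNIV. c i * H i \<theta>) = C * (\<integral>p. f p \<partial>M)" for \<theta>
  proof -
    have "(\<Sum>i\<in>UNIV. c i * H i \<theta>) = (\<integral>p. (\<Sum>i\<in>UNIV. c i * (V i \<theta> p * f p)) \<partial>M)"
      unfolding H_def using iV by simp
    also have "\<dots> = (\<integral>p. C * f p \<partial>M)"
    proof (rule Bochner_Integration.integral_cong[OF refl])
      fix p assume p: "p \<in> space M"
      have "(\<Sum>i\<in>UNIV. c i * (V i \<theta> p * f p)) = (\<Sum>i\<in>UNIV. c i * V i \<theta> p) * f p"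
        by (simp add: sum_distrib_right mult.assoc)
      then show "(\<Sum>i\<in>UNIV. c i * (V i \<theta> p * f p)) = C * f p" using const[OF p] by simp
    qed
    finally show ?thesis by simp
  qed
  then have "((\<lambda>\<theta>. \<Sum>i\<in>UNIV. c i * H i \<theta>) has_real_derivative 0) (at 0)" by simp
  moreover have "((\<lambda>\<theta>. \<Sum>i\<in>UNIV. c i * H i \<theta>) has_real_derivative (\<Sum>i\<in>UNIV. c i * D i)) (at 0)"
    by (intro DERIV_sum DERIV_cmult D)
  ultimately have "(\<Sum>i\<in>UNIV. c i * D i) = 0" using DERIV_unique by blast
  moreover have "(\<integral>p. (\<Sum>i\<in>UNIV. V i 0 p * g i p) \<partial>M) = (\<Sum>i\<in>UNIV. \<integral>p. V i 0 p * g i p \<partial>M)"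
    using fd(1) by simp
  ultimately show ?thesis unfolding T by (simp add: sum_negf)
qed

section \<open>Test functions and their translates\<close>

lemma compactin_slab: assumes "0 < a" shows "compactin cyl_topology ({a..b} \<times> (bohr :: 'n::finite bohr_point set))"
  unfolding cyl_topology_def compactin_Times
  using assms compact_bohr by (auto simp: compactin_subtopology compact_space_def)

text \<open>Compactness in the open half-line keeps the support away from t = 0: its projection to
  the time axis is a compact set of positive numbers.\<close>

lemma C10_support:
  fixes f :: "real \<times> 'n::finite bohr_point \<Rightarrow> real"
  assumes "f \<in> C10"
  obtains a b where "0 < a" "\<And>t y. 0 < t \<Longrightarrow> y \<in> bohr \<Longrightarrow> t \<notin> {a..b} \<Longrightarrow> f (t, y) = 0"
proof -
  let ?Z = "cyl_topology closure_of {p \<in> topspace cyl_topology. f p \<noteq> 0}"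
  have "compactin cyl_topology ?Z" using assms unfolding C10_def by blast
  then have "compactin (top_of_set {0<..}) (fst ` ?Z)"
    by (rule image_compactin) (auto simp: cyl_topology_def continuous_map_fst)
  then have K: "compact (fst ` ?Z)" "fst ` ?Z \<subseteq> {0<..}" by (auto simp: compactin_subtopology)
  have Z: "t \<in> fst ` ?Z" if "0 < t" "y \<in> bohr" "f (t, y) \<noteq> 0" for t y
  proof -
    have "(t, y) \<in> ?Z" using that closure_of_subset[of "{p \<in> topspace cyl_topology. f p \<noteq> 0}" cyl_topology] by auto
    then show ?thesis by force
  qed
  show ?thesis
  proof (cases "fst ` ?Z = {}")
    case True
    then have "f (t, y) = 0" if "0 < t" "y \<in> bohr" for t y using Z[OF that] by auto
    then show ?thesis by (intro that[of 1 1]) auto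
  next
    case False
    obtain a where a: "a \<in> fst ` ?Z" "\<And>t. t \<in> fst ` ?Z \<Longrightarrow> a \<le> t" using compact_attains_inf[OF K(1) False] by blast
    obtain b where b: "\<And>t. t \<in> fst ` ?Z \<Longrightarrow> t \<le> b" using compact_attains_sup[OF K(1) False] by blast
    show ?thesis
    proof (rule that[of a b])
      show "0 < a" using a(1) K(2) by auto
      show "f (t, y) = 0" if "0 < t" "y \<in> bohr" "t \<notin> {a..b}" for t y
        using Z[OF that(1,2)] a(2) b that(3) by auto
    qed
  qed
qed

lemma continuous_map_slab_bounded:
  fixes g :: "real \<times> 'n::finite bohr_point \<Rightarrow> real"
  assumes "continuous_map cyl_topology euclidean g" "0 < a"
  obtains B where "\<And>t y. t \<in> {a..b} \<Longrightarrow> y \<in> bohr \<Longrightarrow> \<bar>g (t, y)\<bar> \<le> B"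
proof -
  have "compact (g ` ({a..b} \<times> bohr))"
    using image_compactin[OF compactin_slab[OF assms(2)] assms(1)] by simp
  then have "bounded (g ` ({a..b} \<times> bohr))" by (rule compact_imp_bounded)
  then obtain B where "\<forall>x\<in>g ` ({a..b} \<times> bohr). norm x \<le> B" unfolding bounded_iff ..
  then show ?thesis by (intro that[of B]) auto
qed

text \<open>Time is \<open>None\<close> and the j-th space direction is \<open>Some j\<close>, so
  that all n + 1 directions form one finite family of flows for
  \<open>flow_derivatives_cancel\<close>.\<close>

definition partial :: "'n option \<Rightarrow> (real \<times> 'n::finite bohr_point \<Rightarrow> real) \<Rightarrow> real \<times> 'n bohr_point \<Rightarrow> real" where
  "partial i f p = (case i of None \<Rightarrow> partial_t f p | Some j \<Rightarrow> partial_x j f p)"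

definition shift :: "'n option \<Rightarrow> real \<Rightarrow> real \<times> 'n::finite bohr_point \<Rightarrow> real \<times> 'n bohr_point" where
  "shift i s = (\<lambda>(t, y). case i of None \<Rightarrow> (t + s, y) | Some j \<Rightarrow> (t, bohr_shift (s *\<^sub>R axis j 1) y))"

text \<open>Extension by zero to all times: translations in time are measure-preserving flows on the
  full line, not on the half-line.\<close>

definition extend :: "(real \<times> 'n::finite bohr_point \<Rightarrow> real) \<Rightarrow> real \<times> 'n bohr_point \<Rightarrow> real" where
  "extend f p = (if 0 < fst p then f p else 0)"

lemma shift_shift: assumes "snd p \<in> bohr" shows "shift i s (shift i r p) = shift i (r + s) p"
  using assms by (cases p) (auto simp: shift_def bohr_shift_shift scaleR_left_distrib[symmetric] split: option.splits)

lemma shift_zero: assumes "snd p \<in> bohr" shows "shift i 0 p = p"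
  using assms by (cases p) (auto simp: shift_def bohr_shift_zero split: option.splits)

lemma shift_in: "snd p \<in> bohr \<Longrightarrow> snd (shift i s p) \<in> bohr"
  by (cases p) (auto simp: shift_def split: option.splits)

lemma fst_shift: "\<bar>fst (shift i s p) - fst p\<bar> \<le> \<bar>s\<bar>"
  by (cases p) (auto simp: shift_def split: option.splits)

text \<open>The support of f begins at some a > 0, so the extension by zero is differentiable across
  t = 0 as well. The flow property reduces the derivative at r to one at 0.\<close>

lemma extend_derivative:
  fixes f :: "real \<times> 'n::finite bohr_point \<Rightarrow> real"
  assumes f: "f \<in> C10" and p: "snd p \<in> bohr"
  shows "((\<lambda>s. extend f (shift i s p)) has_real_derivative extend (partial i f) (shift i r p)) (at r)"
proof -
  obtain a b where a: "0 < a" "\<And>t y. 0 < t \<Longrightarrow> y \<in> bohr \<Longrightarrow> t \<notin> {a..b} \<Longrightarrow> f (t, y) = 0" using C10_support[OF f] by blast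
  have zero: "((\<lambda>s. extend f (shift i s (t, y))) has_real_derivative extend (partial i f) (t, y)) (at 0)" if y: "y \<in> bohr" for t y
  proof (cases "0 < t")
    case True
    have q: "(quot_t f (t, y) \<longlongrightarrow> partial_t f (t, y)) (at 0)" "(quot_x j f (t, y) \<longlongrightarrow> partial_x j f (t, y)) (at 0)" for j
      using f y True unfolding C10_def by auto
    show ?thesis
    proof (cases i)
      case None
      have "eventually (\<lambda>s. s \<in> {-t<..}) (nhds 0)" using True by (intro eventually_nhds_in_open) auto
      then have "eventually (\<lambda>s. quot_t f (t, y) s = (extend f (shift i (0 + s) (t, y)) - extend f (shift i 0 (t, y))) / s) (at 0)"
        unfolding eventually_at_filter by eventually_elim (use True None in \<open>simp add: quot_t_def extend_def shift_def\<close>)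
      then show ?thesis unfolding DERIV_def using q(1) True None
        by (auto simp: extend_def partial_def dest: Lim_transform_eventually)
    next
      case (Some j)
      then show ?thesis unfolding DERIV_def using q(2)[of j] True y
        by (simp add: extend_def partial_def quot_x_def shift_def bohr_add_right bohr_shift_zero)
    qed
  next
    case False
    \<comment> \<open>For t \<le> 0 and s < a the shifted time stays below a, where f
      vanishes.\<close>
    have "extend f (shift i s (t, y)) = 0" if "s < a" for s
      using that False y a(2)[of "t + s" y] by (auto simp: extend_def shift_def split: option.splits)
    then have "((\<lambda>s. extend f (shift i s (t, y))) has_real_derivative 0) (at 0)"
      using a(1) by (intro DERIV_cong_ev[THEN iffD2, OF refl _ refl DERIV_const])
        (auto intro!: eventually_mono[OF eventually_nhds_in_open[of "{..<a}" 0]])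
    then show ?thesis using False by (simp add: extend_def)
  qed
  have "((\<lambda>s. extend f (shift i s (shift i r p))) has_real_derivative extend (partial i f) (shift i r p)) (at 0)"
    using zero[of "snd (shift i r p)" "fst (shift i r p)"] shift_in[OF p] by simp
  then show ?thesis using DERIV_shift[of "\<lambda>s. extend f (shift i s p)" "extend (partial i f) (shift i r p)" 0 r]
    by (simp add: shift_shift[OF p] add.commute)
qed

lemma sum_option: "(\<Sum>i\<in>UNIV. h i) = h None + (\<Sum>j\<in>UNIV. h (Some j))" for h :: "'n::finite option \<Rightarrow> real"
  unfolding UNIV_option_conv by (subst sum.insert) (auto simp: sum.reindex)


context haar_space
begin

text \<open>Rounding the time down to multiples of 1 / (n + 1) leaves countably many functions of y
  alone, each measurable by continuity, and continuity in t gives convergence to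
  \<open>extend f\<close>.\<close>

lemma extend_measurable:
  assumes f: "continuous_map cyl_topology euclidean f"
  shows "extend f \<in> borel_measurable (lborel \<Otimes>\<^sub>M m)"
proof (rule borel_measurable_LIMSEQ_real)
  fix p :: "real \<times> 'n bohr_point" assume "p \<in> space (lborel \<Otimes>\<^sub>M m)"
  then obtain t y where p: "p = (t, y)" "y \<in> bohr" by (cases p) (auto simp: space_pair_measure space_m)
  show "(\<lambda>n. extend f (real_of_int \<lfloor>real (Suc n) * fst p\<rfloor> / real (Suc n), snd p)) \<longlonglongrightarrow> extend f p"
  proof -
    have lim: "(\<lambda>n. real_of_int \<lfloor>real (Suc n) * t\<rfloor> / real (Suc n)) \<longlonglongrightarrow> t"
    proof (rule real_tendsto_sandwich)
      have "(\<lambda>n. t - 1 / real (Suc n)) \<longlonglongrightarrow> t - 0" by (intro tendsto_diff tendsto_const LIMSEQ_Suc[OF lim_1_over_n])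
      then show "(\<lambda>n. t - 1 / real (Suc n)) \<longlonglongrightarrow> t" by simp
      show "eventually (\<lambda>n. t - 1 / real (Suc n) \<le> real_of_int \<lfloor>real (Suc n) * t\<rfloor> / real (Suc n)) sequentially"
      proof (intro always_eventually allI)
        fix n
        have "real (Suc n) * t - 1 \<le> real_of_int \<lfloor>real (Suc n) * t\<rfloor>" by linarith
        then have "(real (Suc n) * t - 1) / real (Suc n) \<le> real_of_int \<lfloor>real (Suc n) * t\<rfloor> / real (Suc n)" by (intro divide_right_mono) auto
        then show "t - 1 / real (Suc n) \<le> real_of_int \<lfloor>real (Suc n) * t\<rfloor> / real (Suc n)" by (simp add: diff_divide_distrib)
      qed
      show "eventually (\<lambda>n. real_of_int \<lfloor>real (Suc n) * t\<rfloor> / real (Suc n) \<le> t) sequentially"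
      proof (intro always_eventually allI)
        fix n
        have "real_of_int \<lfloor>real (Suc n) * t\<rfloor> \<le> t * real (Suc n)" by (metis mult.commute of_int_floor_le)
        then show "real_of_int \<lfloor>real (Suc n) * t\<rfloor> / real (Suc n) \<le> t" by (simp add: divide_le_eq)
      qed
    qed (rule tendsto_const)
    show ?thesis
    proof (cases "0 < t")
      case True
      have "continuous_map (top_of_set {0<..}) euclidean (f \<circ> (\<lambda>s. (s, y)))"
        by (rule continuous_map_compose[OF _ f])
           (use p(2) in \<open>auto simp: cyl_topology_def continuous_map_pairwise comp_def intro!: continuous_intros\<close>)
      then have "continuous_on {0<..} (\<lambda>s. f (s, y))" by (simp add: comp_def)
      then have "isCont (\<lambda>s. f (s, y)) t" using True by (simp add: continuous_on_eq_continuous_at)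
      from isCont_tendsto_compose[OF this lim]
      have "(\<lambda>n. f (real_of_int \<lfloor>real (Suc n) * t\<rfloor> / real (Suc n), y)) \<longlonglongrightarrow> f (t, y)" .
      moreover have "eventually (\<lambda>n. f (real_of_int \<lfloor>real (Suc n) * t\<rfloor> / real (Suc n), y) =
          extend f (real_of_int \<lfloor>real (Suc n) * t\<rfloor> / real (Suc n), y)) sequentially"
        using order_tendstoD(1)[OF lim True] by eventually_elim (simp add: extend_def)
      ultimately have "(\<lambda>n. extend f (real_of_int \<lfloor>real (Suc n) * t\<rfloor> / real (Suc n), y)) \<longlonglongrightarrow> f (t, y)"
        by (rule Lim_transform_eventually)
      then show ?thesis using True p by (simp add: extend_def)
    next
      case False
      \<comment> \<open>Nonpositive times are rounded to nonpositive times, so the extension by zero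
        is respected.\<close>
      have "real_of_int \<lfloor>real (Suc n) * t\<rfloor> / real (Suc n) \<le> 0" for n
      proof -
        have "real (Suc n) * t \<le> 0" using False by (simp add: mult_nonneg_nonpos)
        then have "\<lfloor>real (Suc n) * t\<rfloor> \<le> 0" by linarith
        then show ?thesis by (simp add: divide_le_0_iff)
      qed
      then have "extend f (real_of_int \<lfloor>real (Suc n) * t\<rfloor> / real (Suc n), y) = 0" for n
        unfolding extend_def fst_conv by (meson not_less)
      then show ?thesis using False p by (simp add: extend_def del: of_nat_Suc)
    qed
  qed
next
  fix n
  show "(\<lambda>p. extend f (real_of_int \<lfloor>real (Suc n) * fst p\<rfloor> / real (Suc n), snd p)) \<in> borel_measurable (lborel \<Otimes>\<^sub>M m)"
  proof (rule measurable_compose_countable[where f="\<lambda>k p. extend f (real_of_int k / real (Suc n), snd p)" and g="\<lambda>p. \<lfloor>real (Suc n) * fst p\<rfloor>"])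
    fix k :: int
    define t where "t = real_of_int k / real (Suc n)"
    have "(\<lambda>y. extend f (t, y)) \<in> borel_measurable m"
    proof (cases "0 < t")
      case True
      have "continuous_map bohr_topology euclidean (f \<circ> (\<lambda>y. (t, y)))"
        by (rule continuous_map_compose[OF _ f])
           (use True in \<open>auto simp: cyl_topology_def continuous_map_pairwise comp_def\<close>)
      then show ?thesis using True borel_measurable_continuous_map by (simp add: extend_def comp_def)
    qed (simp add: extend_def)
    then show "(\<lambda>p. extend f (real_of_int k / real (Suc n), snd p)) \<in> borel_measurable (lborel \<Otimes>\<^sub>M m)"
      unfolding t_def by (rule measurable_compose[OF measurable_snd])
  qed measurable
qed

lemma distr_translation:
  fixes s :: real
  shows "distr (lborel \<Otimes>\<^sub>M m) (lborel \<Otimes>\<^sub>M m) (\<lambda>(t, y). (t + s, bohr_shift d y)) = lborel \<Otimes>\<^sub>M m"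
proof -
  have "distr lborel lborel (\<lambda>t. t + s) = distr lborel borel ((+) s)" for s :: real by (rule distr_cong) (auto simp: add.commute)
  then have L: "distr lborel lborel (\<lambda>t. t + s) = lborel" for s :: real by (simp add: lborel_distr_plus)
  have "distr lborel lborel (\<lambda>t. t + s) \<Otimes>\<^sub>M distr m m (bohr_shift d) =
      distr (lborel \<Otimes>\<^sub>M m) (lborel \<Otimes>\<^sub>M m) (\<lambda>(t, y). (t + s, bohr_shift d y))"
    by (rule pair_measure_distr) (auto simp: distr_bohr_shift sigma_finite_measure_axioms)
  then show ?thesis by (simp add: L distr_bohr_shift)
qed

lemma shift_flow:
  "shift i s \<in> measurable (lborel \<Otimes>\<^sub>M m) (lborel \<Otimes>\<^sub>M m)"
  "distr (lborel \<Otimes>\<^sub>M m) (lborel \<Otimes>\<^sub>M m) (shift i s) = lborel \<Otimes>\<^sub>M m"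
proof -
  define t0 where "t0 = (case i of None \<Rightarrow> s | Some j \<Rightarrow> 0)"
  define d where "d = (case i of None \<Rightarrow> 0 :: real^'n | Some j \<Rightarrow> s *\<^sub>R axis j 1)"
  have eq: "shift i s p = (\<lambda>(t, y). (t + t0, bohr_shift d y)) p" if "p \<in> space (lborel \<Otimes>\<^sub>M m)" for p
    using that by (cases p) (auto simp: t0_def d_def shift_def bohr_shift_zero space_pair_measure space_m split: option.splits)
  have "(\<lambda>(t, y). (t + t0, bohr_shift d y)) \<in> measurable (lborel \<Otimes>\<^sub>M m) (lborel \<Otimes>\<^sub>M m)" by measurable
  then show "shift i s \<in> measurable (lborel \<Otimes>\<^sub>M m) (lborel \<Otimes>\<^sub>M m)"
    by (subst measurable_cong[where g="\<lambda>(t, y). (t + t0, bohr_shift d y)"]) (rule eq)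
  show "distr (lborel \<Otimes>\<^sub>M m) (lborel \<Otimes>\<^sub>M m) (shift i s) = lborel \<Otimes>\<^sub>M m"
    by (subst distr_cong[where g="\<lambda>(t, y). (t + t0, bohr_shift d y)", OF refl refl]) (rule eq distr_translation, assumption?)+
qed

text \<open>\<open>V i \<theta>\<close> is \<open>G i\<close> of the wave with phase advanced by
  \<theta>. A shift by s in direction i advances the phase by \<open>c i * s\<close>, with speed - a
  in time and \<open>\<xi> $ j\<close> in space, so the hypothesis with C says exactly that the
  combination of the V with weights c is constant. The G may jump, as the entropy fluxes
  require.\<close>

lemma travelling_wave:
  fixes \<xi> :: "real^'n" and G :: "'n option \<Rightarrow> real \<Rightarrow> real"
  assumes f: "f \<in> C10" and xi: "\<xi> \<noteq> 0" and r: "0 \<le> r"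
    and G: "\<And>i. G i \<in> borel_measurable borel" "\<And>i w. w \<in> {x-r..x+r} \<Longrightarrow> \<bar>G i w\<bar> \<le> K"
    and C: "\<And>w. w \<in> {x-r..x+r} \<Longrightarrow> (\<Sum>j\<in>UNIV. \<xi> $ j * G (Some j) w) - a * G None w = C"
  defines "v \<equiv> \<lambda>p. x + r * Re (tone (- a) (fst p) * bohr_char \<xi> (snd p))"
  shows "(\<integral>p. (\<Sum>i\<in>UNIV. G i (v p) * partial i f p) \<partial>cyl_measure m) = 0"
proof -
  let ?M = "lborel \<Otimes>\<^sub>M m :: (real \<times> 'n bohr_point) measure"
  have sp: "snd p \<in> bohr" if "p \<in> space ?M" for p using that by (cases p) (auto simp: space_pair_measure space_m)
  obtain \<alpha> \<beta> where ab: "0 < \<alpha>" "\<And>t y. 0 < t \<Longrightarrow> y \<in> bohr \<Longrightarrow> t \<notin> {\<alpha>..\<beta>} \<Longrightarrow> f (t, y) = 0" using C10_support[OF f] by blast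
  have cf: "continuous_map cyl_topology euclidean f" "continuous_map cyl_topology euclidean (partial i f)" for i
    using f unfolding C10_def partial_def[abs_def] by (cases i; auto)+
  have ef: "extend f p = 0" if "snd p \<in> bohr" "fst p \<notin> {\<alpha>..\<beta>}" for p
    using ab(2)[of "fst p" "snd p"] that by (auto simp: extend_def)
  \<comment> \<open>Near a point off the slab the extension of f is identically zero along the flow,
    hence so is its derivative.\<close>
  have pz: "extend (partial i f) p = 0" if p: "snd p \<in> bohr" "fst p \<notin> {\<alpha>..\<beta>}" for i p
  proof -
    have "eventually (\<lambda>s. s \<in> (\<lambda>s. fst (shift i s p)) -` (- {\<alpha>..\<beta>})) (nhds 0)"
    proof (rule eventually_nhds_in_open)
      have "continuous_on UNIV (\<lambda>s. fst (shift i s p))"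
        by (cases p; cases i) (auto simp: shift_def intro!: continuous_intros)
      then show "open ((\<lambda>s. fst (shift i s p)) -` (- {\<alpha>..\<beta>}))" by (intro open_vimage) auto
    qed (use p shift_zero[OF p(1)] in auto)
    then have ev: "eventually (\<lambda>s. extend f (shift i s p) = 0) (nhds 0)"
      by eventually_elim (use ef shift_in[OF p(1)] in auto)
    have "((\<lambda>s. extend f (shift i s p)) has_real_derivative 0) (at 0)"
      by (rule DERIV_cong_ev[THEN iffD2, OF refl ev refl DERIV_const])
    from DERIV_unique[OF this extend_derivative[OF f p(1), of i 0]] show ?thesis
      by (simp add: shift_zero[OF p(1)])
  qed
  have "\<exists>B. \<forall>p. snd p \<in> bohr \<longrightarrow> \<bar>extend g p\<bar> \<le> B"
    if g: "continuous_map cyl_topology euclidean g" "\<And>p. snd p \<in> bohr \<Longrightarrow> fst p \<notin> {\<alpha>..\<beta>} \<Longrightarrow> extend g p = 0" for g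
  proof -
    obtain B where B: "\<And>t y. t \<in> {\<alpha>..\<beta>} \<Longrightarrow> y \<in> bohr \<Longrightarrow> \<bar>g (t, y)\<bar> \<le> B"
      using continuous_map_slab_bounded[OF g(1) ab(1)] by blast
    have "\<bar>extend g p\<bar> \<le> max B 0" if "snd p \<in> bohr" for p
    proof (cases "fst p \<in> {\<alpha>..\<beta>}")
      case True
      then show ?thesis using B[OF True that] by (auto simp: extend_def)
    qed (use g(2)[OF that] in auto)
    then show ?thesis by blast
  qed note bd = this
  obtain Bf where Bf: "\<And>p. snd p \<in> bohr \<Longrightarrow> \<bar>extend f p\<bar> \<le> Bf" using bd[OF cf(1) ef] by blast
  have "\<forall>i. \<exists>B. \<forall>p. snd p \<in> bohr \<longrightarrow> \<bar>extend (partial i f) p\<bar> \<le> B" using bd[OF cf(2) pz] by blast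
  then obtain Bi where Bi: "\<And>i p. snd p \<in> bohr \<Longrightarrow> \<bar>extend (partial i f) p\<bar> \<le> Bi i" by metis
  define B where "B = (\<Sum>i\<in>UNIV. \<bar>Bi i\<bar>)"
  have B: "\<bar>extend (partial i f) p\<bar> \<le> B" if "snd p \<in> bohr" for i p
  proof -
    have "\<bar>Bi i\<bar> \<le> B" unfolding B_def by (rule member_le_sum) auto
    then show ?thesis using Bi[OF that, of i] by simp
  qed
  have B0: "0 \<le> B" unfolding B_def by (intro sum_nonneg) auto
  define V where "V i \<theta> p = G i (x + r * Re (tone 1 \<theta> * (tone (- a) (fst p) * bohr_char \<xi> (snd p))))" for i \<theta> and p :: "real \<times> 'n bohr_point"
  define c where "c i = (case i of None \<Rightarrow> - a | Some j \<Rightarrow> \<xi> $ j)" for i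
  \<comment> \<open>The dominating function lives on the slab widened by 1, because time shifts of
    length up to 1 may enter the support.\<close>
  define w where "w p = B * indicator ({\<alpha>-1..\<beta>+1} \<times> space m) p" for p :: "real \<times> 'n bohr_point"
  have range: "x + r * Re (tone 1 \<theta> * (tone (- a) (fst p) * bohr_char \<xi> (snd p))) \<in> {x-r..x+r}" if "snd p \<in> bohr" for \<theta> p
  proof -
    have "\<bar>Re (tone 1 \<theta> * (tone (- a) (fst p) * bohr_char \<xi> (snd p)))\<bar> \<le> 1"
      by (rule order.trans[OF abs_Re_le_cmod]) (simp add: norm_mult norm_bohr_char[OF that])
    then have "\<bar>r * Re (tone 1 \<theta> * (tone (- a) (fst p) * bohr_char \<xi> (snd p)))\<bar> \<le> r * 1"
      unfolding abs_mult using r by (intro mult_mono) auto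
    then show ?thesis by (auto simp: abs_le_iff)
  qed
  have quot: "\<bar>(extend f (shift i s p) - extend f p) / s\<bar> \<le> w p" if p: "p \<in> space ?M" and s: "s \<noteq> 0" "\<bar>s\<bar> \<le> 1" for i s p
  proof (cases "fst p \<in> {\<alpha>-1..\<beta>+1}")
    case True
    have "norm (extend f (shift i s p) - extend f (shift i 0 p)) \<le> B * norm (s - 0)"
      by (rule field_differentiable_bound[of UNIV _ "\<lambda>r. extend (partial i f) (shift i r p)"])
         (use extend_derivative[OF f sp[OF p]] B[OF shift_in[OF sp[OF p]]] in auto)
    then have "\<bar>extend f (shift i s p) - extend f p\<bar> \<le> B * \<bar>s\<bar>" by (simp add: shift_zero[OF sp[OF p]])
    moreover have "w p = B" using True p by (cases p) (auto simp: w_def space_pair_measure)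
    ultimately show ?thesis using s by (simp add: abs_divide divide_le_eq)
  next
    case False
    then have "fst p \<notin> {\<alpha>..\<beta>}" "fst (shift i s p) \<notin> {\<alpha>..\<beta>}" using fst_shift[of i s p] s(2) by auto
    then have "extend f (shift i s p) - extend f p = 0" using ef sp[OF p] shift_in[OF sp[OF p]] by simp
    then show ?thesis using B0 by (simp add: w_def)
  qed
  obtain j0 where j0: "\<xi> $ j0 \<noteq> 0" using xi by (auto simp: vec_eq_iff)
  have "(\<integral>p. (\<Sum>i\<in>UNIV. V i 0 p * extend (partial i f) p) \<partial>?M) = 0"
  proof (rule flow_derivatives_cancel[where \<tau>=shift and V=V and K=K and c=c and f="extend f" and w=w and C=C and ?i0.0="Some j0"])
    show "shift i s \<in> measurable ?M ?M" "distr ?M ?M (shift i s) = ?M" for i s by (rule shift_flow)+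
    show "shift i 0 p = p" if "p \<in> space ?M" for i p by (rule shift_zero[OF sp[OF that]])
    show "V i \<theta> \<in> borel_measurable ?M" for i \<theta> using G(1)[of i] unfolding V_def[abs_def] by measurable
    show "\<bar>V i \<theta> p\<bar> \<le> K" if "p \<in> space ?M" for i \<theta> p unfolding V_def by (rule G(2)[OF range[OF sp[OF that]]])
    show "V j (- (c i * s)) (shift i s p) = V j 0 p" if p: "p \<in> space ?M" for i j s p
    proof -
      have tone: "tone 1 (- (c i * s)) * (tone (- a) (fst (shift i s p)) * bohr_char \<xi> (snd (shift i s p))) = tone (- a) (fst p) * bohr_char \<xi> (snd p)"
      proof (cases i)
        case None
        have "tone 1 (a * s) * tone (- a) (fst p + s) = tone (- a) (fst p)"
          unfolding tone_def exp_add[symmetric] by (rule arg_cong[where f=exp]) (simp add: algebra_simps)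
        then show ?thesis using None by (simp add: c_def shift_def split_beta mult.assoc[symmetric])
      next
        case (Some j)
        have "tone 1 (- (\<xi> $ j * s)) * bohr_exp \<xi> (s *\<^sub>R axis j 1) = 1"
          unfolding tone_def bohr_exp_def exp_add[symmetric] by (simp add: inner_axis algebra_simps)
        then have "tone 1 (- (\<xi> $ j * s)) * (bohr_exp \<xi> (s *\<^sub>R axis j 1) * z) = z" for z by (simp add: mult.assoc[symmetric])
        then show ?thesis using Some sp[OF p] by (simp add: c_def shift_def split_beta bohr_char_def bohr_shift_exp mult.left_commute)
      qed
      have "tone 1 0 = 1" by (simp add: tone_def)
      then show ?thesis unfolding V_def tone by simp
    qed
    show "integrable ?M (extend f)"
      by (rule integrable_slab[OF extend_measurable[OF cf(1)], of Bf \<alpha> \<beta>]) (use Bf ef in \<open>auto simp: space_m\<close>)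
    show "integrable ?M w"
    proof (rule integrable_slab[of _ B "\<alpha>-1" "\<beta>+1"])
      have "{\<alpha>-1..\<beta>+1} \<times> space m \<in> sets ?M" by (intro pair_measureI) auto
      then show "w \<in> borel_measurable ?M" unfolding w_def[abs_def] by measurable
    qed (use B0 in \<open>auto simp: w_def indicator_def\<close>)
    show "\<bar>(extend f (shift i s p) - extend f p) / s\<bar> \<le> w p" if "p \<in> space ?M" "s \<noteq> 0" "\<bar>s\<bar> \<le> 1" for i s p
      by (rule quot[OF that])
    show "((\<lambda>s. extend f (shift i s p)) has_real_derivative extend (partial i f) p) (at 0)" if "p \<in> space ?M" for i p
      using extend_derivative[OF f sp[OF that], of i 0] by (simp add: shift_zero[OF sp[OF that]])
    show "c (Some j0) \<noteq> 0" using j0 by (simp add: c_def)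
    show "(\<Sum>i\<in>UNIV. c i * V i \<theta> p) = C" if "p \<in> space ?M" for \<theta> p
      using C[OF range[OF sp[OF that], of \<theta>]] by (simp add: sum_option c_def V_def)
  qed
  moreover have "(\<integral>p. (\<Sum>i\<in>UNIV. G i (v p) * partial i f p) \<partial>cyl_measure m) =
      (\<integral>p. indicator ({0<..} \<times> space m) p *\<^sub>R (\<Sum>i\<in>UNIV. G i (v p) * partial i f p) \<partial>?M)"
    unfolding cyl_measure_restrict by (rule integral_restrict_space) (use slab_set in auto)
  moreover have "\<dots> = (\<integral>p. (\<Sum>i\<in>UNIV. V i 0 p * extend (partial i f) p) \<partial>?M)"
  proof (rule Bochner_Integration.integral_cong[OF refl])
    fix p assume "p \<in> space ?M"
    then have "indicator ({0<..} \<times> space m) p = (if 0 < fst p then 1 else 0 :: real)"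
      by (cases p) (auto simp: space_pair_measure)
    then show "indicator ({0<..} \<times> space m) p *\<^sub>R (\<Sum>i\<in>UNIV. G i (v p) * partial i f p) = (\<Sum>i\<in>UNIV. V i 0 p * extend (partial i f) p)"
      by (simp add: V_def v_def extend_def tone_def)
  qed
  ultimately show ?thesis by simp
qed

end

section \<open>The cosine wave\<close>

context haar_space
begin

definition wave :: "real \<Rightarrow> real \<Rightarrow> real \<Rightarrow> real^'n \<Rightarrow> real \<times> 'n bohr_point \<Rightarrow> real" where
  "wave x r a \<xi> p = x + r * Re (tone (- a) (fst p) * bohr_char \<xi> (snd p))"

lemma wave_range:
  assumes "0 \<le> r" "snd p \<in> bohr" shows "wave x r a \<xi> p \<in> {x-r..x+r}"
proof -
  have "\<bar>Re (tone (- a) (fst p) * bohr_char \<xi> (snd p))\<bar> \<le> 1"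
    by (rule order.trans[OF abs_Re_le_cmod]) (simp add: norm_mult norm_bohr_char[OF assms(2)])
  then have "\<bar>r * Re (tone (- a) (fst p) * bohr_char \<xi> (snd p))\<bar> \<le> r * 1"
    unfolding abs_mult using assms(1) by (intro mult_mono) auto
  then show ?thesis by (auto simp: wave_def abs_le_iff)
qed

lemma wave_measurable [measurable]: "wave x r a \<xi> \<in> borel_measurable (lborel \<Otimes>\<^sub>M m)"
  unfolding wave_def[abs_def] by measurable

lemma wave_section_measurable [measurable]: "(\<lambda>y. wave x r a \<xi> (t, y)) \<in> borel_measurable m"
  by measurable

lemma wave_start: "wave x r a \<xi> (0, y) = x + r * Re (bohr_char \<xi> y)"
  by (simp add: wave_def tone_def)

lemma wave_integral: assumes "\<xi> \<noteq> 0" shows "(\<integral>y. wave x r a \<xi> (t, y) \<partial>m) = x"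
proof -
  have i: "integrable m (\<lambda>y. tone (- a) t * bohr_char \<xi> y)"
    by (rule integrable_bdd[where B=1]) (auto simp: norm_mult norm_bohr_char space_m)
  have "(\<integral>y. wave x r a \<xi> (t, y) \<partial>m) = x + r * Re (\<integral>y. tone (- a) t * bohr_char \<xi> y \<partial>m)"
    unfolding wave_def fst_conv snd_conv integral_Re[OF i, symmetric]
    using integrable_Re[OF i] total by (simp del: times_complex.simps integral_Re)
  then show ?thesis using bohr_char_integral[OF assms] by simp
qed

lemma wave_spectrum: "Sp m (\<lambda>y. wave x r a \<xi> (0, y)) \<subseteq> {0, \<xi>, - \<xi>}"
proof (rule subsetI, rule ccontr)
  fix l assume l: "l \<in> Sp m (\<lambda>y. wave x r a \<xi> (0, y))" "l \<notin> {0, \<xi>, - \<xi>}"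
  have i: "integrable m (bohr_char k)" for k
    by (rule integrable_bdd[where B=1]) (auto simp: norm_bohr_char space_m)
  have "(\<integral>y. of_real (wave x r a \<xi> (0, y)) * cnj (gelfand (bohr_exp l) y) \<partial>m) =
    (\<integral>y. of_real x * bohr_char (- l) y + (of_real (r / 2) * bohr_char (\<xi> - l) y + of_real (r / 2) * bohr_char (- \<xi> - l) y) \<partial>m)"
  proof (rule Bochner_Integration.integral_cong[OF refl])
    fix y assume "y \<in> space m"
    then have y: "y \<in> bohr" by (simp add: space_m)
    have g: "cnj (gelfand (bohr_exp l) y) = bohr_char (- l) y" unfolding bohr_char_uminus[OF y] by (simp add: gelfand_def bohr_char_def)
    have h: "complex_of_real (Re (bohr_char \<xi> y)) = (bohr_char \<xi> y + bohr_char (- \<xi>) y) / 2"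
      unfolding bohr_char_uminus[OF y] complex_add_cnj by simp
    have "bohr_char (\<xi> - l) y = bohr_char \<xi> y * bohr_char (- l) y" "bohr_char (- \<xi> - l) y = bohr_char (- \<xi>) y * bohr_char (- l) y"
      using bohr_char_add[OF y, of \<xi> "- l"] bohr_char_add[OF y, of "- \<xi>" "- l"] by simp_all
    then show "of_real (wave x r a \<xi> (0, y)) * cnj (gelfand (bohr_exp l) y) =
      of_real x * bohr_char (- l) y + (of_real (r / 2) * bohr_char (\<xi> - l) y + of_real (r / 2) * bohr_char (- \<xi> - l) y)"
      unfolding wave_start g of_real_add of_real_mult h by (simp add: field_simps)
  qed
  also have "\<dots> = of_real x * (\<integral>y. bohr_char (- l) y \<partial>m) +
      (of_real (r / 2) * (\<integral>y. bohr_char (\<xi> - l) y \<partial>m) + of_real (r / 2) * (\<integral>y. bohr_char (- \<xi> - l) y \<partial>m))"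
    using i by (simp del: of_real_divide)
  also have "\<dots> = 0"
    using l(2) bohr_char_integral[of "- l"] bohr_char_integral[of "\<xi> - l"] bohr_char_integral[of "- \<xi> - l"] by auto
  finally show False using l(1) by (simp add: Sp_def)
qed

text \<open>For |z| = 1 one has |Re z| \<ge> (Re z)^2 = (1 + Re (z^2)) / 2, and here z^2 is a
  multiple of the character of frequency 2 \<xi>, which has mean zero.\<close>

lemma wave_deviation: assumes "\<xi> \<noteq> 0" "0 \<le> r" shows "r / 2 \<le> (\<integral>y. \<bar>wave x r a \<xi> (t, y) - x\<bar> \<partial>m)"
proof -
  define z where "z y = tone (- a) t * bohr_char \<xi> y" for y
  have [measurable]: "z \<in> borel_measurable m" unfolding z_def[abs_def] by measurable
  have nz: "norm (z y) = 1" if "y \<in> bohr" for y by (simp add: z_def norm_mult norm_bohr_char[OF that])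
  have i: "integrable m (\<lambda>y. (tone (- a) t)^2 * bohr_char (\<xi> + \<xi>) y)"
    by (rule integrable_bdd[where B=1]) (auto simp: norm_mult norm_power norm_bohr_char space_m)
  have "\<xi> + \<xi> \<noteq> 0" using assms(1) by (simp add: scaleR_2[symmetric])
  from bohr_char_integral[OF this] have "(\<integral>y. (tone (- a) t)^2 * bohr_char (\<xi> + \<xi>) y \<partial>m) = 0" by (simp only: integral_mult_right_zero mult_zero_right)
  then have "(\<integral>y. Re ((tone (- a) t)^2 * bohr_char (\<xi> + \<xi>) y) \<partial>m) = 0" by (simp only: integral_Re[OF i] zero_complex.simps)
  then have "(\<integral>y. (r / 2) * (1 + Re ((tone (- a) t)^2 * bohr_char (\<xi> + \<xi>) y)) \<partial>m) = r / 2"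
    using integrable_Re[OF i] total by (simp del: times_complex.simps)
  moreover have "(\<integral>y. (r / 2) * (1 + Re ((tone (- a) t)^2 * bohr_char (\<xi> + \<xi>) y)) \<partial>m) \<le> (\<integral>y. \<bar>wave x r a \<xi> (t, y) - x\<bar> \<partial>m)"
  proof (rule integral_mono)
    show "integrable m (\<lambda>y. (r / 2) * (1 + Re ((tone (- a) t)^2 * bohr_char (\<xi> + \<xi>) y)))" using integrable_Re[OF i] by (simp del: times_complex.simps)
    show "integrable m (\<lambda>y. \<bar>wave x r a \<xi> (t, y) - x\<bar>)"
    proof (rule integrable_bdd[where B=r])
      show "norm \<bar>wave x r a \<xi> (t, y) - x\<bar> \<le> r" if "y \<in> space m" for y
        using wave_range[OF assms(2), of "(t, y)" x a \<xi>] that by (simp add: space_m abs_le_iff)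
    qed measurable
    fix y assume "y \<in> space m"
    then have y: "y \<in> bohr" by (simp add: space_m)
    have "(tone (- a) t)^2 * bohr_char (\<xi> + \<xi>) y = (z y)^2" unfolding z_def bohr_char_add[OF y] by (simp add: power2_eq_square mult_ac)
    moreover have "(Re (z y))^2 + (Im (z y))^2 = 1" using nz[OF y] by (simp add: cmod_def)
    ultimately have "1 + Re ((tone (- a) t)^2 * bohr_char (\<xi> + \<xi>) y) = 2 * (Re (z y))^2" by (simp add: power2_eq_square)
    also have "(Re (z y))^2 \<le> \<bar>Re (z y)\<bar>"
    proof -
      have "\<bar>Re (z y)\<bar> \<le> 1" using abs_Re_le_cmod[of "z y"] nz[OF y] by simp
      then have "\<bar>Re (z y)\<bar> * \<bar>Re (z y)\<bar> \<le> \<bar>Re (z y)\<bar> * 1" by (intro mult_left_mono) auto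
      then show ?thesis by (simp add: power2_eq_square)
    qed
    finally have "(r / 2) * (1 + Re ((tone (- a) t)^2 * bohr_char (\<xi> + \<xi>) y)) \<le> (r / 2) * (2 * \<bar>Re (z y)\<bar>)"
      using assms(2) by (intro mult_left_mono) auto
    also have "\<dots> = \<bar>wave x r a \<xi> (t, y) - x\<bar>" using assms(2) by (simp add: wave_def z_def abs_mult)
    finally show "(r / 2) * (1 + Re ((tone (- a) t)^2 * bohr_char (\<xi> + \<xi>) y)) \<le> \<bar>wave x r a \<xi> (t, y) - x\<bar>" .
  qed
  ultimately show ?thesis by (simp only:)
qed

text \<open>The wave at time t differs from its start only through the factor
  \<open>tone (- a) t - 1\<close>, uniformly in y.\<close>

lemma wave_initial: "0 \<le> r \<Longrightarrow> ((\<lambda>t. \<integral>y. \<bar>wave x r a \<xi> (t, y) - wave x r a \<xi> (0, y)\<bar> \<partial>m) \<longlongrightarrow> 0) (at_right 0)"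
proof (rule tendsto_sandwich[of "\<lambda>_. 0"])
  assume r: "0 \<le> r"
  have "continuous_on UNIV (\<lambda>t. r * norm (tone (- a) t - 1))" by (intro continuous_intros)
  then have "isCont (\<lambda>t. r * norm (tone (- a) t - 1)) 0" by (simp add: continuous_on_eq_continuous_at)
  then have "((\<lambda>t. r * norm (tone (- a) t - 1)) \<longlongrightarrow> r * norm (tone (- a) 0 - 1)) (at 0)" by (simp add: isCont_def)
  moreover have "tone (- a) 0 = 1" by (simp add: tone_def)
  ultimately have "((\<lambda>t. r * norm (tone (- a) t - 1)) \<longlongrightarrow> 0) (at 0)" by simp
  then show "((\<lambda>t. r * norm (tone (- a) t - 1)) \<longlongrightarrow> 0) (at_right 0)" by (rule tendsto_mono[rotated]) (simp add: at_le)
  have "(\<integral>y. \<bar>wave x r a \<xi> (t, y) - wave x r a \<xi> (0, y)\<bar> \<partial>m) \<le> r * norm (tone (- a) t - 1)" for t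
  proof -
    have b: "\<bar>wave x r a \<xi> (t, y) - wave x r a \<xi> (0, y)\<bar> \<le> r * norm (tone (- a) t - 1)" if y: "y \<in> bohr" for y
    proof -
      have "wave x r a \<xi> (t, y) - wave x r a \<xi> (0, y) = r * Re ((tone (- a) t - 1) * bohr_char \<xi> y)"
        by (simp add: wave_def tone_def algebra_simps)
      moreover have "\<bar>Re ((tone (- a) t - 1) * bohr_char \<xi> y)\<bar> \<le> norm (tone (- a) t - 1)"
        by (rule order.trans[OF abs_Re_le_cmod]) (simp add: norm_mult norm_bohr_char[OF y])
      ultimately show ?thesis using r by (simp add: abs_mult mult_left_mono)
    qed
    show ?thesis using norm_integral_le[of "\<lambda>y. \<bar>wave x r a \<xi> (t, y) - wave x r a \<xi> (0, y)\<bar>" "r * norm (tone (- a) t - 1)"] b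
      by (auto simp: space_m)
  qed
  then show "eventually (\<lambda>t. (\<integral>y. \<bar>wave x r a \<xi> (t, y) - wave x r a \<xi> (0, y)\<bar> \<partial>m) \<le> r * norm (tone (- a) t - 1)) (at_right 0)" by simp
qed auto

lemma wave_Linf: assumes "0 \<le> r" shows "wave x r a \<xi> \<in> Linf (cyl_measure m)" "(\<lambda>y. wave x r a \<xi> (0, y)) \<in> Linf m"
proof -
  have b: "\<bar>wave x r a \<xi> p\<bar> \<le> \<bar>x\<bar> + r" if "snd p \<in> bohr" for p
    using wave_range[OF assms that, of x a \<xi>] by auto
  have "space (cyl_measure m) = {0<..} \<times> space m" unfolding cyl_measure_def by (simp add: space_pair_measure space_restrict_space)
  then have "AE p in cyl_measure m. \<bar>wave x r a \<xi> p\<bar> \<le> \<bar>x\<bar> + r" using b by (intro AE_I2) (auto simp: space_m)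
  moreover have "wave x r a \<xi> \<in> borel_measurable (cyl_measure m)"
    unfolding cyl_measure_restrict by (rule measurable_restrict_space1) measurable
  ultimately show "wave x r a \<xi> \<in> Linf (cyl_measure m)" unfolding Linf_def by blast
  have "AE y in m. \<bar>wave x r a \<xi> (0, y)\<bar> \<le> \<bar>x\<bar> + r" using b by (intro AE_I2) (auto simp: space_m)
  then show "(\<lambda>y. wave x r a \<xi> (0, y)) \<in> Linf m" unfolding Linf_def using wave_section_measurable by blast
qed

text \<open>G lists the entropy |w - k| and the components of its flux. On the range of the wave,
  the \<xi>-component of the flux minus a times the entropy is constant for each k, so
  \<open>travelling_wave\<close> gives the entropy inequality with equality.\<close>

lemma wave_entropy_solution:
  fixes \<phi> :: "real \<Rightarrow> real^'n"
  assumes phi: "continuous_on UNIV \<phi>" and xi: "\<xi> \<noteq> 0" and r: "0 \<le> r"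
    and aff: "\<And>w. w \<in> {x-r..x+r} \<Longrightarrow> \<xi> \<bullet> \<phi> w = a * w + b"
  shows "entropy_solution m \<phi> (\<lambda>y. wave x r a \<xi> (0, y)) (wave x r a \<xi>)"
  unfolding entropy_solution_def
proof (intro conjI allI ballI impI wave_Linf r)
  show "ess_tendsto (\<lambda>t. \<integral>y. \<bar>wave x r a \<xi> (t, y) - wave x r a \<xi> (0, y)\<bar> \<partial>m) 0 (at_right 0)"
    unfolding ess_tendsto_def using wave_initial[OF r] by (intro bexI[of _ "{}"]) auto
  fix k and f :: "real \<times> 'n bohr_point \<Rightarrow> real" assume f: "f \<in> C10"
  have phim[measurable]: "\<phi> \<in> borel_measurable borel" using phi by (rule borel_measurable_continuous_onI)
  define G where "G i w = (case i of None \<Rightarrow> \<bar>w - k\<bar> | Some j \<Rightarrow> sgn (w - k) * (\<phi> w $ j - \<phi> k $ j))" for i w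
  have Gm: "G i \<in> borel_measurable borel" for i
  proof (cases i)
    case (Some j)
    have "(\<lambda>w. \<phi> w $ j) \<in> borel_measurable borel" by (intro borel_measurable_continuous_onI continuous_intros phi)
    then show ?thesis using Some unfolding G_def[abs_def] by simp
  qed (simp add: G_def[abs_def])
  have "compact (\<phi> ` {x-r..x+r})" by (meson phi compact_Icc compact_continuous_image continuous_on_subset subset_UNIV)
  then have "bounded (\<phi> ` {x-r..x+r})" by (rule compact_imp_bounded)
  then obtain B where B: "\<And>w. w \<in> {x-r..x+r} \<Longrightarrow> norm (\<phi> w) \<le> B" unfolding bounded_iff by blast
  define K where "K = (\<bar>x\<bar> + r + \<bar>k\<bar>) + (B + norm (\<phi> k))"
  have Gb: "\<bar>G i w\<bar> \<le> K" if w: "w \<in> {x-r..x+r}" for i w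
  proof -
    have 0: "0 \<le> B" using B[OF w] norm_ge_zero order.trans by blast
    show ?thesis
    proof (cases i)
      case None
      have "\<bar>w\<bar> \<le> \<bar>x\<bar> + r" using w r by auto
      moreover have "\<bar>w - k\<bar> \<le> \<bar>w\<bar> + \<bar>k\<bar>" by (rule abs_triangle_ineq4)
      moreover have "\<bar>G i w\<bar> = \<bar>w - k\<bar>" using None by (simp add: G_def)
      ultimately show ?thesis unfolding K_def using 0 norm_ge_zero[of "\<phi> k"] by linarith
    next
      case (Some j)
      have "\<bar>\<phi> w $ j - \<phi> k $ j\<bar> \<le> B + norm (\<phi> k)"
        using component_le_norm_cart[of "\<phi> w" j] component_le_norm_cart[of "\<phi> k" j] B[OF w] by linarith
      moreover have "\<bar>G i w\<bar> \<le> \<bar>\<phi> w $ j - \<phi> k $ j\<bar>" using Some by (simp add: G_def abs_mult sgn_if)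
      ultimately show ?thesis using r by (simp add: K_def)
    qed
  qed
  have "\<exists>C. \<forall>w\<in>{x-r..x+r}. (\<Sum>j\<in>UNIV. \<xi> $ j * G (Some j) w) - a * G None w = C"
  proof -
    have s: "(\<Sum>j\<in>UNIV. \<xi> $ j * G (Some j) w) = sgn (w - k) * (\<xi> \<bullet> \<phi> w - \<xi> \<bullet> \<phi> k)" for w
      unfolding G_def inner_vec_def by (simp add: sum_subtractf[symmetric] sum_distrib_left algebra_simps)
    \<comment> \<open>For k inside the range the affine law holds at k as well, and the constant is
      0. For k outside, nothing is known of \<open>\<phi> k\<close>, but the sign of w - k is fixed
      and \<open>\<phi> k\<close> enters the constant.\<close>
    consider "k \<in> {x-r..x+r}" | "k < x - r" | "x + r < k" by fastforce
    then show ?thesis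
    proof cases
      case 1
      have "sgn (w - k) * (a * w + b - (a * k + b)) - a * \<bar>w - k\<bar> = 0" for w
        by (cases "w - k" "0 :: real" rule: linorder_cases) (simp_all add: algebra_simps)
      then show ?thesis unfolding s using aff 1 by (intro exI[of _ 0]) (simp add: G_def)
    next
      case 2
      then show ?thesis unfolding s using aff
        by (intro exI[of _ "b - \<xi> \<bullet> \<phi> k + a * k"]) (auto simp: G_def algebra_simps)
    next
      case 3
      then show ?thesis unfolding s using aff
        by (intro exI[of _ "\<xi> \<bullet> \<phi> k - b - a * k"]) (auto simp: G_def algebra_simps)
    qed
  qed
  then obtain C where C: "\<And>w. w \<in> {x-r..x+r} \<Longrightarrow> (\<Sum>j\<in>UNIV. \<xi> $ j * G (Some j) w) - a * G None w = C" by blast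
  have "\<bar>wave x r a \<xi> p - k\<bar> * partial_t f p + (sgn (wave x r a \<xi> p - k) *\<^sub>R (\<phi> (wave x r a \<xi> p) - \<phi> k)) \<bullet> grad_x f p =
      (\<Sum>i\<in>UNIV. G i (wave x r a \<xi> p) * partial i f p)" for p
    by (simp add: sum_option G_def partial_def grad_x_def inner_vec_def mult.assoc)
  then show "0 \<le> (\<integral>p. \<bar>wave x r a \<xi> p - k\<bar> * partial_t f p +
      (sgn (wave x r a \<xi> p - k) *\<^sub>R (\<phi> (wave x r a \<xi> p) - \<phi> k)) \<bullet> grad_x f p \<partial>cyl_measure m)"
    using travelling_wave[OF f xi r Gm Gb C] by (simp add: wave_def)
qed

lemma wave_no_decay:
  assumes "\<xi> \<noteq> 0" "0 < r"
  shows "\<not> ess_tendsto (\<lambda>t. \<integral>y. \<bar>wave x r a \<xi> (t, y) - x\<bar> \<partial>m) 0 at_top"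
proof
  assume "ess_tendsto (\<lambda>t. \<integral>y. \<bar>wave x r a \<xi> (t, y) - x\<bar> \<partial>m) 0 at_top"
  then obtain N where N: "N \<in> null_sets lborel" "((\<lambda>t. \<integral>y. \<bar>wave x r a \<xi> (t, y) - x\<bar> \<partial>m) \<longlongrightarrow> 0) (inf at_top (principal (- N)))"
    unfolding ess_tendsto_def by blast
  have "0 < r / 2" using assms(2) by simp
  from order_tendstoD(2)[OF N(2) this]
  have "eventually (\<lambda>t. t \<in> - N \<longrightarrow> (\<integral>y. \<bar>wave x r a \<xi> (t, y) - x\<bar> \<partial>m) < r / 2) at_top"
    unfolding eventually_inf_principal .
  then obtain T where T: "\<And>t. T \<le> t \<Longrightarrow> t \<notin> N \<Longrightarrow> (\<integral>y. \<bar>wave x r a \<xi> (t, y) - x\<bar> \<partial>m) < r / 2"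
    unfolding eventually_at_top_linorder by auto
  obtain t where "T < t" "t \<notin> N" using null_set_avoid[OF N(1), of T "T + 1"] by auto
  then show False using T[of t] wave_deviation[OF assms(1), of r x a t] assms(2) by simp
qed

theorem decay_nondegenerate:
  fixes \<phi> :: "real \<Rightarrow> real^'n"
  assumes phi: "continuous_on UNIV \<phi>" and M: "0 \<in> M" "\<And>x. x \<in> M \<Longrightarrow> - x \<in> M"
    and decay: "\<And>v0 v. v0 \<in> Linf m \<Longrightarrow> Sp m v0 \<subseteq> M \<Longrightarrow> entropy_solution m \<phi> v0 v \<Longrightarrow>
       ess_tendsto (\<lambda>t. \<integral>y. \<bar>v (t, y) - (\<integral>z. v0 z \<partial>m)\<bar> \<partial>m) 0 at_top"
  shows "nondegenerate \<phi> M"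
  unfolding nondegenerate_def
proof (intro ballI allI impI notI)
  fix \<xi> I assume xi: "\<xi> \<in> M" "\<xi> \<noteq> 0" and I: "open I \<and> is_interval I \<and> I \<noteq> {}" and aff: "affine_fun_on I (\<lambda>u. \<xi> \<bullet> \<phi> u)"
  obtain x where "x \<in> I" using I by blast
  \<comment> \<open>A closed ball, because the wave takes its values in [x - r, x + r].\<close>
  then obtain r where r: "0 < r" "cball x r \<subseteq> I" using I open_contains_cball by blast
  obtain a b where ab: "\<And>w. w \<in> I \<Longrightarrow> \<xi> \<bullet> \<phi> w = a * w + b" using aff unfolding affine_fun_on_def by blast
  have "entropy_solution m \<phi> (\<lambda>y. wave x r a \<xi> (0, y)) (wave x r a \<xi>)"
    by (rule wave_entropy_solution[OF phi xi(2)]) (use r ab in \<open>auto simp: cball_eq_atLeastAtMost\<close>)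
  moreover have "Sp m (\<lambda>y. wave x r a \<xi> (0, y)) \<subseteq> M" using wave_spectrum[of x r a \<xi>] xi(1) M by blast
  ultimately have "ess_tendsto (\<lambda>t. \<integral>y. \<bar>wave x r a \<xi> (t, y) - (\<integral>z. wave x r a \<xi> (0, z) \<partial>m)\<bar> \<partial>m) 0 at_top"
    using r(1) by (intro decay wave_Linf) auto
  then show False using wave_no_decay[OF xi(2) r(1)] by (simp add: wave_integral[OF xi(2)])
qed

end

theorem theorem3p2:
  fixes \<phi> :: "real \<Rightarrow> real^'n"
    and M0 :: "(real^'n) set"
    and m :: "'n::finite bohr_point measure"
  assumes haar: "normalized_haar m"
    and cont: "continuous_on UNIV \<phi>"
    and zero: "0 \<in> M0"
    and add: "\<And>x y. x \<in> M0 \<Longrightarrow> y \<in> M0 \<Longrightarrow> x + y \<in> M0"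
    and neg: "\<And>x. x \<in> M0 \<Longrightarrow> - x \<in> M0"
  shows "nondegenerate \<phi> M0 \<longleftrightarrow>
    (\<forall>v0 v. v0 \<in> Linf m \<and> Sp m v0 \<subseteq> M0 \<and> entropy_solution m \<phi> v0 v \<longrightarrow>
       ess_tendsto (\<lambda>t. \<integral>y. \<bar>v (t, y) - (\<integral>z. v0 z \<partial>m)\<bar> \<partial>m) 0 at_top)"
proof -
  interpret haar_space m by (rule haar_space.intro[OF haar])
  show ?thesis
    using nondegenerate_decay[OF cont zero add neg] decay_nondegenerate[OF cont zero neg] by blast
qed

end
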